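(* Fix an integer $M\ge1$ and let $C_n$ be the number of key comparisons used by Yaroslavskiy's dual-pivot Quicksort with Insertionsort threshold $M$ (described in the context) on a uniformly random permutation of $\{1,\dots,n\}$. Then \[ \frac{C_n-\mathbb{E}[C_n]}{n}\longrightarrow C^*\qquad(n\to\infty), \] in distribution and with convergence of second moments, where the law of $C^*$ is the unique solution, among distributions with $\mathbb{E}[X]=0$ and $\mathbb{E}[X^2]<\infty$, of the distributional fixed-point equation \[ X\overset{d}{=}1+(D_1+D_2)(D_2+2D_3)+\sum_{j=1}^3\Bigl(D_jX^{(j)}+\tfrac{19}{10}D_j\ln D_j\Bigr), \] where $(D_1,D_2,D_3),X^{(1)},X^{(2)},X^{(3)}$ are independent and each $X^{(j)}$ has the same distribution as $X$. Moreover $\mathrm{Var}(C_n)\sim\sigma_C^2n^2$ as $n\to\infty$ with $\sigma_C^2=\tfrac{2231}{360}-\tfrac{361}{600}\pi^2=0.25901\ldots$.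
   Context: $(D_1,D_2,D_3)=(U_{(1)},U_{(2)}-U_{(1)},1-U_{(2)})$ where $U_{(1)}\le U_{(2)}$ are the order statistics of two independent uniform $[0,1]$ random variables; equivalently $(D_1,D_2)$ has density $2$ on $\{x_1,x_2\ge0,x_1+x_2\le1\}$ and $D_3=1-D_1-D_2$. Convention: $x\ln x=0$ for $x=0$. Yaroslavskiy's dual-pivot Quicksort with threshold $M$: procedure $\mathrm{QS}(A,\mathit{left},\mathit{right})$, initial call $\mathrm{QS}(A,1,n)$: (1) if $\mathit{right}-\mathit{left}<M$, run InsertionSort on $A[\mathit{left}..\mathit{right}]$ and return; (2) else if $A[\mathit{left}]>A[\mathit{right}]$ set $p\gets A[\mathit{right}],q\gets A[\mathit{left}]$, else $p\gets A[\mathit{left}],q\gets A[\mathit{right}]$; set $\ell\gets\mathit{left}+1$, $g\gets\mathit{right}-1$, $k\gets\ell$; (3) while $k\le g$: if $A[k]<p$ then swap $A[k],A[\ell]$, $\ell\gets\ell+1$; else if $A[k]\ge q$ then {while ($A[g]>q$ and $k<g$) do $g\gets g-1$; if $A[g]\ge p$ swap $A[k],A[g]$, else swap $A[k],A[g]$, swap $A[k],A[\ell]$, $\ell\gets\ell+1$; $g\gets g-1$}; $k\gets k+1$; (4) $\ell\gets\ell-1$, $g\gets g+1$, $A[\mathit{left}]\gets A[\ell]$, $A[\ell]\gets p$, $A[\mathit{right}]\gets A[g]$, $A[g]\gets q$; (5) recursively call QS on $(\mathit{left},\ell-1)$, $(\ell+1,g-1)$, $(g+1,\mathit{right})$. InsertionSort$(A,\mathit{left},\mathit{right})$: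 for $i=\mathit{left}+1..\mathit{right}$: $j\gets i-1$, $v\gets A[i]$; while $j\ge\mathit{left}$ and $v<A[j]$: $A[j+1]\gets A[j]$, $j\gets j-1$; $A[j+1]\gets v$. Key comparisons counted: $A[\mathit{left}]>A[\mathit{right}]$ once per partitioning step, and every evaluation of $A[k]<p$, $A[k]\ge q$, $A[g]>q$ (at each test of the inner while condition), $A[g]\ge p$, and $v<A[j]$ (evaluated only when $j\ge\mathit{left}$). *)

theory Defs
  imports
    "HOL-Probability.Probability"
    "HOL-Combinatorics.Permutations"
    "HOL-Library.Landau_Symbols"
begin

text \<open>
  Arrays are functions on \<open>int\<close>, so that an index may run below the left or above the right
  boundary without truncation.  All procedures thread the array together with a counter \<open>c\<close> of the
  key comparisons made so far; comparisons of indices are not counted.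
\<close>

definition swap :: "(int \<Rightarrow> 'a) \<Rightarrow> int \<Rightarrow> int \<Rightarrow> int \<Rightarrow> 'a" where
  "swap A i j = A(i := A j, j := A i)"

text \<open>The inner while loop of InsertionSort; it returns the final array, index \<open>j\<close> and counter.\<close>

function insertion_shift ::
  "int \<Rightarrow> 'a::linorder \<Rightarrow> (int \<Rightarrow> 'a) \<Rightarrow> int \<Rightarrow> nat \<Rightarrow> (int \<Rightarrow> 'a) \<times> int \<times> nat" where
  "insertion_shift left v A j c =
     (if left \<le> j then
        if v < A j then insertion_shift left v (A(j + 1 := A j)) (j - 1) (c + 1)
        else (A, j, c + 1)
      else (A, j, c))"
  by pat_completeness auto
termination by (relation "Wellfounded.measure (\<lambda>(left, v, A, j, c). nat (j - left + 1))") auto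

declare insertion_shift.simps [simp del]

definition insertion_step ::
  "int \<Rightarrow> int \<Rightarrow> (int \<Rightarrow> 'a::linorder) \<times> nat \<Rightarrow> (int \<Rightarrow> 'a) \<times> nat" where
  "insertion_step left i = (\<lambda>(A, c).
     let v = A i;
         (A', j, c') = insertion_shift left v A (i - 1) c
     in (A'(j + 1 := v), c'))"

definition insertion_sort ::
  "(int \<Rightarrow> 'a::linorder) \<Rightarrow> int \<Rightarrow> int \<Rightarrow> nat \<Rightarrow> (int \<Rightarrow> 'a) \<times> nat" where
  "insertion_sort A left right c = fold (insertion_step left) [left + 1..right] (A, c)"

text \<open>
  The inner while loop of the partitioning.  The key comparison \<open>A g > q\<close> is the first operand of
  the loop condition, hence it is evaluated, and counted, at every test, also when \<open>k = g\<close>.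
\<close>

function scan_g ::
  "(int \<Rightarrow> 'a::linorder) \<Rightarrow> 'a \<Rightarrow> int \<Rightarrow> int \<Rightarrow> nat \<Rightarrow> int \<times> nat" where
  "scan_g A q k g c =
     (if A g > q \<and> k < g then scan_g A q k (g - 1) (c + 1) else (g, c + 1))"
  by pat_completeness auto
termination by (relation "Wellfounded.measure (\<lambda>(A, q, k, g, c). nat (g - k))") auto

declare scan_g.simps [simp del]

lemma scan_g_bounds:
  "k \<le> g \<Longrightarrow> scan_g A q k g c = (g', c') \<Longrightarrow> k \<le> g' \<and> g' \<le> g"
proof (induction A q k g c rule: scan_g.induct)
  case (1 A q k g c)
  show ?case
  proof (cases "A g > q \<and> k < g")
    case True
    with 1 show ?thesis by (subst (asm) (2) scan_g.simps) force
  next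
    case False
    with 1 show ?thesis by (subst (asm) (2) scan_g.simps) auto
  qed
qed

function partition_loop ::
  "'a::linorder \<Rightarrow> 'a \<Rightarrow> (int \<Rightarrow> 'a) \<Rightarrow> int \<Rightarrow> int \<Rightarrow> int \<Rightarrow> nat \<Rightarrow> (int \<Rightarrow> 'a) \<times> int \<times> int \<times> nat" where
  "partition_loop p q A l k g c =
     (if k \<le> g then
        if A k < p then partition_loop p q (swap A k l) (l + 1) (k + 1) g (c + 1)
        else if A k \<ge> q then
          (case scan_g A q k g (c + 2) of (g', c') \<Rightarrow>
             if A g' \<ge> p
             then partition_loop p q (swap A k g') l (k + 1) (g' - 1) (c' + 1)
             else partition_loop p q (swap (swap A k g') k l) (l + 1) (k + 1) (g' - 1) (c' + 1))
        else partition_loop p q A l (k + 1) g (c + 2)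
      else (A, l, g, c))"
  by pat_completeness auto
termination
  by (relation "Wellfounded.measure (\<lambda>(p, q, A, l, k, g, c). nat (g - k + 1))")
     (auto dest: scan_g_bounds[OF _ sym])

declare partition_loop.simps [simp del]

text \<open>One partitioning step: it returns the array and the final positions of the two pivots.\<close>

definition partition_step ::
  "(int \<Rightarrow> 'a::linorder) \<Rightarrow> int \<Rightarrow> int \<Rightarrow> nat \<Rightarrow> (int \<Rightarrow> 'a) \<times> int \<times> int \<times> nat" where
  "partition_step A left right c =
     (let (p, q) = (if A left > A right then (A right, A left) else (A left, A right));
          (A1, l1, g1, c1) = partition_loop p q A (left + 1) (left + 1) (right - 1) (c + 1);
          l = l1 - 1;
          g = g1 + 1;
          A2 = A1(left := A1 l);
          A3 = A2(l := p);
          A4 = A3(right := A3 g);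
          A5 = A4(g := q)
      in (A5, l, g, c1))"

lemma partition_loop_bounds:
  "partition_loop p q A l k g c = (A', l', g', c') \<Longrightarrow> l \<le> k \<Longrightarrow> k \<le> g + 2 \<Longrightarrow>
     l \<le> l' \<and> l' \<le> max k (g + 1) \<and> k \<le> g' + 2 \<and> g' \<le> g"
proof (induction p q A l k g c rule: partition_loop.induct)
  case (1 p q A l k g c)
  consider "\<not> k \<le> g" | "k \<le> g" "A k < p" | "k \<le> g" "\<not> A k < p" "\<not> A k \<ge> q"
    | "k \<le> g" "\<not> A k < p" "A k \<ge> q" by blast
  then show ?case
  proof cases
    case 1
    with "1.prems" show ?thesis by (subst (asm) partition_loop.simps) auto
  next
    case 2
    with "1.prems" have "partition_loop p q (swap A k l) (l + 1) (k + 1) g (c + 1) = (A', l', g', c')"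
      by (subst (asm) partition_loop.simps) auto
    from "1.IH"(1)[OF 2 this] 2 "1.prems" show ?thesis by auto
  next
    case 3
    with "1.prems" have "partition_loop p q A l (k + 1) g (c + 2) = (A', l', g', c')"
      by (subst (asm) partition_loop.simps) auto
    from "1.IH"(4)[OF 3 this] 3 "1.prems" show ?thesis by auto
  next
    case 4
    obtain h d where s: "scan_g A q k g (c + 2) = (h, d)" by fastforce
    have b: "k \<le> h" "h \<le> g" using scan_g_bounds[OF 4(1) s] by auto
    show ?thesis
    proof (cases "A h \<ge> p")
      case True
      with 4 s "1.prems" have "partition_loop p q (swap A k h) l (k + 1) (h - 1) (d + 1) = (A', l', g', c')"
        by (subst (asm) partition_loop.simps) auto
      from "1.IH"(2)[OF 4 s[symmetric] True this] b 4 "1.prems" show ?thesis by auto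
    next
      case False
      with 4 s "1.prems" have
        "partition_loop p q (swap (swap A k h) k l) (l + 1) (k + 1) (h - 1) (d + 1) = (A', l', g', c')"
        by (subst (asm) partition_loop.simps) auto
      from "1.IH"(3)[OF 4 s[symmetric] False this] b 4 "1.prems" show ?thesis by auto
    qed
  qed
qed

lemma partition_step_bounds:
  assumes "left \<le> right" "partition_step A left right c = (A', l, g, c')"
  shows "left \<le> l" "l \<le> right" "left \<le> g" "g \<le> right"
proof -
  obtain p q where pq: "(if A left > A right then (A right, A left) else (A left, A right)) = (p, q)"
    by fastforce
  obtain A1 l1 g1 c1 where
    loop: "partition_loop p q A (left + 1) (left + 1) (right - 1) (c + 1) = (A1, l1, g1, c1)"
    by (metis prod_cases4)
  have "l = l1 - 1" "g = g1 + 1"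
    using assms(2) unfolding partition_step_def pq by (auto simp: loop[simplified] Let_def)
  with partition_loop_bounds[OF loop] assms(1)
  show "left \<le> l" "l \<le> right" "left \<le> g" "g \<le> right" by auto
qed

function dual_pivot_quicksort ::
  "nat \<Rightarrow> (int \<Rightarrow> 'a::linorder) \<Rightarrow> int \<Rightarrow> int \<Rightarrow> nat \<Rightarrow> (int \<Rightarrow> 'a) \<times> nat" where
  "dual_pivot_quicksort M A left right c =
     (if right - left < int M then insertion_sort A left right c
      else
        (case partition_step A left right c of (A0, l, g, c0) \<Rightarrow>
        (case dual_pivot_quicksort M A0 left (l - 1) c0 of (A1, c1) \<Rightarrow>
        (case dual_pivot_quicksort M A1 (l + 1) (g - 1) c1 of (A2, c2) \<Rightarrow>
         dual_pivot_quicksort M A2 (g + 1) right c2))))"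
  by pat_completeness auto
termination
proof (relation "Wellfounded.measure (\<lambda>(M, A, left, right, c). nat (right - left + 1))", goal_cases)
  case 1
  show ?case by simp
next
  case (2 M A left right c A0 y l y' g c0)
  then have "left \<le> right" "partition_step A left right c = (A0, l, g, c0)" by simp_all
  from partition_step_bounds[OF this] \<open>left \<le> right\<close> show ?case by simp
next
  case (3 M A left right c A0 y l y' g c0 A1 c1)
  then have "left \<le> right" "partition_step A left right c = (A0, l, g, c0)" by simp_all
  from partition_step_bounds[OF this] \<open>left \<le> right\<close> show ?case by simp
next
  case (4 M A left right c A0 y l y' g c0 A1 c1 A2 c2)
  then have "left \<le> right" "partition_step A left right c = (A0, l, g, c0)" by simp_all
  from partition_step_bounds[OF this] \<open>left \<le> right\<close> show ?case by simp
qed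

declare dual_pivot_quicksort.simps [simp del]

text \<open>The random permutation of \<open>{1..n}\<close> is the input array itself.\<close>

definition random_permutation :: "nat \<Rightarrow> (int \<Rightarrow> int) pmf" where
  "random_permutation n = pmf_of_set {\<pi>. \<pi> permutes {1..int n}}"

definition comparisons :: "nat \<Rightarrow> nat \<Rightarrow> (int \<Rightarrow> int) \<Rightarrow> real" where
  "comparisons M n \<pi> = real (snd (dual_pivot_quicksort M \<pi> 1 (int n) 0))"

definition expected_comparisons :: "nat \<Rightarrow> nat \<Rightarrow> real" where
  "expected_comparisons M n = measure_pmf.expectation (random_permutation n) (comparisons M n)"

definition variance_comparisons :: "nat \<Rightarrow> nat \<Rightarrow> real" where
  "variance_comparisons M n = measure_pmf.variance (random_permutation n) (comparisons M n)"

definition normalized_comparisons :: "nat \<Rightarrow> nat \<Rightarrow> (int \<Rightarrow> int) \<Rightarrow> real" where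
  "normalized_comparisons M n \<pi> = (comparisons M n \<pi> - expected_comparisons M n) / real n"

text \<open>The joint law of the spacings of two independent uniform random variables.\<close>

definition spacings_law :: "(real \<times> real \<times> real) measure" where
  "spacings_law =
     distr (uniform_measure lborel {0..1} \<Otimes>\<^sub>M uniform_measure lborel {0..1}) borel
       (\<lambda>(u, v). (min u v, max u v - min u v, 1 - max u v))"

text \<open>
  The right-hand side of the fixed-point equation, as a function of the coefficients and the
  three copies of \<open>X\<close>.  Since \<open>ln 0 = 0\<close> in HOL, the convention for \<open>x ln x\<close> at \<open>x = 0\<close> holds.
\<close>

definition fixed_point_rhs :: "(real \<times> real \<times> real) \<times> real \<times> real \<times> real \<Rightarrow> real" where
  "fixed_point_rhs = (\<lambda>((d1, d2, d3), x1, x2, x3).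
     1 + (d1 + d2) * (d2 + 2 * d3)
       + ((d1 * x1 + 19 / 10 * d1 * ln d1)
        + (d2 * x2 + 19 / 10 * d2 * ln d2)
        + (d3 * x3 + 19 / 10 * d3 * ln d3)))"

text \<open>
  Independence of the coefficient vector and the three copies, each with law \<open>\<mu>\<close>, means that their
  joint law is the product measure.
\<close>

definition fixed_point_solution :: "real measure \<Rightarrow> bool" where
  "fixed_point_solution \<mu> \<longleftrightarrow>
     distr (spacings_law \<Otimes>\<^sub>M (\<mu> \<Otimes>\<^sub>M (\<mu> \<Otimes>\<^sub>M \<mu>))) borel fixed_point_rhs = \<mu>"

definition centered_square_integrable :: "real measure \<Rightarrow> bool" where
  "centered_square_integrable \<mu> \<longleftrightarrow>
     real_distribution \<mu> \<and> integrable \<mu> (\<lambda>x. x) \<and> (\<integral>x. x \<partial>\<mu>) = 0 \<and> integrable \<mu> (\<lambda>x. x\<^sup>2)"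

end

theory Submission
  imports Defs "HOL-Real_Asymp.Real_Asymp"
begin

text \<open>A partitioning step commutes with every renaming of the keys that preserves the three blocks below,
  between and above the pivots. Averaging over these renamings shows that, given the pivots, the three
  subarrays are independent uniformly random permutations, so the normalised costs satisfy a recursion in
  law. The cost of one step is, up to \<open>O(n)\<close> in variance, a function of the block sizes; the mean recursion
  then gives \<open>E C\<^sub>n = 19/10 n ln n + c n + o(n)\<close>, and the recursion converges to the fixed-point equation once
  the pivot ranks are coupled with uniform variables. Convergence is a contraction argument for the
  weighted distance \<open>sup |\<phi>(t) - \<psi>(t)| / |t| powr (3/2)\<close> of characteristic functions; second moments obey a
  scalar recursion of the same kind.\<close>


section \<open>Renaming keys\<close>

text \<open>The number of comparisons in one step is not a function of the pivot ranks, and its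
  joint law with them is never computed. A block-preserving renaming leaves it unchanged, so it is a
  constant inside each average over renamings, and only its mean-square distance from a polynomial
  in the block proportions matters. The constant \<open>19 / 10\<close> is forced: the limiting toll
  has mean \<open>19 / 12\<close>, the sum of \<open>D ln D\<close> over the three spacings has mean
  \<open>- 5 / 6\<close>, and only the ratio of these numbers makes the inhomogeneous term
  \<open>b\<close> of the fixed-point equation centred. As the squares of the spacings have mean sum
  \<open>1 / 2\<close>, the variance solves \<open>v = E b^2 + v / 2\<close>. The exponent of the
  distance must exceed 1, because the proportions add up to 1 and exponent 1 would not contract.
  Exponent 2 gives the factor \<open>1 / 2\<close> and settles existence and uniqueness of the fixed
  point. For finite \<open>n\<close>, however, the errors of the toll and of the coupling enter
  linearly in \<open>t\<close>, which a division by \<open>t^2\<close> does not tolerate near 0;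
  \<open>3 / 2\<close> lies between the two.\<close>

definition sim :: "('a \<Rightarrow> 'b) \<Rightarrow> int \<Rightarrow> int set \<Rightarrow> (int \<Rightarrow> 'a) \<Rightarrow> (int \<Rightarrow> 'b) \<Rightarrow> bool" where
  "sim f d S A B \<longleftrightarrow> (\<forall>i\<in>S. B (i + d) = f (A i))"

lemma simD: "sim f d S A B \<Longrightarrow> i \<in> S \<Longrightarrow> B (i + d) = f (A i)"
  by (simp add: sim_def)

lemma sim_subset: "sim f d S A B \<Longrightarrow> T \<subseteq> S \<Longrightarrow> sim f d T A B"
  by (auto simp: sim_def)

lemma sim_update: "sim f d S A B \<Longrightarrow> w = f v \<Longrightarrow> j = i + d \<Longrightarrow> sim f d S (A(i := v)) (B(j := w))"
  by (auto simp: sim_def)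

lemma sim_swap:
  "sim f d S A B \<Longrightarrow> i \<in> S \<Longrightarrow> j \<in> S \<Longrightarrow> sim f d S (swap A i j) (swap B (i + d) (j + d))"
  by (auto simp: sim_def swap_def)

text \<open>The two runs start from unrelated counters \<open>c\<close> and \<open>b\<close>, and
  only the increment \<open>n\<close> is compared; this is what later makes the cost of a call
  independent of the counter that it inherits. The bounds on \<open>j'\<close> guarantee that the
  write to position \<open>j' + 1\<close> that follows stays inside the segment.\<close>

lemma insertion_shift_sim:
  fixes f :: "'a::linorder \<Rightarrow> 'b::linorder"
  assumes "strict_mono f"
  shows "insertion_shift left v A j c = (A', j', c') \<Longrightarrow> sim f d {left..right} A B \<Longrightarrow>
    left - 1 \<le> j \<Longrightarrow> j < right \<Longrightarrow>
    \<exists>B' n. c' = c + n \<and> insertion_shift (left + d) (f v) B (j + d) b = (B', j' + d, b + n) \<and>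
      sim f d {left..right} A' B' \<and> (\<forall>i. i \<notin> {left..right} \<longrightarrow> A' i = A i) \<and> left - 1 \<le> j' \<and> j' \<le> j"
proof (induction left v A j c arbitrary: B b rule: insertion_shift.induct)
  case (1 left v A j c)
  have eq: "f v < B (j + d) \<longleftrightarrow> v < A j" if "left \<le> j"
    using 1(3,5) that assms by (auto simp: sim_def strict_mono_less)
  show ?case
  proof (cases "left \<le> j \<and> v < A j")
    case True
    then have e: "insertion_shift left v (A(j + 1 := A j)) (j - 1) (c + 1) = (A', j', c')"
      using 1(2) by (subst (asm) insertion_shift.simps) auto
    have s: "sim f d {left..right} (A(j + 1 := A j)) (B(j + d + 1 := B (j + d)))"
      using 1(3,5) True by (intro sim_update) (auto simp: sim_def)
    obtain B' n where *: "c' = c + 1 + n"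
      "insertion_shift (left + d) (f v) (B(j + d + 1 := B (j + d))) (j - 1 + d) (b + 1) = (B', j' + d, b + 1 + n)"
      "sim f d {left..right} A' B'" "\<forall>i. i \<notin> {left..right} \<longrightarrow> A' i = (A(j + 1 := A j)) i"
      "left - 1 \<le> j'" "j' \<le> j - 1"
      using 1(1)[OF _ _ e s, of "b + 1"] True 1(4,5) by (auto simp del: fun_upd_apply)
    show ?thesis
    proof (intro exI conjI)
      show "c' = c + Suc n" using * by simp
      show "insertion_shift (left + d) (f v) B (j + d) b = (B', j' + d, b + Suc n)"
        using * True eq by (subst insertion_shift.simps) (auto simp: algebra_simps)
    qed (use * True 1(5) in auto)
  next
    case False
    then have "insertion_shift left v A j c = (A, j, if left \<le> j then c + 1 else c)"
      by (subst insertion_shift.simps) auto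
    moreover have "insertion_shift (left + d) (f v) B (j + d) b = (B, j + d, if left \<le> j then b + 1 else b)"
      using False eq by (subst insertion_shift.simps) auto
    ultimately show ?thesis using 1 by (auto split: if_splits)
  qed
qed

lemma insertion_step_sim:
  fixes f :: "'a::linorder \<Rightarrow> 'b::linorder"
  assumes "strict_mono f" "insertion_step left i (A, c) = (A', c')" "sim f d {left..right} A B"
    "i \<in> {left..right}"
  shows "\<exists>B' n. c' = c + n \<and> insertion_step (left + d) (i + d) (B, b) = (B', b + n) \<and>
      sim f d {left..right} A' B' \<and> (\<forall>i. i \<notin> {left..right} \<longrightarrow> A' i = A i)"
proof -
  obtain A1 j c1 where 1: "insertion_shift left (A i) A (i - 1) c = (A1, j, c1)"
    by (metis prod_cases3)
  obtain B1 n where 2: "c1 = c + n" 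
    "insertion_shift (left + d) (f (A i)) B (i - 1 + d) b = (B1, j + d, b + n)"
    "sim f d {left..right} A1 B1" "\<forall>i. i \<notin> {left..right} \<longrightarrow> A1 i = A i" "left - 1 \<le> j" "j \<le> i - 1"
    using insertion_shift_sim[OF assms(1) 1 assms(3), of b] assms(4) by auto
  have "f (A i) = B (i + d)" using assms by (auto simp: sim_def)
  then have "insertion_step (left + d) (i + d) (B, b) = (B1(j + d + 1 := f (A i)), b + n)"
    using 2 by (simp add: insertion_step_def Let_def algebra_simps)
  moreover have "A' = A1(j + 1 := A i)" "c' = c1"
    using assms(2) 1 by (auto simp: insertion_step_def)
  moreover have "sim f d {left..right} (A1(j + 1 := A i)) (B1(j + d + 1 := f (A i)))"
    by (rule sim_update[OF 2(3)]) auto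
  ultimately show ?thesis using 2 assms(4) by auto
qed

lemma insertion_fold_sim:
  fixes f :: "'a::linorder \<Rightarrow> 'b::linorder"
  assumes "strict_mono f"
  shows "fold (insertion_step left) xs (A, c) = (A', c') \<Longrightarrow> sim f d {left..right} A B \<Longrightarrow>
    set xs \<subseteq> {left..right} \<Longrightarrow>
    \<exists>B' n. c' = c + n \<and> fold (insertion_step (left + d)) (map (\<lambda>i. i + d) xs) (B, b) = (B', b + n) \<and>
      sim f d {left..right} A' B' \<and> (\<forall>i. i \<notin> {left..right} \<longrightarrow> A' i = A i)"
proof (induction xs arbitrary: A B b c)
  case Nil
  then show ?case by auto
next
  case (Cons x xs)
  obtain A1 c1 where 1: "insertion_step left x (A, c) = (A1, c1)" by fastforce
  obtain B1 n where 2: "c1 = c + n" "insertion_step (left + d) (x + d) (B, b) = (B1, b + n)"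
    "sim f d {left..right} A1 B1" "\<forall>i. i \<notin> {left..right} \<longrightarrow> A1 i = A i"
    using insertion_step_sim[OF assms 1 Cons(3), of b] Cons(4) by auto
  obtain B' m where 3: "c' = c1 + m" 
    "fold (insertion_step (left + d)) (map (\<lambda>i. i + d) xs) (B1, b + n) = (B', b + n + m)"
    "sim f d {left..right} A' B'" "\<forall>i. i \<notin> {left..right} \<longrightarrow> A' i = A1 i"
    using Cons(1)[OF _ 2(3), of c1 "b + n"] 1 Cons(2,4) by auto
  show ?case using 2 3
    by (intro exI[of _ B'] exI[of _ "n + m"]) (auto simp: add.assoc)
qed

lemma upto_shift: "[i + d..j + d] = map (\<lambda>x. x + d) [i..j]"
proof (induction i j rule: upto.induct)
  case (1 i j)
  have "i + 1 + d = i + d + 1" by simp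
  with 1 show ?case
    by (cases "i \<le> j") (simp_all add: upto_rec1 del: upto.simps)
qed

lemma insertion_sort_sim:
  fixes f :: "'a::linorder \<Rightarrow> 'b::linorder"
  assumes "strict_mono f" "insertion_sort A left right c = (A', c')" "sim f d {left..right} A B"
  shows "\<exists>B' n. c' = c + n \<and> insertion_sort B (left + d) (right + d) b = (B', b + n) \<and>
      sim f d {left..right} A' B' \<and> (\<forall>i. i \<notin> {left..right} \<longrightarrow> A' i = A i)"
  using insertion_fold_sim[OF assms(1) _ assms(3), of "[left + 1..right]" c A' c' b] assms(2)
    upto_shift[of "left + 1" d right]
  by (auto simp: insertion_sort_def algebra_simps)

text \<open>The scan looks at keys only through the test against the upper pivot, so a renaming is
  admissible as soon as it respects that one test.\<close>

lemma scan_g_sim: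
  fixes f :: "'a::linorder \<Rightarrow> 'b::linorder"
  assumes "\<And>x. q' < f x \<longleftrightarrow> q < x"
  shows "scan_g A q k g c = (g', c') \<Longrightarrow> k \<le> g \<Longrightarrow> sim f d {k..g} A B \<Longrightarrow>
    \<exists>n. c' = c + n \<and> scan_g B q' (k + d) (g + d) b = (g' + d, b + n)"
  using assms
proof (induction A q k g c arbitrary: b rule: scan_g.induct)
  case (1 A q k g c)
  have eq: "q' < B (g + d) \<longleftrightarrow> q < A g"
    using simD[OF 1(4), of g] 1(3,5) by simp
  show ?case
  proof (cases "q < A g \<and> k < g")
    case True
    then have e: "scan_g A q k (g - 1) (c + 1) = (g', c')"
      using 1(2) by (subst (asm) scan_g.simps) auto
    obtain n where "c' = c + 1 + n" "scan_g B q' (k + d) (g - 1 + d) (b + 1) = (g' + d, b + 1 + n)"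
      using 1(1)[OF True e _ _ 1(5), of "b + 1"] True sim_subset[OF 1(4), of "{k..g - 1}"] by auto
    then show ?thesis using True eq
      by (intro exI[of _ "Suc n"]) (subst scan_g.simps, auto simp: algebra_simps)
  next
    case False
    then have "scan_g A q k g c = (g, c + 1)" "scan_g B q' (k + d) (g + d) b = (g + d, b + 1)"
      using eq by (subst scan_g.simps; auto)+
    then show ?thesis using 1(2) by auto
  qed
qed

text \<open>Keys are compared with the two pivots only, never with one another. The hypotheses list
  exactly these tests, \<open>A g >= p\<close> being the negation of the first, so \<open>f\<close>
  may shuffle the keys inside each block. This freedom is what leaves the subarrays uniformly random
  after a step.\<close>

lemma partition_loop_sim:
  fixes f :: "'a::linorder \<Rightarrow> 'b::linorder"
  assumes p: "\<And>x. f x < p' \<longleftrightarrow> x < p" and q: "\<And>x. q' < f x \<longleftrightarrow> q < x"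
    and q2: "\<And>x. q' \<le> f x \<longleftrightarrow> q \<le> x"
  shows "partition_loop p q A l k g c = (A', l', g', c') \<Longrightarrow> sim f d {lo..hi} A B \<Longrightarrow>
    lo \<le> l \<Longrightarrow> l \<le> k \<Longrightarrow> g \<le> hi \<Longrightarrow>
    \<exists>n B'. c' = c + n \<and> partition_loop p' q' B (l + d) (k + d) (g + d) b = (B', l' + d, g' + d, b + n) \<and>
      sim f d {lo..hi} A' B' \<and> (\<forall>i. i \<notin> {lo..hi} \<longrightarrow> A' i = A i)"
  using assms
proof (induction p q A l k g c arbitrary: B b rule: partition_loop.induct)
  case (1 p q A l k g c)
  note p = "1.prems"(6) and q = "1.prems"(7) and q2 = "1.prems"(8)
  note prems = "1.prems"(1-5)
  have eq: "B (k + d) < p' \<longleftrightarrow> A k < p" "q' \<le> B (k + d) \<longleftrightarrow> q \<le> A k" if "k \<le> g"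
    using simD[OF prems(2), of k] prems(3-5) that p q2 by auto
  consider "\<not> k \<le> g" | "k \<le> g" "A k < p" | "k \<le> g" "\<not> A k < p" "\<not> A k \<ge> q"
    | "k \<le> g" "\<not> A k < p" "A k \<ge> q" by blast
  then show ?case
  proof cases
    case 1
    then show ?thesis using prems
      by (subst (asm) partition_loop.simps, subst partition_loop.simps) auto
  next
    case 2
    then have e: "partition_loop p q (swap A k l) (l + 1) (k + 1) g (c + 1) = (A', l', g', c')"
      using prems(1) by (subst (asm) partition_loop.simps) auto
    have s: "sim f d {lo..hi} (swap A k l) (swap B (k + d) (l + d))"
      using prems 2 by (intro sim_swap) auto
    obtain n B' where *: "c' = c + 1 + n" 
      "partition_loop p' q' (swap B (k + d) (l + d)) (l + 1 + d) (k + 1 + d) (g + d) (b + 1) = (B', l' + d, g' + d, b + 1 + n)"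
      "sim f d {lo..hi} A' B'" "\<forall>i. i \<notin> {lo..hi} \<longrightarrow> A' i = swap A k l i"
      using "1.IH"(1)[OF 2 e s _ _ _ p q q2, of "b + 1"] prems by auto
    have "partition_loop p' q' B (l + d) (k + d) (g + d) b = (B', l' + d, g' + d, b + (1 + n))"
      using * 2 eq by (subst partition_loop.simps) (auto simp: algebra_simps)
    then show ?thesis using * prems 2
      by (intro exI[of _ "1 + n"] exI[of _ B']) (auto simp: swap_def)
  next
    case 3
    then have e: "partition_loop p q A l (k + 1) g (c + 2) = (A', l', g', c')"
      using prems(1) by (subst (asm) partition_loop.simps) auto
    obtain n B' where *: "c' = c + 2 + n" 
      "partition_loop p' q' B (l + d) (k + 1 + d) (g + d) (b + 2) = (B', l' + d, g' + d, b + 2 + n)"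
      "sim f d {lo..hi} A' B'" "\<forall>i. i \<notin> {lo..hi} \<longrightarrow> A' i = A i"
      using "1.IH"(4)[OF 3 e prems(2) _ _ _ p q q2, of "b + 2"] prems by auto
    have "partition_loop p' q' B (l + d) (k + d) (g + d) b = (B', l' + d, g' + d, b + (2 + n))"
      using * 3 eq by (subst partition_loop.simps) (auto simp: algebra_simps)
    then show ?thesis using * prems 3
      by (intro exI[of _ "2 + n"] exI[of _ B']) auto
  next
    case 4
    obtain h e where s: "scan_g A q k g (c + 2) = (h, e)" by fastforce
    have h: "k \<le> h" "h \<le> g" using scan_g_bounds[OF 4(1) s] by auto
    obtain m where m: "e = c + 2 + m" "scan_g B q' (k + d) (g + d) (b + 2) = (h + d, b + 2 + m)"
      using scan_g_sim[OF q s 4(1) sim_subset[OF prems(2)], of "b + 2"] prems by auto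
    have eqh: "p' \<le> B (h + d) \<longleftrightarrow> p \<le> A h"
      using simD[OF prems(2), of h] prems(3-5) h p by (auto simp: not_less[symmetric])
    have s1: "sim f d {lo..hi} (swap A k h) (swap B (k + d) (h + d))"
      using prems h by (intro sim_swap) auto
    show ?thesis
    proof (cases "A h \<ge> p")
      case True
      then have r: "partition_loop p q (swap A k h) l (k + 1) (h - 1) (e + 1) = (A', l', g', c')"
        using prems(1) 4 s by (subst (asm) partition_loop.simps) auto
      obtain n B' where *: "c' = e + 1 + n" 
        "partition_loop p' q' (swap B (k + d) (h + d)) (l + d) (k + 1 + d) (h - 1 + d) (b + 2 + m + 1) = (B', l' + d, g' + d, b + 2 + m + 1 + n)"
        "sim f d {lo..hi} A' B'" "\<forall>i. i \<notin> {lo..hi} \<longrightarrow> A' i = swap A k h i"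
        using "1.IH"(2)[OF 4 s[symmetric] True r s1 _ _ _ p q q2, of "b + 2 + m + 1"] prems h by auto
      have "partition_loop p' q' B (l + d) (k + d) (g + d) b = (B', l' + d, g' + d, b + (3 + m + n))"
        using * 4 eq eqh True m by (subst partition_loop.simps) (auto simp: algebra_simps)
      then show ?thesis using * prems h m
        by (intro exI[of _ "3 + m + n"] exI[of _ B']) (auto simp: swap_def)
    next
      case False
      then have r: "partition_loop p q (swap (swap A k h) k l) (l + 1) (k + 1) (h - 1) (e + 1) = (A', l', g', c')"
        using prems(1) 4 s by (subst (asm) partition_loop.simps) auto
      have s2: "sim f d {lo..hi} (swap (swap A k h) k l) (swap (swap B (k + d) (h + d)) (k + d) (l + d))"
        using prems h by (intro sim_swap s1) auto
      obtain n B' where *: "c' = e + 1 + n" 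
        "partition_loop p' q' (swap (swap B (k + d) (h + d)) (k + d) (l + d)) (l + 1 + d) (k + 1 + d) (h - 1 + d) (b + 2 + m + 1) = (B', l' + d, g' + d, b + 2 + m + 1 + n)"
        "sim f d {lo..hi} A' B'" "\<forall>i. i \<notin> {lo..hi} \<longrightarrow> A' i = swap (swap A k h) k l i"
        using "1.IH"(3)[OF 4 s[symmetric] False r s2 _ _ _ p q q2, of "b + 2 + m + 1"] prems h by auto
      have "partition_loop p' q' B (l + d) (k + d) (g + d) b = (B', l' + d, g' + d, b + (3 + m + n))"
        using * 4 eq eqh False m by (subst partition_loop.simps) (auto simp: algebra_simps)
      then show ?thesis using * prems h m
        by (intro exI[of _ "3 + m + n"] exI[of _ B']) (auto simp: swap_def)
    qed
  qed
qed

lemma partition_step_sim: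
  fixes f :: "'a::linorder \<Rightarrow> 'b::linorder"
  assumes "left \<le> right" "partition_step A left right c = (A', l, g, c')"
    "sim f d {left..right} A B"
  defines "p \<equiv> min (A left) (A right)" and "q \<equiv> max (A left) (A right)"
  assumes p: "\<And>x. f x < f p \<longleftrightarrow> x < p" and q: "\<And>x. f q < f x \<longleftrightarrow> q < x"
    and q2: "\<And>x. f q \<le> f x \<longleftrightarrow> q \<le> x"
  shows "\<exists>n B'. c' = c + n \<and> partition_step B (left + d) (right + d) b = (B', l + d, g + d, b + n) \<and>
      sim f d {left..right} A' B' \<and> (\<forall>i. i \<notin> {left..right} \<longrightarrow> A' i = A i)"
proof -
  have pq: "(if A left > A right then (A right, A left) else (A left, A right)) = (p, q)"
    by (auto simp: p_def q_def)
  have B: "B (left + d) = f (A left)" "B (right + d) = f (A right)"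
    using simD[OF assms(3)] assms(1) by auto
  \<comment> \<open>The initial test of the two ends is a comparison of a key with a pivot as well,
    hence covered by the same hypotheses.\<close>
  have "f (A right) < f (A left) \<longleftrightarrow> A right < A left"
    using p[of "A right"] q2[of "A right"] by (cases "A right < A left") (auto simp: p_def q_def)
  then have pq': "(if B (left + d) > B (right + d) then (B (right + d), B (left + d))
      else (B (left + d), B (right + d))) = (f p, f q)"
    by (auto simp: p_def q_def B)
  obtain A1 l1 g1 c1 where
    loop: "partition_loop p q A (left + 1) (left + 1) (right - 1) (c + 1) = (A1, l1, g1, c1)"
    by (metis prod_cases4)
  have A': "l = l1 - 1" "g = g1 + 1" "c' = c1"
      "A' = A1(left := A1 l, l := p, right := (A1(left := A1 l, l := p)) g, g := q)"
    using assms(2) unfolding partition_step_def pq by (auto simp: loop[simplified] Let_def)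
  obtain n B1 where n: "c1 = c + 1 + n" "sim f d {left..right} A1 B1"
    "partition_loop (f p) (f q) B (left + 1 + d) (left + 1 + d) (right - 1 + d) (b + 1) =
      (B1, l1 + d, g1 + d, b + 1 + n)" "\<forall>i. i \<notin> {left..right} \<longrightarrow> A1 i = A i"
    using partition_loop_sim[OF p q q2 loop assms(3), of "b + 1"] by auto
  have 1: "l \<in> {left..right}" "g \<in> {left..right}"
    using partition_step_bounds[OF assms(1,2)] by auto
  let ?B = "B1(left + d := B1 (l + d), l + d := f p, 
         right + d := (B1(left + d := B1 (l + d), l + d := f p)) (g + d), g + d := f q)"
  have s1: "sim f d {left..right} (A1(left := A1 l, l := p)) (B1(left + d := B1 (l + d), l + d := f p))"
    using n(2) 1 by (intro sim_update) (auto simp: simD)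
  have "sim f d {left..right} A' ?B"
    unfolding A'(4) by (rule sim_update[OF sim_update[OF s1 simD[OF s1 1(2)] refl] refl refl])
  moreover have "partition_step B (left + d) (right + d) b = (?B, l + d, g + d, b + 1 + n)"
  proof -
    have "partition_loop (f p) (f q) B (left + d + 1) (left + d + 1) (right + d - 1) (b + 1) =
      (B1, l1 + d, g1 + d, b + 1 + n)" using n(3) by (simp add: algebra_simps)
    moreover have "l1 + d = l + d + 1" "g1 + d = g + d - 1" using A' by auto
    ultimately show ?thesis
      unfolding partition_step_def pq' by (simp add: Let_def del: fun_upd_apply)
  qed
  ultimately show ?thesis using n 1 assms(1)
    by (intro exI[of _ "1 + n"] exI[of _ ?B]) (auto simp: A')
qed

text \<open>Lifts agreement from the segment of a recursive call to the enclosing set of positions: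
  inside, the call provides it; outside, both arrays are as before.\<close>

lemma sim_glue:
  assumes "sim f d {lo..hi} A' B'" "\<forall>i. i \<notin> {lo..hi} \<longrightarrow> A' i = A i"
    "\<forall>i. i \<notin> {lo + d..hi + d} \<longrightarrow> B' i = B i" "sim f d S A B"
  shows "sim f d S A' B'"
  unfolding sim_def
proof
  fix i assume "i \<in> S"
  then show "B' (i + d) = f (A' i)"
    using assms by (cases "i \<in> {lo..hi}") (auto simp: sim_def)
qed

text \<open>The frame condition is a by-product of simulation: the run is simulated by itself, with
  the identity as renaming and no translation.\<close>

lemma insertion_sort_outside:
  assumes "insertion_sort A left right c = (A', c')" "i \<notin> {left..right}"
  shows "A' i = A i"
  using insertion_sort_sim[OF _ assms(1), of id 0 A] assms(2)
  by (auto simp: sim_def strict_mono_def)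

lemma partition_step_outside:
  assumes "left \<le> right" "partition_step A left right c = (A', l, g, c')" "i \<notin> {left..right}"
  shows "A' i = A i"
  using partition_step_sim[OF assms(1,2), of id 0 A] assms(3)
  by (auto simp: sim_def)

text \<open>Unlike for a single partitioning step, the renaming is strictly monotone here, because
  insertion sort compares arbitrary pairs of keys. The frame condition for \<open>B\<close> is part
  of the induction since \<open>sim_glue\<close> has to know that neither array is touched outside
  the segment of a call.\<close>

lemma dual_pivot_quicksort_sim:
  fixes f :: "'a::linorder \<Rightarrow> 'b::linorder"
  assumes "strict_mono f"
  shows "dual_pivot_quicksort M A left right c = (A', c') \<Longrightarrow> sim f d {left..right} A B \<Longrightarrow>
    \<exists>n B'. c' = c + n \<and> dual_pivot_quicksort M B (left + d) (right + d) b = (B', b + n) \<and>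
      sim f d {left..right} A' B' \<and> (\<forall>i. i \<notin> {left..right} \<longrightarrow> A' i = A i) \<and>
      (\<forall>i. i \<notin> {left + d..right + d} \<longrightarrow> B' i = B i)"
proof (induction M A left right c arbitrary: B b A' c' rule: dual_pivot_quicksort.induct)
  case (1 M A left right c)
  show ?case
  proof (cases "right - left < int M")
    case True
    then have "insertion_sort A left right c = (A', c')"
      using 1(4) by (subst (asm) dual_pivot_quicksort.simps) auto
    from insertion_sort_sim[OF assms this 1(5), of b] obtain n B' where *: "c' = c + n"
        "insertion_sort B (left + d) (right + d) b = (B', b + n)" "sim f d {left..right} A' B'"
        "\<forall>i. i \<notin> {left..right} \<longrightarrow> A' i = A i" by auto
    moreover have "dual_pivot_quicksort M B (left + d) (right + d) b = (B', b + n)"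
      using * True by (subst dual_pivot_quicksort.simps) auto
    ultimately show ?thesis
      using insertion_sort_outside[OF *(2)] by (intro exI[of _ n] exI[of _ B']) auto
  next
    case False
    then have le: "left \<le> right" by auto
    obtain A0 l g c0 where ps: "partition_step A left right c = (A0, l, g, c0)"
      by (metis prod_cases4)
    obtain A1 c1 where q1: "dual_pivot_quicksort M A0 left (l - 1) c0 = (A1, c1)" by fastforce
    obtain A2 c2 where q2: "dual_pivot_quicksort M A1 (l + 1) (g - 1) c1 = (A2, c2)" by fastforce
    have q3: "dual_pivot_quicksort M A2 (g + 1) right c2 = (A', c')"
      using 1(4) False ps q1 q2 by (subst (asm) dual_pivot_quicksort.simps) auto
    note IH = "1.IH"(1)[OF False ps[symmetric] refl refl q1] 
      "1.IH"(2)[OF False ps[symmetric] refl refl q1[symmetric] q2]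
      "1.IH"(3)[OF False ps[symmetric] refl refl q1[symmetric] q2[symmetric] q3]
    have b: "left \<le> l" "l \<le> right" "left \<le> g" "g \<le> right"
      using partition_step_bounds[OF le ps] by auto
    obtain n0 B0 where 0: "c0 = c + n0" 
      "partition_step B (left + d) (right + d) b = (B0, l + d, g + d, b + n0)"
      "sim f d {left..right} A0 B0" "\<forall>i. i \<notin> {left..right} \<longrightarrow> A0 i = A i"
      using partition_step_sim[OF le ps 1(5), of b] assms
      by (auto simp: strict_mono_less strict_mono_less_eq)
    have z: "\<forall>i. i \<notin> {left + d..right + d} \<longrightarrow> B0 i = B i"
      using partition_step_outside[OF _ 0(2)] le by auto
    obtain n1 B1 where 1: "c1 = c0 + n1" 
      "dual_pivot_quicksort M B0 (left + d) (l - 1 + d) (b + n0) = (B1, b + n0 + n1)"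
      "sim f d {left..l - 1} A1 B1" "\<forall>i. i \<notin> {left..l - 1} \<longrightarrow> A1 i = A0 i"
      "\<forall>i. i \<notin> {left + d..l - 1 + d} \<longrightarrow> B1 i = B0 i"
      using IH(1)[OF sim_subset[OF 0(3)], of "b + n0"] b by auto
    have s1: "sim f d {left..right} A1 B1"
      by (rule sim_glue[OF 1(3-5) 0(3)])
    obtain n2 B2 where 2: "c2 = c1 + n2" 
      "dual_pivot_quicksort M B1 (l + 1 + d) (g - 1 + d) (b + n0 + n1) = (B2, b + n0 + n1 + n2)"
      "sim f d {l + 1..g - 1} A2 B2" "\<forall>i. i \<notin> {l + 1..g - 1} \<longrightarrow> A2 i = A1 i"
      "\<forall>i. i \<notin> {l + 1 + d..g - 1 + d} \<longrightarrow> B2 i = B1 i"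
      using IH(2)[OF sim_subset[OF s1], of "b + n0 + n1"] b by auto
    have s2: "sim f d {left..right} A2 B2"
      by (rule sim_glue[OF 2(3-5) s1])
    obtain n3 B3 where 3: "c' = c2 + n3" 
      "dual_pivot_quicksort M B2 (g + 1 + d) (right + d) (b + n0 + n1 + n2) = (B3, b + n0 + n1 + n2 + n3)"
      "sim f d {g + 1..right} A' B3" "\<forall>i. i \<notin> {g + 1..right} \<longrightarrow> A' i = A2 i"
      "\<forall>i. i \<notin> {g + 1 + d..right + d} \<longrightarrow> B3 i = B2 i"
      using IH(3)[OF sim_subset[OF s2], of "b + n0 + n1 + n2"] b by auto
    have s3: "sim f d {left..right} A' B3"
      by (rule sim_glue[OF 3(3-5) s2])
    have "dual_pivot_quicksort M B (left + d) (right + d) b = (B3, b + n0 + n1 + n2 + n3)"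
      using False 0(2) 1(2) 2(2) 3(2)
      by (subst dual_pivot_quicksort.simps) (auto simp: algebra_simps)
    moreover have "\<forall>i. i \<notin> {left..right} \<longrightarrow> A' i = A i"
      using 0(4) 1(4) 2(4) 3(4) b by auto
    moreover have "\<forall>i. i \<notin> {left + d..right + d} \<longrightarrow> B3 i = B i"
      using z 1(5) 2(5) 3(5) b by auto
    ultimately show ?thesis
      using 0(1) 1(1) 2(1) 3(1) s3
      by (intro exI[of _ "n0 + n1 + n2 + n3"] exI[of _ B3]) (auto simp: add.assoc)
  qed
qed

section \<open>Costs of calls as functions of the input segment\<close>

definition cost :: "nat \<Rightarrow> (int \<Rightarrow> 'a::linorder) \<Rightarrow> int \<Rightarrow> int \<Rightarrow> nat" where
  "cost M A left right = snd (dual_pivot_quicksort M A left right 0)"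

text \<open>Taken with the identity and \<open>d = 0\<close>, this also says that keys outside the
  segment do not influence the cost, which is how it serves in the recursion below.\<close>

lemma cost_sim:
  assumes "strict_mono f" "sim f d {left..right} A B"
  shows "cost M B (left + d) (right + d) = cost M A left right"
  using dual_pivot_quicksort_sim[OF assms(1) _ assms(2), of M 0 _ _ 0]
  by (cases "dual_pivot_quicksort M A left right 0") (fastforce simp: cost_def)

lemma dual_pivot_quicksort_cost:
  assumes "dual_pivot_quicksort M A left right c = (A', c')" 
  shows "c' = c + cost M A left right" "i \<notin> {left..right} \<Longrightarrow> A' i = A i"
proof -
  have "strict_mono (id :: 'a \<Rightarrow> 'a)" "sim id 0 {left..right} A A"
    by (auto simp: sim_def strict_mono_def)
  from dual_pivot_quicksort_sim[OF this(1) assms this(2), of 0]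
  show "c' = c + cost M A left right" "i \<notin> {left..right} \<Longrightarrow> A' i = A i"
    by (auto simp: cost_def)
qed

text \<open>All three costs refer to the array \<open>A'\<close> right after partitioning, although
  the second and third call find it modified: the earlier calls write only into their own segments.
  \<open>l < g\<close> keeps the first segment away from the third.\<close>

lemma cost_rec:
  assumes "int M \<le> right - left" "partition_step A left right 0 = (A', l, g, t)" "l < g"
  shows "cost M A left right =
    t + cost M A' left (l - 1) + cost M A' (l + 1) (g - 1) + cost M A' (g + 1) right"
proof -
  obtain A1 c1 where q1: "dual_pivot_quicksort M A' left (l - 1) t = (A1, c1)" by fastforce
  obtain A2 c2 where q2: "dual_pivot_quicksort M A1 (l + 1) (g - 1) c1 = (A2, c2)" by fastforce
  obtain A3 c3 where q3: "dual_pivot_quicksort M A2 (g + 1) right c2 = (A3, c3)" by fastforce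
  have "left \<le> right" using assms(1) by auto
  note b = partition_step_bounds[OF this assms(2)]
  have "cost M A left right = c3"
    using assms(1,2) q1 q2 q3 unfolding cost_def by (subst dual_pivot_quicksort.simps) auto
  also have "\<dots> = t + cost M A' left (l - 1) + cost M A1 (l + 1) (g - 1) + cost M A2 (g + 1) right"
    using dual_pivot_quicksort_cost(1)[OF q1] dual_pivot_quicksort_cost(1)[OF q2]
      dual_pivot_quicksort_cost(1)[OF q3] by simp
  also have "cost M A1 (l + 1) (g - 1) = cost M A' (l + 1) (g - 1)"
    using cost_sim[of id 0 "l + 1" "g - 1" A' A1 M] dual_pivot_quicksort_cost(2)[OF q1]
    by (auto simp: sim_def strict_mono_def)
  also have "cost M A2 (g + 1) right = cost M A' (g + 1) right"
    using cost_sim[of id 0 "g + 1" right A' A2 M] dual_pivot_quicksort_cost(2)[OF q1]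
      dual_pivot_quicksort_cost(2)[OF q2] assms(3)
    by (auto simp: sim_def strict_mono_def)
  finally show ?thesis .
qed


section \<open>The partitioning loop\<close>

lemma swap_eq_comp_transpose: "swap A i j = A \<circ> Transposition.transpose i j"
  by (auto simp: swap_def Transposition.transpose_def fun_eq_iff)

lemma swap_permutes:
  assumes "A permutes S" "i \<in> S" "j \<in> S"
  shows "swap A i j permutes S"
  unfolding swap_eq_comp_transpose using assms by (intro permutes_compose permutes_swap_id)

text \<open>The last test, which stops the scan, is counted too; hence the summand 1. The final
  disjunction tells apart the two reasons for stopping: a key that is not above \<open>q\<close>, or
  the meeting of the indices.\<close>

lemma scan_g_result:
  "scan_g A q k g c = (h, e) \<Longrightarrow> k \<le> g \<Longrightarrow>
    int e = int c + (g - h) + 1 \<and> (\<forall>i\<in>{h<..g}. q < A i) \<and> (A h \<le> q \<or> h = k)"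
proof (induction A q k g c rule: scan_g.induct)
  case (1 A q k g c)
  show ?case
  proof (cases "q < A g \<and> k < g")
    case True
    then have e: "scan_g A q k (g - 1) (c + 1) = (h, e)"
      using 1(2) by (subst (asm) scan_g.simps) auto
    with 1(1)[OF True e] True have *: "int e = int (c + 1) + (g - 1 - h) + 1"
      "\<forall>i\<in>{h<..g - 1}. q < A i" "A h \<le> q \<or> h = k" by auto
    have "q < A i" if "i \<in> {h<..g}" for i
      using *(2) True that by (cases "i = g") auto
    with * show ?thesis by auto
  next
    case False
    then have "scan_g A q k g c = (g, c + 1)"
      by (subst scan_g.simps) auto
    then show ?thesis using 1(2,3) False by auto
  qed
qed

text \<open>The regions are: below \<open>p\<close> up to \<open>l - 1\<close>, between the pivots
  up to \<open>k - 1\<close>, uninspected up to \<open>g\<close>, at least \<open>q\<close> beyond.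
  The upper limit of the middle region is \<open>min (k - 1) g\<close> because a last exchange at a
  meeting point leaves \<open>k\<close> two above \<open>g\<close>, and then position
  \<open>k - 1\<close> already belongs to the right region.\<close>

lemma partition_loop_invariant:
  assumes "p < q"
  shows "partition_loop p q A l k g c = (A', l', g', c') \<Longrightarrow> A permutes S \<Longrightarrow> {lo..hi} \<subseteq> S \<Longrightarrow>
    \<forall>i\<in>{lo..l - 1}. A i < p \<Longrightarrow> \<forall>i\<in>{l..min (k - 1) g}. p \<le> A i \<and> A i \<le> q \<Longrightarrow> \<forall>i\<in>{g + 1..hi}. q \<le> A i \<Longrightarrow>
    lo \<le> l \<Longrightarrow> l \<le> k \<Longrightarrow> l \<le> g + 1 \<Longrightarrow> g \<le> hi \<Longrightarrow> k \<le> g + 2 \<Longrightarrow>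
    A' permutes S \<and> (\<forall>i\<in>{lo..l' - 1}. A' i < p) \<and> (\<forall>i\<in>{l'..g'}. p \<le> A' i \<and> A' i \<le> q) \<and>
    (\<forall>i\<in>{g' + 1..hi}. q \<le> A' i) \<and> lo \<le> l' \<and> l' \<le> g' + 1 \<and> g' \<le> hi"
  using assms
proof (induction p q A l k g c rule: partition_loop.induct)
  case (1 p q A l k g c)
  note prems = "1.prems"(1-11)
  note lt = "1.prems"(12)
  have kS: "k \<in> S" "l \<in> S" if "k \<le> g" using prems that by auto
  consider "\<not> k \<le> g" | "k \<le> g" "A k < p" | "k \<le> g" "\<not> A k < p" "\<not> A k \<ge> q"
    | "k \<le> g" "\<not> A k < p" "A k \<ge> q" by blast
  then show ?case
  proof cases
    case 1
    then have "partition_loop p q A l k g c = (A, l, g, c)" by (subst partition_loop.simps) auto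
    then show ?thesis using prems 1 by (auto simp: min_def split: if_splits)
  next
    case 2
    then have e: "partition_loop p q (swap A k l) (l + 1) (k + 1) g (c + 1) = (A', l', g', c')"
      using prems(1) by (subst (asm) partition_loop.simps) auto
    show ?thesis
      by (rule "1.IH"(1)[OF 2 e swap_permutes[OF prems(2)] prems(3)])
         (use prems 2 lt kS in \<open>auto simp: swap_def\<close>)
  next
    case 3
    then have e: "partition_loop p q A l (k + 1) g (c + 2) = (A', l', g', c')"
      using prems(1) by (subst (asm) partition_loop.simps) auto
    have m: "\<forall>i\<in>{l..min (k + 1 - 1) g}. p \<le> A i \<and> A i \<le> q"
    proof
      fix i assume "i \<in> {l..min (k + 1 - 1) g}"
      then show "p \<le> A i \<and> A i \<le> q" using prems(5) 3 by (cases "i = k") auto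
    qed
    show ?thesis
      by (rule "1.IH"(4)[OF 3 e prems(2,3,4) m]) (use prems lt 3 in auto)
  next
    case 4
    obtain h e where s: "scan_g A q k g (c + 2) = (h, e)" by fastforce
    have h: "k \<le> h" "h \<le> g" using scan_g_bounds[OF 4(1) s] by auto
    have hr: "\<forall>i\<in>{h<..g}. q < A i" "A h \<le> q \<or> h = k" using scan_g_result[OF s 4(1)] by auto
    have hS: "h \<in> S" using prems h by auto
    have large: "q \<le> A i" if "i \<in> {h + 1..hi}" for i
      using prems(6) hr(1) that by (cases "i \<le> g") (auto intro: less_imp_le)
    show ?thesis
    proof (cases "A h \<ge> p")
      case True
      then have r: "partition_loop p q (swap A k h) l (k + 1) (h - 1) (e + 1) = (A', l', g', c')"
        using prems(1) 4 s by (subst (asm) partition_loop.simps) auto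
      have m: "\<forall>i\<in>{l..min (k + 1 - 1) (h - 1)}. p \<le> swap A k h i \<and> swap A k h i \<le> q"
      proof
        fix i assume "i \<in> {l..min (k + 1 - 1) (h - 1)}"
        then show "p \<le> swap A k h i \<and> swap A k h i \<le> q"
          using prems(5) 4 hr(2) True h by (cases "i = k") (auto simp: swap_def)
      qed
      have la: "\<forall>i\<in>{h - 1 + 1..hi}. q \<le> swap A k h i"
        using large 4 h by (auto simp: swap_def)
      show ?thesis
        by (rule "1.IH"(2)[OF 4 s[symmetric] True r swap_permutes[OF prems(2)] prems(3) _ m la])
           (use prems lt 4 h kS hS in \<open>auto simp: swap_def\<close>)
    next
      case False
      \<comment> \<open>The key at position \<open>k\<close> is at least \<open>q > p\<close>, so a
        key below \<open>p\<close> must sit elsewhere; the exchange is a genuine one.\<close>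
      then have kh: "k < h" using 4 h by (cases "k = h") auto
      from False have r: "partition_loop p q (swap (swap A k h) k l) (l + 1) (k + 1) (h - 1) (e + 1) = (A', l', g', c')"
        using prems(1) 4 s by (subst (asm) partition_loop.simps) auto
      have m: "\<forall>i\<in>{l + 1..min (k + 1 - 1) (h - 1)}.
          p \<le> swap (swap A k h) k l i \<and> swap (swap A k h) k l i \<le> q"
      proof
        fix i assume i: "i \<in> {l + 1..min (k + 1 - 1) (h - 1)}"
        then show "p \<le> swap (swap A k h) k l i \<and> swap (swap A k h) k l i \<le> q"
          using prems(5) h kh 4 by (cases "i = k") (auto simp: swap_def)
      qed
      have la: "\<forall>i\<in>{h - 1 + 1..hi}. q \<le> swap (swap A k h) k l i"
        using large 4 h kh prems by (auto simp: swap_def)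
      have sm: "\<forall>i\<in>{lo..l + 1 - 1}. swap (swap A k h) k l i < p"
        using prems False kh by (auto simp: swap_def)
      show ?thesis
        by (rule "1.IH"(3)[OF 4 s[symmetric] False r swap_permutes[OF swap_permutes[OF prems(2)]]
              prems(3) sm m la])
           (use prems lt 4 h kh kS hS in auto)
    qed
  qed
qed

text \<open>
  Every element of the initial array is inspected by exactly one of the two indices, up to one
  element when they cross; this is why the counts refer to the array before the loop.
\<close>

lemma partition_loop_cost:
  assumes "p < q"
  shows "partition_loop p q A l k g c = (A', l', g', c') \<Longrightarrow> l \<le> k \<Longrightarrow> k \<le> g + 1 \<Longrightarrow>
    k \<le> g' + 1 \<and> g' \<le> g \<and>
    int c' - int c - (\<Sum>i\<in>{k..g'}. 1 + of_bool (p \<le> A i)) - (\<Sum>i\<in>{g' + 1..g}. 1 + of_bool (A i \<le> q))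
      \<in> {0..3}"
  using assms
proof (induction p q A l k g c rule: partition_loop.induct)
  case (1 p q A l k g c)
  note prems = "1.prems"(1-3)
  note lt = "1.prems"(4)
  have split: "(\<Sum>i\<in>{k..j}. f i) = f k + (\<Sum>i\<in>{k + 1..j}. f i)" if "k \<le> j"
    for f :: "int \<Rightarrow> int" and j
  proof -
    have "{k..j} = insert k {k + 1..j}" using that by auto
    then show ?thesis by simp
  qed
  consider "\<not> k \<le> g" | "k \<le> g" "A k < p" | "k \<le> g" "\<not> A k < p" "\<not> A k \<ge> q"
    | "k \<le> g" "\<not> A k < p" "A k \<ge> q" by blast
  then show ?case
  proof cases
    case 1
    then have "partition_loop p q A l k g c = (A, l, g, c)" by (subst partition_loop.simps) auto
    then show ?thesis using prems 1 by auto
  next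
    case 2
    then have e: "partition_loop p q (swap A k l) (l + 1) (k + 1) g (c + 1) = (A', l', g', c')"
      using prems(1) by (subst (asm) partition_loop.simps) auto
    have eq: "swap A k l i = A i" if "i > k" for i
      using that prems by (auto simp: swap_def)
    have IH: "k + 1 \<le> g' + 1 \<and> g' \<le> g \<and> int c' - int (c + 1) -
       (\<Sum>i\<in>{k + 1..g'}. 1 + of_bool (p \<le> swap A k l i)) -
       (\<Sum>i\<in>{g' + 1..g}. 1 + of_bool (swap A k l i \<le> q)) \<in> {0..3}"
      by (rule "1.IH"(1)[OF 2 e]) (use prems 2 lt in auto)
    have s1: "(\<Sum>i\<in>{k + 1..g'}. 1 + of_bool (p \<le> swap A k l i)) = (\<Sum>i\<in>{k + 1..g'}. 1 + of_bool (p \<le> A i) :: int)"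
      by (intro sum.cong) (auto simp: eq)
    have s2: "(\<Sum>i\<in>{g' + 1..g}. 1 + of_bool (swap A k l i \<le> q)) = (\<Sum>i\<in>{g' + 1..g}. 1 + of_bool (A i \<le> q) :: int)"
      using IH by (intro sum.cong) (auto simp: eq)
    show ?thesis using IH unfolding s1 s2 using 2 by (auto simp: split)
  next
    case 3
    then have e: "partition_loop p q A l (k + 1) g (c + 2) = (A', l', g', c')"
      using prems(1) by (subst (asm) partition_loop.simps) auto
    have "k + 1 \<le> g' + 1 \<and> g' \<le> g \<and> int c' - int (c + 2) -
       (\<Sum>i\<in>{k + 1..g'}. 1 + of_bool (p \<le> A i)) -
       (\<Sum>i\<in>{g' + 1..g}. 1 + of_bool (A i \<le> q)) \<in> {0..3}"
      by (rule "1.IH"(4)[OF 3 e]) (use prems 3 lt in auto)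
    then show ?thesis using 3 by (auto simp: split)
  next
    case 4
    obtain h e where s: "scan_g A q k g (c + 2) = (h, e)" by fastforce
    have h: "k \<le> h" "h \<le> g" using scan_g_bounds[OF 4(1) s] by auto
    have hr: "int e = int (c + 2) + (g - h) + 1" "\<forall>i\<in>{h<..g}. q < A i" "A h \<le> q \<or> h = k"
      using scan_g_result[OF s 4(1)] by auto
    \<comment> \<open>Keys passed by the scan exceed \<open>q\<close>, so the charge for each of
      them is the single test that it cost.\<close>
    have "\<not> A i \<le> q" if "i \<in> {h + 1..g}" for i
      using hr(2) that by (auto simp: not_le)
    then have "(\<Sum>i\<in>{h + 1..g}. 1 + of_bool (A i \<le> q)) = (\<Sum>i\<in>{h + 1..g}. 1 :: int)"
      by (intro sum.cong) auto
    moreover have "{h..g} = insert h {h + 1..g}" using h by auto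
    ultimately have tail: "(\<Sum>i\<in>{h..g}. 1 + of_bool (A i \<le> q)) = g - h + (1 + of_bool (A h \<le> q) :: int)"
      using h by simp
    show ?thesis
    proof (cases "h = k")
      case True
      \<comment> \<open>This is the only case in which the charge is not exact: the element where
        the indices meet is tested from both sides, at most 3 comparisons more than the sums
        record.\<close>
      have "p \<le> A h" using True 4 lt by auto
      then have r: "partition_loop p q (swap A k h) l (k + 1) (h - 1) (e + 1) = (A', l', g', c')"
        using prems(1) 4 s by (subst (asm) partition_loop.simps) auto
      then have "g' = k - 1" "c' = e + 1"
        using True by (subst (asm) partition_loop.simps; auto)+
      then show ?thesis using True tail hr h by auto
    next
      case False
      then have Ah: "A h \<le> q" "k < h" using hr h by auto
      \<comment> \<open>Both outcomes of the test at \<open>h\<close> alter only positions outside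
        the range still to be processed, so one computation with an arbitrary altered array
        \<open>B\<close> serves for both.\<close>
      have step: ?thesis
        if IH: "k + 1 \<le> g' + 1 \<and> g' \<le> h - 1 \<and> int c' - int (e + 1) -
          (\<Sum>i\<in>{k + 1..g'}. 1 + of_bool (p \<le> B i)) -
          (\<Sum>i\<in>{g' + 1..h - 1}. 1 + of_bool (B i \<le> q)) \<in> {0..3}"
          and eq: "\<And>i. k < i \<Longrightarrow> i < h \<Longrightarrow> B i = A i" for B
      proof -
        have s1: "(\<Sum>i\<in>{k + 1..g'}. 1 + of_bool (p \<le> B i)) = (\<Sum>i\<in>{k + 1..g'}. 1 + of_bool (p \<le> A i) :: int)"
          using IH by (intro sum.cong) (auto simp: eq)
        have s2: "(\<Sum>i\<in>{g' + 1..h - 1}. 1 + of_bool (B i \<le> q)) = (\<Sum>i\<in>{g' + 1..h - 1}. 1 + of_bool (A i \<le> q) :: int)"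
          using IH by (intro sum.cong) (auto simp: eq)
        have "{g' + 1..g} = {g' + 1..h - 1} \<union> {h..g}" using IH h by auto
        then have s3: "(\<Sum>i\<in>{g' + 1..g}. 1 + of_bool (A i \<le> q)) =
            (\<Sum>i\<in>{g' + 1..h - 1}. 1 + of_bool (A i \<le> q)) + (\<Sum>i\<in>{h..g}. 1 + of_bool (A i \<le> q) :: int)"
          by (simp add: sum.union_disjoint[symmetric])
        show ?thesis
          using IH 4 h hr(1) Ah unfolding s1 s2 s3 tail by (auto simp: split)
      qed
      show ?thesis
      proof (cases "A h \<ge> p")
        case True
        then have r: "partition_loop p q (swap A k h) l (k + 1) (h - 1) (e + 1) = (A', l', g', c')"
          using prems(1) 4 s by (subst (asm) partition_loop.simps) auto
        show ?thesis
          by (rule step[OF "1.IH"(2)[OF 4 s[symmetric] True r]]) (use prems Ah lt in \<open>auto simp: swap_def\<close>)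
      next
        case False
        then have r: "partition_loop p q (swap (swap A k h) k l) (l + 1) (k + 1) (h - 1) (e + 1) = (A', l', g', c')"
          using prems(1) 4 s by (subst (asm) partition_loop.simps) auto
        show ?thesis
          by (rule step[OF "1.IH"(3)[OF 4 s[symmetric] False r]]) (use prems Ah lt in \<open>auto simp: swap_def\<close>)
      qed
    qed
  qed
qed


text \<open>For pivots in range and integer keys, the strict and weak tests together force
  \<open>s p = p\<close> and \<open>s q = q\<close>. The set is then the product of the symmetric
  groups of the three blocks, and its members satisfy the hypotheses on renamings in
  \<open>partition_step_sim\<close>.\<close>

definition block_permutations :: "nat \<Rightarrow> int \<Rightarrow> int \<Rightarrow> (int \<Rightarrow> int) set" where
  "block_permutations n p q = {s. s permutes {1..int n} \<and>
     (\<forall>x. (s x < p \<longleftrightarrow> x < p) \<and> (s x \<le> p \<longleftrightarrow> x \<le> p) \<and> (s x < q \<longleftrightarrow> x < q) \<and> (s x \<le> q \<longleftrightarrow> x \<le> q))}"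

text \<open>Counting: the \<open>l - 1\<close> positions before \<open>l\<close> carry exactly the
  \<open>p - 1\<close> keys below \<open>p\<close>.\<close>

lemma permutes_card_less:
  assumes "\<pi> permutes {1..int n}" "1 \<le> p" "p \<le> int n" "1 \<le> l" "l \<le> int n"
    and "\<And>i. i \<in> {1..int n} \<Longrightarrow> \<pi> i < p \<longleftrightarrow> i < l"
  shows "l = p"
proof -
  have "\<pi> ` {1..l - 1} = {1..p - 1}"
  proof (intro equalityI subsetI)
    fix y assume "y \<in> \<pi> ` {1..l - 1}"
    then obtain i where "i \<in> {1..l - 1}" "y = \<pi> i" by auto
    then show "y \<in> {1..p - 1}"
      using assms(2-5) assms(6)[of i] permutes_in_image[OF assms(1), of i] by auto
  next
    fix y assume y: "y \<in> {1..p - 1}"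
    then have "y \<in> \<pi> ` {1..int n}" using permutes_image[OF assms(1)] assms(3) by auto
    then obtain i where "i \<in> {1..int n}" "y = \<pi> i" by auto
    then show "y \<in> \<pi> ` {1..l - 1}" using y assms(6)[of i] by auto
  qed
  then have "card {1..l - 1} = card {1..p - 1}"
    using card_image[OF inj_on_subset[OF permutes_inj[OF assms(1)]], of "{1..l - 1}"] by auto
  then show ?thesis using assms(2,4) by simp
qed

text \<open>As the keys are the ranks, a pivot ends at the position that equals its own value, and
  the array after the step is itself a block permutation. It thus belongs to the group over which
  averages are later taken. The initial test of the two ends shifts the slack of the loop from
  \<open>{0..3}\<close> to \<open>{1..4}\<close>.\<close>

lemma partition_step_permutation:
  fixes \<pi> :: "int \<Rightarrow> int"
  assumes pi: "\<pi> permutes {1..int n}" and n: "2 \<le> n"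
    and ps: "partition_step \<pi> 1 (int n) c = (A, l, g, c')"
  defines "p \<equiv> min (\<pi> 1) (\<pi> (int n))" and "q \<equiv> max (\<pi> 1) (\<pi> (int n))"
  shows "l = p" "g = q" "A \<in> block_permutations n p q"
    "int c' - int c - (\<Sum>i\<in>{2..q - 1}. 1 + of_bool (p \<le> \<pi> i)) - (\<Sum>i\<in>{q..int n - 1}. 1 + of_bool (\<pi> i \<le> q))
      \<in> {1..4}"
proof -
  have pq: "(if \<pi> 1 > \<pi> (int n) then (\<pi> (int n), \<pi> 1) else (\<pi> 1, \<pi> (int n))) = (p, q)"
    by (auto simp: p_def q_def)
  have ne: "\<pi> 1 \<noteq> \<pi> (int n)"
    using inj_eq[OF permutes_inj[OF pi], of 1 "int n"] n by auto
  have range: "\<pi> 1 \<in> {1..int n}" "\<pi> (int n) \<in> {1..int n}"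
    using permutes_in_image[OF pi, of 1] permutes_in_image[OF pi, of "int n"] n by auto
  have lt: "p < q" using ne by (auto simp: p_def q_def)
  obtain A1 l1 g1 c1 where
    loop: "partition_loop p q \<pi> (1 + 1) (1 + 1) (int n - 1) (c + 1) = (A1, l1, g1, c1)"
    by (metis prod_cases4)
  have A: "l = l1 - 1" "g = g1 + 1" "c' = c1"
      "A = A1(1 := A1 l, l := p, int n := (A1(1 := A1 l, l := p)) g, g := q)"
    using ps unfolding partition_step_def pq by (auto simp: loop[simplified] Let_def)
  have inv: "A1 permutes {1..int n} \<and> (\<forall>i\<in>{2..l1 - 1}. A1 i < p) \<and> (\<forall>i\<in>{l1..g1}. p \<le> A1 i \<and> A1 i \<le> q) \<and>
      (\<forall>i\<in>{g1 + 1..int n - 1}. q \<le> A1 i) \<and> 2 \<le> l1 \<and> l1 \<le> g1 + 1 \<and> g1 \<le> int n - 1"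
    by (rule partition_loop_invariant[OF lt loop pi]) (use n in auto)
  have out: "A1 1 = \<pi> 1" "A1 (int n) = \<pi> (int n)"
    using partition_loop_sim[OF _ _ _ loop, of "\<lambda>x. x" p q 0 2 "int n - 1" \<pi> 0] n
    by (auto simp: sim_def)
  have b: "1 \<le> l" "l < g" "g \<le> int n" using inv A by auto
  \<comment> \<open>The four closing assignments amount to swapping each pivot into place; if the
    ends were in the wrong order, they also exchange the ends.\<close>
  have A_perm: "A permutes {1..int n}"
  proof (cases "\<pi> 1 < \<pi> (int n)")
    case True
    then have "A = swap (swap A1 1 l) (int n) g"
      using b n out unfolding A(4) by (auto simp: swap_def fun_eq_iff p_def q_def)
    then show ?thesis using inv b by (auto intro!: swap_permutes)
  next
    case False
    then have "A = swap (swap (swap A1 1 (int n)) 1 l) (int n) g"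
      using b n out unfolding A(4) by (auto simp: swap_def fun_eq_iff p_def q_def)
    then show ?thesis using inv b by (auto intro!: swap_permutes)
  qed
  have Al: "A l = p" "A g = q" using b A(4) by auto
  have weak: "i < l \<Longrightarrow> A i \<le> p" "l < i \<Longrightarrow> i < g \<Longrightarrow> p \<le> A i \<and> A i \<le> q" "g < i \<Longrightarrow> q \<le> A i"
    if "i \<in> {1..int n}" for i
  proof -
    show "i < l \<Longrightarrow> A i \<le> p" using that inv b A out by (cases "l = 1") (auto simp: less_imp_le)
    show "l < i \<Longrightarrow> i < g \<Longrightarrow> p \<le> A i \<and> A i \<le> q" using that inv b A by auto
    show "g < i \<Longrightarrow> q \<le> A i" using that inv b A by auto
  qed
  have inj: "A i = A j \<longleftrightarrow> i = j" for i j by (rule inj_eq[OF permutes_inj[OF A_perm]])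
  \<comment> \<open>The weak inequalities become strict because a permutation takes the values
    \<open>p\<close> and \<open>q\<close> only once, namely at \<open>l\<close> and
    \<open>g\<close>.\<close>
  have strict: "A i < p \<longleftrightarrow> i < l" "A i \<le> p \<longleftrightarrow> i \<le> l" "A i < q \<longleftrightarrow> i < g" "A i \<le> q \<longleftrightarrow> i \<le> g"
    if i: "i \<in> {1..int n}" for i
  proof -
    have ne: "i \<noteq> l \<Longrightarrow> A i \<noteq> p" "i \<noteq> g \<Longrightarrow> A i \<noteq> q" using inj Al by auto
    consider "i < l" "A i < p" | "i = l" "A i = p" | "l < i" "i < g" "p < A i" "A i < q"
      | "i = g" "A i = q" | "g < i" "q < A i"
      using weak[OF i] ne Al by (smt (verit))
    then show "A i < p \<longleftrightarrow> i < l" "A i \<le> p \<longleftrightarrow> i \<le> l" "A i < q \<longleftrightarrow> i < g" "A i \<le> q \<longleftrightarrow> i \<le> g"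
      using b lt by (cases; simp)+
  qed
  show l: "l = p"
    by (rule permutes_card_less[OF A_perm]) (use strict range b in \<open>auto simp: p_def\<close>)
  show g: "g = q"
    by (rule permutes_card_less[OF A_perm]) (use strict range b in \<open>auto simp: q_def\<close>)
  show "A \<in> block_permutations n p q"
    unfolding block_permutations_def
  proof (intro CollectI conjI allI)
    fix x
    show "A x < p \<longleftrightarrow> x < p" "A x \<le> p \<longleftrightarrow> x \<le> p" "A x < q \<longleftrightarrow> x < q" "A x \<le> q \<longleftrightarrow> x \<le> q"
      using strict[of x] permutes_not_in[OF A_perm, of x] by (cases "x \<in> {1..int n}"; simp add: l g)+
  qed (rule A_perm)
  have "(2::int) \<le> g1 + 1 \<and> g1 \<le> int n - 1 \<and>
    int c1 - int (c + 1) - (\<Sum>i\<in>{2..g1}. 1 + of_bool (p \<le> \<pi> i)) - (\<Sum>i\<in>{g1 + 1..int n - 1}. 1 + of_bool (\<pi> i \<le> q))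
      \<in> {0..3}"
    using partition_loop_cost[OF lt loop] n by auto
  \<comment> \<open>The meeting point is known beforehand: the right index ends just below the rank
    of \<open>q\<close>. So the two ranges in the count depend on the upper pivot alone.\<close>
  moreover have "g1 = q - 1" using A g by auto
  ultimately show "int c' - int c - (\<Sum>i\<in>{2..q - 1}. 1 + of_bool (p \<le> \<pi> i)) - (\<Sum>i\<in>{q..int n - 1}. 1 + of_bool (\<pi> i \<le> q))
      \<in> {1..4}"
    using A by auto
qed


section \<open>The recursion in law\<close>

definition shift_perm :: "int \<Rightarrow> (int \<Rightarrow> int) \<Rightarrow> int \<Rightarrow> int" where
  "shift_perm a s = (\<lambda>x. s (x - a) + a)"

text \<open>Moving the block to an interval that starts at 1 and continuing by the identity turns it
  into an input of the kind over which smaller problems are averaged.\<close>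

definition restrict_perm :: "int \<Rightarrow> int \<Rightarrow> (int \<Rightarrow> int) \<Rightarrow> int \<Rightarrow> int" where
  "restrict_perm a b s = (\<lambda>x. if x \<in> {1..b - a} then s (x + a) - a else x)"

lemma shift_perm_permutes:
  assumes "s permutes {1..b - a}"
  shows "shift_perm a s permutes {a + 1..b}"
  unfolding permutes_def
proof (intro conjI allI impI)
  fix x assume "x \<notin> {a + 1..b}"
  then show "shift_perm a s x = x"
    using permutes_not_in[OF assms, of "x - a"] by (auto simp: shift_perm_def)
next
  fix y
  have "\<exists>!x. s x = y - a" using assms by (simp add: permutes_def)
  then show "\<exists>!x. shift_perm a s x = y"
    unfolding shift_perm_def by (metis add_diff_cancel diff_add_cancel)
qed

lemma restrict_perm_permutes:
  assumes "inj s" "\<And>x. x \<in> {a + 1..b} \<Longrightarrow> s x \<in> {a + 1..b}"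
  shows "restrict_perm a b s permutes {1..b - a}"
proof (rule bij_imp_permutes)
  have "inj_on (restrict_perm a b s) {1..b - a}"
    using inj_eq[OF assms(1)] by (auto simp: inj_on_def restrict_perm_def)
  moreover have "restrict_perm a b s ` {1..b - a} \<subseteq> {1..b - a}"
  proof (rule image_subsetI)
    fix x assume "x \<in> {1..b - a}"
    then show "restrict_perm a b s x \<in> {1..b - a}"
      using assms(2)[of "x + a"] by (auto simp: restrict_perm_def)
  qed
  ultimately show "bij_betw (restrict_perm a b s) {1..b - a} {1..b - a}"
    by (simp add: bij_betw_def endo_inj_surj)
qed (auto simp: restrict_perm_def)

lemma cost_restrict_perm:
  "cost M (restrict_perm a b s) 1 (b - a) = cost M s (a + 1) b"
  using cost_sim[of "\<lambda>x. x + a" a 1 "b - a" "restrict_perm a b s" s M]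
  by (simp add: sim_def restrict_perm_def strict_mono_def algebra_simps)

abbreviation perms :: "nat \<Rightarrow> (int \<Rightarrow> int) set" where
  "perms n \<equiv> {\<pi>. \<pi> permutes {1..int n}}"

lemma finite_perms [simp]: "finite (perms n)"
  by (rule finite_permutations) simp

lemma card_perms: "card (perms n) = fact n"
  by (rule card_permutations) auto

section \<open>The group of block-preserving permutations\<close>

context
  fixes n :: nat and p q :: int
  assumes pq: "1 \<le> p" "p < q" "q \<le> int n"
begin

lemma block_permutationsD:
  assumes "s \<in> block_permutations n p q"
  shows "s permutes {1..int n}" "s x < p \<longleftrightarrow> x < p" "s x \<le> p \<longleftrightarrow> x \<le> p"
    "s x < q \<longleftrightarrow> x < q" "s x \<le> q \<longleftrightarrow> x \<le> q" "s p = p" "s q = q"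
proof -
  have *: "s permutes {1..int n}" "\<And>x. s x < p \<longleftrightarrow> x < p" "\<And>x. s x \<le> p \<longleftrightarrow> x \<le> p"
    "\<And>x. s x < q \<longleftrightarrow> x < q" "\<And>x. s x \<le> q \<longleftrightarrow> x \<le> q"
    using assms unfolding block_permutations_def by blast+
  show "s permutes {1..int n}" "s x < p \<longleftrightarrow> x < p" "s x \<le> p \<longleftrightarrow> x \<le> p"
    "s x < q \<longleftrightarrow> x < q" "s x \<le> q \<longleftrightarrow> x \<le> q" by (fact *)+
  show "s p = p" using *(2)[of p] *(3)[of p] by linarith
  show "s q = q" using *(4)[of q] *(5)[of q] by linarith
qed

lemma block_permutations_comp:
  "s \<in> block_permutations n p q \<Longrightarrow> t \<in> block_permutations n p q \<Longrightarrow> s \<circ> t \<in> block_permutations n p q"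
  by (auto simp: block_permutations_def intro: permutes_compose)

lemma block_permutations_inv:
  assumes "s \<in> block_permutations n p q"
  shows "inv s \<in> block_permutations n p q"
proof -
  note D = block_permutationsD[OF assms]
  have "s (inv s x) = x" for x
    by (rule permutes_inverses(1)[OF D(1)])
  then have "inv s x < p \<longleftrightarrow> x < p" "inv s x \<le> p \<longleftrightarrow> x \<le> p" "inv s x < q \<longleftrightarrow> x < q"
      "inv s x \<le> q \<longleftrightarrow> x \<le> q" for x
    using D(2-5)[of "inv s x"] by simp_all
  then show ?thesis
    using permutes_inv[OF D(1)] unfolding block_permutations_def by simp
qed

lemma finite_block_permutations: "finite (block_permutations n p q)"
  by (rule finite_subset[OF _ finite_perms[of n]]) (auto simp: block_permutations_def)

text \<open>Right translation by \<open>t\<close> permutes the group; the translation by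
  \<open>inv t\<close> undoes it.\<close>

lemma sum_block_permutations_comp:
  assumes "t \<in> block_permutations n p q"
  shows "(\<Sum>s\<in>block_permutations n p q. h (s \<circ> t)) = (\<Sum>s\<in>block_permutations n p q. h s)"
proof (rule sum.reindex_bij_witness[where i = "\<lambda>s. s \<circ> inv t" and j = "\<lambda>s. s \<circ> t"])
  have t: "t permutes {1..int n}" using block_permutationsD(1)[OF assms] .
  fix s assume s: "s \<in> block_permutations n p q"
  show "s \<circ> t \<circ> inv t = s" "s \<circ> inv t \<circ> t = s"
    using permutes_inv_o[OF t] by (simp_all add: o_assoc[symmetric])
  show "s \<circ> t \<in> block_permutations n p q" "s \<circ> inv t \<in> block_permutations n p q"
    using s assms by (auto intro: block_permutations_comp block_permutations_inv)
qed simp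

text \<open>The group is a product of three symmetric groups, and the cost of a block sees only its
  own factor: this is independence and uniformity of the subarrays in the language of finite sums.
  The values of \<open>h\<close> lie in an arbitrary commutative monoid, so the constant 1 yields
  the order of the group and vector-valued \<open>h\<close> the recursion in law.\<close>

lemma sum_block_permutations:
  fixes h :: "nat \<Rightarrow> nat \<Rightarrow> nat \<Rightarrow> 'b::comm_monoid_add"
  defines "i \<equiv> nat (p - 1)" and "j \<equiv> nat (q - p - 1)" and "k \<equiv> nat (int n - q)"
  shows "(\<Sum>s\<in>block_permutations n p q. h (cost M s 1 (p - 1)) (cost M s (p + 1) (q - 1)) (cost M s (q + 1) (int n))) =
    (\<Sum>a\<in>perms i. \<Sum>b\<in>perms j. \<Sum>c\<in>perms k. h (cost M a 1 (int i)) (cost M b 1 (int j)) (cost M c 1 (int k)))"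
proof -
  have ijk: "int i = p - 1 - 0" "int j = q - 1 - p" "int k = int n - q"
    using pq by (auto simp: i_def j_def k_def)
  \<comment> \<open>The three translated permutations have disjoint supports that avoid the pivots,
    so on each block their composite acts as the respective factor.\<close>
  have glue: "x < p \<Longrightarrow> (shift_perm 0 a \<circ> (shift_perm p b \<circ> shift_perm q c)) x = shift_perm 0 a x \<and> (shift_perm 0 a \<circ> (shift_perm p b \<circ> shift_perm q c)) x < p" 
      "p < x \<Longrightarrow> x < q \<Longrightarrow> (shift_perm 0 a \<circ> (shift_perm p b \<circ> shift_perm q c)) x = shift_perm p b x \<and> p < (shift_perm 0 a \<circ> (shift_perm p b \<circ> shift_perm q c)) x \<and> (shift_perm 0 a \<circ> (shift_perm p b \<circ> shift_perm q c)) x < q"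
      "q < x \<Longrightarrow> (shift_perm 0 a \<circ> (shift_perm p b \<circ> shift_perm q c)) x = shift_perm q c x \<and> q < (shift_perm 0 a \<circ> (shift_perm p b \<circ> shift_perm q c)) x" "x = p \<Longrightarrow> (shift_perm 0 a \<circ> (shift_perm p b \<circ> shift_perm q c)) x = p" "x = q \<Longrightarrow> (shift_perm 0 a \<circ> (shift_perm p b \<circ> shift_perm q c)) x = q"
      "(shift_perm 0 a \<circ> (shift_perm p b \<circ> shift_perm q c)) permutes {1..int n}"
    if "a permutes {1..int i}" "b permutes {1..int j}" "c permutes {1..int k}"
 for a b c x
  proof -
    let ?s = "shift_perm 0 a \<circ> (shift_perm p b \<circ> shift_perm q c)"
    have s: "shift_perm 0 a permutes {0 + 1..p - 1}" "shift_perm p b permutes {p + 1..q - 1}"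
      "shift_perm q c permutes {q + 1..int n}"
      by (fact that[unfolded ijk, THEN shift_perm_permutes])+
    note out = permutes_not_in[OF s(1)] permutes_not_in[OF s(2)] permutes_not_in[OF s(3)]
    note inn = permutes_in_image[OF s(1)] permutes_in_image[OF s(2)] permutes_in_image[OF s(3)]
    show "?s permutes {1..int n}"
      using pq by (intro permutes_compose permutes_subset[OF s(1)] permutes_subset[OF s(2)] permutes_subset[OF s(3)]) auto
    show "?s x = shift_perm 0 a x \<and> ?s x < p" if "x < p"
      using that inn(1)[of x] out(1)[of x] out(2)[of x] out(3)[of x] pq
      by (cases "x \<in> {0 + 1..p - 1}") auto
    show "?s x = shift_perm p b x \<and> p < ?s x \<and> ?s x < q" if "p < x" "x < q"
      using that inn(2)[of x] out(1)[of "shift_perm p b x"] out(3)[of x] pq by auto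
    show "?s x = shift_perm q c x \<and> q < ?s x" if "q < x"
      using that inn(3)[of x] out(3)[of x] out(2)[of "shift_perm q c x"] out(1)[of "shift_perm q c x"] pq
      by (cases "x \<in> {q + 1..int n}") auto
    show "x = p \<Longrightarrow> ?s x = p" "x = q \<Longrightarrow> ?s x = q"
      using out(1)[of x] out(2)[of x] out(3)[of x] pq by auto
  qed
  have restrict_block: "restrict_perm 0 (p - 1) s permutes {1..int i}"
      "restrict_perm p (q - 1) s permutes {1..int j}" "restrict_perm q (int n) s permutes {1..int k}"
    if "s \<in> block_permutations n p q" for s
  proof -
    note D = block_permutationsD[OF that]
    have in1: "s x \<in> {1..int n}" if "x \<in> {1..int n}" for x
      using permutes_in_image[OF D(1)] that by auto
    have "s x \<in> {0 + 1..p - 1}" if "x \<in> {0 + 1..p - 1}" for x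
      using in1[of x] D(2)[of x] that pq by auto
    moreover have "s x \<in> {p + 1..q - 1}" if "x \<in> {p + 1..q - 1}" for x
      using in1[of x] D(3)[of x] D(4)[of x] that pq by auto
    moreover have "s x \<in> {q + 1..int n}" if "x \<in> {q + 1..int n}" for x
      using in1[of x] D(5)[of x] that pq by auto
    ultimately have "restrict_perm 0 (p - 1) s permutes {1..p - 1 - 0}"
      "restrict_perm p (q - 1) s permutes {1..q - 1 - p}"
      "restrict_perm q (int n) s permutes {1..int n - q}"
      by (intro restrict_perm_permutes[OF permutes_inj[OF D(1)]]; blast)+
    then show "restrict_perm 0 (p - 1) s permutes {1..int i}"
      "restrict_perm p (q - 1) s permutes {1..int j}" "restrict_perm q (int n) s permutes {1..int k}"
      unfolding ijk .
  qed
  have "(\<Sum>s\<in>block_permutations n p q. h (cost M s 1 (p - 1)) (cost M s (p + 1) (q - 1)) (cost M s (q + 1) (int n))) =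
    (\<Sum>(a, b, c)\<in>perms i \<times> perms j \<times> perms k. h (cost M a 1 (int i)) (cost M b 1 (int j)) (cost M c 1 (int k)))"
  proof (rule sum.reindex_bij_witness
      [where i = "\<lambda>(a, b, c). shift_perm 0 a \<circ> (shift_perm p b \<circ> shift_perm q c)"
         and j = "\<lambda>s. (restrict_perm 0 (p - 1) s, restrict_perm p (q - 1) s, restrict_perm q (int n) s)"], goal_cases)
    case (1 s)
    note D = block_permutationsD[OF 1]
    note r = restrict_block[OF 1]
    note g = glue[OF r]
    show ?case
    proof
      fix x
      consider "x < p" | "x = p" | "p < x" "x < q" | "x = q" | "q < x" by linarith
      then show "(case (restrict_perm 0 (p - 1) s, restrict_perm p (q - 1) s, restrict_perm q (int n) s) of
          (a, b, c) \<Rightarrow> shift_perm 0 a \<circ> (shift_perm p b \<circ> shift_perm q c)) x = s x"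
        using D(6,7) g(1-5)[of x] permutes_not_in[OF D(1), of x] D(2-5)[of x]
        by cases (auto simp: shift_perm_def restrict_perm_def)
    qed
  next
    case (2 s)
    show ?case using restrict_block[OF 2] by simp
  next
    case (3 t)
    then obtain a b c where t: "t = (a, b, c)" "a permutes {1..int i}" "b permutes {1..int j}"
      "c permutes {1..int k}" by auto
    note g = glue[OF t(2-4)]
    let ?s = "shift_perm 0 a \<circ> (shift_perm p b \<circ> shift_perm q c)"
    have "restrict_perm 0 (p - 1) ?s = a"
    proof
      fix x
      show "restrict_perm (0) (p - 1) ?s x = a x"
        using g(1)[of "x + 0"] permutes_not_in[OF t(2), of x] ijk
        by (auto simp: restrict_perm_def shift_perm_def)
    qed
    moreover have "restrict_perm p (q - 1) ?s = b"
    proof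
      fix x
      show "restrict_perm (p) (q - 1) ?s x = b x"
        using g(2)[of "x + p"] permutes_not_in[OF t(3), of x] ijk
        by (auto simp: restrict_perm_def shift_perm_def)
    qed
    moreover have "restrict_perm q (int n) ?s = c"
    proof
      fix x
      show "restrict_perm (q) (int n) ?s x = c x"
        using g(3)[of "x + q"] permutes_not_in[OF t(4), of x] ijk
        by (auto simp: restrict_perm_def shift_perm_def)
    qed
    ultimately show ?case unfolding t by simp
  next
    case (4 t)
    then obtain a b c where t: "t = (a, b, c)" "a permutes {1..int i}" "b permutes {1..int j}"
      "c permutes {1..int k}" by auto
    note g = glue[OF t(2-4)]
    let ?s = "shift_perm 0 a \<circ> (shift_perm p b \<circ> shift_perm q c)"
    have "(?s x < p \<longleftrightarrow> x < p) \<and> (?s x \<le> p \<longleftrightarrow> x \<le> p) \<and> (?s x < q \<longleftrightarrow> x < q) \<and> (?s x \<le> q \<longleftrightarrow> x \<le> q)" for x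
    proof -
      consider "x < p" | "x = p" | "p < x" "x < q" | "x = q" | "q < x" by linarith
      then show ?thesis
        by cases (use g(1-5)[of x] pq in linarith)+
    qed
    moreover note g(6)
    ultimately show ?case unfolding t block_permutations_def by simp
  next
    case (5 s)
    show ?case
      using cost_restrict_perm[of M 0 "p - 1" s] cost_restrict_perm[of M p "q - 1" s]
        cost_restrict_perm[of M q "int n" s]
      by (simp add: ijk)
  qed
  then show ?thesis by (simp add: sum.cartesian_product)
qed

lemma card_block_permutations:
  "card (block_permutations n p q) = fact (nat (p - 1)) * fact (nat (q - p - 1)) * fact (nat (int n - q))"
  using sum_block_permutations[of "\<lambda>_ _ _. 1::nat" 0] by (simp add: card_perms del: int_nat_eq)

end


section \<open>Averages over permutations and the cost recursion\<close>

definition low_rank :: "nat \<Rightarrow> (int \<Rightarrow> int) \<Rightarrow> int" where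
  "low_rank n \<pi> = min (\<pi> 1) (\<pi> (int n))"

definition high_rank :: "nat \<Rightarrow> (int \<Rightarrow> int) \<Rightarrow> int" where
  "high_rank n \<pi> = max (\<pi> 1) (\<pi> (int n))"

definition toll :: "nat \<Rightarrow> (int \<Rightarrow> int) \<Rightarrow> nat" where
  "toll n \<pi> = snd (snd (snd (partition_step \<pi> 1 (int n) 0)))"

definition small_size :: "nat \<Rightarrow> (int \<Rightarrow> int) \<Rightarrow> nat" where
  "small_size n \<pi> = nat (low_rank n \<pi> - 1)"

definition medium_size :: "nat \<Rightarrow> (int \<Rightarrow> int) \<Rightarrow> nat" where
  "medium_size n \<pi> = nat (high_rank n \<pi> - low_rank n \<pi> - 1)"

definition large_size :: "nat \<Rightarrow> (int \<Rightarrow> int) \<Rightarrow> nat" where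
  "large_size n \<pi> = nat (int n - high_rank n \<pi>)"

text \<open>The expectation over a random permutation as a finite sum. Values in any real vector
  space let one recursion serve for means, second moments and complex characteristic functions
  alike.\<close>

definition perm_avg :: "nat \<Rightarrow> ((int \<Rightarrow> int) \<Rightarrow> 'b::real_vector) \<Rightarrow> 'b" where
  "perm_avg n F = (\<Sum>\<pi>\<in>perms n. F \<pi>) /\<^sub>R fact n"

abbreviation same_blocks :: "nat \<Rightarrow> (int \<Rightarrow> int) \<Rightarrow> (int \<Rightarrow> int) set" where
  "same_blocks n \<pi> \<equiv> block_permutations n (low_rank n \<pi>) (high_rank n \<pi>)"

lemma rank_bounds:
  assumes "\<pi> \<in> perms n" "2 \<le> n"
  shows "1 \<le> low_rank n \<pi>" "low_rank n \<pi> < high_rank n \<pi>" "high_rank n \<pi> \<le> int n"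
proof -
  have pi: "\<pi> permutes {1..int n}" using assms by simp
  have "\<pi> 1 \<noteq> \<pi> (int n)" using inj_eq[OF permutes_inj[OF pi], of 1 "int n"] assms(2) by auto
  then show "1 \<le> low_rank n \<pi>" "low_rank n \<pi> < high_rank n \<pi>" "high_rank n \<pi> \<le> int n"
    using permutes_in_image[OF pi, of 1] permutes_in_image[OF pi, of "int n"] assms(2)
    by (auto simp: low_rank_def high_rank_def)
qed

lemma rank_comp:
  assumes "\<pi> \<in> perms n" "2 \<le> n" "s \<in> same_blocks n \<pi>"
  shows "(s \<circ> \<pi>) 1 = \<pi> 1" "(s \<circ> \<pi>) (int n) = \<pi> (int n)"
    "low_rank n (s \<circ> \<pi>) = low_rank n \<pi>" "high_rank n (s \<circ> \<pi>) = high_rank n \<pi>"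
proof -
  have "s (low_rank n \<pi>) = low_rank n \<pi>" "s (high_rank n \<pi>) = high_rank n \<pi>"
    using block_permutationsD(6,7)[OF rank_bounds[OF assms(1,2)] assms(3)] .
  then have "s (\<pi> 1) = \<pi> 1 \<and> s (\<pi> (int n)) = \<pi> (int n)"
    by (auto simp: low_rank_def high_rank_def min_def max_def split: if_splits)
  then show "(s \<circ> \<pi>) 1 = \<pi> 1" "(s \<circ> \<pi>) (int n) = \<pi> (int n)"
    "low_rank n (s \<circ> \<pi>) = low_rank n \<pi>" "high_rank n (s \<circ> \<pi>) = high_rank n \<pi>"
    by (simp_all add: low_rank_def high_rank_def)
qed

text \<open>Averaging over orbits does not change the total: sending \<open>(\<pi>, s)\<close> to
  \<open>(s o \<pi>, inv s)\<close> is an involution on the pairs, and the pivot ranks, hence the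
  group attached to a permutation, are constant along it.\<close>

lemma perm_avg_same_blocks:
  assumes "2 \<le> n"
  shows "perm_avg n F = perm_avg n (\<lambda>\<pi>. (\<Sum>s\<in>same_blocks n \<pi>. F (s \<circ> \<pi>)) /\<^sub>R card (same_blocks n \<pi>))"
proof -
  have fin: "finite (same_blocks n \<pi>)" if "\<pi> \<in> perms n" for \<pi>
    by (rule finite_block_permutations[OF rank_bounds[OF that assms]])
  have ne: "card (same_blocks n \<pi>) > 0" if "\<pi> \<in> perms n" for \<pi>
    unfolding card_block_permutations[OF rank_bounds[OF that assms]] by simp
  have "(\<Sum>\<pi>\<in>perms n. (\<Sum>s\<in>same_blocks n \<pi>. F (s \<circ> \<pi>)) /\<^sub>R card (same_blocks n \<pi>)) =
    (\<Sum>(\<pi>, s)\<in>Sigma (perms n) (same_blocks n). F (s \<circ> \<pi>) /\<^sub>R card (same_blocks n \<pi>))"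
    by (subst sum.Sigma[symmetric]) (auto simp: fin scaleR_sum_right)
  also have "\<dots> = (\<Sum>(\<pi>, s)\<in>Sigma (perms n) (same_blocks n). F \<pi> /\<^sub>R card (same_blocks n \<pi>))"
  proof (rule sum.reindex_bij_witness[where i = "\<lambda>(\<pi>, s). (s \<circ> \<pi>, inv s)" and j = "\<lambda>(\<pi>, s). (s \<circ> \<pi>, inv s)"])
    fix x assume x: "x \<in> Sigma (perms n) (same_blocks n)"
    obtain \<pi> s where [simp]: "x = (\<pi>, s)" by fastforce
    have pi: "\<pi> \<in> perms n" and s: "s \<in> same_blocks n \<pi>" using x by auto
    note b = rank_bounds[OF pi assms]
    note s_perm = block_permutationsD(1)[OF b s]
    have "inv s \<circ> (s \<circ> \<pi>) = \<pi>" "inv (inv s) = s"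
      using permutes_inv_o[OF s_perm] permutes_inv_inv[OF s_perm] by (simp_all add: o_assoc)
    then show "(\<lambda>(\<pi>, s). (s \<circ> \<pi>, inv s)) ((\<lambda>(\<pi>, s). (s \<circ> \<pi>, inv s)) x) = x"
      "(\<lambda>(\<pi>, s). (s \<circ> \<pi>, inv s)) ((\<lambda>(\<pi>, s). (s \<circ> \<pi>, inv s)) x) = x" by simp_all
    have "(s \<circ> \<pi>, inv s) \<in> Sigma (perms n) (same_blocks n)"
      using block_permutations_inv[OF b s] rank_comp[OF pi assms s] pi s_perm
      by (auto intro: permutes_compose)
    then show "(\<lambda>(\<pi>, s). (s \<circ> \<pi>, inv s)) x \<in> Sigma (perms n) (same_blocks n)"
      "(\<lambda>(\<pi>, s). (s \<circ> \<pi>, inv s)) x \<in> Sigma (perms n) (same_blocks n)" by simp_all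
    show "(case (\<lambda>(\<pi>, s). (s \<circ> \<pi>, inv s)) x of (\<pi>, s) \<Rightarrow> F \<pi> /\<^sub>R card (same_blocks n \<pi>)) =
      (case x of (\<pi>, s) \<Rightarrow> F (s \<circ> \<pi>) /\<^sub>R card (same_blocks n \<pi>))"
      using rank_comp[OF pi assms s] by simp
  qed
  also have "\<dots> = (\<Sum>\<pi>\<in>perms n. (\<Sum>s\<in>same_blocks n \<pi>. F \<pi> /\<^sub>R card (same_blocks n \<pi>)))"
    by (subst sum.Sigma) (auto simp: fin)
  also have "\<dots> = (\<Sum>\<pi>\<in>perms n. F \<pi>)"
    using ne by (intro sum.cong) (auto simp: sum_constant_scaleR)
  finally show ?thesis by (simp add: perm_avg_def)
qed

lemma partition_step_facts:
  assumes "\<pi> \<in> perms n" "2 \<le> n"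
  obtains A where "partition_step \<pi> 1 (int n) 0 = (A, low_rank n \<pi>, high_rank n \<pi>, toll n \<pi>)"
    "A \<in> same_blocks n \<pi>"
proof -
  obtain A l g c where 1: "partition_step \<pi> 1 (int n) 0 = (A, l, g, c)" by (metis prod_cases4)
  have pi: "\<pi> permutes {1..int n}" using assms by simp
  note * = partition_step_permutation[OF pi assms(2) 1]
  show thesis
    by (rule that[of A]) (use 1 * in \<open>auto simp: toll_def low_rank_def high_rank_def\<close>)
qed

text \<open>Since \<open>s\<close> fixes the pivots and respects the blocks, the step on
  \<open>s o \<pi>\<close> makes the same moves as on \<open>\<pi>\<close>: same pivot positions,
  same toll, and on the segment the array \<open>s o A\<close>.\<close>

lemma cost_comp:
  assumes pi: "\<pi> \<in> perms n" and n: "2 \<le> n" "M < n"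
    and A: "partition_step \<pi> 1 (int n) 0 = (A, low_rank n \<pi>, high_rank n \<pi>, toll n \<pi>)"
    and s: "s \<in> same_blocks n \<pi>"
  shows "cost M (s \<circ> \<pi>) 1 (int n) = toll n \<pi> + cost M (s \<circ> A) 1 (low_rank n \<pi> - 1) +
    cost M (s \<circ> A) (low_rank n \<pi> + 1) (high_rank n \<pi> - 1) + cost M (s \<circ> A) (high_rank n \<pi> + 1) (int n)"
proof -
  note b = rank_bounds[OF pi n(1)]
  note D = block_permutationsD[OF b s]
  have fixp: "s (low_rank n \<pi>) = low_rank n \<pi>" "s (high_rank n \<pi>) = high_rank n \<pi>"
    by (fact D)+
  obtain B where B: "partition_step (s \<circ> \<pi>) 1 (int n) 0 = (B, low_rank n \<pi>, high_rank n \<pi>, toll n \<pi>)"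
      "sim s 0 {1..int n} A B"
    using partition_step_sim[OF _ A, of s 0 "s \<circ> \<pi>" 0] n D fixp
    by (auto simp: sim_def low_rank_def[symmetric] high_rank_def[symmetric] not_le[symmetric])
  have eq: "cost M B x y = cost M (s \<circ> A) x y" if "1 \<le> x" "y \<le> int n" for x y
    using cost_sim[of id 0 x y "s \<circ> A" B M] B(2) that by (auto simp: sim_def strict_mono_def)
  have "cost M (s \<circ> \<pi>) 1 (int n) = toll n \<pi> + cost M B 1 (low_rank n \<pi> - 1) +
    cost M B (low_rank n \<pi> + 1) (high_rank n \<pi> - 1) + cost M B (high_rank n \<pi> + 1) (int n)"
    by (rule cost_rec[OF _ B(1)]) (use n b in auto)
  then show ?thesis using b by (simp add: eq)
qed

text \<open>Within an orbit the toll is constant, and the subarrays are those of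
  \<open>s o A\<close> with \<open>A\<close> in the group; so \<open>A\<close> can be translated
  away and the remaining sum over \<open>s\<close> factorises into three averages. The arbitrary
  function \<open>f\<close> makes this a recursion in law.\<close>

lemma perm_avg_cost_rec:
  fixes f :: "nat \<Rightarrow> 'b::real_vector"
  assumes "2 \<le> n" "M < n"
  shows "perm_avg n (\<lambda>\<pi>. f (cost M \<pi> 1 (int n))) = perm_avg n (\<lambda>\<pi>.
    perm_avg (small_size n \<pi>) (\<lambda>a. perm_avg (medium_size n \<pi>) (\<lambda>b. perm_avg (large_size n \<pi>) (\<lambda>c.
      f (toll n \<pi> + cost M a 1 (int (small_size n \<pi>)) + cost M b 1 (int (medium_size n \<pi>)) +
         cost M c 1 (int (large_size n \<pi>)))))))"
proof -
  have "(\<Sum>s\<in>same_blocks n \<pi>. f (cost M (s \<circ> \<pi>) 1 (int n))) /\<^sub>R card (same_blocks n \<pi>) =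
    perm_avg (small_size n \<pi>) (\<lambda>a. perm_avg (medium_size n \<pi>) (\<lambda>b. perm_avg (large_size n \<pi>) (\<lambda>c.
      f (toll n \<pi> + cost M a 1 (int (small_size n \<pi>)) + cost M b 1 (int (medium_size n \<pi>)) +
         cost M c 1 (int (large_size n \<pi>))))))" if pi: "\<pi> \<in> perms n" for \<pi>
  proof -
    define p q where "p = low_rank n \<pi>" and "q = high_rank n \<pi>"
    note b = rank_bounds[OF pi assms(1), folded p_def q_def]
    obtain A where A: "partition_step \<pi> 1 (int n) 0 = (A, p, q, toll n \<pi>)" "A \<in> block_permutations n p q"
      using partition_step_facts[OF pi assms(1)] unfolding p_def q_def by blast
    have "(\<Sum>s\<in>block_permutations n p q. f (cost M (s \<circ> \<pi>) 1 (int n))) = (\<Sum>s\<in>block_permutations n p q.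
        f (toll n \<pi> + cost M (s \<circ> A) 1 (p - 1) + cost M (s \<circ> A) (p + 1) (q - 1) + cost M (s \<circ> A) (q + 1) (int n)))"
      using cost_comp[OF pi assms A(1)[unfolded p_def q_def]] by (intro sum.cong) (auto simp: p_def q_def)
    also have "\<dots> = (\<Sum>s\<in>block_permutations n p q.
        f (toll n \<pi> + cost M s 1 (p - 1) + cost M s (p + 1) (q - 1) + cost M s (q + 1) (int n)))"
      by (rule sum_block_permutations_comp[OF b A(2)])
    also have "\<dots> = (\<Sum>a\<in>perms (small_size n \<pi>). \<Sum>b\<in>perms (medium_size n \<pi>). \<Sum>c\<in>perms (large_size n \<pi>).
        f (toll n \<pi> + cost M a 1 (int (small_size n \<pi>)) + cost M b 1 (int (medium_size n \<pi>)) +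
         cost M c 1 (int (large_size n \<pi>))))"
      using sum_block_permutations[OF b, of "\<lambda>x y z. f (toll n \<pi> + x + y + z)" M]
      unfolding small_size_def medium_size_def large_size_def p_def q_def .
    finally show ?thesis
      unfolding p_def[symmetric] q_def[symmetric] card_block_permutations[OF b]
      unfolding small_size_def medium_size_def large_size_def perm_avg_def
        p_def[symmetric] q_def[symmetric]
      by (simp add: scaleR_sum_right mult.assoc)
  qed
  then show ?thesis
    unfolding perm_avg_same_blocks[OF assms(1), of "\<lambda>\<pi>. f (cost M \<pi> 1 (int n))"]
    unfolding perm_avg_def by simp
qed


section \<open>Pivot ranks\<close>

definition ends_fibre :: "nat \<Rightarrow> int \<times> int \<Rightarrow> (int \<Rightarrow> int) set" where
  "ends_fibre n ab = {\<pi>\<in>perms n. (\<pi> 1, \<pi> (int n)) = ab}"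

definition offdiag :: "nat \<Rightarrow> (int \<times> int) set" where
  "offdiag n = {(a, b)\<in>{1..int n} \<times> {1..int n}. a \<noteq> b}"

lemma finite_ends_fibre: "finite (ends_fibre n ab)"
  by (rule finite_subset[OF _ finite_perms[of n]]) (auto simp: ends_fibre_def)

lemma finite_offdiag: "finite (offdiag n)"
  by (rule finite_subset[of _ "{1..int n} \<times> {1..int n}"]) (auto simp: offdiag_def)

lemma card_offdiag: "card (offdiag n) = n * (n - 1)"
proof -
  have "offdiag n = Sigma {1..int n} (\<lambda>a. {1..int n} - {a})" by (auto simp: offdiag_def)
  then have "card (offdiag n) = (\<Sum>a\<in>{1..int n}. card ({1..int n} - {a}))"
    by (simp add: card_SigmaI)
  also have "\<dots> = (\<Sum>a\<in>{1..int n}. n - 1)" by (intro sum.cong) (auto simp: card_Diff_singleton)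
  finally show ?thesis by simp
qed

lemma ends_in_offdiag:
  assumes "\<pi> \<in> perms n" "2 \<le> n"
  shows "(\<pi> 1, \<pi> (int n)) \<in> offdiag n"
proof -
  have pi: "\<pi> permutes {1..int n}" using assms by simp
  then show ?thesis
    using inj_eq[OF permutes_inj[OF pi], of 1 "int n"] assms(2)
      permutes_in_image[OF pi, of 1] permutes_in_image[OF pi, of "int n"]
    by (auto simp: offdiag_def)
qed

lemma sum_perms_fibres:
  assumes "2 \<le> n"
  shows "(\<Sum>\<pi>\<in>perms n. F \<pi>) = (\<Sum>ab\<in>offdiag n. \<Sum>\<pi>\<in>ends_fibre n ab. F \<pi>)"
  unfolding ends_fibre_def
  by (rule sum.group[symmetric]) (use ends_in_offdiag[OF _ assms] finite_offdiag in auto)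

text \<open>All fibres have the same size, since composition with a suitable permutation embeds any
  one of them into any other; there are \<open>n (n - 1)\<close> fibres.\<close>

lemma card_ends_fibre:
  assumes "2 \<le> n" "ab \<in> offdiag n"
  shows "real n * (real n - 1) * card (ends_fibre n ab) = fact n"
proof -
  have le: "card (ends_fibre n (a, b)) \<le> card (ends_fibre n (a', b'))"
    if "(a, b) \<in> offdiag n" "(a', b') \<in> offdiag n" for a b a' b'
  proof -
    \<comment> \<open>\<open>t\<close> carries \<open>a\<close> to \<open>a'\<close>; then
      \<open>u\<close> carries the image of \<open>b\<close> to \<open>b'\<close> without moving
      \<open>a'\<close>.\<close>
    define t where "t = Transposition.transpose a a'"
    define u where "u = Transposition.transpose (t b) b'"
    have ta: "t a = a'" "t b \<noteq> a'" and tb: "t b \<in> {1..int n}"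
      using that by (auto simp: t_def Transposition.transpose_def offdiag_def)
    have ut: "u (t a) = a'" "u (t b) = b'"
      using ta that by (auto simp: u_def Transposition.transpose_def offdiag_def)
    have p: "u \<circ> t permutes {1..int n}"
      unfolding t_def u_def using that tb
      by (intro permutes_compose permutes_swap_id) (auto simp: offdiag_def t_def)
    show ?thesis
    proof (rule card_inj_on_le[of "\<lambda>\<pi>. u \<circ> t \<circ> \<pi>"])
      show "inj_on (\<lambda>\<pi>. u \<circ> t \<circ> \<pi>) (ends_fibre n (a, b))"
        using inj_eq[OF permutes_inj[OF p]] by (auto simp: inj_on_def fun_eq_iff)
      show "(\<lambda>\<pi>. u \<circ> t \<circ> \<pi>) ` ends_fibre n (a, b) \<subseteq> ends_fibre n (a', b')"
        using permutes_compose[OF _ p] ut by (auto simp: ends_fibre_def)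
    qed (rule finite_ends_fibre)
  qed
  have "card (ends_fibre n xy) = card (ends_fibre n ab)" if "xy \<in> offdiag n" for xy
    using le[of "fst xy" "snd xy" "fst ab" "snd ab"] le[of "fst ab" "snd ab" "fst xy" "snd xy"] that assms(2)
    by simp
  then have "(\<Sum>xy\<in>offdiag n. card (ends_fibre n xy)) = n * (n - 1) * card (ends_fibre n ab)"
    by (simp add: card_offdiag)
  moreover have "fact n = (\<Sum>xy\<in>offdiag n. card (ends_fibre n xy))"
    using sum_perms_fibres[OF assms(1), of "\<lambda>_. 1::nat"] by (simp add: card_perms)
  ultimately have "real (fact n) = real (n * (n - 1) * card (ends_fibre n ab))" by simp
  then show ?thesis using assms(1) by (simp add: of_nat_diff)
qed

lemma perm_avg_ends:
  fixes \<Phi> :: "int \<Rightarrow> int \<Rightarrow> 'b::real_vector"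
  assumes "2 \<le> n"
  shows "perm_avg n (\<lambda>\<pi>. \<Phi> (\<pi> 1) (\<pi> (int n))) = (\<Sum>(a, b)\<in>offdiag n. \<Phi> a b) /\<^sub>R (real n * (real n - 1))"
proof -
  have c: "real (card (ends_fibre n ab)) / fact n = 1 / (real n * (real n - 1))" if "ab \<in> offdiag n" for ab
    using card_ends_fibre[OF assms that] assms by (auto simp: field_simps)
  have "perm_avg n (\<lambda>\<pi>. \<Phi> (\<pi> 1) (\<pi> (int n))) =
      (\<Sum>ab\<in>offdiag n. \<Sum>\<pi>\<in>ends_fibre n ab. \<Phi> (\<pi> 1) (\<pi> (int n))) /\<^sub>R fact n"
    by (simp add: perm_avg_def sum_perms_fibres[OF assms])
  also have "\<dots> = (\<Sum>ab\<in>offdiag n. (real (card (ends_fibre n ab)) / fact n) *\<^sub>R \<Phi> (fst ab) (snd ab))"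
    unfolding scaleR_sum_right
  proof (rule sum.cong)
    fix ab
    have "(\<Sum>\<pi>\<in>ends_fibre n ab. \<Phi> (\<pi> 1) (\<pi> (int n)) /\<^sub>R fact n) = (\<Sum>\<pi>\<in>ends_fibre n ab. \<Phi> (fst ab) (snd ab) /\<^sub>R fact n)"
      by (intro sum.cong) (auto simp: ends_fibre_def)
    then show "(\<Sum>\<pi>\<in>ends_fibre n ab. \<Phi> (\<pi> 1) (\<pi> (int n)) /\<^sub>R fact n) =
        (real (card (ends_fibre n ab)) / fact n) *\<^sub>R \<Phi> (fst ab) (snd ab)"
      by (simp add: sum_constant_scaleR divide_inverse)
  qed simp
  also have "\<dots> = (\<Sum>ab\<in>offdiag n. (1 / (real n * (real n - 1))) *\<^sub>R \<Phi> (fst ab) (snd ab))"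
    using c by (intro sum.cong) auto
  finally show ?thesis
    by (simp add: scaleR_sum_right case_prod_beta divide_inverse)
qed

text \<open>Two ordered pairs of end values give the same sizes, hence the factor 2;
  \<open>n - 2\<close> is the number of keys other than the pivots.\<close>

lemma perm_avg_sizes:
  fixes H :: "nat \<Rightarrow> nat \<Rightarrow> nat \<Rightarrow> 'b::real_vector"
  assumes "2 \<le> n"
  shows "perm_avg n (\<lambda>\<pi>. H (small_size n \<pi>) (medium_size n \<pi>) (large_size n \<pi>)) =
    (2 / (real n * (real n - 1))) *\<^sub>R (\<Sum>i\<le>n - 2. \<Sum>j\<le>n - 2 - i. H i j (n - 2 - i - j))"
proof -
  define h where "h p q = H (nat (p - 1)) (nat (q - p - 1)) (nat (int n - q))" for p q :: int
  define U where "U = {(a, b)\<in>{1..int n} \<times> {1..int n}. a < b}"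
  have fin: "finite U" unfolding U_def by (rule finite_subset[of _ "{1..int n} \<times> {1..int n}"]) auto
  have split: "offdiag n = U \<union> (\<lambda>(a, b). (b, a)) ` U" "U \<inter> (\<lambda>(a, b). (b, a)) ` U = {}"
    by (auto simp: offdiag_def U_def)
  have "(\<Sum>(a, b)\<in>offdiag n. h (min a b) (max a b)) =
      (\<Sum>(a, b)\<in>U. h (min a b) (max a b)) + (\<Sum>(a, b)\<in>(\<lambda>(a, b). (b, a)) ` U. h (min a b) (max a b))"
    unfolding split(1) by (rule sum.union_disjoint[OF fin finite_imageI[OF fin] split(2)])
  also have "(\<Sum>(a, b)\<in>(\<lambda>(a, b). (b, a)) ` U. h (min a b) (max a b)) = (\<Sum>(a, b)\<in>U. h (min a b) (max a b))"
    by (subst sum.reindex) (auto simp: inj_on_def min.commute max.commute intro!: sum.cong)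
  also have "(\<Sum>(a, b)\<in>U. h (min a b) (max a b)) = (\<Sum>(i, j)\<in>Sigma {..n - 2} (\<lambda>i. {..n - 2 - i}). H i j (n - 2 - i - j))"
    using assms unfolding U_def
    by (intro sum.reindex_bij_witness[where i = "\<lambda>(i, j). (int i + 1, int i + int j + 2)"
        and j = "\<lambda>(p, q). (nat (p - 1), nat (q - p - 1))"]) (auto simp: h_def min_def max_def nat_diff_distrib intro!: arg_cong[of _ _ "H _ _"])
  also have "\<dots> = (\<Sum>i\<le>n - 2. \<Sum>j\<le>n - 2 - i. H i j (n - 2 - i - j))"
    by (subst sum.Sigma) auto
  finally have "(\<Sum>(a, b)\<in>offdiag n. h (min a b) (max a b)) =
      2 *\<^sub>R (\<Sum>i\<le>n - 2. \<Sum>j\<le>n - 2 - i. H i j (n - 2 - i - j))"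
    by (simp add: scaleR_2)
  moreover have "perm_avg n (\<lambda>\<pi>. H (small_size n \<pi>) (medium_size n \<pi>) (large_size n \<pi>)) =
      perm_avg n (\<lambda>\<pi>. h (min (\<pi> 1) (\<pi> (int n))) (max (\<pi> 1) (\<pi> (int n))))"
    by (simp add: h_def small_size_def medium_size_def large_size_def low_rank_def high_rank_def)
  ultimately show ?thesis
    using perm_avg_ends[OF assms, of "\<lambda>a b. h (min a b) (max a b)"]
    by (simp add: divide_inverse mult.commute)
qed

lemma sum_triangle_fst:
  fixes g :: "nat \<Rightarrow> real"
  shows "(\<Sum>i\<le>m. \<Sum>j\<le>m - i. g i) = (\<Sum>k\<le>m. (real m + 1 - real k) * g k)"
    "(\<Sum>i\<le>m. \<Sum>j\<le>m - i. g j) = (\<Sum>k\<le>m. (real m + 1 - real k) * g k)"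
    "(\<Sum>i\<le>m. \<Sum>j\<le>m - i. g (m - i - j)) = (\<Sum>k\<le>m. (real m + 1 - real k) * g k)"
proof -
  show 1: "(\<Sum>i\<le>m. \<Sum>j\<le>m - i. g i) = (\<Sum>k\<le>m. (real m + 1 - real k) * g k)"
    by (intro sum.cong) (auto simp: of_nat_diff)
  have S: "(\<Sum>i\<le>m. \<Sum>j\<le>m - i. f i j) = (\<Sum>(i, j)\<in>Sigma {..m} (\<lambda>i. {..m - i}). f i j)"
    for f :: "nat \<Rightarrow> nat \<Rightarrow> real" by (rule sum.Sigma) auto
  have "(\<Sum>i\<le>m. \<Sum>j\<le>m - i. g j) = (\<Sum>i\<le>m. \<Sum>j\<le>m - i. g i)"
    unfolding S
    by (rule sum.reindex_bij_witness[where i = "\<lambda>(i, j). (j, i)" and j = "\<lambda>(i, j). (j, i)"]) auto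
  with 1 show 2: "(\<Sum>i\<le>m. \<Sum>j\<le>m - i. g j) = (\<Sum>k\<le>m. (real m + 1 - real k) * g k)" by simp
  have "(\<Sum>j\<le>m - i. g (m - i - j)) = (\<Sum>j\<le>m - i. g j)" for i
    by (rule sum.reindex_bij_witness[where i = "\<lambda>j. m - i - j" and j = "\<lambda>j. m - i - j"]) auto
  with 2 show "(\<Sum>i\<le>m. \<Sum>j\<le>m - i. g (m - i - j)) = (\<Sum>k\<le>m. (real m + 1 - real k) * g k)" by simp
qed

text \<open>The three blocks are exchangeable in a sum over all size triples; 6 is the number 3 of
  blocks times the factor 2 for the order of the pivots.\<close>

lemma perm_avg_sum_sizes:
  fixes g :: "nat \<Rightarrow> real"
  assumes "2 \<le> n"
  shows "perm_avg n (\<lambda>\<pi>. g (small_size n \<pi>) + g (medium_size n \<pi>) + g (large_size n \<pi>)) =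
    6 / (real n * (real n - 1)) * (\<Sum>k<n - 1. (real n - 1 - real k) * g k)"
proof -
  have e: "{..<n - 1} = {..n - 2}" using assms by auto
  have r: "real (n - 2) + 1 - real k = real n - 1 - real k" for k using assms by (simp add: of_nat_diff)
  show ?thesis
    unfolding perm_avg_sizes[OF assms, of "\<lambda>i j k. g i + g j + g k"] e
    by (simp only: sum.distrib sum_triangle_fst r) simp
qed

lemma sizes_sum:
  assumes "\<pi> \<in> perms n" "2 \<le> n"
  shows "small_size n \<pi> + medium_size n \<pi> + large_size n \<pi> = n - 2"
  using rank_bounds[OF assms] by (auto simp: small_size_def medium_size_def large_size_def)


section \<open>Concentration of the cost of a partitioning step\<close>

text \<open>
  The number of elements of \<open>W\<close> at the positions in \<open>K\<close> is hypergeometric once the family is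
  invariant under exchanging two positions of \<open>P\<close>; no counting of permutations is needed.
\<close>

lemma exchangeable_count_variance:
  fixes \<Omega> :: "('i \<Rightarrow> 'a) set" and w :: real
  assumes fin: "finite \<Omega>" "finite P" and P: "2 \<le> card P" and K: "K \<subseteq> P"
    and inv: "\<And>\<pi> i j. \<pi> \<in> \<Omega> \<Longrightarrow> i \<in> P \<Longrightarrow> j \<in> P \<Longrightarrow> \<pi> \<circ> Transposition.transpose i j \<in> \<Omega>"
    and w: "\<And>\<pi>. \<pi> \<in> \<Omega> \<Longrightarrow> (\<Sum>i\<in>P. of_bool (\<pi> i \<in> W)) = w"
    and wN: "w \<le> card P" "w = 0 \<or> 1 \<le> w"
  shows "(\<Sum>\<pi>\<in>\<Omega>. ((\<Sum>i\<in>K. of_bool (\<pi> i \<in> W)) - real (card K) * w / card P)\<^sup>2) \<le> card \<Omega> * real (card P)"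
proof -
  define N where "N = real (card P)"
  define k where "k = real (card K)"
  define x where "x \<pi> i = (of_bool (\<pi> i \<in> W) :: real)" for \<pi> :: "'i \<Rightarrow> 'a" and i
  have xx: "x \<pi> i * x \<pi> i = x \<pi> i" for \<pi> i by (simp add: x_def)
  have N2: "2 \<le> N" using P by (simp add: N_def)
  have finK: "finite K" using finite_subset[OF K fin(2)] .
  have kN: "k \<le> N" unfolding k_def N_def using card_mono[OF fin(2) K] by simp
  have exch: "(\<Sum>\<pi>\<in>\<Omega>. f (\<pi> \<circ> Transposition.transpose i j)) = (\<Sum>\<pi>\<in>\<Omega>. f \<pi>)"
    if "i \<in> P" "j \<in> P" for i j and f :: "('i \<Rightarrow> 'a) \<Rightarrow> real"
    by (rule sum.reindex_bij_witness[where i = "\<lambda>\<pi>. \<pi> \<circ> Transposition.transpose i j"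
          and j = "\<lambda>\<pi>. \<pi> \<circ> Transposition.transpose i j"])
       (use inv that in \<open>auto simp: o_assoc[symmetric]\<close>)
  define E where "E i = (\<Sum>\<pi>\<in>\<Omega>. x \<pi> i)" for i
  define E2 where "E2 i j = (\<Sum>\<pi>\<in>\<Omega>. x \<pi> i * x \<pi> j)" for i j
  define e where "e = card \<Omega> * w / N"
  \<comment> \<open>Exchanging positions makes all means equal, and they add up to the fixed total
    \<open>w\<close>.\<close>
  have Ei: "E i = e" if i: "i \<in> P" for i
  proof -
    have "E j = E i" if "j \<in> P" for j
      using exch[OF i that, of "\<lambda>\<pi>. x \<pi> i"] by (simp add: E_def x_def)
    then have "(\<Sum>j\<in>P. E j) = N * E i" by (simp add: N_def)
    moreover have "(\<Sum>j\<in>P. E j) = (\<Sum>\<pi>\<in>\<Omega>. \<Sum>j\<in>P. x \<pi> j)"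
      unfolding E_def by (rule sum.swap)
    moreover have "\<dots> = card \<Omega> * w" using w by (simp add: x_def)
    ultimately have "N * E i = card \<Omega> * w" by simp
    then show ?thesis using N2 by (simp add: e_def eq_divide_eq mult.commute)
  qed
  \<comment> \<open>Exchanges of \<open>j\<close> with positions other than \<open>i\<close> leave
    \<open>i\<close> alone, so the pair moments with fixed \<open>i\<close> agree. Their sum is that
    of \<open>x \<pi> i * (w - x \<pi> i)\<close>, which is linear in \<open>x \<pi> i\<close>
    because an indicator equals its square.\<close>
  have Eij: "E2 i j = (w - 1) * e / (N - 1)" if ij: "i \<in> P" "j \<in> P" "i \<noteq> j" for i j
  proof -
    have "E2 i j' = E2 i j" if "j' \<in> P - {i}" for j'
      using exch[OF ij(2), of j' "\<lambda>\<pi>. x \<pi> i * x \<pi> j"] that ij not_sym[OF ij(3)]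
      by (auto simp: E2_def x_def Transposition.transpose_def)
    then have "(\<Sum>j'\<in>P - {i}. E2 i j') = (N - 1) * E2 i j"
      using card_Suc_Diff1[OF fin(2) ij(1)] by (simp add: N_def)
    moreover have "(\<Sum>j'\<in>P - {i}. E2 i j') = (\<Sum>\<pi>\<in>\<Omega>. x \<pi> i * (w - x \<pi> i))"
    proof -
      have "(\<Sum>j'\<in>P - {i}. E2 i j') = (\<Sum>\<pi>\<in>\<Omega>. \<Sum>j'\<in>P - {i}. x \<pi> i * x \<pi> j')"
        unfolding E2_def by (rule sum.swap)
      also have "\<dots> = (\<Sum>\<pi>\<in>\<Omega>. x \<pi> i * (w - x \<pi> i))"
      proof (rule sum.cong)
        fix \<pi> assume "\<pi> \<in> \<Omega>"
        then have "(\<Sum>j'\<in>P - {i}. x \<pi> j') = w - x \<pi> i"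
          using sum.remove[OF fin(2) ij(1), of "x \<pi>"] w[of \<pi>] by (simp add: x_def del: sum_of_bool_eq)
        then show "(\<Sum>j'\<in>P - {i}. x \<pi> i * x \<pi> j') = x \<pi> i * (w - x \<pi> i)"
          by (simp add: sum_distrib_left[symmetric])
      qed simp
      finally show ?thesis .
    qed
    moreover have "(\<Sum>\<pi>\<in>\<Omega>. x \<pi> i * (w - x \<pi> i)) = (w - 1) * e"
    proof -
      have "x \<pi> i * (w - x \<pi> i) = (w - 1) * x \<pi> i" for \<pi>
        using xx[of \<pi> i] by (simp add: algebra_simps)
      then show ?thesis using Ei[OF ij(1)] by (simp only: sum_distrib_left[symmetric] E_def)
    qed
    ultimately show ?thesis using N2 by (simp add: eq_divide_eq mult.commute)
  qed
  have lin: "(\<Sum>\<pi>\<in>\<Omega>. \<Sum>i\<in>K. x \<pi> i) = k * e"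
  proof -
    have "(\<Sum>\<pi>\<in>\<Omega>. \<Sum>i\<in>K. x \<pi> i) = (\<Sum>i\<in>K. E i)" unfolding E_def by (rule sum.swap)
    then show ?thesis using Ei K by (simp add: k_def subset_iff)
  qed
  have quad: "(\<Sum>\<pi>\<in>\<Omega>. (\<Sum>i\<in>K. x \<pi> i)\<^sup>2) = k * (e + (k - 1) * ((w - 1) * e / (N - 1)))"
  proof -
    have "(\<Sum>\<pi>\<in>\<Omega>. (\<Sum>i\<in>K. x \<pi> i)\<^sup>2) = (\<Sum>\<pi>\<in>\<Omega>. \<Sum>i\<in>K. \<Sum>j\<in>K. x \<pi> i * x \<pi> j)"
      by (simp add: power2_eq_square sum_product)
    also have "\<dots> = (\<Sum>i\<in>K. \<Sum>j\<in>K. E2 i j)"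
      unfolding E2_def by (subst sum.swap) (intro sum.cong refl sum.swap)
    also have "\<dots> = (\<Sum>i\<in>K. e + (k - 1) * ((w - 1) * e / (N - 1)))"
    proof (rule sum.cong)
      fix i assume i: "i \<in> K"
      have "E2 i i = e" using Ei[of i] i K by (auto simp: E2_def xx E_def)
      moreover have "(\<Sum>j\<in>K - {i}. E2 i j) = (\<Sum>j\<in>K - {i}. (w - 1) * e / (N - 1))"
        using Eij i K by (intro sum.cong) auto
      moreover have "real (card (K - {i})) = k - 1"
      proof -
        have "Suc (card (K - {i})) = card K" by (rule card_Suc_Diff1[OF finK i])
        then show ?thesis by (simp add: k_def)
      qed
      ultimately show "(\<Sum>j\<in>K. E2 i j) = e + (k - 1) * ((w - 1) * e / (N - 1))"
        using i finK by (simp add: sum.remove)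
    qed simp
    also have "\<dots> = k * (e + (k - 1) * ((w - 1) * e / (N - 1)))" by (simp add: k_def)
    finally show ?thesis .
  qed
  have "(\<Sum>\<pi>\<in>\<Omega>. ((\<Sum>i\<in>K. x \<pi> i) - k * w / N)\<^sup>2) =
     (\<Sum>\<pi>\<in>\<Omega>. (\<Sum>i\<in>K. x \<pi> i)\<^sup>2) - 2 * (k * w / N) * (\<Sum>\<pi>\<in>\<Omega>. \<Sum>i\<in>K. x \<pi> i) + card \<Omega> * (k * w / N)\<^sup>2"
    proof -
    have "((\<Sum>i\<in>K. x \<pi> i) - k * w / N)\<^sup>2 =
        (\<Sum>i\<in>K. x \<pi> i)\<^sup>2 - 2 * (k * w / N) * (\<Sum>i\<in>K. x \<pi> i) + (k * w / N)\<^sup>2" for \<pi>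
      by (simp add: power2_eq_square algebra_simps)
    then show ?thesis
      by (simp only: sum.distrib sum_subtractf sum_distrib_left[symmetric]) simp
  qed
  also have "\<dots> = k * e * (1 + ((k - 1) * (w - 1) / (N - 1) - k * w / N))"
  proof -
    have "card \<Omega> * (k * w / N)\<^sup>2 = k * w / N * (k * e)"
      by (simp add: e_def power2_eq_square)
    then show ?thesis unfolding lin quad by (simp add: algebra_simps)
  qed
  also have "\<dots> \<le> k * e"
  proof (cases "k = 0 \<or> w = 0")
    case True
    then show ?thesis by (auto simp: e_def)
  next
    case False
    then have "1 \<le> w" "1 \<le> k" using wN by (auto simp: k_def Suc_leI)
    \<comment> \<open>Sampling without replacement correlates the indicators negatively: by this
      ratio bound the off-diagonal correction is not positive, and the diagonal part
      \<open>k * e\<close> remains.\<close>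
    have "(k - 1) / (N - 1) \<le> k / N"
      using kN N2 by (simp add: field_simps)
    then have "(k - 1) / (N - 1) * (w - 1) \<le> k / N * w"
      using \<open>1 \<le> w\<close> \<open>1 \<le> k\<close> N2 by (intro mult_mono) auto
    moreover have "0 \<le> k * e" using \<open>1 \<le> w\<close> \<open>1 \<le> k\<close> N2 by (auto simp: e_def)
    ultimately show ?thesis by (intro mult_left_le) auto
  qed
  also have "k * e \<le> card \<Omega> * N"
  proof -
    have "k * e = card \<Omega> * (k / N * w)" by (simp add: e_def)
    also have "\<dots> \<le> card \<Omega> * (1 * N)"
      using kN wN N2 by (intro mult_left_mono mult_mono) (auto simp: N_def)
    finally show ?thesis by simp
  qed
  finally show ?thesis by (simp add: x_def k_def N_def)
qed

definition limit_toll :: "real \<times> real \<times> real \<Rightarrow> real" where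
  "limit_toll = (\<lambda>(d1, d2, d3). 1 + (d1 + d2) * (d2 + 2 * d3))"

definition proportions :: "nat \<Rightarrow> (int \<Rightarrow> int) \<Rightarrow> real \<times> real \<times> real" where
  "proportions n \<pi> = (small_size n \<pi> / n, medium_size n \<pi> / n, large_size n \<pi> / n)"

text \<open>Once both end values are fixed, the inner positions are exchangeable, and every key of
  \<open>W\<close> sits at one of them, so the total count is \<open>card W\<close>.\<close>

lemma fibre_count_variance:
  assumes n: "4 \<le> n" and K: "K \<subseteq> {2..int n - 1}" and ab: "(a, b) \<in> offdiag n" and W: "W \<subseteq> {1..int n} - {a, b}"
  shows "(\<Sum>\<pi>\<in>ends_fibre n (a, b). ((\<Sum>i\<in>K. of_bool (\<pi> i \<in> W)) - real (card K) * card W / (real n - 2))\<^sup>2)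
      \<le> card (ends_fibre n (a, b)) * (real n - 2)"
proof -
  have cP: "real (card {2..int n - 1}) = real n - 2" using n by simp
  have "card W \<le> card ({1..int n} - {a, b})" using W by (intro card_mono) auto
  also have "card ({1..int n} - {a, b}) = n - 2"
    using ab by (subst card_Diff_subset) (auto simp: offdiag_def)
  finally have cW: "card W \<le> n - 2" .
  have "(\<Sum>\<pi>\<in>ends_fibre n (a, b). ((\<Sum>i\<in>K. of_bool (\<pi> i \<in> W)) - real (card K) * real (card W) / card {2..int n - 1})\<^sup>2)
      \<le> card (ends_fibre n (a, b)) * real (card {2..int n - 1})"
  proof (rule exchangeable_count_variance[OF finite_ends_fibre _ _ K])
    fix \<pi> assume pi: "\<pi> \<in> ends_fibre n (a, b)"
    then have p: "\<pi> permutes {1..int n}" and e: "\<pi> 1 = a" "\<pi> (int n) = b"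
      by (auto simp: ends_fibre_def)
    show "\<pi> \<circ> Transposition.transpose i j \<in> ends_fibre n (a, b)" if "i \<in> {2..int n - 1}" "j \<in> {2..int n - 1}" for i j
      using that e permutes_compose[OF permutes_swap_id p, of i j]
      by (auto simp: ends_fibre_def Transposition.transpose_def)
    have "(\<Sum>i\<in>{2..int n - 1}. of_bool (\<pi> i \<in> W)) = real (card {i\<in>{2..int n - 1}. \<pi> i \<in> W})"
      by (simp add: of_bool_def sum.If_cases Int_def)
    also have "card {i\<in>{2..int n - 1}. \<pi> i \<in> W} = card (\<pi> ` {i\<in>{2..int n - 1}. \<pi> i \<in> W})"
      by (rule card_image[symmetric]) (rule inj_on_subset[OF permutes_inj[OF p]], simp)
    also have "\<pi> ` {i\<in>{2..int n - 1}. \<pi> i \<in> W} = W"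
    proof (intro equalityI subsetI)
      fix y assume y: "y \<in> W"
      then have "y \<in> \<pi> ` {1..int n}" using permutes_image[OF p] W by auto
      then obtain i where i: "i \<in> {1..int n}" "y = \<pi> i" by auto
      moreover have "i \<noteq> 1" "i \<noteq> int n" using i y W e by auto
      ultimately show "y \<in> \<pi> ` {i\<in>{2..int n - 1}. \<pi> i \<in> W}" using y by auto
    qed auto
    finally show "(\<Sum>i\<in>{2..int n - 1}. of_bool (\<pi> i \<in> W)) = real (card W)" .
  qed (use n cW in auto)
  then show ?thesis by (simp add: cP[simplified] n)
qed

text \<open>Each inner position is charged one comparison; a position before \<open>q\<close> a
  second one if its key is above \<open>p\<close>, a position from \<open>q\<close> on if its key is
  below \<open>q\<close>. Inner positions never carry a pivot, so the pivots may be removed from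
  both key sets, as the variance estimate requires.\<close>

lemma toll_bounds:
  assumes pi: "\<pi> \<in> perms n" and n: "2 \<le> n"
  defines "p \<equiv> low_rank n \<pi>" and "q \<equiv> high_rank n \<pi>"
  shows "real (toll n \<pi>) - (real n - 2) - (\<Sum>i\<in>{2..q - 1}. of_bool (\<pi> i \<in> {p + 1..int n} - {q}))
      - (\<Sum>i\<in>{q..int n - 1}. of_bool (\<pi> i \<in> {1..q - 1} - {p})) \<in> {1..4}"
proof -
  have perm: "\<pi> permutes {1..int n}" using pi by simp
  note b = rank_bounds[OF pi n, folded p_def q_def]
  obtain A where A: "partition_step \<pi> 1 (int n) 0 = (A, p, q, toll n \<pi>)"
    using partition_step_facts[OF pi n] unfolding p_def q_def by blast
  have ne: "\<pi> i \<noteq> p \<and> \<pi> i \<noteq> q \<and> \<pi> i \<in> {1..int n}" if "i \<in> {2..int n - 1}" for i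
    using inj_eq[OF permutes_inj[OF perm], of i 1] inj_eq[OF permutes_inj[OF perm], of i "int n"]
      permutes_in_image[OF perm, of i] that
    by (auto simp: p_def q_def low_rank_def high_rank_def min_def max_def)
  have "(int (toll n \<pi>) - int 0 - (\<Sum>i\<in>{2..q - 1}. 1 + of_bool (p \<le> \<pi> i)) - (\<Sum>i\<in>{q..int n - 1}. 1 + of_bool (\<pi> i \<le> q))) \<in> {1..4}"
    using partition_step_permutation(4)[OF perm n A] unfolding p_def q_def low_rank_def high_rank_def .
  moreover have "(\<Sum>i\<in>{2..q - 1}. 1 + of_bool (p \<le> \<pi> i)) = (\<Sum>i\<in>{2..q - 1}. 1 + of_bool (\<pi> i \<in> {p + 1..int n} - {q}) :: int)"
    using ne b by (intro sum.cong) (force simp: of_bool_def)+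
  moreover have "(\<Sum>i\<in>{q..int n - 1}. 1 + of_bool (\<pi> i \<le> q)) = (\<Sum>i\<in>{q..int n - 1}. 1 + of_bool (\<pi> i \<in> {1..q - 1} - {p}) :: int)"
    using ne b by (intro sum.cong) (force simp: of_bool_def)+
  moreover define Y where "Y = int (toll n \<pi>) - (int n - 2) - (\<Sum>i\<in>{2..q - 1}. of_bool (\<pi> i \<in> {p + 1..int n} - {q}))
      - (\<Sum>i\<in>{q..int n - 1}. of_bool (\<pi> i \<in> {1..q - 1} - {p}))"
  moreover have "(\<Sum>i\<in>{2..q - 1}. 1 + f i) = q - 2 + (\<Sum>i\<in>{2..q - 1}. f i)"
    "(\<Sum>i\<in>{q..int n - 1}. 1 + f i) = int n - q + (\<Sum>i\<in>{q..int n - 1}. f i)" for f :: "int \<Rightarrow> int"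
    using b by (simp_all add: sum.distrib)
  ultimately have "Y \<in> {1..4}" by (simp del: sum_of_bool_eq)
  then have "1 \<le> real_of_int Y" "real_of_int Y \<le> 4" by auto
  then show ?thesis by (simp add: Y_def)
qed

text \<open>With \<open>s\<close>, \<open>m\<close>, \<open>l\<close> keys in the blocks, the two
  counts have conditional means \<open>(s + m) (m + l) / (n - 2)\<close> and
  \<open>l (s + m) / (n - 2)\<close>. Their sum is \<open>(s + m) (m + 2 l) / (n - 2)\<close>, the
  origin of the term \<open>(D_1 + D_2) (D_2 + 2 D_3)\<close>. Each variance is at most
  \<open>n - 2\<close> and the remainder at most 6 in absolute value, so the mean square is below
  \<open>3 (2 n + 36)\<close>.\<close>

lemma toll_second_moment:
  assumes n: "4 \<le> n"
  shows "perm_avg n (\<lambda>\<pi>. (real (toll n \<pi>) - n * limit_toll (proportions n \<pi>))\<^sup>2) \<le> 6 * real n + 108"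
proof -
  define D where "D \<pi> = real (toll n \<pi>) - n * limit_toll (proportions n \<pi>)" for \<pi>
  have fibre: "(\<Sum>\<pi>\<in>ends_fibre n ab. (D \<pi>)\<^sup>2) \<le> card (ends_fibre n ab) * (6 * real n + 108)"
    if ab: "ab \<in> offdiag n" for ab
  proof -
    obtain a b where [simp]: "ab = (a, b)" by fastforce
    define p q where "p = min a b" and "q = max a b"
    have pq: "1 \<le> p" "p < q" "q \<le> int n" using ab by (auto simp: offdiag_def p_def q_def)
    define K1 W1 K2 W2 where "K1 = {2..q - 1}" and "W1 = {p + 1..int n} - {q}"
      and "K2 = {q..int n - 1}" and "W2 = {1..q - 1} - {p}"
    define s m l where "s = real_of_int p - 1" and "m = real_of_int q - p - 1" and "l = real n - q"
    have cards: "real (card K1) = s + m" "real (card W1) = m + l" "real (card K2) = l" "real (card W2) = s + m"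
      using pq by (auto simp: K1_def W1_def K2_def W2_def s_def m_def l_def card_Diff_singleton of_nat_diff)
    have sml: "0 \<le> s" "0 \<le> m" "0 \<le> l" "s + m + l = real n - 2"
      using pq by (auto simp: s_def m_def l_def)
    define X1 X2 where "X1 \<pi> = (\<Sum>i\<in>K1. of_bool (\<pi> i \<in> W1)) - (s + m) * (m + l) / (real n - 2)"
      and "X2 \<pi> = (\<Sum>i\<in>K2. of_bool (\<pi> i \<in> W2)) - l * (s + m) / (real n - 2)" for \<pi> :: "int \<Rightarrow> int"
    have v1: "(\<Sum>\<pi>\<in>ends_fibre n (a, b). (X1 \<pi>)\<^sup>2) \<le> card (ends_fibre n (a, b)) * (real n - 2)"
    proof -
      have "K1 \<subseteq> {2..int n - 1}" "W1 \<subseteq> {1..int n} - {a, b}"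
        using ab pq by (auto simp: K1_def W1_def p_def q_def)
      from fibre_count_variance[OF n this(1) ab[simplified] this(2)] show ?thesis
        unfolding X1_def cards .
    qed
    have v2: "(\<Sum>\<pi>\<in>ends_fibre n (a, b). (X2 \<pi>)\<^sup>2) \<le> card (ends_fibre n (a, b)) * (real n - 2)"
    proof -
      have "K2 \<subseteq> {2..int n - 1}" "W2 \<subseteq> {1..int n} - {a, b}"
        using ab pq by (auto simp: K2_def W2_def p_def q_def)
      from fibre_count_variance[OF n this(1) ab[simplified] this(2)] show ?thesis
        unfolding X2_def cards .
    qed
    have pw: "(D \<pi>)\<^sup>2 \<le> 3 * ((X1 \<pi>)\<^sup>2 + (X2 \<pi>)\<^sup>2 + 36)" if pi: "\<pi> \<in> ends_fibre n (a, b)" for \<pi>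
    proof -
      have P: "\<pi> \<in> perms n" "low_rank n \<pi> = p" "high_rank n \<pi> = q"
        using pi by (auto simp: ends_fibre_def low_rank_def high_rank_def p_def q_def)
      have "limit_toll (proportions n \<pi>) = 1 + (s / n + m / n) * (m / n + 2 * (l / n))"
        using pq by (simp add: limit_toll_def proportions_def small_size_def medium_size_def large_size_def P
            s_def m_def l_def)
      then have lt: "n * limit_toll (proportions n \<pi>) = n + (s + m) * (m + 2 * l) / n"
        using n by (simp add: field_simps)
      define d where "d = real (toll n \<pi>) - (real n - 2) - (\<Sum>i\<in>K1. of_bool (\<pi> i \<in> W1)) - (\<Sum>i\<in>K2. of_bool (\<pi> i \<in> W2))"
      have d: "1 \<le> d" "d \<le> 4"
        using toll_bounds[OF P(1)] n unfolding P d_def K1_def K2_def W1_def W2_def by auto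
      \<comment> \<open>Replacing the denominator \<open>n - 2\<close> by \<open>n\<close> costs at
        most 4: the numerator is at most \<open>2 (n - 2)^2\<close>, and the two reciprocals differ
        by \<open>2 / (n (n - 2))\<close>. With the slack \<open>d - 2\<close> between -1 and 2 this
        gives the remainder 6.\<close>
      have "(s + m) * (m + 2 * l) \<le> (real n - 2) * (2 * (real n - 2))"
        using sml by (intro mult_mono) auto
      moreover have nn: "0 < real n" "0 < real n - 2" using n by auto
      ultimately have "(s + m) * (m + 2 * l) / (real n - 2) - (s + m) * (m + 2 * l) / n \<le> 4"
        by (simp add: field_simps)
      moreover have "0 \<le> (s + m) * (m + 2 * l) / (real n - 2) - (s + m) * (m + 2 * l) / n"
        using sml nn by (simp add: field_simps mult_nonneg_nonneg)
      moreover have "D \<pi> = X1 \<pi> + X2 \<pi> + (d - 2 + ((s + m) * (m + 2 * l) / (real n - 2) - (s + m) * (m + 2 * l) / n))"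
      proof -
        have lin: "t - (u + d) = x - a + (y - b) + (t - (u - 2) - x - y - 2 + (c - d))"
          if "a + b = c" for t u a b c d x y :: real using that by simp
        have "(s + m) * (m + l) / (real n - 2) + l * (s + m) / (real n - 2) = (s + m) * (m + 2 * l) / (real n - 2)"
          by (simp add: add_divide_distrib[symmetric] algebra_simps)
        then show ?thesis unfolding D_def lt X1_def X2_def d_def by (rule lin)
      qed
      ultimately obtain r where r: "D \<pi> = X1 \<pi> + X2 \<pi> + r" "\<bar>r\<bar> \<le> 6" using d by force
      have "(x + y + z)\<^sup>2 \<le> 3 * (x\<^sup>2 + y\<^sup>2 + z\<^sup>2)" for x y z :: real
      proof -
        have "0 \<le> (x - y)\<^sup>2 + (y - z)\<^sup>2 + (x - z)\<^sup>2" by simp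
        then show ?thesis by (simp add: power2_eq_square algebra_simps)
      qed
      moreover have "r\<^sup>2 \<le> 36" using power_mono[OF r(2), of 2] by simp
      ultimately show ?thesis unfolding r(1) by (smt (verit))
    qed
    have "(\<Sum>\<pi>\<in>ends_fibre n (a, b). (D \<pi>)\<^sup>2) \<le> (\<Sum>\<pi>\<in>ends_fibre n (a, b). 3 * ((X1 \<pi>)\<^sup>2 + (X2 \<pi>)\<^sup>2 + 36))"
      by (rule sum_mono) (rule pw)
    also have "\<dots> = 3 * (\<Sum>\<pi>\<in>ends_fibre n (a, b). (X1 \<pi>)\<^sup>2) + 3 * (\<Sum>\<pi>\<in>ends_fibre n (a, b). (X2 \<pi>)\<^sup>2) + 108 * card (ends_fibre n (a, b))"
      by (simp add: sum.distrib sum_distrib_left[symmetric] algebra_simps)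
    also have "\<dots> \<le> card (ends_fibre n ab) * (6 * real n + 108)"
      using v1 v2 by (simp add: algebra_simps)
    finally show ?thesis by simp
  qed
  have "(\<Sum>\<pi>\<in>perms n. (D \<pi>)\<^sup>2) = (\<Sum>ab\<in>offdiag n. \<Sum>\<pi>\<in>ends_fibre n ab. (D \<pi>)\<^sup>2)"
    using n by (intro sum_perms_fibres) auto
  also have "\<dots> \<le> (\<Sum>ab\<in>offdiag n. card (ends_fibre n ab) * (6 * real n + 108))"
    by (rule sum_mono) (rule fibre)
  also have "\<dots> = real (\<Sum>ab\<in>offdiag n. card (ends_fibre n ab)) * (6 * real n + 108)"
    by (simp add: sum_distrib_right)
  also have "(\<Sum>ab\<in>offdiag n. card (ends_fibre n ab)) = fact n"
    using sum_perms_fibres[of n "\<lambda>_. 1::nat"] n by (simp add: card_perms)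
  finally show ?thesis by (simp add: perm_avg_def D_def field_simps)
qed


section \<open>Weighted recursions\<close>

text \<open>
  The factor multiplying the \<open>k\<close>-th error in the recursions below: \<open>6 (n - 1 - k) / (n (n - 1))\<close> is the
  expected number of subproblems of size \<open>k\<close>, and \<open>x / 4 + x\<^sup>2\<close> dominates both \<open>x\<^sup>2\<close> and \<open>x powr (3/2)\<close>
  while keeping the total mass below 1.
\<close>

definition weight :: "nat \<Rightarrow> nat \<Rightarrow> real" where
  "weight n k = 6 / (real n * (real n - 1)) * (real n - 1 - real k) * (real k / real n / 4 + (real k / real n)\<^sup>2)"

lemma weight_nonneg: "k < n - 1 \<Longrightarrow> 0 \<le> weight n k"
  by (auto simp: weight_def intro!: mult_nonneg_nonneg add_nonneg_nonneg)

lemma sum_sub_mult: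
  "(\<Sum>k<m. (N - real k) * real k) = N * (real m * (real m - 1) / 2) - (real m - 1) * real m * (2 * real m - 1) / 6"
  "(\<Sum>k<m. (N - real k) * (real k)\<^sup>2) = N * ((real m - 1) * real m * (2 * real m - 1) / 6) - (real m * (real m - 1) / 2)\<^sup>2"
  by (induction m) (simp_all add: algebra_simps power2_eq_square divide_simps)

text \<open>The two parts of the weight have total masses tending to \<open>6 / 4\<close> times the
  integral of \<open>(1 - x) x\<close> and 6 times that of \<open>(1 - x) x^2\<close>, that is
  \<open>1 / 4\<close> and \<open>1 / 2\<close>; the exact sums stay below these limits.\<close>

lemma weight_sum_le:
  assumes "2 \<le> n"
  shows "(\<Sum>k<n - 1. weight n k) \<le> 3 / 4"
proof -
  define N where "N = real n - 1"
  have n: "real n = N + 1" "real (n - 1) = N" "1 \<le> N" using assms by (auto simp: N_def of_nat_diff)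
  have "(\<Sum>k<n - 1. weight n k) = (\<Sum>k<n - 1. 6 / ((N + 1) * N) *
      ((N - real k) * real k / (4 * (N + 1)) + (N - real k) * (real k)\<^sup>2 / (N + 1)\<^sup>2))"
  proof -
    have "A * x * (k / P / 4 + (k / P)\<^sup>2) = A * (x * k / (4 * P) + x * k\<^sup>2 / P\<^sup>2)" for A x k P :: real
      by (simp add: power_divide distrib_left mult.assoc mult.commute[of P 4])
    moreover have "N + 1 - 1 = N" by simp
    ultimately show ?thesis by (simp only: weight_def n)
  qed
  also have "\<dots> = 6 / ((N + 1) * N) *
      ((\<Sum>k<n - 1. (N - real k) * real k) / (4 * (N + 1)) + (\<Sum>k<n - 1. (N - real k) * (real k)\<^sup>2) / (N + 1)\<^sup>2)"
    by (simp add: sum_distrib_left[symmetric] sum.distrib sum_divide_distrib[symmetric])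
  also have "\<dots> = (N - 1) / (4 * (N + 1)) + N * (N - 1) / (2 * (N + 1)\<^sup>2)"
  proof -
    have s1: "(\<Sum>k<n - 1. (N - real k) * real k) = (N - 1) * N * (N + 1) / 6"
      unfolding sum_sub_mult n by (simp add: field_simps)
    have s2: "(\<Sum>k<n - 1. (N - real k) * (real k)\<^sup>2) = (N - 1) * N\<^sup>2 * (N + 1) / 12"
      unfolding sum_sub_mult n by (simp add: field_simps power2_eq_square)
    have "6 / ((N + 1) * N) * ((N - 1) * N * (N + 1) / 6 / (4 * (N + 1))) = (N - 1) / (4 * (N + 1))"
      using n(3) by (simp add: divide_simps) (simp add: algebra_simps)
    moreover have "6 / ((N + 1) * N) * ((N - 1) * N\<^sup>2 * (N + 1) / 12 / (N + 1)\<^sup>2) = N * (N - 1) / (2 * (N + 1)\<^sup>2)"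
      using n(3) by (simp add: divide_simps power2_eq_square)
    ultimately show ?thesis unfolding s1 s2 distrib_left by simp
  qed
  also have "\<dots> \<le> 1 / 4 + 1 / 2"
  proof (rule add_mono)
    show "(N - 1) / (4 * (N + 1)) \<le> 1 / 4" using n(3) by (simp add: divide_simps)
    have "N * (N - 1) \<le> (N + 1)\<^sup>2" using n(3) by (simp add: power2_eq_square algebra_simps)
    then show "N * (N - 1) / (2 * (N + 1)\<^sup>2) \<le> 1 / 2" using n(3) by (simp add: divide_simps)
  qed
  finally show ?thesis by simp
qed

text \<open>Every single index is eventually forgotten, so the behaviour of a recursion below any
  fixed size, the range of insertion sort included, does not affect its limit.\<close>

lemma weight_tendsto_0: "(\<lambda>n. weight n k) \<longlonglongrightarrow> 0"
proof (rule tendsto_sandwich[OF _ _ tendsto_const])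
  show "\<forall>\<^sub>F n in sequentially. 0 \<le> weight n k"
    using eventually_gt_at_top[of "k + 1"] by eventually_elim (rule weight_nonneg, simp)
  show "\<forall>\<^sub>F n in sequentially. weight n k \<le> 6 * (real k / 4 + (real k)\<^sup>2) / real n"
    using eventually_gt_at_top[of "k + 1"]
  proof eventually_elim
    case (elim n)
    have "(real n - 1 - real k) / (real n - 1) \<le> 1" "real k / real n \<le> real k"
      using elim mult_left_mono[of 1 "real n" "real k"] by (auto simp: divide_simps)
    moreover have "(real k / real n)\<^sup>2 \<le> (real k)\<^sup>2"
      using \<open>real k / real n \<le> real k\<close> by (intro power_mono) auto
    ultimately have "real k / real n / 4 + (real k / real n)\<^sup>2 \<le> real k / 4 + (real k)\<^sup>2"
      by (intro add_mono divide_right_mono) auto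
    with \<open>(real n - 1 - real k) / (real n - 1) \<le> 1\<close>
    have "6 / real n * ((real n - 1 - real k) / (real n - 1)) * (real k / real n / 4 + (real k / real n)\<^sup>2)
      \<le> 6 / real n * 1 * (real k / 4 + (real k)\<^sup>2)"
      using elim by (intro mult_mono) auto
    then show ?case by (simp add: weight_def)
  qed
  show "(\<lambda>n. 6 * (real k / 4 + (real k)\<^sup>2) / real n) \<longlonglongrightarrow> 0"
    by (rule lim_const_over_n)
qed

text \<open>Total mass at most \<open>3 / 4\<close> gives boundedness. After that any eventual bound
  \<open>c\<close> improves to \<open>7 / 8 * c\<close>: late indices contribute at most
  \<open>3 / 4 * c\<close>, while early indices and \<open>r\<close> together sink below
  \<open>c / 8\<close>.\<close>

lemma weighted_recursion_tendsto_0: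
  fixes a r :: "nat \<Rightarrow> real"
  assumes a: "\<And>n. 0 \<le> a n" and r: "r \<longlonglongrightarrow> 0" and "2 \<le> n0"
    and rec: "\<And>n. n0 \<le> n \<Longrightarrow> a n \<le> r n + (\<Sum>k<n - 1. weight n k * a k)"
  shows "a \<longlonglongrightarrow> 0"
proof -
  obtain R where R: "0 < R" "\<And>n. \<bar>r n\<bar> \<le> R"
    using convergent_imp_Bseq[OF convergentI[OF r]] by (auto simp: Bseq_def)
  \<comment> \<open>The bound reproduces itself because \<open>R + 3 / 4 * b <= b\<close> as soon as
    \<open>b\<close> is at least \<open>4 * R\<close>.\<close>
  define b where "b = max (Max (a ` {..n0})) (4 * R)"
  have b: "a n \<le> b" for n
  proof (induction n rule: less_induct)
    case (less n)
    show ?case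
    proof (cases "n \<le> n0")
      case True
      then have "a n \<le> Max (a ` {..n0})" by (intro Max_ge) auto
      then show ?thesis by (simp add: b_def)
    next
      case False
      have "0 \<le> b" using R by (simp add: b_def)
      have "(\<Sum>k<n - 1. weight n k * a k) \<le> (\<Sum>k<n - 1. weight n k * b)"
        using less by (intro sum_mono mult_left_mono weight_nonneg) auto
      also have "\<dots> \<le> 3 / 4 * b"
        unfolding sum_distrib_right[symmetric] using \<open>0 \<le> b\<close> weight_sum_le[of n] False assms(3)
        by (intro mult_right_mono) auto
      finally have "a n \<le> r n + 3 / 4 * b" using rec[of n] False by simp
      moreover have "r n \<le> R" using R(2)[of n] by simp
      moreover have "4 * R \<le> b" by (simp add: b_def)
      ultimately show ?thesis by simp
    qed
  qed
  have b0: "0 < b" using R by (auto simp: b_def)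
  have step: "\<forall>\<^sub>F n in sequentially. a n \<le> 7 / 8 * c" if c: "0 < c" "\<forall>\<^sub>F n in sequentially. a n \<le> c" for c
  proof -
    obtain N where N: "\<And>n. N \<le> n \<Longrightarrow> a n \<le> c" using c(2) by (auto simp: eventually_sequentially)
    have "(\<lambda>n. r n + (\<Sum>k<N. weight n k * b)) \<longlonglongrightarrow> 0 + (\<Sum>k<N. 0 * b)"
      by (intro tendsto_add r tendsto_sum tendsto_mult weight_tendsto_0 tendsto_const)
    then have "\<forall>\<^sub>F n in sequentially. r n + (\<Sum>k<N. weight n k * b) < c / 8"
      using c(1) by (intro order_tendstoD(2)) auto
    then show ?thesis using eventually_ge_at_top[of "max n0 (N + 1)"]
    proof eventually_elim
      case (elim n)
      have s: "{..<n - 1} = {..<N} \<union> {N..<n - 1}" using elim by auto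
      have "(\<Sum>k<n - 1. weight n k * a k) = (\<Sum>k<N. weight n k * a k) + (\<Sum>k=N..<n - 1. weight n k * a k)"
        unfolding s by (rule sum.union_disjoint) auto
      also have "(\<Sum>k<N. weight n k * a k) \<le> (\<Sum>k<N. weight n k * b)"
        using b elim by (intro sum_mono mult_left_mono weight_nonneg) auto
      also have "(\<Sum>k=N..<n - 1. weight n k * a k) \<le> (\<Sum>k=N..<n - 1. weight n k * c)"
        using N elim by (intro sum_mono mult_left_mono weight_nonneg) auto
      also have "\<dots> \<le> (\<Sum>k<n - 1. weight n k * c)"
        using c(1) by (intro sum_mono2 mult_nonneg_nonneg weight_nonneg) auto
      also have "\<dots> \<le> 3 / 4 * c"
        unfolding sum_distrib_right[symmetric] using c(1) weight_sum_le[of n] elim assms(3)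
        by (intro mult_right_mono) auto
      finally show ?case using rec[of n] elim by simp
    qed
  qed
  have pow: "\<forall>\<^sub>F n in sequentially. a n \<le> (7 / 8) ^ j * b" for j
  proof (induction j)
    case (Suc j)
    from step[OF _ this] b0 show ?case by (simp add: mult.assoc)
  qed (use b in simp)
  show ?thesis
  proof (rule order_tendstoI)
    fix e :: real assume e: "0 < e"
    have "(\<lambda>j. (7 / 8 :: real) ^ j * b) \<longlonglongrightarrow> 0 * b"
      by (intro tendsto_mult LIMSEQ_realpow_zero tendsto_const) auto
    then have "\<forall>\<^sub>F j in sequentially. (7 / 8) ^ j * b < e" using e by (intro order_tendstoD(2)) auto
    then obtain j where "(7 / 8) ^ j * b < e" by (auto simp: eventually_sequentially)
    with pow[of j] show "\<forall>\<^sub>F n in sequentially. a n < e" by (auto elim: eventually_mono)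
  next
    fix e :: real assume "e < 0"
    then show "\<forall>\<^sub>F n in sequentially. e < a n" using a by (auto intro: always_eventually less_le_trans)
  qed
qed

section \<open>Asymptotics of the mean\<close>

lemma stolz_cesaro:
  fixes a b :: "nat \<Rightarrow> real"
  assumes b: "strict_mono b" "filterlim b at_top sequentially"
    and lim: "(\<lambda>n. (a (Suc n) - a n) / (b (Suc n) - b n)) \<longlonglongrightarrow> L"
  shows "(\<lambda>n. a n / b n) \<longlonglongrightarrow> L"
proof (rule tendstoI)
  fix e :: real assume e: "0 < e"
  have pos: "0 < b (Suc n) - b n" for n using strict_monoD[OF b(1), of n "Suc n"] by simp
  have "\<forall>\<^sub>F n in sequentially. \<bar>(a (Suc n) - a n) / (b (Suc n) - b n) - L\<bar> < e / 2"
    using tendstoD[OF lim, of "e / 2"] e by (simp add: dist_real_def)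
  then obtain N where N: "\<And>n. N \<le> n \<Longrightarrow> \<bar>(a (Suc n) - a n) / (b (Suc n) - b n) - L\<bar> < e / 2"
    by (auto simp: eventually_sequentially)
  have incr: "\<bar>(a (Suc n) - L * b (Suc n)) - (a n - L * b n)\<bar> \<le> e / 2 * (b (Suc n) - b n)" if "N \<le> n" for n
  proof -
    have "(a (Suc n) - L * b (Suc n)) - (a n - L * b n) = ((a (Suc n) - a n) / (b (Suc n) - b n) - L) * (b (Suc n) - b n)"
      using pos[of n] by (simp add: field_simps)
    also have "\<bar>\<dots>\<bar> = \<bar>(a (Suc n) - a n) / (b (Suc n) - b n) - L\<bar> * (b (Suc n) - b n)"
      using pos[of n] by (simp add: abs_mult)
    also have "\<dots> \<le> e / 2 * (b (Suc n) - b n)"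
      using N[OF that] pos[of n] by (intro mult_right_mono) auto
    finally show ?thesis .
  qed
  have tot: "\<bar>(a n - L * b n) - (a N - L * b N)\<bar> \<le> e / 2 * (b n - b N)" if "N \<le> n" for n
    using that
  proof (induction n rule: dec_induct)
    case (step m)
    have "\<bar>z - x\<bar> \<le> \<bar>z - y\<bar> + \<bar>y - x\<bar>" for x y z :: real by simp
    then have "\<bar>(a (Suc m) - L * b (Suc m)) - (a N - L * b N)\<bar> \<le>
        \<bar>(a (Suc m) - L * b (Suc m)) - (a m - L * b m)\<bar> + \<bar>(a m - L * b m) - (a N - L * b N)\<bar>" .
    also have "\<dots> \<le> e / 2 * (b (Suc m) - b m) + e / 2 * (b m - b N)"
      by (intro add_mono incr step.IH) (use step in auto)
    finally show ?case by (simp add: right_diff_distrib)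
  qed simp
  define C where "C = \<bar>a N - L * b N\<bar> + e / 2 * \<bar>b N\<bar>"
  have "\<forall>\<^sub>F n in sequentially. 2 * C / e + 1 \<le> b n" "\<forall>\<^sub>F n in sequentially. 1 \<le> b n"
    using b(2) by (auto simp: filterlim_at_top)
  then show "\<forall>\<^sub>F n in sequentially. dist (a n / b n) L < e" using eventually_ge_at_top[of N]
  proof eventually_elim
    case (elim n)
    have "\<bar>a n - L * b n\<bar> \<le> e / 2 * b n + C"
    proof -
      have "- (e / 2 * b N) \<le> e / 2 * \<bar>b N\<bar>"
        unfolding mult_minus_right[symmetric] using e by (intro mult_left_mono) auto
      moreover have "\<bar>a n - L * b n\<bar> \<le> e / 2 * b n - e / 2 * b N + \<bar>a N - L * b N\<bar>"
        using tot[OF elim(3)] unfolding right_diff_distrib by linarith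
      ultimately show ?thesis unfolding C_def by linarith
    qed
    also have "C < e / 2 * b n" using elim(1) e by (simp add: field_simps)
    finally have "\<bar>a n - L * b n\<bar> < e * b n" by simp
    moreover have "a n / b n - L = (a n - L * b n) / b n" using elim(2) by (simp add: field_simps)
    ultimately show ?case using elim(2) by (simp add: dist_real_def pos_divide_less_eq)
  qed
qed

lemma summable_diff_imp_convergent:
  fixes f :: "nat \<Rightarrow> real"
  assumes "summable (\<lambda>n. f (Suc n) - f n)"
  obtains l where "f \<longlonglongrightarrow> l"
proof -
  obtain s where "(\<lambda>n. \<Sum>k<n. f (Suc k) - f k) \<longlonglongrightarrow> s"
    using assms by (auto simp: summable_def sums_def)
  then have "(\<lambda>n. f n - f 0 + f 0) \<longlonglongrightarrow> s + f 0"
    unfolding sum_lessThan_telescope by (intro tendsto_add tendsto_const)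
  then show thesis using that by simp
qed

text \<open>
  The recursion is an Euler type difference equation with indicial roots \<open>3\<close> and \<open>-2\<close> for the
  partial sums \<open>S\<close>. Passing to \<open>(n - 1) R + 2 S\<close>, where \<open>R\<close> is the difference of \<open>S\<close>, removes the
  first root and leaves two telescoping first-order recursions.
\<close>

lemma dual_pivot_recursion_asymptotics:
  fixes m t :: "nat \<Rightarrow> real"
  assumes n0: "2 \<le> n0"
    and rec: "\<And>n. n0 \<le> n \<Longrightarrow> m n = t n + 6 / (real n * (real n - 1)) * (\<Sum>k<n - 1. (real n - 1 - real k) * m k)"
    and toll: "\<And>n. n0 \<le> n \<Longrightarrow> \<bar>t n - c * real n\<bar> \<le> C * sqrt (real n)"
  obtains d where "(\<lambda>n. m n / real n - 6 / 5 * c * ln (real n)) \<longlonglongrightarrow> d"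
proof -
  define S where "S n = (\<Sum>k<n - 1. (real n - 1 - real k) * m k)" for n
  define R where "R n = (\<Sum>k<n. m k)" for n
  define P where "P n = (real n - 1) * R n + 2 * S n" for n
  define e where "e n = real n * (real n - 1) * m n - 6 * S n" for n
  have R_Suc: "R (Suc n) = R n + m n" for n by (simp add: R_def)
  have S_Suc: "S (Suc n) = S n + R n" if n: "1 \<le> n" for n
  proof -
    have "{..<n} = insert (n - 1) {..<n - 1}" using n by auto
    then have "(\<Sum>k<n. (real n - 1 - real k) * m k) = S n"
      using n by (simp add: S_def of_nat_diff)
    moreover have "S (Suc n) = (\<Sum>k<n. (real n - 1 - real k) * m k + m k)"
      unfolding S_def by (intro sum.cong) (auto simp: algebra_simps)
    ultimately show ?thesis by (simp add: R_def sum.distrib)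
  qed
  have e: "e n = real n * (real n - 1) * t n" if n: "n0 \<le> n" for n
  proof -
    have "real n * (real n - 1) \<noteq> 0" using n n0 by auto
    then show ?thesis unfolding e_def rec[OF n] S_def[symmetric]
      by (simp add: field_simps)
  qed
  have P_Suc: "(real n - 1) * P (Suc n) = (real n + 2) * P n + e n" if "1 \<le> n" for n
    unfolding P_def e_def R_Suc S_Suc[OF that] by (simp add: algebra_simps)
  \<comment> \<open>\<open>(n + 1) n (n - 1)\<close> solves the homogeneous recursion
    \<open>(n - 1) P (n + 1) = (n + 2) P n\<close>, so the quotient telescopes.\<close>
  define Q where "Q n = P n / ((real n + 1) * real n * (real n - 1))" for n
  have Q_Suc: "Q (Suc n) - Q n = e n / ((real n + 2) * (real n + 1) * real n * (real n - 1))" if n: "2 \<le> n" for n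
  proof -
    have nz: "real n + 2 \<noteq> 0" "real n + 1 \<noteq> 0" "real n \<noteq> 0" "real n - 1 \<noteq> 0" using n by auto
    have "P (Suc n) = ((real n + 2) * P n + e n) / (real n - 1)"
      using P_Suc[of n] n nz by (simp add: field_simps)
    then have "Q (Suc n) = ((real n + 2) * P n + e n) / ((real n + 2) * (real n + 1) * real n * (real n - 1))"
      by (simp add: Q_def algebra_simps)
    also have "\<dots> = Q n + e n / ((real n + 2) * (real n + 1) * real n * (real n - 1))"
      unfolding add_divide_distrib Q_def using nz by simp
    finally show ?thesis by simp
  qed
  \<comment> \<open>The increments of \<open>Q\<close> are \<open>c / n\<close> up to a summable
    error: an error of order \<open>sqrt n\<close> in the toll becomes one of order
    \<open>n powr (- 3 / 2)\<close> here.\<close>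
  define Z where "Z n = Q n - c * ln (real n)" for n
  have "summable (\<lambda>n. Z (Suc n) - Z n)"
  proof (rule summable_comparison_test_bigo)
    show "summable (\<lambda>n. norm (real n powr (- 3 / 2)))"
      by (simp add: summable_real_powr_iff)
    have "(\<lambda>n. c * (real n / ((real n + 1) * (real n + 2)) - (ln (real n + 1) - ln (real n))) +
        (t n - c * real n) / ((real n + 2) * (real n + 1))) \<in> O(\<lambda>n. real n powr (- 3 / 2))"
    proof (rule sum_in_bigo)
      have "(\<lambda>n. real n / ((real n + 1) * (real n + 2)) - (ln (real n + 1) - ln (real n))) \<in> O(\<lambda>n. real n powr (- 3 / 2))"
        by real_asymp
      then show "(\<lambda>n. c * (real n / ((real n + 1) * (real n + 2)) - (ln (real n + 1) - ln (real n)))) \<in> O(\<lambda>n. real n powr (- 3 / 2))"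
        by simp
      have "(\<lambda>n. t n - c * real n) \<in> O(\<lambda>n. sqrt (real n))"
        using toll by (intro bigoI[of _ C] eventually_sequentiallyI[of n0]) auto
      then have "(\<lambda>n. (t n - c * real n) / ((real n + 2) * (real n + 1))) \<in> O(\<lambda>n. sqrt (real n) / ((real n + 2) * (real n + 1)))"
        by (rule landau_o.big.divide_right[rotated]) (intro eventually_sequentiallyI[of 0], simp)
      also have "(\<lambda>n. sqrt (real n) / ((real n + 2) * (real n + 1))) \<in> O(\<lambda>n. real n powr (- 3 / 2))"
        by real_asymp
      finally show "(\<lambda>n. (t n - c * real n) / ((real n + 2) * (real n + 1))) \<in> O(\<lambda>n. real n powr (- 3 / 2))" .
    qed
    moreover have "Z (Suc n) - Z n = c * (real n / ((real n + 1) * (real n + 2)) - (ln (real n + 1) - ln (real n))) +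
        (t n - c * real n) / ((real n + 2) * (real n + 1))" if n: "n0 \<le> n" for n
    proof -
      have "Q (Suc n) - Q n = t n / ((real n + 2) * (real n + 1))"
        using Q_Suc[of n] n n0 unfolding e[OF n] by simp
      then show ?thesis
        unfolding Z_def by (simp add: diff_divide_distrib right_diff_distrib mult.commute add.commute)
    qed
    ultimately show "(\<lambda>n. Z (Suc n) - Z n) \<in> O(\<lambda>n. real n powr (- 3 / 2))"
      by (subst landau_o.big.in_cong) (auto intro: eventually_sequentiallyI[of n0])
  qed
  then obtain l where l: "Z \<longlonglongrightarrow> l" by (rule summable_diff_imp_convergent)
  \<comment> \<open>\<open>S\<close> satisfies \<open>(n - 1) S (n + 1) = (n - 3) S n + P n\<close>,
    and \<open>(n - 2) (n - 3)\<close> is the summation factor of this recursion.\<close>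
  define X where "X n = (real n - 2) * (real n - 3) * S n" for n
  have X_Suc: "X (Suc n) = X n + (real n - 2) * P n" if "1 \<le> n" for n
    unfolding X_def P_def S_Suc[OF that] by (simp add: algebra_simps)
  \<comment> \<open>\<open>(n - 2) P n\<close> grows like \<open>c n^4 ln n\<close>; the leading
    term of its sum is subtracted, so that a limit remains for the quotient by
    \<open>n^5\<close>.\<close>
  define Y where "Y n = X n - c / 5 * (real n ^ 5 * ln (real n))" for n
  have Y: "(\<lambda>n. Y n / real n ^ 5) \<longlonglongrightarrow> (l - c / 5) / 5"
  proof (rule stolz_cesaro)
    show "strict_mono (\<lambda>n. real n ^ 5)" by (auto simp: strict_mono_def power_strict_mono)
    show "filterlim (\<lambda>n. real n ^ 5) at_top sequentially" by real_asymp
    define D where "D n = real (Suc n) ^ 5 - real n ^ 5" for n :: nat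
    have "(\<lambda>n. (real n - 2) * (real n + 1) * real n * (real n - 1) / D n * Z n +
        c * (((real n - 2) * (real n + 1) * real n * (real n - 1) * ln (real n) -
           (real (Suc n) ^ 5 * ln (real (Suc n)) - real n ^ 5 * ln (real n)) / 5) / D n))
        \<longlonglongrightarrow> 1 / 5 * l + c * (- 1 / 25)"
    proof (intro tendsto_add tendsto_mult l tendsto_const)
      show "(\<lambda>n. (real n - 2) * (real n + 1) * real n * (real n - 1) / D n) \<longlonglongrightarrow> 1 / 5"
        unfolding D_def by real_asymp
      \<comment> \<open>The derivative of \<open>n^5 ln n / 5\<close> is
        \<open>n^4 ln n + n^4 / 5\<close>; the second summand, divided by \<open>5 n^4\<close>, is
        the \<open>1 / 25\<close>.\<close>
      show "(\<lambda>n. ((real n - 2) * (real n + 1) * real n * (real n - 1) * ln (real n) -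
           (real (Suc n) ^ 5 * ln (real (Suc n)) - real n ^ 5 * ln (real n)) / 5) / D n) \<longlonglongrightarrow> - 1 / 25"
        unfolding D_def by real_asymp
    qed
    moreover have "\<forall>\<^sub>F n in sequentially. (real n - 2) * (real n + 1) * real n * (real n - 1) / D n * Z n +
        c * (((real n - 2) * (real n + 1) * real n * (real n - 1) * ln (real n) -
           (real (Suc n) ^ 5 * ln (real (Suc n)) - real n ^ 5 * ln (real n)) / 5) / D n) = (Y (Suc n) - Y n) / D n"
      using eventually_ge_at_top[of 2]
    proof eventually_elim
      case (elim n)
      have "(real n + 1) * real n * (real n - 1) \<noteq> 0" using elim by auto
      then have P: "P n = (real n + 1) * real n * (real n - 1) * (Z n + c * ln (real n))"
        by (simp add: Z_def Q_def)
      have "Y (Suc n) - Y n = (real n - 2) * P n - c / 5 * (real (Suc n) ^ 5 * ln (real (Suc n)) - real n ^ 5 * ln (real n))"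
        unfolding Y_def using X_Suc[of n] elim by (simp add: right_diff_distrib)
      then show ?case unfolding P
        by (simp only: add_divide_distrib[symmetric] times_divide_eq_left times_divide_eq_right)
           (simp add: algebra_simps)
    qed
    ultimately have "(\<lambda>n. (Y (Suc n) - Y n) / D n) \<longlonglongrightarrow> 1 / 5 * l + c * (- 1 / 25)"
      by (rule Lim_transform_eventually)
    then show "(\<lambda>n. (Y (Suc n) - Y n) / (real (Suc n) ^ 5 - real n ^ 5)) \<longlonglongrightarrow> (l - c / 5) / 5"
      by (simp add: D_def field_simps)
  qed
  have t: "(\<lambda>n. (t n - c * real n) / real n) \<longlonglongrightarrow> 0"
  proof (rule Lim_null_comparison)
    show "\<forall>\<^sub>F n in sequentially. norm ((t n - c * real n) / real n) \<le> C * (sqrt (real n) / real n)"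
      using eventually_ge_at_top[of n0]
      by eventually_elim (use toll in \<open>auto simp: divide_right_mono\<close>)
    have "(\<lambda>n. sqrt (real n) / real n) \<longlonglongrightarrow> 0" by real_asymp
    then show "(\<lambda>n. C * (sqrt (real n) / real n)) \<longlonglongrightarrow> 0" by (rule tendsto_mult_right_zero)
  qed
  \<comment> \<open>The quotient differs from 1 by \<open>O(1 / n)\<close>, little enough to vanish
    even after multiplication by \<open>ln n\<close>.\<close>
  have K: "(\<lambda>n. real n ^ 5 / (real n ^ 2 * (real n - 1) * (real n - 2) * (real n - 3))) \<longlonglongrightarrow> 1"
    "(\<lambda>n. ln (real n) * (real n ^ 5 / (real n ^ 2 * (real n - 1) * (real n - 2) * (real n - 3)) - 1)) \<longlonglongrightarrow> 0"
    by real_asymp+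
  have "(\<lambda>n. c + (t n - c * real n) / real n +
      6 * (Y n / real n ^ 5) * (real n ^ 5 / (real n ^ 2 * (real n - 1) * (real n - 2) * (real n - 3))) +
      6 / 5 * c * (ln (real n) * (real n ^ 5 / (real n ^ 2 * (real n - 1) * (real n - 2) * (real n - 3)) - 1)))
      \<longlonglongrightarrow> c + 0 + 6 * ((l - c / 5) / 5) * 1 + 6 / 5 * c * 0"
    by (rule tendsto_add[OF tendsto_add[OF tendsto_add[OF tendsto_const t]
          tendsto_mult[OF tendsto_mult[OF tendsto_const Y] K(1)]] tendsto_mult[OF tendsto_const K(2)]])
  moreover have "\<forall>\<^sub>F n in sequentially. c + (t n - c * real n) / real n +
      6 * (Y n / real n ^ 5) * (real n ^ 5 / (real n ^ 2 * (real n - 1) * (real n - 2) * (real n - 3))) +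
      6 / 5 * c * (ln (real n) * (real n ^ 5 / (real n ^ 2 * (real n - 1) * (real n - 2) * (real n - 3)) - 1)) =
      m n / real n - 6 / 5 * c * ln (real n)"
    using eventually_ge_at_top[of "max n0 4"]
  proof eventually_elim
    case (elim n)
    define K where "K = real n ^ 5 / (real n ^ 2 * (real n - 1) * (real n - 2) * (real n - 3))"
    have nz: "real n \<noteq> 0" "real n - 1 \<noteq> 0" "real n - 2 \<noteq> 0" "real n - 3 \<noteq> 0" using elim by auto
    have "6 * (Y n / real n ^ 5) * K + 6 / 5 * c * (ln (real n) * (K - 1)) =
        6 * (X n / real n ^ 5) * K - 6 / 5 * c * ln (real n)"
      using nz by (simp add: Y_def diff_divide_distrib algebra_simps)
    moreover have "6 * (X n / real n ^ 5) * K = 6 * S n / (real n ^ 2 * (real n - 1))"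
      using nz by (simp add: X_def K_def)
    moreover have "m n / real n = t n / real n + 6 * S n / (real n ^ 2 * (real n - 1))"
    proof -
      have "m n = t n + 6 / (real n * (real n - 1)) * S n" using rec[of n] elim by (simp add: S_def)
      then show ?thesis using nz by (simp add: add_divide_distrib power2_eq_square mult.commute mult.left_commute)
    qed
    moreover have "(t n - c * real n) / real n = t n / real n - c" using nz by (simp add: field_simps)
    ultimately show ?case unfolding K_def[symmetric] by simp
  qed
  ultimately have "(\<lambda>n. m n / real n - 6 / 5 * c * ln (real n)) \<longlonglongrightarrow> c + 0 + 6 * ((l - c / 5) / 5) * 1 + 6 / 5 * c * 0"
    by (rule Lim_transform_eventually)
  then show thesis by (rule that)
qed


section \<open>Entropy integrals\<close>

definition xlnx :: "real \<Rightarrow> real" where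
  "xlnx x = x * ln x"

lemma xlnx_0_1 [simp]: "xlnx 0 = 0" "xlnx 1 = 0"
  by (simp_all add: xlnx_def)

lemma continuous_on_xlnx: "continuous_on {0..} xlnx"
  unfolding continuous_on_eq_continuous_within
proof
  fix x :: real assume "x \<in> {0..}"
  then consider "x = 0" | "0 < x" by fastforce
  then show "continuous (at x within {0..}) xlnx"
  proof cases
    case 1
    have "((\<lambda>x. x * ln x) \<longlongrightarrow> 0) (at_right (0 :: real))" by real_asymp
    then have "((\<lambda>x. x * ln x) \<longlongrightarrow> 0) (at (0 :: real) within {0..})"
      by (simp add: at_within_Ici_at_right)
    then show ?thesis using 1 by (simp add: continuous_within xlnx_def[abs_def])
  next
    case 2
    then have "isCont (\<lambda>x. x * ln x) x" by (intro continuous_intros) auto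
    then show ?thesis unfolding xlnx_def by (rule continuous_at_imp_continuous_at_within)
  qed
qed

lemma continuous_on_xlnx_comp [continuous_intros]:
  "continuous_on S f \<Longrightarrow> (\<And>x. x \<in> S \<Longrightarrow> 0 \<le> f x) \<Longrightarrow> continuous_on S (\<lambda>x. xlnx (f x))"
  by (rule continuous_on_compose2[OF continuous_on_xlnx]) auto

lemma borel_measurable_xlnx [measurable]: "xlnx \<in> borel_measurable borel"
  unfolding xlnx_def by measurable

definition entropy2 :: "real \<Rightarrow> real" where
  "entropy2 x = xlnx x + xlnx (1 - x)"

lemma borel_measurable_entropy2 [measurable]: "entropy2 \<in> borel_measurable borel"
  unfolding entropy2_def by measurable

lemma continuous_on_entropy2: "continuous_on {0..1} entropy2"
  unfolding entropy2_def by (intro continuous_intros) auto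

lemma has_integral_pow: "((\<lambda>x::real. x ^ k) has_integral 1 / (real k + 1)) {0..1}"
proof -
  have "((\<lambda>x::real. x ^ k) has_integral (1 ^ Suc k / (real k + 1) - 0 ^ Suc k / (real k + 1))) {0..1}"
    by (rule fundamental_theorem_of_calculus)
       (auto intro!: derivative_eq_intros simp: has_real_derivative_iff_has_vector_derivative[symmetric]
          add.commute[of 1] simp del: power_Suc)
  then show ?thesis by simp
qed

lemma has_integral_pow_xlnx: "((\<lambda>x. x ^ k * xlnx x) has_integral - (1 / (real k + 2)\<^sup>2)) {0..1}"
proof -
  define F where "F x = x ^ Suc k * xlnx x / (real k + 2) - x ^ Suc (Suc k) / (real k + 2)\<^sup>2" for x
  have "((\<lambda>x. x ^ k * xlnx x) has_integral (F 1 - F 0)) {0..1}"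
  proof (rule fundamental_theorem_of_calculus_interior)
    show "continuous_on {0..1} F" unfolding F_def by (intro continuous_intros) auto
    fix x :: real assume x: "x \<in> {0<..<1}"
    have "((\<lambda>x. x ^ (k + 2) * ln x / (real k + 2) - x ^ (k + 2) / (real k + 2)\<^sup>2) has_real_derivative
      ((real k + 2) * x ^ (k + 1) * ln x + x ^ (k + 2) * (1 / x)) / (real k + 2) - (real k + 2) * x ^ (k + 1) / (real k + 2)\<^sup>2) (at x)"
    proof -
      have "((\<lambda>x. x ^ (k + 2)) has_real_derivative (real k + 2) * x ^ (k + 1)) (at x)"
        using DERIV_pow[of "k + 2" x] by (simp add: add.commute)
      note d1 = this
      have d2: "(ln has_real_derivative 1 / x) (at x)" using x by (intro DERIV_ln_divide) auto
      show ?thesis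
        by (rule DERIV_cong[OF DERIV_diff[OF DERIV_cdivide[OF DERIV_mult[OF d1 d2]] DERIV_cdivide[OF d1]]])
           (simp add: mult.commute)
    qed
    also have "((real k + 2) * x ^ (k + 1) * ln x + x ^ (k + 2) * (1 / x)) / (real k + 2) - (real k + 2) * x ^ (k + 1) / (real k + 2)\<^sup>2 = x ^ k * xlnx x"
    proof -
      have "x ^ (k + 2) * (1 / x) = x ^ (k + 1)" using x by (simp add: power_add power2_eq_square)
      moreover have "real k + 2 \<noteq> 0" by simp
      ultimately show ?thesis by (simp add: xlnx_def power2_eq_square add_divide_distrib mult_ac)
    qed
    finally have "((\<lambda>x. x ^ (k + 2) * ln x / (real k + 2) - x ^ (k + 2) / (real k + 2)\<^sup>2) has_real_derivative x ^ k * xlnx x) (at x)" .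
    then show "(F has_vector_derivative x ^ k * xlnx x) (at x)"
      unfolding has_real_derivative_iff_has_vector_derivative[symmetric] F_def xlnx_def
      by (simp add: mult.assoc mult.left_commute)
  qed simp
  then show ?thesis by (simp add: F_def)
qed

lemma has_integral_xlnx_squared: "((\<lambda>x. (xlnx x)\<^sup>2) has_integral 2 / 27) {0..1}"
proof -
  define F where "F x = x * (xlnx x)\<^sup>2 / 3 - 2 * x\<^sup>2 * xlnx x / 9 + 2 * x ^ 3 / 27" for x
  have "((\<lambda>x. (xlnx x)\<^sup>2) has_integral (F 1 - F 0)) {0..1}"
  proof (rule fundamental_theorem_of_calculus_interior)
    show "continuous_on {0..1} F" unfolding F_def by (intro continuous_intros) auto
    fix x :: real assume x: "x \<in> {0<..<1}"
    have "(F has_real_derivative (xlnx x)\<^sup>2) (at x)"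
      unfolding F_def xlnx_def using x
      by (auto intro!: derivative_eq_intros simp: power2_eq_square power3_eq_cube field_simps)
    then show "(F has_vector_derivative (xlnx x)\<^sup>2) (at x)"
      by (simp add: has_real_derivative_iff_has_vector_derivative)
  qed simp
  then show ?thesis by (simp add: F_def)
qed

lemma has_integral_reflect_unit:
  fixes f :: "real \<Rightarrow> real"
  assumes "(f has_integral I) {0..1}"
  shows "((\<lambda>x. f (1 - x)) has_integral I) {0..1}"
proof -
  have "((\<lambda>x. f (- 1 *\<^sub>R x + 1)) has_integral I /\<^sub>R \<bar>- 1\<bar> ^ DIM(real)) ((\<lambda>x. (x - 1) /\<^sub>R - 1) ` cbox 0 1)"
    using has_integral_affinity[of f I 0 1 "- 1" 1] assms by (simp add: image_comp o_def)
  moreover have "(\<lambda>x::real. (x - 1) /\<^sub>R - 1) ` cbox 0 1 = {0..1}"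
    by (auto simp: image_iff intro!: bexI[of _ "1 - _"])
  ultimately show ?thesis by simp
qed

text \<open>Partial fractions split each term into telescoping differences of reciprocals and terms
  of the series of inverse squares with its first two or three members removed.\<close>

lemma sums_pi_squared_37:
  "(\<lambda>k. 1 / (real k + 1) * (1 / (real k + 3)\<^sup>2 - 1 / (real k + 4)\<^sup>2)) sums (37 / 108 - pi\<^sup>2 / 36)"
proof -
  have sq: "(\<lambda>k. 1 / (real k + 1)\<^sup>2) sums (pi\<^sup>2 / 6)" using inverse_squares_sums by (simp add: add.commute)
  from sums_split_initial_segment[OF sq, of 2] sums_split_initial_segment[OF sq, of 3]
  have s: "(\<lambda>k. 1 / (real k + 3)\<^sup>2) sums (pi\<^sup>2 / 6 - 5 / 4)" "(\<lambda>k. 1 / (real k + 4)\<^sup>2) sums (pi\<^sup>2 / 6 - 49 / 36)"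
    by (simp_all add: eval_nat_numeral add.commute)
  define a where "a k = 1 / (real k + 1) + 1 / (real k + 2)" for k
  define b where "b k = 1 / (real k + 1) + 1 / (real k + 2) + 1 / (real k + 3)" for k
  have "a \<longlonglongrightarrow> 0" "b \<longlonglongrightarrow> 0" unfolding a_def b_def by real_asymp+
  then have t: "(\<lambda>k. a k - a (Suc k)) sums (3 / 2)" "(\<lambda>k. b k - b (Suc k)) sums (11 / 6)"
    using telescope_sums'[of a 0] telescope_sums'[of b 0] by (simp_all add: a_def b_def)
  have "(\<lambda>k. 1 / 4 * (a k - a (Suc k)) - 1 / 2 * (1 / (real k + 3)\<^sup>2) - (1 / 9 * (b k - b (Suc k)) - 1 / 3 * (1 / (real k + 4)\<^sup>2)))
    sums (1 / 4 * (3 / 2) - 1 / 2 * (pi\<^sup>2 / 6 - 5 / 4) - (1 / 9 * (11 / 6) - 1 / 3 * (pi\<^sup>2 / 6 - 49 / 36)))"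
    by (intro sums_diff sums_mult s t)
  moreover have "1 / 4 * (a k - a (Suc k)) - 1 / 2 * (1 / (real k + 3)\<^sup>2) - (1 / 9 * (b k - b (Suc k)) - 1 / 3 * (1 / (real k + 4)\<^sup>2)) =
      1 / (real k + 1) * (1 / (real k + 3)\<^sup>2 - 1 / (real k + 4)\<^sup>2)" for k
  proof -
    have "1 / 4 * (1 / x - 1 / (x + 2)) - 1 / 2 * (1 / (x + 2)\<^sup>2) = 1 / x * (1 / (x + 2)\<^sup>2)"
      "1 / 9 * (1 / x - 1 / (x + 3)) - 1 / 3 * (1 / (x + 3)\<^sup>2) = 1 / x * (1 / (x + 3)\<^sup>2)" if "0 < x" for x :: real
      using that by (simp_all add: divide_simps) (simp_all add: algebra_simps power2_eq_square)
    from this[of "real k + 1"] show ?thesis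
      by (simp add: a_def b_def right_diff_distrib add.commute)
  qed
  moreover have "1 / 4 * (3 / 2) - 1 / 2 * (pi\<^sup>2 / 6 - 5 / 4) - (1 / 9 * (11 / 6) - 1 / 3 * (pi\<^sup>2 / 6 - 49 / 36)) =
      37 / 108 - pi\<^sup>2 / 36" by (simp add: field_simps)
  ultimately show ?thesis by (simp only:)
qed

text \<open>Expanding \<open>- ln (1 - x)\<close> in powers of \<open>x\<close> gives nonnegative
  terms on the unit interval, so monotone convergence permits termwise integration; the resulting
  series is the one summed just before.\<close>

lemma has_integral_xlnx_product: "((\<lambda>x. xlnx x * xlnx (1 - x)) has_integral 37 / 108 - pi\<^sup>2 / 36) {0..1}"
proof (rule has_integral_monotone_convergence_increasing)
  define g where "g k x = - xlnx x * (1 - x) * (x ^ Suc k / real (Suc k))" for k x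
  show "((\<lambda>x. \<Sum>k<n. g k x) has_integral (\<Sum>k<n. 1 / (real k + 1) * (1 / (real k + 3)\<^sup>2 - 1 / (real k + 4)\<^sup>2))) {0..1}" for n
  proof (intro has_integral_sum)
    fix k
    have "((\<lambda>x. 1 / (real k + 1) * (x ^ (k + 2) * xlnx x - x ^ (k + 1) * xlnx x)) has_integral
      1 / (real k + 1) * (- (1 / (real (k + 2) + 2)\<^sup>2) - - (1 / (real (k + 1) + 2)\<^sup>2))) {0..1}"
      by (intro has_integral_mult_right has_integral_diff has_integral_pow_xlnx)
    moreover have "g k = (\<lambda>x. 1 / (real k + 1) * (x ^ (k + 2) * xlnx x - x ^ (k + 1) * xlnx x))"
      by (simp add: fun_eq_iff g_def algebra_simps diff_divide_distrib add_divide_distrib)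
    ultimately show "(g k has_integral 1 / (real k + 1) * (1 / (real k + 3)\<^sup>2 - 1 / (real k + 4)\<^sup>2)) {0..1}"
      by (simp add: add.commute)
  qed simp
  fix n and x :: real assume x: "x \<in> {0..1}"
  have "xlnx x \<le> 0" using x by (cases "x = 0") (auto simp: xlnx_def mult_nonneg_nonpos)
  then have "0 \<le> g n x" using x unfolding g_def by (intro mult_nonneg_nonneg) auto
  then show "(\<Sum>k<n. g k x) \<le> (\<Sum>k<Suc n. g k x)" by simp
  show "(\<lambda>n. \<Sum>k<n. g k x) \<longlonglongrightarrow> xlnx x * xlnx (1 - x)"
  proof (cases "x = 1")
    case True
    then show ?thesis by (simp add: g_def)
  next
    case False
    then have "\<bar>- x\<bar> < 1" using x by auto
    from ln_series'[OF this] have "(\<lambda>n. - (x ^ n) / real n) sums ln (1 - x)" by simp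
    then have "(\<lambda>n. - (x ^ Suc n) / real (Suc n)) sums ln (1 - x)"
      by (subst sums_Suc_iff) (simp add: sums_iff_shift')
    then have "(\<lambda>n. xlnx x * (1 - x) * (- (x ^ Suc n) / real (Suc n))) sums (xlnx x * (1 - x) * ln (1 - x))"
      by (rule sums_mult)
    moreover have "xlnx x * (1 - x) * (- (x ^ Suc n) / real (Suc n)) = g n x" for n by (simp add: g_def)
    ultimately show ?thesis by (simp add: sums_def xlnx_def[of "1 - x"] mult.assoc)
  qed
next
  show "(\<lambda>n. \<Sum>k<n. 1 / (real k + 1) * (1 / (real k + 3)\<^sup>2 - 1 / (real k + 4)\<^sup>2)) \<longlonglongrightarrow> 37 / 108 - pi\<^sup>2 / 36"
    using sums_pi_squared_37 by (simp add: sums_def)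
qed

definition entropy_square_integral :: real where
  "entropy_square_integral = 4 / 27 + 2 * (37 / 108 - pi\<^sup>2 / 36)"

lemma has_integral_entropy2_squared: "((\<lambda>x. (entropy2 x)\<^sup>2) has_integral entropy_square_integral) {0..1}"
proof -
  have "((\<lambda>x. (xlnx x)\<^sup>2 + (xlnx (1 - x))\<^sup>2 + 2 * (xlnx x * xlnx (1 - x))) has_integral
      2 / 27 + 2 / 27 + 2 * (37 / 108 - pi\<^sup>2 / 36)) {0..1}"
    by (intro has_integral_add has_integral_mult_right has_integral_xlnx_squared has_integral_xlnx_product
        has_integral_reflect_unit[OF has_integral_xlnx_squared])
  then show ?thesis
    by (simp add: entropy2_def entropy_square_integral_def power2_sum mult.assoc)
qed

text \<open>\<open>entropy2\<close> is symmetric under reflection, so the factors \<open>x\<close>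
  and \<open>1 - x\<close> give equal integrals, and together they give the integral without a
  factor.\<close>

lemma has_integral_mult_entropy2_squared:
  "((\<lambda>x. x * (entropy2 x)\<^sup>2) has_integral entropy_square_integral / 2) {0..1}"
proof -
  have "(\<lambda>x. x * (entropy2 x)\<^sup>2) integrable_on {0..1}"
    by (intro integrable_continuous_interval continuous_intros continuous_on_entropy2)
  then obtain I where I: "((\<lambda>x. x * (entropy2 x)\<^sup>2) has_integral I) {0..1}" by (auto simp: integrable_on_def)
  have "entropy2 (1 - x) = entropy2 x" for x by (simp add: entropy2_def)
  then have "((\<lambda>x. x * (entropy2 x)\<^sup>2 + (1 - x) * (entropy2 x)\<^sup>2) has_integral I + I) {0..1}"
    using has_integral_add[OF I has_integral_reflect_unit[OF I]] by simp
  moreover have "x * (entropy2 x)\<^sup>2 + (1 - x) * (entropy2 x)\<^sup>2 = (entropy2 x)\<^sup>2" for x by (simp add: algebra_simps)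
  ultimately have "entropy_square_integral = I + I"
    using has_integral_unique[OF has_integral_entropy2_squared] by simp
  then have "I = entropy_square_integral / 2" by simp
  then show ?thesis using I by (simp only:)
qed

lemma has_integral_pow_entropy2:
  "(entropy2 has_integral - 1 / 2) {0..1}"
  "((\<lambda>x. x * entropy2 x) has_integral - 1 / 4) {0..1}"
  "((\<lambda>x. x\<^sup>2 * entropy2 x) has_integral - 1 / 4 + 2 / 9 - 2 / 16) {0..1}"
  "((\<lambda>x. x ^ 3 * entropy2 x) has_integral - 1 / 4 + 3 / 9 - 3 / 16) {0..1}"
proof -
  have p: "(xlnx has_integral - (1 / 4)) {0..1}" "((\<lambda>x. x * xlnx x) has_integral - (1 / 9)) {0..1}"
    "((\<lambda>x. x\<^sup>2 * xlnx x) has_integral - (1 / 16)) {0..1}" "((\<lambda>x. x ^ 3 * xlnx x) has_integral - (1 / 25)) {0..1}"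
    using has_integral_pow_xlnx[of 0] has_integral_pow_xlnx[of 1] has_integral_pow_xlnx[of 2] has_integral_pow_xlnx[of 3]
    by (simp_all add: power2_eq_square)
  \<comment> \<open>The half of the entropy that involves \<open>1 - x\<close> is reflected onto the
    polynomial \<open>f (1 - x)\<close>, so that only moments of \<open>xlnx\<close> are
    needed.\<close>
  have E: "((\<lambda>x. f x * entropy2 x) has_integral a + b) {0..1}"
    if "((\<lambda>x. f x * xlnx x) has_integral a) {0..1}" "((\<lambda>x. f (1 - x) * xlnx x) has_integral b) {0..1}" for f a b
    using has_integral_add[OF that(1) has_integral_reflect_unit[OF that(2)]]
    by (simp add: entropy2_def distrib_left)
  show "(entropy2 has_integral - 1 / 2) {0..1}" using E[of "\<lambda>_. 1" "- (1 / 4)" "- (1 / 4)"] p(1) by simp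
  have "((\<lambda>x. xlnx x - x * xlnx x) has_integral - (1 / 4) - - (1 / 9)) {0..1}"
    by (intro has_integral_diff p)
  then show "((\<lambda>x. x * entropy2 x) has_integral - 1 / 4) {0..1}"
    using E[of "\<lambda>x. x" "- (1 / 9)" "- (5 / 36)"] p(2) by (simp add: left_diff_distrib)
  have "((\<lambda>x. xlnx x - 2 * (x * xlnx x) + x\<^sup>2 * xlnx x) has_integral - (1 / 4) - 2 * - (1 / 9) + - (1 / 16)) {0..1}"
    by (intro has_integral_diff has_integral_add has_integral_mult_right p)
  moreover have "xlnx x - 2 * (x * xlnx x) + x\<^sup>2 * xlnx x = (1 - x)\<^sup>2 * xlnx x" for x
    by (simp add: power2_eq_square algebra_simps)
  ultimately show "((\<lambda>x. x\<^sup>2 * entropy2 x) has_integral - 1 / 4 + 2 / 9 - 2 / 16) {0..1}"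
    using E[of "\<lambda>x. x\<^sup>2" "- (1 / 16)" "- (13 / 144)"] p(3) by simp
  have "((\<lambda>x. xlnx x - 3 * (x * xlnx x) + 3 * (x\<^sup>2 * xlnx x) - x ^ 3 * xlnx x) has_integral
      - (1 / 4) - 3 * - (1 / 9) + 3 * - (1 / 16) - - (1 / 25)) {0..1}"
    by (intro has_integral_diff has_integral_add has_integral_mult_right p)
  moreover have "xlnx x - 3 * (x * xlnx x) + 3 * (x\<^sup>2 * xlnx x) - x ^ 3 * xlnx x = (1 - x) ^ 3 * xlnx x" for x
    by (simp add: power2_eq_square power3_eq_cube algebra_simps)
  ultimately show "((\<lambda>x. x ^ 3 * entropy2 x) has_integral - 1 / 4 + 3 / 9 - 3 / 16) {0..1}"
    using E[of "\<lambda>x. x ^ 3" "- (1 / 25)" "- (77 / 1200)"] p(4) by simp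
qed


section \<open>Spacings of two uniform variables\<close>

abbreviation unit_uniform :: "real measure" where
  "unit_uniform \<equiv> uniform_measure lborel {0..1}"

interpretation U: prob_space unit_uniform
  by (rule prob_space_uniform_measure) auto

interpretation UU: pair_prob_space unit_uniform unit_uniform ..

lemma AE_unit_uniform: "AE u in unit_uniform. 0 \<le> u \<and> u \<le> 1"
  by (rule AE_uniform_measureI) auto

lemma integral_unit_uniform:
  fixes f :: "real \<Rightarrow> 'a::{banach, second_countable_topology}"
  assumes [measurable]: "f \<in> borel_measurable borel"
  shows "(\<integral>u. f u \<partial>unit_uniform) = (\<integral>u. indicator {0..1} u *\<^sub>R f u \<partial>lborel)"
proof -
  have "unit_uniform = density lborel (\<lambda>u. ennreal (indicator {0..1} u))"
    unfolding uniform_measure_def by (intro density_cong) (auto split: split_indicator)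
  then show ?thesis by (simp add: integral_density)
qed

lemma integral_unit_uniform_has_integral:
  fixes f :: "real \<Rightarrow> real"
  assumes "f \<in> borel_measurable borel" "continuous_on {0..1} f" "(f has_integral I) {0..1}"
  shows "(\<integral>u. f u \<partial>unit_uniform) = I"
  using set_borel_integral_eq_integral(2)[OF borel_integrable_atLeastAtMost'[OF assms(2)]] assms(3)
  by (simp add: integral_unit_uniform[OF assms(1)] set_lebesgue_integral_def integral_unique)

text \<open>Substitution \<open>u = v * w\<close>: given that it falls below \<open>v\<close>, a
  uniform variable is \<open>v\<close> times a uniform one. The two versions differ by the null
  event \<open>u = v\<close>.\<close>

lemma integral_unit_uniform_below:
  fixes G :: "real \<Rightarrow> real"
  assumes [measurable]: "G \<in> borel_measurable borel" and v: "0 \<le> v" "v \<le> 1"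
  shows "(\<integral>u. (if u \<le> v then G u else 0) \<partial>unit_uniform) = v * (\<integral>w. G (v * w) \<partial>unit_uniform)"
    "(\<integral>u. (if u < v then G u else 0) \<partial>unit_uniform) = v * (\<integral>w. G (v * w) \<partial>unit_uniform)"
proof -
  have "(\<integral>u. (if u \<le> v then G u else 0) \<partial>unit_uniform) = (\<integral>u. indicator {0..v} u *\<^sub>R G u \<partial>lborel)"
    using v by (subst integral_unit_uniform) (auto intro!: Bochner_Integration.integral_cong split: split_indicator)
  also have "\<dots> = v * (\<integral>w. G (v * w) \<partial>unit_uniform)"
  proof (cases "v = 0")
    case True
    have "AE u in lborel. indicator {0..v} u *\<^sub>R G u = 0"
      using AE_lborel_singleton[of 0] by eventually_elim (use True in \<open>auto split: split_indicator\<close>)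
    then have "(\<integral>u. indicator {0..v} u *\<^sub>R G u \<partial>lborel) = 0"
      by (rule integral_eq_zero_AE)
    then show ?thesis using True by simp
  next
    case False
    then have "0 < v" using v by simp
    then have "(\<integral>u. indicator {0..v} u *\<^sub>R G u \<partial>lborel) = v * (\<integral>w. indicator {0..1} w *\<^sub>R G (v * w) \<partial>lborel)"
      by (subst lborel_integral_real_affine[of v _ 0])
         (auto intro!: Bochner_Integration.integral_cong simp: zero_le_mult_iff mult_le_cancel_left1 split: split_indicator)
    then show ?thesis by (simp add: integral_unit_uniform)
  qed
  finally show 1: "(\<integral>u. (if u \<le> v then G u else 0) \<partial>unit_uniform) = v * (\<integral>w. G (v * w) \<partial>unit_uniform)" .
  have "AE u in unit_uniform. u \<noteq> v"
    by (rule AE_uniform_measureI) (use AE_lborel_singleton[of v] in auto)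
  then have "(\<integral>u. (if u < v then G u else 0) \<partial>unit_uniform) = (\<integral>u. (if u \<le> v then G u else 0) \<partial>unit_uniform)"
    by (intro integral_cong_AE) auto
  with 1 show "(\<integral>u. (if u < v then G u else 0) \<partial>unit_uniform) = v * (\<integral>w. G (v * w) \<partial>unit_uniform)" by simp
qed

definition spacings :: "real \<times> real \<Rightarrow> real \<times> real \<times> real" where
  "spacings = (\<lambda>(u, v). (min u v, max u v - min u v, 1 - max u v))"

lemma spacings_measurable [measurable]: "spacings \<in> borel_measurable (unit_uniform \<Otimes>\<^sub>M unit_uniform)"
  unfolding spacings_def by measurable

lemma spacings_law_alt: "spacings_law = distr (unit_uniform \<Otimes>\<^sub>M unit_uniform) borel spacings"
  by (simp add: spacings_law_def spacings_def)

lemma prob_space_spacings_law: "prob_space spacings_law"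
  unfolding spacings_law_alt by (rule UU.prob_space_distr) measurable

lemma sets_spacings_law [measurable_cong]: "sets spacings_law = sets borel"
  by (simp add: spacings_law_alt)

lemma AE_unit_square: "AE x in unit_uniform \<Otimes>\<^sub>M unit_uniform. 0 \<le> fst x \<and> fst x \<le> 1 \<and> 0 \<le> snd x \<and> snd x \<le> 1"
proof (rule UU.AE_pair_measure)
  show "AE x in unit_uniform. AE y in unit_uniform. 0 \<le> fst (x, y) \<and> fst (x, y) \<le> 1 \<and> 0 \<le> snd (x, y) \<and> snd (x, y) \<le> 1"
    using AE_unit_uniform by eventually_elim (use AE_unit_uniform in eventually_elim, auto)
qed measurable

abbreviation in_simplex :: "real \<times> real \<times> real \<Rightarrow> bool" where
  "in_simplex \<equiv> \<lambda>(d1, d2, d3). 0 \<le> d1 \<and> 0 \<le> d2 \<and> 0 \<le> d3 \<and> d1 + d2 + d3 = 1"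

lemma AE_spacings_law: "AE d in spacings_law. in_simplex d"
  unfolding spacings_law_alt
proof (subst AE_distr_iff)
  show "AE x in unit_uniform \<Otimes>\<^sub>M unit_uniform. in_simplex (spacings x)"
    using AE_unit_square by eventually_elim (auto simp: spacings_def)
  show "{d \<in> space borel. in_simplex d} \<in> sets borel"
    unfolding borel_prod[symmetric] by measurable
qed measurable

text \<open>The larger of two uniform variables has density \<open>2 v\<close>, and given its value
  the smaller one is uniform below it; hence the coordinates \<open>v w\<close>,
  \<open>v (1 - w)\<close> and \<open>1 - v\<close>.\<close>

lemma integral_spacings_law:
  fixes F :: "real \<times> real \<times> real \<Rightarrow> real"
  assumes F [measurable]: "F \<in> borel_measurable borel"
    and bound: "\<And>d. in_simplex d \<Longrightarrow> \<bar>F d\<bar> \<le> B"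
  shows "integrable spacings_law F"
    "(\<integral>d. F d \<partial>spacings_law) = (\<integral>v. (\<integral>w. F (v * w, v * (1 - w), 1 - v) \<partial>unit_uniform) * (2 * v) \<partial>unit_uniform)"
proof -
  interpret S: prob_space spacings_law by (rule prob_space_spacings_law)
  show "integrable spacings_law F"
    by (rule S.integrable_const_bound[of _ B]) (use AE_spacings_law bound in \<open>auto elim!: eventually_mono\<close>)
  have [measurable]: "(\<lambda>x. F (spacings x)) \<in> borel_measurable (unit_uniform \<Otimes>\<^sub>M unit_uniform)"
    by (rule measurable_compose[OF spacings_measurable F])
  \<comment> \<open>The square is split according to which variable is larger; ties go to
    \<open>A2\<close>, so the sum of both parts is exact.\<close>
  define A1 where "A1 = (\<lambda>(u, v). if u < v then F (u, v - u, 1 - v) else 0)"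
  define A2 where "A2 = (\<lambda>(u, v). if v \<le> u then F (v, u - v, 1 - u) else 0)"
  have [measurable]: "A1 \<in> borel_measurable (unit_uniform \<Otimes>\<^sub>M unit_uniform)"
    "A2 \<in> borel_measurable (unit_uniform \<Otimes>\<^sub>M unit_uniform)"
    unfolding A1_def A2_def by measurable
  have B0: "0 \<le> B" using bound[of "(1, 0, 0)"] by simp
  have "integrable (unit_uniform \<Otimes>\<^sub>M unit_uniform) A1"
    by (rule UU.integrable_const_bound[of _ B], rule eventually_mono[OF AE_unit_square])
       (use B0 in \<open>auto intro!: bound simp: A1_def\<close>)
  moreover have "integrable (unit_uniform \<Otimes>\<^sub>M unit_uniform) A2"
    by (rule UU.integrable_const_bound[of _ B], rule eventually_mono[OF AE_unit_square])
       (use B0 in \<open>auto intro!: bound simp: A2_def\<close>)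
  moreover have "F (spacings x) = A1 x + A2 x" for x
    by (auto simp: A1_def A2_def spacings_def min_def max_def split: prod.splits)
  ultimately have "(\<integral>d. F d \<partial>spacings_law) = (\<integral>x. A1 x \<partial>(unit_uniform \<Otimes>\<^sub>M unit_uniform)) + (\<integral>x. A2 x \<partial>(unit_uniform \<Otimes>\<^sub>M unit_uniform))"
    unfolding spacings_law_alt by (subst integral_distr) auto
  also have "(\<integral>x. A1 x \<partial>(unit_uniform \<Otimes>\<^sub>M unit_uniform)) = (\<integral>v. (\<integral>u. A1 (u, v) \<partial>unit_uniform) \<partial>unit_uniform)"
    by (rule UU.integral_snd[symmetric, where f = "\<lambda>u v. A1 (u, v)", simplified]) fact
  also have "\<dots> = (\<integral>v. v * (\<integral>w. F (v * w, v * (1 - w), 1 - v) \<partial>unit_uniform) \<partial>unit_uniform)"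
  proof (rule integral_cong_AE)
    show "AE v in unit_uniform. (\<integral>u. A1 (u, v) \<partial>unit_uniform) = v * (\<integral>w. F (v * w, v * (1 - w), 1 - v) \<partial>unit_uniform)"
      using AE_unit_uniform
    proof eventually_elim
      case (elim v)
      then show ?case
        using integral_unit_uniform_below(2)[of "\<lambda>u. F (u, v - u, 1 - v)" v] by (simp add: A1_def right_diff_distrib)
    qed
  qed measurable
  also have "(\<integral>x. A2 x \<partial>(unit_uniform \<Otimes>\<^sub>M unit_uniform)) = (\<integral>v. (\<integral>u. A2 (v, u) \<partial>unit_uniform) \<partial>unit_uniform)"
    by (rule UU.integral_fst'[symmetric]) fact
  also have "\<dots> = (\<integral>v. v * (\<integral>w. F (v * w, v * (1 - w), 1 - v) \<partial>unit_uniform) \<partial>unit_uniform)"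
  proof (rule integral_cong_AE)
    show "AE v in unit_uniform. (\<integral>u. A2 (v, u) \<partial>unit_uniform) = v * (\<integral>w. F (v * w, v * (1 - w), 1 - v) \<partial>unit_uniform)"
      using AE_unit_uniform
    proof eventually_elim
      case (elim v)
      then show ?case
        using integral_unit_uniform_below(1)[of "\<lambda>u. F (u, v - u, 1 - v)" v] by (simp add: A2_def right_diff_distrib)
    qed
  qed measurable
  finally show "(\<integral>d. F d \<partial>spacings_law) = (\<integral>v. (\<integral>w. F (v * w, v * (1 - w), 1 - v) \<partial>unit_uniform) * (2 * v) \<partial>unit_uniform)"
    by (simp add: mult_ac flip: Bochner_Integration.integral_mult_right_zero)
qed

section \<open>Moments of the limiting toll\<close>

definition limit_cost :: "real \<times> real \<times> real \<Rightarrow> real" where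
  "limit_cost = (\<lambda>(d1, d2, d3). limit_toll (d1, d2, d3) + 19 / 10 * (xlnx d1 + xlnx d2 + xlnx d3))"

lemma limit_toll_measurable [measurable]: "limit_toll \<in> borel_measurable borel"
  unfolding limit_toll_def borel_prod[symmetric] by measurable

lemma limit_cost_measurable [measurable]: "limit_cost \<in> borel_measurable borel"
  unfolding limit_cost_def borel_prod[symmetric] limit_toll_def by measurable

lemma xlnx_scale: "0 \<le> v \<Longrightarrow> 0 \<le> w \<Longrightarrow> xlnx (v * w) = w * xlnx v + v * xlnx w"
  by (cases "v = 0 \<or> w = 0") (auto simp: xlnx_def ln_mult algebra_simps)

text \<open>The chain rule of entropy: \<open>x ln x\<close> summed over the three spacings equals
  \<open>entropy2 v + v * entropy2 w\<close>. This separates the variables and reduces all moments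
  to one-dimensional integrals.\<close>

lemma limit_cost_scale:
  assumes "0 \<le> v" "v \<le> 1" "0 \<le> w" "w \<le> 1"
  shows "limit_cost (v * w, v * (1 - w), 1 - v) =
    (1 + 2 * v - 2 * v\<^sup>2 + 19 / 10 * entropy2 v) + v\<^sup>2 * (1 - w) + 19 / 10 * v * entropy2 w"
proof -
  have "xlnx (v * w) = w * xlnx v + v * xlnx w" "xlnx (v * (1 - w)) = (1 - w) * xlnx v + v * xlnx (1 - w)"
    using assms by (auto intro!: xlnx_scale)
  then show ?thesis
    unfolding limit_cost_def limit_toll_def entropy2_def by (simp add: field_simps power2_eq_square)
qed

text \<open>\<open>g v\<close> is the inner integral over \<open>w\<close>, and \<open>2 * v\<close>
  the density of the larger variable. Continuity on the unit interval identifies both Lebesgue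
  integrals with gauge integrals, for which closed forms are at hand.\<close>

lemma integral_spacings_law_eq:
  fixes F :: "real \<times> real \<times> real \<Rightarrow> real"
  assumes "F \<in> borel_measurable borel" "\<And>d. in_simplex d \<Longrightarrow> \<bar>F d\<bar> \<le> B"
    and f: "\<And>v. f v \<in> borel_measurable borel" "\<And>v. 0 \<le> v \<Longrightarrow> v \<le> 1 \<Longrightarrow> continuous_on {0..1} (f v)"
      "\<And>v. 0 \<le> v \<Longrightarrow> v \<le> 1 \<Longrightarrow> (f v has_integral g v) {0..1}"
      "\<And>v w. 0 \<le> v \<Longrightarrow> v \<le> 1 \<Longrightarrow> 0 \<le> w \<Longrightarrow> w \<le> 1 \<Longrightarrow> F (v * w, v * (1 - w), 1 - v) = f v w"
    and g: "g \<in> borel_measurable borel" "continuous_on {0..1} g"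
      "((\<lambda>v. g v * (2 * v)) has_integral I) {0..1}"
  shows "(\<integral>d. F d \<partial>spacings_law) = I"
proof -
  have [measurable]: "F \<in> borel_measurable borel" "g \<in> borel_measurable borel" by (fact assms)+
  have "(\<integral>d. F d \<partial>spacings_law) = (\<integral>v. (\<integral>w. F (v * w, v * (1 - w), 1 - v) \<partial>unit_uniform) * (2 * v) \<partial>unit_uniform)"
    by (rule integral_spacings_law(2)[OF assms(1,2)])
  also have "\<dots> = (\<integral>v. g v * (2 * v) \<partial>unit_uniform)"
  proof (rule integral_cong_AE)
    show "AE v in unit_uniform. (\<integral>w. F (v * w, v * (1 - w), 1 - v) \<partial>unit_uniform) * (2 * v) = g v * (2 * v)"
      using AE_unit_uniform
    proof eventually_elim
      case (elim v)
      have "(\<integral>w. F (v * w, v * (1 - w), 1 - v) \<partial>unit_uniform) = (\<integral>w. f v w \<partial>unit_uniform)"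
      proof (rule integral_cong_AE)
        show "AE w in unit_uniform. F (v * w, v * (1 - w), 1 - v) = f v w"
          using AE_unit_uniform by eventually_elim (use elim f(4) in auto)
      qed (use f(1) in measurable)
      also have "\<dots> = g v"
        using elim by (intro integral_unit_uniform_has_integral f) auto
      finally show ?case by simp
    qed
  qed measurable
  also have "\<dots> = I"
    by (rule integral_unit_uniform_has_integral) (use g in \<open>auto intro!: continuous_intros\<close>)
  finally show ?thesis .
qed

lemma continuous_limit_cost: "continuous_on ({0..1} \<times> {0..1} \<times> {0..1}) limit_cost"
  unfolding limit_cost_def limit_toll_def case_prod_beta by (intro continuous_intros) auto

lemma limit_cost_bounded:
  obtains B where "0 \<le> B" "\<And>d. d \<in> {0..1} \<times> {0..1} \<times> {0..1} \<Longrightarrow> \<bar>limit_cost d\<bar> \<le> B"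
proof -
  have "bounded (limit_cost ` ({0..1} \<times> {0..1} \<times> {0..1}))"
    by (intro compact_imp_bounded compact_continuous_image continuous_limit_cost compact_Times compact_Icc)
  then obtain B where "\<forall>x\<in>limit_cost ` ({0..1} \<times> {0..1} \<times> {0..1}). norm x \<le> B"
    unfolding bounded_iff by blast
  then have B: "\<bar>limit_cost d\<bar> \<le> B" if "d \<in> {0..1} \<times> {0..1} \<times> {0..1}" for d
    using imageI[OF that, of limit_cost] by (metis real_norm_def)
  have "\<bar>limit_cost (0, 0, 0)\<bar> \<le> B" by (rule B) auto
  then have "0 \<le> B" by linarith
  then show thesis by (rule that) (rule B)
qed

lemma in_simplex_imp_cube: "in_simplex d \<Longrightarrow> d \<in> {0..1} \<times> {0..1} \<times> {0..1}"
  by (cases d) auto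

lemma has_integral_unit_intros:
  "((\<lambda>x::real. c) has_integral c) {0..1}" "((\<lambda>x::real. x) has_integral 1 / 2) {0..1}"
  "((\<lambda>x::real. x ^ 2) has_integral 1 / 3) {0..1}" "((\<lambda>x::real. x ^ 3) has_integral 1 / 4) {0..1}"
  "((\<lambda>x::real. x ^ 4) has_integral 1 / 5) {0..1}" "((\<lambda>x::real. x ^ 5) has_integral 1 / 6) {0..1}"
  using has_integral_const_real[of c 0 1] has_integral_pow[of 1] has_integral_pow[of 2] has_integral_pow[of 3]
    has_integral_pow[of 4] has_integral_pow[of 5]
  by simp_all

lemma has_integral_entropy2_reflected: "((\<lambda>x. (1 - x) * entropy2 x) has_integral - 1 / 4) {0..1}"
  using has_integral_diff[OF has_integral_pow_entropy2(1,2)] by (simp add: left_diff_distrib)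

lemma limit_toll_mean: "(\<integral>d. limit_toll d \<partial>spacings_law) = 19 / 12"
proof (rule integral_spacings_law_eq)
  show "\<bar>limit_toll d\<bar> \<le> 4" if "in_simplex d" for d
  proof -
    obtain d1 d2 d3 where d: "d = (d1, d2, d3)" by (metis prod_cases3)
    have "(d1 + d2) * (d2 + 2 * d3) \<le> 1 * 3" using that d by (intro mult_mono) auto
    moreover have "0 \<le> (d1 + d2) * (d2 + 2 * d3)" using that d by auto
    ultimately show ?thesis by (simp add: d limit_toll_def)
  qed
  fix v w :: real
  show "limit_toll (v * w, v * (1 - w), 1 - v) = (1 + 2 * v - v\<^sup>2) - v\<^sup>2 * w"
    by (simp add: limit_toll_def algebra_simps power2_eq_square)
  show "((\<lambda>w. (1 + 2 * v - v\<^sup>2) - v\<^sup>2 * w) has_integral (1 + 2 * v - v\<^sup>2) - v\<^sup>2 * (1 / 2)) {0..1}"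
    by (intro has_integral_diff has_integral_mult_right has_integral_unit_intros)
next
  have "((\<lambda>v::real. 2 * v + 4 * v ^ 2 - 3 * v ^ 3) has_integral 2 * (1 / 2) + 4 * (1 / 3) - 3 * (1 / 4)) {0..1}"
    by (intro has_integral_diff has_integral_add has_integral_mult_right has_integral_unit_intros)
  then show "((\<lambda>v::real. ((1 + 2 * v - v\<^sup>2) - v\<^sup>2 * (1 / 2)) * (2 * v)) has_integral 19 / 12) {0..1}"
    by (simp add: algebra_simps power2_eq_square power3_eq_cube)
qed (auto intro!: continuous_intros)

lemma squares_mean: "(\<integral>d. (fst d)\<^sup>2 + (fst (snd d))\<^sup>2 + (snd (snd d))\<^sup>2 \<partial>spacings_law) = 1 / 2"
proof (rule integral_spacings_law_eq)
  show "\<bar>(fst d)\<^sup>2 + (fst (snd d))\<^sup>2 + (snd (snd d))\<^sup>2\<bar> \<le> 3" if "in_simplex d" for d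
  proof -
    obtain d1 d2 d3 where d: "d = (d1, d2, d3)" by (metis prod_cases3)
    have "d1\<^sup>2 \<le> 1" "d2\<^sup>2 \<le> 1" "d3\<^sup>2 \<le> 1" using that d by (auto simp: power_le_one)
    then show ?thesis by (simp add: d)
  qed
  fix v w :: real
  show "(fst (v * w, v * (1 - w), 1 - v))\<^sup>2 + (fst (snd (v * w, v * (1 - w), 1 - v)))\<^sup>2 +
      (snd (snd (v * w, v * (1 - w), 1 - v)))\<^sup>2 = v\<^sup>2 * (2 * w ^ 2 - 2 * w + 1) + (1 - v)\<^sup>2"
    by (simp add: algebra_simps power2_eq_square)
  show "((\<lambda>w. v\<^sup>2 * (2 * w ^ 2 - 2 * w + 1) + (1 - v)\<^sup>2) has_integral v\<^sup>2 * (2 * (1 / 3) - 2 * (1 / 2) + 1) + (1 - v)\<^sup>2) {0..1}"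
    by (intro has_integral_diff has_integral_add has_integral_mult_right has_integral_unit_intros)
next
  have "((\<lambda>v::real. 10 / 3 * v ^ 3 - 4 * v ^ 2 + 2 * v) has_integral 10 / 3 * (1 / 4) - 4 * (1 / 3) + 2 * (1 / 2)) {0..1}"
    by (intro has_integral_diff has_integral_add has_integral_mult_right has_integral_unit_intros)
  moreover have "10 / 3 * v ^ 3 - 4 * v ^ 2 + 2 * v = (v\<^sup>2 * (2 * (1 / 3) - 2 * (1 / 2) + 1) + (1 - v)\<^sup>2) * (2 * v)" for v :: real
    by (simp add: field_simps power2_eq_square power3_eq_cube)
  ultimately show "((\<lambda>v::real. (v\<^sup>2 * (2 * (1 / 3) - 2 * (1 / 2) + 1) + (1 - v)\<^sup>2) * (2 * v)) has_integral 1 / 2) {0..1}"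
    by simp
qed (auto intro!: continuous_intros borel_measurable_continuous_onI)

text \<open>Half of the asserted constant, because the second moment \<open>v\<close> of a centred
  solution satisfies \<open>v = limit_cost_variance + v / 2\<close>.\<close>

definition limit_cost_variance :: real where
  "limit_cost_variance = 2231 / 720 - 361 / 1200 * pi\<^sup>2"

text \<open>This is where the coefficient \<open>19 / 10\<close> proves to be the right one: with it
  the fixed-point map preserves centred laws.\<close>

lemma limit_cost_mean: "(\<integral>d. limit_cost d \<partial>spacings_law) = 0"
proof -
  obtain B where B: "\<And>d. d \<in> {0..1} \<times> {0..1} \<times> {0..1} \<Longrightarrow> \<bar>limit_cost d\<bar> \<le> B"
    using limit_cost_bounded by blast
  show ?thesis
  proof (rule integral_spacings_law_eq[OF limit_cost_measurable B[OF in_simplex_imp_cube]])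
    fix v w :: real
    let ?f = "1 + 2 * v - 2 * v\<^sup>2 + 19 / 10 * entropy2 v"
    show "0 \<le> v \<Longrightarrow> v \<le> 1 \<Longrightarrow> 0 \<le> w \<Longrightarrow> w \<le> 1 \<Longrightarrow> limit_cost (v * w, v * (1 - w), 1 - v) =
        ?f + v\<^sup>2 * (1 - w) + 19 / 10 * v * entropy2 w"
      by (rule limit_cost_scale)
    show "((\<lambda>w. ?f + v\<^sup>2 * (1 - w) + 19 / 10 * v * entropy2 w) has_integral
        ?f + v\<^sup>2 * (1 - 1 / 2) + 19 / 10 * v * (- 1 / 2)) {0..1}"
      by (intro has_integral_diff has_integral_add has_integral_mult_right has_integral_unit_intros has_integral_pow_entropy2)
  next
    have "((\<lambda>v. 2 * v + 21 / 10 * v ^ 2 - 3 * v ^ 3 + 19 / 5 * (v * entropy2 v)) has_integral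
        2 * (1 / 2) + 21 / 10 * (1 / 3) - 3 * (1 / 4) + 19 / 5 * (- 1 / 4)) {0..1}"
      by (intro has_integral_diff has_integral_add has_integral_mult_right has_integral_unit_intros has_integral_pow_entropy2)
    moreover have "2 * v + 21 / 10 * v ^ 2 - 3 * v ^ 3 + 19 / 5 * (v * entropy2 v) =
        (1 + 2 * v - 2 * v\<^sup>2 + 19 / 10 * entropy2 v + v\<^sup>2 * (1 - 1 / 2) + 19 / 10 * v * (- 1 / 2)) * (2 * v)" for v
      by (simp add: field_simps power2_eq_square power3_eq_cube)
    ultimately show "((\<lambda>v. (1 + 2 * v - 2 * v\<^sup>2 + 19 / 10 * entropy2 v + v\<^sup>2 * (1 - 1 / 2) + 19 / 10 * v * (- 1 / 2)) * (2 * v)) has_integral 0) {0..1}"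
      by simp
  qed (auto intro!: continuous_intros continuous_on_entropy2)
qed

lemma limit_cost_square_mean: "(\<integral>d. (limit_cost d)\<^sup>2 \<partial>spacings_law) = limit_cost_variance"
proof -
  obtain B where B: "0 \<le> B" "\<And>d. d \<in> {0..1} \<times> {0..1} \<times> {0..1} \<Longrightarrow> \<bar>limit_cost d\<bar> \<le> B"
    using limit_cost_bounded by blast
  have B2: "\<bar>(limit_cost d)\<^sup>2\<bar> \<le> B\<^sup>2" if "in_simplex d" for d
    using power_mono[OF B(2)[OF in_simplex_imp_cube[OF that]], of 2] by simp
  \<comment> \<open>With \<open>19 / 10\<close> and the entropy integral kept as symbols, both
    integrands are linear combinations of functions with known integrals; the numbers enter only in
    the last evaluation.\<close>
  define k :: real where "k = 19 / 10"
  define H where "H = entropy_square_integral"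
  define f where "f v = 1 + 2 * v - 2 * v\<^sup>2 + k * entropy2 v" for v
  define g where "g v = (f v)\<^sup>2 + v ^ 4 * (1 / 3) + (k * v)\<^sup>2 * H + 2 * f v * v\<^sup>2 * (1 / 2) + 2 * f v * k * v * (- 1 / 2) +
      2 * v\<^sup>2 * k * v * (- 1 / 4)" for v
  have [measurable]: "f \<in> borel_measurable borel" unfolding f_def by measurable
  have cf: "continuous_on {0..1} f" unfolding f_def by (intro continuous_intros continuous_on_entropy2)
  show ?thesis
  proof (rule integral_spacings_law_eq[OF _ B2])
    fix v w :: real
    show "(limit_cost (v * w, v * (1 - w), 1 - v))\<^sup>2 = (f v + v\<^sup>2 * (1 - w) + k * v * entropy2 w)\<^sup>2"
      if "0 \<le> v" "v \<le> 1" "0 \<le> w" "w \<le> 1"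
      using limit_cost_scale[OF that] by (simp add: f_def k_def)
    have sq: "((\<lambda>w::real. (1 - w)\<^sup>2) has_integral 1 / 3) {0..1}"
      using has_integral_reflect_unit[OF has_integral_unit_intros(3)] .
    have "((\<lambda>w. (f v)\<^sup>2 + v ^ 4 * (1 - w)\<^sup>2 + (k * v)\<^sup>2 * (entropy2 w)\<^sup>2 + 2 * f v * v\<^sup>2 * (1 - w) + 2 * f v * k * v * entropy2 w +
        2 * v\<^sup>2 * k * v * ((1 - w) * entropy2 w)) has_integral
        (f v)\<^sup>2 + v ^ 4 * (1 / 3) + (k * v)\<^sup>2 * H + 2 * f v * v\<^sup>2 * (1 - 1 / 2) + 2 * f v * k * v * (- 1 / 2) +
        2 * v\<^sup>2 * k * v * (- 1 / 4)) {0..1}"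
      unfolding H_def
      by (intro has_integral_diff has_integral_add has_integral_mult_right has_integral_unit_intros has_integral_pow_entropy2
          sq has_integral_entropy2_squared has_integral_entropy2_reflected)
    moreover have "(f v)\<^sup>2 + v ^ 4 * (1 - w)\<^sup>2 + (k * v)\<^sup>2 * (entropy2 w)\<^sup>2 + 2 * f v * v\<^sup>2 * (1 - w) + 2 * f v * k * v * entropy2 w +
        2 * v\<^sup>2 * k * v * ((1 - w) * entropy2 w) = (f v + v\<^sup>2 * (1 - w) + k * v * entropy2 w)\<^sup>2" for w
    proof -
      have "a\<^sup>2 + v ^ 4 * b\<^sup>2 + (k * v)\<^sup>2 * e\<^sup>2 + 2 * a * v\<^sup>2 * b + 2 * a * k * v * e + 2 * v\<^sup>2 * k * v * (b * e) =
        (a + v\<^sup>2 * b + k * v * e)\<^sup>2" for a b e :: real by algebra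
      then show ?thesis .
    qed
    ultimately show "((\<lambda>w. (f v + v\<^sup>2 * (1 - w) + k * v * entropy2 w)\<^sup>2) has_integral g v) {0..1}"
      by (simp add: g_def)
  next
    have "((\<lambda>v. 2 * v + 8 * v ^ 2 - 16 * v ^ 4 + 8 * v ^ 5 + 4 * k * (v * entropy2 v) + 8 * k * (v ^ 2 * entropy2 v) - 8 * k * (v ^ 3 * entropy2 v) +
        2 * k\<^sup>2 * (v * (entropy2 v)\<^sup>2) + 2 / 3 * v ^ 5 + 2 * k\<^sup>2 * H * v ^ 3 + 2 * v ^ 3 + 4 * v ^ 4 - 4 * v ^ 5 + 2 * k * (v ^ 3 * entropy2 v) -
        2 * k * v ^ 2 - 4 * k * v ^ 3 + 4 * k * v ^ 4 - 2 * k\<^sup>2 * (v ^ 2 * entropy2 v) - k * v ^ 4) has_integral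
        2 * (1 / 2) + 8 * (1 / 3) - 16 * (1 / 5) + 8 * (1 / 6) + 4 * k * (- 1 / 4) + 8 * k * (- 1 / 4 + 2 / 9 - 2 / 16) - 8 * k * (- 1 / 4 + 3 / 9 - 3 / 16) +
        2 * k\<^sup>2 * (H / 2) + 2 / 3 * (1 / 6) + 2 * k\<^sup>2 * H * (1 / 4) + 2 * (1 / 4) + 4 * (1 / 5) - 4 * (1 / 6) + 2 * k * (- 1 / 4 + 3 / 9 - 3 / 16) -
        2 * k * (1 / 3) - 4 * k * (1 / 4) + 4 * k * (1 / 5) - 2 * k\<^sup>2 * (- 1 / 4 + 2 / 9 - 2 / 16) - k * (1 / 5)) {0..1}"
      unfolding H_def
      by (intro has_integral_diff has_integral_add has_integral_mult_right has_integral_unit_intros has_integral_pow_entropy2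
          has_integral_mult_entropy2_squared)
    moreover have "2 * v + 8 * v ^ 2 - 16 * v ^ 4 + 8 * v ^ 5 + 4 * k * (v * entropy2 v) + 8 * k * (v ^ 2 * entropy2 v) - 8 * k * (v ^ 3 * entropy2 v) +
        2 * k\<^sup>2 * (v * (entropy2 v)\<^sup>2) + 2 / 3 * v ^ 5 + 2 * k\<^sup>2 * H * v ^ 3 + 2 * v ^ 3 + 4 * v ^ 4 - 4 * v ^ 5 + 2 * k * (v ^ 3 * entropy2 v) -
        2 * k * v ^ 2 - 4 * k * v ^ 3 + 4 * k * v ^ 4 - 2 * k\<^sup>2 * (v ^ 2 * entropy2 v) - k * v ^ 4 = g v * (2 * v)" for v
    proof -
      have "x ^ 4 = x * x * x * x" "x ^ 5 = x * x * x * x * x" for x :: real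
        by (simp_all add: eval_nat_numeral)
      then show ?thesis
        unfolding g_def f_def power2_eq_square power3_eq_cube by (simp add: algebra_simps)
    qed
    moreover have "2 * (1 / 2) + 8 * (1 / 3) - 16 * (1 / 5) + 8 * (1 / 6) + 4 * k * (- 1 / 4) + 8 * k * (- 1 / 4 + 2 / 9 - 2 / 16) - 8 * k * (- 1 / 4 + 3 / 9 - 3 / 16) +
        2 * k\<^sup>2 * (H / 2) + 2 / 3 * (1 / 6) + 2 * k\<^sup>2 * H * (1 / 4) + 2 * (1 / 4) + 4 * (1 / 5) - 4 * (1 / 6) + 2 * k * (- 1 / 4 + 3 / 9 - 3 / 16) -
        2 * k * (1 / 3) - 4 * k * (1 / 4) + 4 * k * (1 / 5) - 2 * k\<^sup>2 * (- 1 / 4 + 2 / 9 - 2 / 16) - k * (1 / 5) = limit_cost_variance"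
      unfolding H_def k_def entropy_square_integral_def limit_cost_variance_def power2_eq_square
      by simp (simp add: field_simps)
    ultimately show "((\<lambda>v. g v * (2 * v)) has_integral limit_cost_variance) {0..1}"
      by simp
  next
    show "g \<in> borel_measurable borel" unfolding g_def by measurable
    show "continuous_on {0..1} g" unfolding g_def by (intro continuous_intros cf)
  qed (auto intro!: continuous_intros continuous_on_entropy2)
qed


section \<open>Coupling of the pivot ranks\<close>

text \<open>The ceiling takes each value on a half-open interval of length \<open>1 / n\<close>;
  only the null point \<open>u = 0\<close> falls outside the range of ranks.\<close>

lemma integral_unit_uniform_ceiling:
  fixes h :: "int \<Rightarrow> 'b::{banach, second_countable_topology}"
  assumes n: "1 \<le> n"
  shows "(\<integral>u. h \<lceil>real n * u\<rceil> \<partial>unit_uniform) = (\<Sum>a\<in>{1..int n}. h a) /\<^sub>R real n"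
proof -
  define I where "I a = {(real_of_int a - 1) / n<..real_of_int a / n}" for a
  have I: "u \<in> I a \<longleftrightarrow> \<lceil>real n * u\<rceil> = a" for u a
  proof -
    have "u \<in> I a \<longleftrightarrow> real_of_int a - 1 < real n * u \<and> real n * u \<le> real_of_int a"
      using n by (simp add: I_def field_simps)
    then show ?thesis by (auto simp: ceiling_eq_iff)
  qed
  have "AE u in unit_uniform. 0 < u \<and> u \<le> 1"
    by (rule AE_uniform_measureI) (use AE_lborel_singleton[of 0] in auto)
  then have "AE u in unit_uniform. h \<lceil>real n * u\<rceil> = (\<Sum>a\<in>{1..int n}. indicator (I a) u *\<^sub>R h a)"
  proof eventually_elim
    case (elim u)
    have "\<lceil>real n * u\<rceil> \<in> {1..int n}"
      using elim n by (auto simp: le_ceiling_iff ceiling_le_iff mult_left_le)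
    moreover have "(\<Sum>a\<in>{1..int n}. indicator (I a) u *\<^sub>R h a) =
        (\<Sum>a\<in>{1..int n}. if a = \<lceil>real n * u\<rceil> then h a else 0)"
      by (intro sum.cong) (auto simp: I indicator_def)
    ultimately show ?case by (simp add: sum.delta)
  qed
  then have "(\<integral>u. h \<lceil>real n * u\<rceil> \<partial>unit_uniform) = (\<integral>u. (\<Sum>a\<in>{1..int n}. indicator (I a) u *\<^sub>R h a) \<partial>unit_uniform)"
    by (rule integral_cong_AE[rotated 2]) (unfold I_def, measurable)
  also have "\<dots> = (\<Sum>a\<in>{1..int n}. (\<integral>u. indicator (I a) u *\<^sub>R h a \<partial>unit_uniform))"
    by (intro Bochner_Integration.integral_sum)
       (auto intro!: U.integrable_const_bound[of _ "norm (h _)"] simp: I_def split: split_indicator)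
  also have "\<dots> = (\<Sum>a\<in>{1..int n}. h a /\<^sub>R real n)"
  proof (intro sum.cong refl)
    fix a assume a: "a \<in> {1..int n}"
    have "0 \<le> (real_of_int a - 1) / n" "real_of_int a / n \<le> 1" using a n by auto
    then have "{0..1} \<inter> I a = I a" unfolding I_def by (auto intro: less_imp_le order.strict_trans1 order_trans)
    then have "measure unit_uniform (I a) = 1 / n"
      using n by (subst measure_uniform_measure) (auto simp: I_def diff_divide_distrib)
    moreover have "integrable unit_uniform (indicator (I a) :: real \<Rightarrow> real)"
      by (rule U.integrable_const_bound[of _ 1]) (auto simp: I_def split: split_indicator)
    ultimately show "(\<integral>u. indicator (I a) u *\<^sub>R h a \<partial>unit_uniform) = h a /\<^sub>R real n"
      by (simp add: divide_inverse)
  qed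
  finally show ?thesis by (simp add: scaleR_sum_right)
qed

lemma integral_unit_square_ceiling:
  fixes H :: "int \<Rightarrow> int \<Rightarrow> 'b::{banach, second_countable_topology}"
  assumes n: "1 \<le> n" and bd: "\<And>a b. norm (H a b) \<le> C"
  shows "integrable (unit_uniform \<Otimes>\<^sub>M unit_uniform) (\<lambda>x. H \<lceil>real n * fst x\<rceil> \<lceil>real n * snd x\<rceil>)"
    "(\<integral>x. H \<lceil>real n * fst x\<rceil> \<lceil>real n * snd x\<rceil> \<partial>(unit_uniform \<Otimes>\<^sub>M unit_uniform)) =
      (\<Sum>a\<in>{1..int n}. \<Sum>b\<in>{1..int n}. H a b) /\<^sub>R (real n * real n)"
proof -
  have [measurable]: "(\<lambda>x. H \<lceil>real n * fst x\<rceil> \<lceil>real n * snd x\<rceil>) \<in> borel_measurable (unit_uniform \<Otimes>\<^sub>M unit_uniform)"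
    by measurable
  show int: "integrable (unit_uniform \<Otimes>\<^sub>M unit_uniform) (\<lambda>x. H \<lceil>real n * fst x\<rceil> \<lceil>real n * snd x\<rceil>)"
    by (rule UU.integrable_const_bound[of _ C]) (auto simp: bd)
  have "(\<integral>x. H \<lceil>real n * fst x\<rceil> \<lceil>real n * snd x\<rceil> \<partial>(unit_uniform \<Otimes>\<^sub>M unit_uniform)) =
      (\<integral>u. (\<integral>v. H \<lceil>real n * u\<rceil> \<lceil>real n * v\<rceil> \<partial>unit_uniform) \<partial>unit_uniform)"
    using UU.integral_fst'[OF int] by simp
  also have "\<dots> = (\<Sum>a\<in>{1..int n}. (\<Sum>b\<in>{1..int n}. H a b) /\<^sub>R real n) /\<^sub>R real n"
    using integral_unit_uniform_ceiling[OF n, of "\<lambda>a. (\<Sum>b\<in>{1..int n}. H a b) /\<^sub>R real n"]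
    by (simp add: integral_unit_uniform_ceiling[OF n])
  also have "\<dots> = (\<Sum>a\<in>{1..int n}. \<Sum>b\<in>{1..int n}. H a b) /\<^sub>R (real n * real n)"
    by (simp add: scaleR_sum_right)
  finally show "(\<integral>x. H \<lceil>real n * fst x\<rceil> \<lceil>real n * snd x\<rceil> \<partial>(unit_uniform \<Otimes>\<^sub>M unit_uniform)) =
      (\<Sum>a\<in>{1..int n}. \<Sum>b\<in>{1..int n}. H a b) /\<^sub>R (real n * real n)" .
qed

abbreviation cube :: "(real \<times> real \<times> real) set" where
  "cube \<equiv> {0..1} \<times> {0..1} \<times> {0..1}"

definition close_triples :: "real \<Rightarrow> real \<times> real \<times> real \<Rightarrow> real \<times> real \<times> real \<Rightarrow> bool" where
  "close_triples \<delta> = (\<lambda>(x1, x2, x3) (y1, y2, y3). \<bar>x1 - y1\<bar> \<le> \<delta> \<and> \<bar>x2 - y2\<bar> \<le> \<delta> \<and> \<bar>x3 - y3\<bar> \<le> \<delta>)"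

lemma perm_avg_norm_le:
  fixes F :: "(int \<Rightarrow> int) \<Rightarrow> 'b::real_normed_vector"
  assumes "\<And>\<pi>. \<pi> \<in> perms n \<Longrightarrow> norm (F \<pi>) \<le> B"
  shows "norm (perm_avg n F) \<le> B"
proof -
  have "norm (\<Sum>\<pi>\<in>perms n. F \<pi>) \<le> real (card (perms n)) * B"
    using assms by (rule sum_norm_bound)
  then show ?thesis by (simp add: perm_avg_def card_perms field_simps)
qed

lemma perm_avg_const [simp]: "perm_avg n (\<lambda>_. c) = c"
  by (simp add: perm_avg_def card_perms sum_constant_scaleR)

lemma perm_avg_diff: "perm_avg n (\<lambda>\<pi>. F \<pi> - G \<pi>) = perm_avg n F - perm_avg n G"
  by (simp add: perm_avg_def sum_subtractf scaleR_diff_right)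

lemma perm_avg_add: "perm_avg n (\<lambda>\<pi>. F \<pi> + G \<pi>) = perm_avg n F + perm_avg n G"
  by (simp add: perm_avg_def sum.distrib scaleR_add_right)

lemma proportions_in_cube:
  assumes "\<pi> \<in> perms n" "2 \<le> n"
  shows "proportions n \<pi> \<in> cube"
  using sizes_sum[OF assms] assms(2) by (auto simp: proportions_def field_simps)

text \<open>
  The pivot ranks are coupled with two independent uniform variables by rounding up; on the diagonal,
  where the ranks would coincide, the function is replaced by its average.
\<close>

lemma perm_avg_proportions_approx:
  fixes F :: "real \<times> real \<times> real \<Rightarrow> 'b::{banach, second_countable_topology}"
  assumes n: "2 \<le> n" and F [measurable]: "F \<in> borel_measurable borel"
    and close: "\<And>d d'. d \<in> cube \<Longrightarrow> d' \<in> cube \<Longrightarrow> close_triples (2 / n) d d' \<Longrightarrow> norm (F d - F d') \<le> \<epsilon>"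
    and B: "\<And>d d'. d \<in> cube \<Longrightarrow> d' \<in> cube \<Longrightarrow> norm (F d - F d') \<le> B"
  shows "norm (perm_avg n (\<lambda>\<pi>. F (proportions n \<pi>)) - (\<integral>d. F d \<partial>spacings_law)) \<le> \<epsilon> + B / n"
proof -
  define cell where "cell a b = ((real_of_int (min a b) - 1) / n, (real_of_int (max a b) - real_of_int (min a b) - 1) / n,
      (real n - real_of_int (max a b)) / n)" for a b :: int
  define A where "A = perm_avg n (\<lambda>\<pi>. F (proportions n \<pi>))"
  \<comment> \<open>Filling the diagonal with \<open>A\<close> itself makes the integral of
    \<open>G\<close> over the square exactly \<open>A\<close>, so that the different denominators
    \<open>n (n - 1)\<close> and \<open>n^2\<close> do no harm.\<close>
  define G where "G a b = (if (a, b) \<in> offdiag n then F (cell a b) else A)" for a b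
  have cell_cube: "cell a b \<in> cube" if "(a, b) \<in> offdiag n" for a b
    using that n by (auto simp: cell_def offdiag_def divide_simps)
  have prop_cell: "proportions n \<pi> = cell (\<pi> 1) (\<pi> (int n))" if "\<pi> \<in> perms n" for \<pi>
    using rank_bounds[OF that n]
    by (simp add: proportions_def cell_def small_size_def medium_size_def large_size_def low_rank_def high_rank_def)
  have "A = perm_avg n (\<lambda>\<pi>. F (cell (\<pi> 1) (\<pi> (int n))))"
    unfolding A_def perm_avg_def by (simp add: prop_cell)
  also have "\<dots> = (\<Sum>(a, b)\<in>offdiag n. F (cell a b)) /\<^sub>R (real n * (real n - 1))"
    by (rule perm_avg_ends[OF n])
  finally have A: "(real n * (real n - 1)) *\<^sub>R A = (\<Sum>(a, b)\<in>offdiag n. F (cell a b))"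
  proof -
    assume "A = (\<Sum>(a, b)\<in>offdiag n. F (cell a b)) /\<^sub>R (real n * (real n - 1))"
    moreover have "real n * (real n - 1) \<noteq> 0" using n by auto
    ultimately show ?thesis by (simp only: scaleR_scaleR right_inverse scaleR_one not_False_eq_True)
  qed
  have AB: "norm (A - F d) \<le> B" if "d \<in> cube" for d
  proof -
    have "A - F d = perm_avg n (\<lambda>\<pi>. F (proportions n \<pi>) - F d)" by (simp add: A_def perm_avg_diff)
    also have "norm \<dots> \<le> B"
      by (intro perm_avg_norm_le B that proportions_in_cube n)
    finally show ?thesis .
  qed
  have B0: "0 \<le> B" using norm_ge_zero AB[of "(0, 0, 0)"] by (rule order_trans) simp
  have e0: "0 \<le> \<epsilon>" using close[of "(0, 0, 0)" "(0, 0, 0)"] by (simp add: close_triples_def)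
  have Gb: "norm (G a b) \<le> B + norm (F (0, 0, 0))" for a b
  proof -
    have "norm (F (cell a b)) \<le> B + norm (F (0, 0, 0))" if "(a, b) \<in> offdiag n"
      using B[OF cell_cube[OF that], of "(0, 0, 0)"] norm_triangle_sub[of "F (cell a b)" "F (0, 0, 0)"] by simp
    moreover have "norm A \<le> B + norm (F (0, 0, 0))"
      using AB[of "(0, 0, 0)"] norm_triangle_sub[of A "F (0, 0, 0)"] by simp
    ultimately show ?thesis by (simp add: G_def)
  qed
  have "(\<Sum>a\<in>{1..int n}. \<Sum>b\<in>{1..int n}. G a b) = (real n * real n) *\<^sub>R A"
  proof -
    have "(\<Sum>a\<in>{1..int n}. \<Sum>b\<in>{1..int n}. G a b) = (\<Sum>x\<in>{1..int n} \<times> {1..int n}. case x of (a, b) \<Rightarrow> G a b)"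
      by (simp add: sum.cartesian_product)
    also have "{1..int n} \<times> {1..int n} = offdiag n \<union> (\<lambda>a. (a, a)) ` {1..int n}" by (auto simp: offdiag_def)
    also have "(\<Sum>x\<in>\<dots>. case x of (a, b) \<Rightarrow> G a b) =
        (\<Sum>x\<in>offdiag n. case x of (a, b) \<Rightarrow> G a b) + (\<Sum>x\<in>(\<lambda>a. (a, a)) ` {1..int n}. case x of (a, b) \<Rightarrow> G a b)"
      by (rule sum.union_disjoint[OF finite_offdiag]) (auto simp: offdiag_def)
    also have "(\<Sum>x\<in>(\<lambda>a. (a, a)) ` {1..int n}. case x of (a, b) \<Rightarrow> G a b) = real n *\<^sub>R A"
      by (subst sum.reindex) (auto simp: inj_on_def G_def offdiag_def sum_constant_scaleR)
    also have "(\<Sum>x\<in>offdiag n. case x of (a, b) \<Rightarrow> G a b) = (real n * (real n - 1)) *\<^sub>R A"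
      unfolding A by (intro sum.cong) (auto simp: G_def)
    finally show ?thesis by (simp only: scaleR_add_left[symmetric]) (simp add: right_diff_distrib)
  qed
  then have GA: "(\<integral>x. G \<lceil>real n * fst x\<rceil> \<lceil>real n * snd x\<rceil> \<partial>(unit_uniform \<Otimes>\<^sub>M unit_uniform)) = A"
    using integral_unit_square_ceiling(2)[of n G, OF _ Gb] n
    by (simp del: inverse_mult_distrib)
  note Gint = integral_unit_square_ceiling(1)[of n G, OF _ Gb]
  have [measurable]: "(\<lambda>x. F (spacings x)) \<in> borel_measurable (unit_uniform \<Otimes>\<^sub>M unit_uniform)"
    by (rule measurable_compose[OF spacings_measurable F])
  have cube: "spacings x \<in> cube" if "0 \<le> fst x \<and> fst x \<le> 1 \<and> 0 \<le> snd x \<and> snd x \<le> 1" for x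
    using that by (auto simp: spacings_def split: prod.splits)
  have Fint: "integrable (unit_uniform \<Otimes>\<^sub>M unit_uniform) (\<lambda>x. F (spacings x))"
  proof (rule UU.integrable_const_bound[of _ "B + norm (F (0, 0, 0))"], rule eventually_mono[OF AE_unit_square])
    fix x :: "real \<times> real" assume "0 \<le> fst x \<and> fst x \<le> 1 \<and> 0 \<le> snd x \<and> snd x \<le> 1"
    from B[OF cube[OF this], of "(0, 0, 0)"] norm_triangle_sub[of "F (spacings x)" "F (0, 0, 0)"]
    show "norm (F (spacings x)) \<le> B + norm (F (0, 0, 0))" by simp
  qed measurable
  define D where "D x = G \<lceil>real n * fst x\<rceil> \<lceil>real n * snd x\<rceil> - F (spacings x)" for x
  \<comment> \<open>The dominating function is \<epsilon> off the diagonal and exceeds it by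
    \<open>B\<close> on the diagonal, whose probability is \<open>1 / n\<close>.\<close>
  define b where "b x = \<epsilon> + B * of_bool (\<lceil>real n * fst x\<rceil> = \<lceil>real n * snd x\<rceil>)" for x
  have Dint: "integrable (unit_uniform \<Otimes>\<^sub>M unit_uniform) D"
    unfolding D_def using n by (intro Bochner_Integration.integrable_diff Fint Gint) auto
  have bint: "integrable (unit_uniform \<Otimes>\<^sub>M unit_uniform) b" "(\<integral>x. b x \<partial>(unit_uniform \<Otimes>\<^sub>M unit_uniform)) = \<epsilon> + B / n"
  proof -
    let ?H = "\<lambda>i j. \<epsilon> + B * of_bool (i = j)"
    have "norm (?H i j) \<le> \<bar>\<epsilon>\<bar> + \<bar>B\<bar>" for i j :: int by auto
    note * = integral_unit_square_ceiling[of n ?H, OF _ this]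
    show "integrable (unit_uniform \<Otimes>\<^sub>M unit_uniform) b" unfolding b_def using *(1) n by simp
    have "(\<Sum>i\<in>{1..int n}. \<Sum>j\<in>{1..int n}. ?H i j) = (\<Sum>i\<in>{1..int n}. real n * \<epsilon> + B)"
    proof (intro sum.cong refl)
      fix i assume i: "i \<in> {1..int n}"
      have "(\<Sum>j\<in>{1..int n}. of_bool (i = j)) = (1 :: real)"
        using i sum.delta[of "{1..int n}" i "\<lambda>_. 1 :: real"] by (simp add: of_bool_def)
      then show "(\<Sum>j\<in>{1..int n}. ?H i j) = real n * \<epsilon> + B"
        by (simp add: sum.distrib sum_distrib_left[symmetric] del: sum_of_bool_eq)
    qed
    then show "(\<integral>x. b x \<partial>(unit_uniform \<Otimes>\<^sub>M unit_uniform)) = \<epsilon> + B / n"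
    proof -
      have "(\<integral>x. b x \<partial>(unit_uniform \<Otimes>\<^sub>M unit_uniform)) = (real n * (real n * \<epsilon> + B)) /\<^sub>R (real n * real n)"
        unfolding b_def using *(2) n \<open>(\<Sum>i\<in>{1..int n}. \<Sum>j\<in>{1..int n}. ?H i j) = (\<Sum>i\<in>{1..int n}. real n * \<epsilon> + B)\<close>
        by simp
      also have "\<dots> = \<epsilon> + B / n" using n by (simp add: field_simps)
      finally show ?thesis .
    qed
  qed
  have "AE x in unit_uniform \<Otimes>\<^sub>M unit_uniform. norm (D x) \<le> b x"
  proof -
    have "AE x in unit_uniform \<Otimes>\<^sub>M unit_uniform. 0 < fst x \<and> 0 < snd x"
    proof (rule UU.AE_pair_measure)
      have "AE u in unit_uniform. 0 < u"
        by (rule AE_uniform_measureI) (use AE_lborel_singleton[of 0] in auto)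
      then show "AE u in unit_uniform. AE v in unit_uniform. 0 < fst (u, v) \<and> 0 < snd (u, v)" by simp
    qed measurable
    with AE_unit_square show ?thesis
    proof eventually_elim
      case (elim x)
      obtain u v where x: "x = (u, v)" by fastforce
      define i j where "i = \<lceil>real n * u\<rceil>" and "j = \<lceil>real n * v\<rceil>"
      have ij: "i \<in> {1..int n}" "j \<in> {1..int n}"
        using elim n unfolding i_def j_def x by (auto simp: le_ceiling_iff ceiling_le_iff mult_left_le)
      have bounds: "real_of_int i - 1 < n * u" "n * u \<le> i" "real_of_int j - 1 < n * v" "n * v \<le> j"
        unfolding i_def j_def by linarith+
      have sc: "spacings x \<in> cube" by (rule cube) (use elim in auto)
      show ?case
      proof (cases "i = j")
        case True
        then have "D x = A - F (spacings x)" by (simp add: D_def G_def offdiag_def x i_def j_def)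
        then show ?thesis using AB[OF sc] True e0 by (simp add: b_def x i_def j_def)
      next
        case False
        then have od: "(i, j) \<in> offdiag n" using ij by (simp add: offdiag_def)
        have "close_triples (2 / n) (cell i j) (spacings x)"
        proof -
          have *: "\<bar>a / n - c\<bar> \<le> 2 / n" if "\<bar>a - n * c\<bar> \<le> 2" for a c :: real
          proof -
            have "a / n - c = (a - n * c) / n" using n by (simp add: field_simps)
            then show ?thesis using that n by (simp add: divide_right_mono)
          qed
          \<comment> \<open>Rounding up preserves the order, so minimum and maximum of the ranks
            come from the same variables as minimum and maximum of the uniform values.\<close>
          have mono: "i \<le> j" if "u \<le> v"
            unfolding i_def j_def by (rule ceiling_mono) (rule mult_left_mono[OF that], simp)
          have mono': "j \<le> i" if "\<not> u \<le> v"
            unfolding i_def j_def by (rule ceiling_mono) (rule mult_left_mono, use that in auto)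
          have "(min i j = i \<and> min u v = u \<and> max i j = j \<and> max u v = v) \<or>
              (min i j = j \<and> min u v = v \<and> max i j = i \<and> max u v = u)"
            using mono mono' by (cases "u \<le> v") auto
          then have mn: "real_of_int (min i j) - 1 < n * min u v" "n * min u v \<le> real_of_int (min i j)"
            and mx: "real_of_int (max i j) - 1 < n * max u v" "n * max u v \<le> real_of_int (max i j)"
            using bounds by (elim disjE conjE; simp only:)+
          \<comment> \<open>Rounding moves each point by less than 1, and one position is taken by
            each pivot; the worst case, slightly less than 2, is the middle block. Hence the scale
            \<open>2 / n\<close>.\<close>
          have lin: "\<bar>(a - 1) - x\<bar> \<le> 2" "\<bar>(b - a - 1) - (y - x)\<bar> \<le> 2" "\<bar>(N - b) - (N - y)\<bar> \<le> 2"
            if "a - 1 < x" "x \<le> a" "b - 1 < y" "y \<le> b" for a b x y N :: real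
            using that by linarith+
          have "\<bar>(real_of_int (min i j) - 1) - n * min u v\<bar> \<le> 2"
            "\<bar>(real_of_int (max i j) - real_of_int (min i j) - 1) - n * (max u v - min u v)\<bar> \<le> 2"
            "\<bar>(real n - real_of_int (max i j)) - n * (1 - max u v)\<bar> \<le> 2"
            unfolding right_diff_distrib mult_1_right by (rule lin[OF mn mx])+
          note * = *[OF this(1)] *[OF this(2)] *[OF this(3)]
          then show ?thesis
            unfolding close_triples_def cell_def spacings_def x case_prod_conv by blast
        qed
        from close[OF cell_cube[OF od] sc this] show ?thesis
          using False od by (simp add: D_def G_def b_def x i_def j_def)
      qed
    qed
  qed
  then have "norm (\<integral>x. D x \<partial>(unit_uniform \<Otimes>\<^sub>M unit_uniform)) \<le> (\<integral>x. b x \<partial>(unit_uniform \<Otimes>\<^sub>M unit_uniform))"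
    by (rule order_trans[OF integral_norm_bound integral_mono_AE[OF integrable_norm[OF Dint] bint(1)]])
  moreover have "(\<integral>x. D x \<partial>(unit_uniform \<Otimes>\<^sub>M unit_uniform)) = A - (\<integral>d. F d \<partial>spacings_law)"
    unfolding D_def using GA Gint Fint n unfolding spacings_law_alt
    by (subst Bochner_Integration.integral_diff) (simp_all add: integral_distr)
  ultimately show ?thesis by (simp add: A_def bint(2))
qed


section \<open>The fixed-point equation\<close>

lemma (in pair_sigma_finite) integral_mult_pair:
  fixes f :: "'a \<Rightarrow> 'c::{real_normed_field, banach, second_countable_topology}"
  assumes f: "integrable M1 f" and g: "integrable M2 g"
  shows "integrable (M1 \<Otimes>\<^sub>M M2) (\<lambda>x. f (fst x) * g (snd x))"
    "(\<integral>x. f (fst x) * g (snd x) \<partial>(M1 \<Otimes>\<^sub>M M2)) = (\<integral>x. f x \<partial>M1) * (\<integral>y. g y \<partial>M2)"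
proof -
  have [measurable]: "f \<in> borel_measurable M1" "g \<in> borel_measurable M2" using f g by auto
  show 1: "integrable (M1 \<Otimes>\<^sub>M M2) (\<lambda>x. f (fst x) * g (snd x))"
  proof (rule Fubini_integrable)
    have "integrable M1 (\<lambda>x. norm (f x) * (\<integral>y. norm (g y) \<partial>M2))"
      using f by auto
    then show "integrable M1 (\<lambda>x. \<integral>y. norm (f (fst (x, y)) * g (snd (x, y))) \<partial>M2)"
      by (simp add: norm_mult)
    show "AE x in M1. integrable M2 (\<lambda>y. f (fst (x, y)) * g (snd (x, y)))"
      using g by simp
  qed measurable
  show "(\<integral>x. f (fst x) * g (snd x) \<partial>(M1 \<Otimes>\<^sub>M M2)) = (\<integral>x. f x \<partial>M1) * (\<integral>y. g y \<partial>M2)"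
    using integral_fst'[OF 1] by simp
qed

locale law = real_distribution \<mu> for \<mu> :: "real measure"
begin

sublocale P2: pair_prob_space \<mu> \<mu> ..
sublocale P3: pair_prob_space \<mu> "\<mu> \<Otimes>\<^sub>M \<mu>" ..
sublocale S: prob_space spacings_law by (rule prob_space_spacings_law)
sublocale P4: pair_prob_space spacings_law "\<mu> \<Otimes>\<^sub>M (\<mu> \<Otimes>\<^sub>M \<mu>)" ..

abbreviation cubed :: "(real \<times> real \<times> real) measure" where
  "cubed \<equiv> \<mu> \<Otimes>\<^sub>M (\<mu> \<Otimes>\<^sub>M \<mu>)"

lemma integral_mult_cubed:
  fixes f g h :: "real \<Rightarrow> 'c::{real_normed_field, banach, second_countable_topology}"
  assumes "integrable \<mu> f" "integrable \<mu> g" "integrable \<mu> h"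
  shows "integrable cubed (\<lambda>x. f (fst x) * (g (fst (snd x)) * h (snd (snd x))))"
    "(\<integral>x. f (fst x) * (g (fst (snd x)) * h (snd (snd x))) \<partial>cubed) = (\<integral>x. f x \<partial>\<mu>) * ((\<integral>x. g x \<partial>\<mu>) * (\<integral>x. h x \<partial>\<mu>))"
  using P3.integral_mult_pair[OF assms(1) P2.integral_mult_pair(1)[OF assms(2,3)]] P2.integral_mult_pair(2)[OF assms(2,3)]
  by simp_all

lemma fixed_point_rhs_alt:
  "fixed_point_rhs (d, x) = limit_cost d + fst d * fst x + fst (snd d) * fst (snd x) + snd (snd d) * snd (snd x)"
  by (cases d; cases x) (simp add: fixed_point_rhs_def limit_cost_def limit_toll_def xlnx_def algebra_simps)

lemma measurable_fst_snd [measurable]: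
  "fst \<in> borel_measurable (borel :: (real \<times> real \<times> real) measure)"
  "(\<lambda>d. fst (snd d)) \<in> borel_measurable (borel :: (real \<times> real \<times> real) measure)"
  "(\<lambda>d. snd (snd d)) \<in> borel_measurable (borel :: (real \<times> real \<times> real) measure)"
  by (auto intro!: borel_measurable_continuous_onI continuous_intros)

lemma fixed_point_rhs_measurable [measurable]:
  "fixed_point_rhs \<in> borel_measurable (spacings_law \<Otimes>\<^sub>M cubed)"
proof -
  have "(\<lambda>z. limit_cost (fst z) + fst (fst z) * fst (snd z) + fst (snd (fst z)) * fst (snd (snd z)) +
      snd (snd (fst z)) * snd (snd (snd z))) \<in> borel_measurable (spacings_law \<Otimes>\<^sub>M cubed)"
    by measurable
  moreover have "fixed_point_rhs = (\<lambda>z. limit_cost (fst z) + fst (fst z) * fst (snd z) + fst (snd (fst z)) * fst (snd (snd z)) +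
      snd (snd (fst z)) * snd (snd (snd z)))"
    by (auto simp: fixed_point_rhs_alt fun_eq_iff)
  ultimately show ?thesis by simp
qed

text \<open>The fixed-point map on laws; solutions of the equation are its fixed points, so
  existence and uniqueness become statements about iteration.\<close>

definition image_law :: "real measure" where
  "image_law = distr (spacings_law \<Otimes>\<^sub>M cubed) borel fixed_point_rhs"

lemma real_distribution_image_law: "real_distribution image_law"
  unfolding image_law_def by (rule P4.real_distribution_distr) measurable

text \<open>The characteristic function of the right-hand side for given spacings \<open>d\<close>;
  independence of the three copies turns it into a product.\<close>

definition mixture_char :: "real \<Rightarrow> real \<times> real \<times> real \<Rightarrow> complex" where
  "mixture_char t d = iexp (t * limit_cost d) * (char \<mu> (t * fst d) * (char \<mu> (t * fst (snd d)) * char \<mu> (t * snd (snd d))))"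

lemma char_image_law: "char image_law t = (CLINT d|spacings_law. mixture_char t d)"
proof -
  have int: "integrable (spacings_law \<Otimes>\<^sub>M cubed) (\<lambda>z. iexp (t * fixed_point_rhs z))"
    by (rule P4.integrable_const_bound[of _ 1]) auto
  have "char image_law t = (CLINT z|spacings_law \<Otimes>\<^sub>M cubed. iexp (t * fixed_point_rhs z))"
    unfolding char_def image_law_def by (subst integral_distr) auto
  also have "\<dots> = (CLINT d|spacings_law. (CLINT x|cubed. iexp (t * fixed_point_rhs (d, x))))"
    by (rule P4.integral_fst'[OF int, symmetric])
  also have "\<dots> = (CLINT d|spacings_law. mixture_char t d)"
  proof (intro Bochner_Integration.integral_cong refl)
    fix d
    have "iexp (t * fixed_point_rhs (d, x)) = iexp (t * limit_cost d) *
        (iexp (t * fst d * fst x) * (iexp (t * fst (snd d) * fst (snd x)) * iexp (t * snd (snd d) * snd (snd x))))" for x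
      unfolding fixed_point_rhs_alt by (simp add: exp_add[symmetric] algebra_simps)
    then have "(CLINT x|cubed. iexp (t * fixed_point_rhs (d, x))) = iexp (t * limit_cost d) *
        (CLINT x|cubed. iexp (t * fst d * fst x) * (iexp (t * fst (snd d) * fst (snd x)) * iexp (t * snd (snd d) * snd (snd x))))"
      by simp
    also have "(CLINT x|cubed. iexp (t * fst d * fst x) * (iexp (t * fst (snd d) * fst (snd x)) * iexp (t * snd (snd d) * snd (snd x)))) =
        char \<mu> (t * fst d) * (char \<mu> (t * fst (snd d)) * char \<mu> (t * snd (snd d)))"
      unfolding char_def by (rule integral_mult_cubed) (auto intro: integrable_iexp)
    finally show "(CLINT x|cubed. iexp (t * fixed_point_rhs (d, x))) = mixture_char t d" by (simp add: mixture_char_def)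
  qed
  finally show ?thesis .
qed

lemma mixture_char_measurable [measurable]: "mixture_char t \<in> borel_measurable borel"
  unfolding mixture_char_def by measurable

lemma mixture_char_norm: "norm (mixture_char t d) \<le> 1"
  unfolding mixture_char_def norm_mult
  by (auto intro!: mult_le_one mult_nonneg_nonneg cmod_char_le_1)

end

section \<open>Estimates for characteristic functions\<close>

lemma norm_mult3_diff:
  fixes a b c :: complex
  assumes "norm a \<le> 1" "norm b \<le> 1" "norm c \<le> 1" "norm a' \<le> 1" "norm b' \<le> 1" "norm c' \<le> 1"
  shows "norm (a * (b * c) - a' * (b' * c')) \<le> norm (a - a') + norm (b - b') + norm (c - c')"
proof -
  have "a * (b * c) - a' * (b' * c') = (a - a') * (b * c) + a' * ((b - b') * c) + a' * (b' * (c - c'))"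
    by (simp add: algebra_simps)
  moreover have "norm ((a - a') * (b * c)) \<le> norm (a - a')" "norm (a' * ((b - b') * c)) \<le> norm (b - b')"
      "norm (a' * (b' * (c - c'))) \<le> norm (c - c')"
  proof -
    have r: "x * (y * z) \<le> x" if "0 \<le> x" "0 \<le> y" "y \<le> 1" "0 \<le> z" "z \<le> 1" for x y z :: real
      using mult_left_le[OF mult_le_one[OF that(3-5)] that(1)] .
    show "norm ((a - a') * (b * c)) \<le> norm (a - a')" unfolding norm_mult using assms by (intro r) auto
    show "norm (a' * ((b - b') * c)) \<le> norm (b - b')"
      unfolding norm_mult using r[of "norm (b - b')" "norm a'" "norm c"] assms by (simp add: mult.left_commute)
    show "norm (a' * (b' * (c - c'))) \<le> norm (c - c')"
      unfolding norm_mult using r[of "norm (c - c')" "norm a'" "norm b'"] assms by (simp add: mult_ac)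
  qed
  ultimately show ?thesis by (metis (no_types, lifting) add_mono norm_triangle_mono)
qed

lemma iexp_diff_le: "norm (iexp x - iexp y) \<le> \<bar>x - y\<bar>"
proof -
  have "iexp x - iexp y = iexp y * (iexp (x - y) - 1)"
    by (simp add: right_diff_distrib exp_add[symmetric] algebra_simps)
  moreover have "norm (iexp (x - y) - 1) \<le> \<bar>x - y\<bar>" using iexp_approx1[of "x - y" 0] by simp
  ultimately show ?thesis by (simp add: norm_mult)
qed

definition second_moment :: "real measure \<Rightarrow> real" where
  "second_moment \<mu> = (\<integral>x. x\<^sup>2 \<partial>\<mu>)"

text \<open>The quadratic Taylor bound under the integral sign. For centred laws it shows that any
  two characteristic functions differ by \<open>O(t^2)\<close>, the starting point of the
  contraction arguments.\<close>

lemma (in real_distribution) char_first_order: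
  assumes "integrable M (\<lambda>x. x)" "integrable M (\<lambda>x. x\<^sup>2)"
  shows "norm (char M t - 1 - \<i> * t * (\<integral>x. x \<partial>M)) \<le> second_moment M / 2 * t\<^sup>2"
proof -
  have int: "integrable M (\<lambda>x. iexp (t * x))" by (intro integrable_iexp) auto
  have int2: "integrable M (\<lambda>x. \<i> * t * complex_of_real x)" using assms(1) by auto
  have "char M t - 1 - \<i> * t * (\<integral>x. x \<partial>M) = (CLINT x|M. iexp (t * x) - 1 - \<i> * t * x)"
  proof -
    have "prob UNIV = 1" by (metis prob_space space_eq_univ)
    then show ?thesis using int int2 by (simp add: char_def)
  qed
  also have "norm \<dots> \<le> (\<integral>x. norm (iexp (t * x) - 1 - \<i> * t * x) \<partial>M)" by (rule integral_norm_bound)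
  also have "\<dots> \<le> (\<integral>x. t\<^sup>2 / 2 * x\<^sup>2 \<partial>M)"
  proof (rule integral_mono)
    show "integrable M (\<lambda>x. norm (iexp (t * x) - 1 - \<i> * t * x))" using int int2 by auto
    show "integrable M (\<lambda>x. t\<^sup>2 / 2 * x\<^sup>2)" using assms by auto
    show "norm (iexp (t * x) - 1 - \<i> * t * x) \<le> t\<^sup>2 / 2 * x\<^sup>2" for x
      using iexp_approx1[of "t * x" 1] by (simp add: power2_eq_square algebra_simps)
  qed
  also have "\<dots> = second_moment M / 2 * t\<^sup>2" by (simp add: second_moment_def)
  finally show ?thesis .
qed

lemma (in real_distribution) char_lipschitz:
  assumes "integrable M (\<lambda>x. x)"
  shows "norm (char M s - char M t) \<le> (\<integral>x. \<bar>x\<bar> \<partial>M) * \<bar>s - t\<bar>"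
proof -
  have int: "integrable M (\<lambda>x. iexp (u * x))" for u by (intro integrable_iexp) auto
  have "char M s - char M t = (CLINT x|M. iexp (s * x) - iexp (t * x))"
    using int[of s] int[of t] by (simp add: char_def)
  also have "norm \<dots> \<le> (\<integral>x. norm (iexp (s * x) - iexp (t * x)) \<partial>M)"
    by (rule integral_norm_bound)
  also have "\<dots> \<le> (\<integral>x. \<bar>s - t\<bar> * \<bar>x\<bar> \<partial>M)"
  proof (rule integral_mono)
    show "integrable M (\<lambda>x. norm (iexp (s * x) - iexp (t * x)))" using int by auto
    show "integrable M (\<lambda>x. \<bar>s - t\<bar> * \<bar>x\<bar>)" using assms by auto
    show "norm (iexp (s * x) - iexp (t * x)) \<le> \<bar>s - t\<bar> * \<bar>x\<bar>" for x
      using iexp_diff_le[of "s * x" "t * x"] by (simp add: abs_mult[symmetric] left_diff_distrib)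
  qed
  finally show ?thesis by (simp add: mult.commute)
qed

text \<open>The factor \<open>1 / 2\<close> is \<open>E (D\<^sub>1\<^sup>2 + D\<^sub>2\<^sup>2 + D\<^sub>3\<^sup>2)\<close>.\<close>

lemma char_image_law_contraction:
  assumes "law \<mu>" "law \<nu>" and diff: "\<And>t. norm (char \<mu> t - char \<nu> t) \<le> L * t\<^sup>2"
  shows "norm (char (law.image_law \<mu>) t - char (law.image_law \<nu>) t) \<le> L / 2 * t\<^sup>2"
proof -
  interpret A: law \<mu> by fact
  interpret B: law \<nu> by fact
  have intA: "integrable spacings_law (A.mixture_char t)" "integrable spacings_law (B.mixture_char t)"
    by (rule A.S.integrable_const_bound[of _ 1]; simp add: A.mixture_char_norm B.mixture_char_norm)+
  have sq: "integrable spacings_law (\<lambda>d. (fst d)\<^sup>2 + (fst (snd d))\<^sup>2 + (snd (snd d))\<^sup>2)"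
  proof (rule A.S.integrable_const_bound[of _ 3], rule eventually_mono[OF AE_spacings_law])
    fix d assume "in_simplex d"
    then obtain d1 d2 d3 where d: "d = (d1, d2, d3)" "0 \<le> d1" "0 \<le> d2" "0 \<le> d3" "d1 + d2 + d3 = 1" by (cases d) auto
    have "d1\<^sup>2 \<le> 1" "d2\<^sup>2 \<le> 1" "d3\<^sup>2 \<le> 1" using d by (auto simp: power_le_one)
    then show "norm ((fst d)\<^sup>2 + (fst (snd d))\<^sup>2 + (snd (snd d))\<^sup>2) \<le> 3" by (simp add: d)
  qed measurable
  have "char A.image_law t - char B.image_law t = (CLINT d|spacings_law. A.mixture_char t d - B.mixture_char t d)"
    using intA by (simp add: A.char_image_law B.char_image_law)
  also have "norm \<dots> \<le> (\<integral>d. norm (A.mixture_char t d - B.mixture_char t d) \<partial>spacings_law)"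
    by (rule integral_norm_bound)
  also have "\<dots> \<le> (\<integral>d. L * t\<^sup>2 * ((fst d)\<^sup>2 + (fst (snd d))\<^sup>2 + (snd (snd d))\<^sup>2) \<partial>spacings_law)"
  proof (rule integral_mono)
    show "norm (A.mixture_char t d - B.mixture_char t d) \<le> L * t\<^sup>2 * ((fst d)\<^sup>2 + (fst (snd d))\<^sup>2 + (snd (snd d))\<^sup>2)" for d
    proof -
      have "norm (A.mixture_char t d - B.mixture_char t d) \<le> norm (char \<mu> (t * fst d) - char \<nu> (t * fst d)) +
          norm (char \<mu> (t * fst (snd d)) - char \<nu> (t * fst (snd d))) + norm (char \<mu> (t * snd (snd d)) - char \<nu> (t * snd (snd d)))"
        unfolding A.mixture_char_def B.mixture_char_def right_diff_distrib[symmetric] norm_mult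
        by (simp add: norm_mult3_diff A.cmod_char_le_1 B.cmod_char_le_1)
      also have "\<dots> \<le> L * (t * fst d)\<^sup>2 + L * (t * fst (snd d))\<^sup>2 + L * (t * snd (snd d))\<^sup>2"
        by (intro add_mono diff)
      finally show ?thesis by (simp add: power_mult_distrib distrib_left mult.assoc)
    qed
  qed (use intA sq in auto)
  also have "\<dots> = L / 2 * t\<^sup>2" using sq squares_mean by simp
  finally show ?thesis .
qed


lemma limit_cost_variance_nonneg: "0 \<le> limit_cost_variance"
  by (simp add: limit_cost_square_mean[symmetric])

lemma limit_cost_integrable: "integrable spacings_law limit_cost" "integrable spacings_law (\<lambda>d. (limit_cost d)\<^sup>2)"
proof -
  obtain B where B: "\<And>d. d \<in> cube \<Longrightarrow> \<bar>limit_cost d\<bar> \<le> B" using limit_cost_bounded by blast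
  have B': "\<bar>limit_cost d\<bar> \<le> B" if "in_simplex d" for d by (rule B[OF in_simplex_imp_cube[OF that]])
  show "integrable spacings_law limit_cost" by (rule integral_spacings_law(1)[OF limit_cost_measurable B'])
  show "integrable spacings_law (\<lambda>d. (limit_cost d)\<^sup>2)"
    by (rule integral_spacings_law(1)[of _ "B\<^sup>2"])
       (use power_mono[OF B', of _ 2] in auto)
qed

lemma centered_square_integrable_law: "centered_square_integrable \<mu> \<Longrightarrow> law \<mu>"
  by (simp add: centered_square_integrable_def law_def)

lemma integrable_spacings_coordinates:
  "integrable spacings_law fst" "integrable spacings_law (\<lambda>d. fst (snd d))" "integrable spacings_law (\<lambda>d. snd (snd d))"
  "integrable spacings_law (\<lambda>d. (fst d)\<^sup>2)" "integrable spacings_law (\<lambda>d. (fst (snd d))\<^sup>2)"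
  "integrable spacings_law (\<lambda>d. (snd (snd d))\<^sup>2)"
  by (rule integral_spacings_law(1)[of _ 1];
      auto simp: power_le_one intro!: borel_measurable_continuous_onI continuous_intros)+

context
  fixes \<mu> :: "real measure"
  assumes csi: "centered_square_integrable \<mu>"
begin

interpretation law \<mu> by (rule centered_square_integrable_law[OF csi])

lemma csi_facts:
  "integrable \<mu> (\<lambda>x. x)" "(\<integral>x. x \<partial>\<mu>) = 0" "integrable \<mu> (\<lambda>x. x\<^sup>2)"
  using csi by (auto simp: centered_square_integrable_def)

text \<open>For fixed spacings all mixed terms vanish, because the copies are independent and
  centred. Of the rest, \<open>limit_cost\<close> contributes its moments and the squared spacings
  their mean sum \<open>1 / 2\<close>.\<close>

lemma image_law_moments:
  "centered_square_integrable (law.image_law \<mu>)"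
  "second_moment (law.image_law \<mu>) = limit_cost_variance + second_moment \<mu> / 2"
proof -
  have one: "integrable \<mu> (\<lambda>_. 1 :: real)" by simp
  have [simp]: "prob UNIV = 1" by (metis prob_space space_eq_univ)
  have e: "fixed_point_rhs z = limit_cost (fst z) + fst (fst z) * fst (snd z) + fst (snd (fst z)) * fst (snd (snd z)) + snd (snd (fst z)) * snd (snd (snd z))" for z
    by (cases z) (simp add: fixed_point_rhs_alt)
  note x = csi_facts
  note c1 = integral_mult_cubed[OF x(1) one one] and c2 = integral_mult_cubed[OF one x(1) one]
    and c3 = integral_mult_cubed[OF one one x(1)]
    and s1 = integral_mult_cubed[OF x(3) one one] and s2 = integral_mult_cubed[OF one x(3) one]
    and s3 = integral_mult_cubed[OF one one x(3)]
    and p12 = integral_mult_cubed[OF x(1) x(1) one] and p13 = integral_mult_cubed[OF x(1) one x(1)]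
    and p23 = integral_mult_cubed[OF one x(1) x(1)]
  note co = integrable_spacings_coordinates
  have one_l: "integrable spacings_law (\<lambda>_. 1 :: real)" and one_c: "integrable cubed (\<lambda>_. 1 :: real)" by simp_all
  have lin: "integrable (spacings_law \<Otimes>\<^sub>M cubed) (\<lambda>z. fixed_point_rhs z)"
    using P4.integral_mult_pair(1)[OF limit_cost_integrable(1) one_c] P4.integral_mult_pair(1)[OF co(1) c1(1)]
      P4.integral_mult_pair(1)[OF co(2) c2(1)] P4.integral_mult_pair(1)[OF co(3) c3(1)]
    unfolding e by (intro Bochner_Integration.integrable_add) simp_all
  have quad: "integrable (spacings_law \<Otimes>\<^sub>M cubed) (\<lambda>z. (fixed_point_rhs z)\<^sup>2)"
  proof (rule Bochner_Integration.integrable_bound)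
    show "integrable (spacings_law \<Otimes>\<^sub>M cubed) (\<lambda>z. 4 * ((limit_cost (fst z))\<^sup>2 + (fst (fst z))\<^sup>2 * (fst (snd z))\<^sup>2 +
        (fst (snd (fst z)))\<^sup>2 * (fst (snd (snd z)))\<^sup>2 + (snd (snd (fst z)))\<^sup>2 * (snd (snd (snd z)))\<^sup>2))"
      using P4.integral_mult_pair(1)[OF limit_cost_integrable(2) one_c] P4.integral_mult_pair(1)[OF co(4) s1(1)]
        P4.integral_mult_pair(1)[OF co(5) s2(1)] P4.integral_mult_pair(1)[OF co(6) s3(1)]
      by (intro integrable_mult_right Bochner_Integration.integrable_add) simp_all
    \<comment> \<open>Integrability has to be known before the order of integration may be
      exchanged; this inequality reduces it to products of integrable factors in separate
      variables.\<close>
    have sq4: "(a + b + c + d)\<^sup>2 \<le> 4 * (a\<^sup>2 + b\<^sup>2 + c\<^sup>2 + d\<^sup>2)" for a b c d :: real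
    proof -
      have "0 \<le> (a - b)\<^sup>2 + (a - c)\<^sup>2 + (a - d)\<^sup>2 + (b - c)\<^sup>2 + (b - d)\<^sup>2 + (c - d)\<^sup>2" by simp
      then show ?thesis by (simp add: power2_eq_square algebra_simps)
    qed
    show "AE z in spacings_law \<Otimes>\<^sub>M cubed. norm ((fixed_point_rhs z)\<^sup>2) \<le> norm (4 * ((limit_cost (fst z))\<^sup>2 + (fst (fst z))\<^sup>2 * (fst (snd z))\<^sup>2 +
        (fst (snd (fst z)))\<^sup>2 * (fst (snd (snd z)))\<^sup>2 + (snd (snd (fst z)))\<^sup>2 * (snd (snd (snd z)))\<^sup>2))"
    proof (rule AE_I2)
      fix z
      note sq4[of "limit_cost (fst z)" "fst (fst z) * fst (snd z)" "fst (snd (fst z)) * fst (snd (snd z))" "snd (snd (fst z)) * snd (snd (snd z))"]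
      then show "norm ((fixed_point_rhs z)\<^sup>2) \<le> norm (4 * ((limit_cost (fst z))\<^sup>2 + (fst (fst z))\<^sup>2 * (fst (snd z))\<^sup>2 +
        (fst (snd (fst z)))\<^sup>2 * (fst (snd (snd z)))\<^sup>2 + (snd (snd (fst z)))\<^sup>2 * (snd (snd (snd z)))\<^sup>2))"
        unfolding e power_mult_distrib by simp
    qed
  qed measurable
  have "(\<integral>x. x \<partial>image_law) = (\<integral>z. fixed_point_rhs z \<partial>(spacings_law \<Otimes>\<^sub>M cubed))"
    unfolding image_law_def by (rule integral_distr) measurable
  also have "\<dots> = (\<integral>d. (\<integral>x. fixed_point_rhs (d, x) \<partial>cubed) \<partial>spacings_law)"
    by (rule P4.integral_fst'[OF lin, symmetric])
  also have "\<dots> = (\<integral>d. limit_cost d \<partial>spacings_law)"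
  proof (intro Bochner_Integration.integral_cong refl)
    fix d
    show "(\<integral>x. fixed_point_rhs (d, x) \<partial>cubed) = limit_cost d"
      using c1 c2 c3 x(2) by (simp add: e P3.P.prob_space)
  qed
  finally have mean: "(\<integral>x. x \<partial>image_law) = 0" by (simp add: limit_cost_mean)
  have "(\<integral>x. x\<^sup>2 \<partial>image_law) = (\<integral>z. (fixed_point_rhs z)\<^sup>2 \<partial>(spacings_law \<Otimes>\<^sub>M cubed))"
    unfolding image_law_def by (rule integral_distr) measurable
  also have "\<dots> = (\<integral>d. (\<integral>x. (fixed_point_rhs (d, x))\<^sup>2 \<partial>cubed) \<partial>spacings_law)"
    by (rule P4.integral_fst'[OF quad, symmetric])
  also have "\<dots> = (\<integral>d. (limit_cost d)\<^sup>2 + second_moment \<mu> * ((fst d)\<^sup>2 + (fst (snd d))\<^sup>2 + (snd (snd d))\<^sup>2) \<partial>spacings_law)"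
  proof (intro Bochner_Integration.integral_cong refl)
    fix d :: "real \<times> real \<times> real"
    define b d1 d2 d3 where "b = limit_cost d" and "d1 = fst d" and "d2 = fst (snd d)" and "d3 = snd (snd d)"
    have "(\<integral>x. (fixed_point_rhs (d, x))\<^sup>2 \<partial>cubed) = (\<integral>x. b\<^sup>2 * 1 + d1\<^sup>2 * (fst x)\<^sup>2 + d2\<^sup>2 * (fst (snd x))\<^sup>2 + d3\<^sup>2 * (snd (snd x))\<^sup>2 +
        2 * b * d1 * fst x + 2 * b * d2 * fst (snd x) + 2 * b * d3 * snd (snd x) + 2 * d1 * d2 * (fst x * fst (snd x)) +
        2 * d1 * d3 * (fst x * snd (snd x)) + 2 * d2 * d3 * (fst (snd x) * snd (snd x)) \<partial>cubed)"
      by (intro Bochner_Integration.integral_cong refl)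
         (simp add: e b_def d1_def d2_def d3_def power2_eq_square algebra_simps)
    also have "\<dots> = b\<^sup>2 + second_moment \<mu> * (d1\<^sup>2 + d2\<^sup>2 + d3\<^sup>2)"
      using c1 c2 c3 s1 s2 s3 p12 p13 p23 x(2)
      by (simp add: P3.P.prob_space second_moment_def) (simp add: distrib_left mult.commute)
    finally show "(\<integral>x. (fixed_point_rhs (d, x))\<^sup>2 \<partial>cubed) =
        (limit_cost d)\<^sup>2 + second_moment \<mu> * ((fst d)\<^sup>2 + (fst (snd d))\<^sup>2 + (snd (snd d))\<^sup>2)"
      by (simp add: b_def d1_def d2_def d3_def)
  qed
  also have "\<dots> = limit_cost_variance + second_moment \<mu> * (1 / 2)"
    using limit_cost_integrable(2) co(4-6) squares_mean limit_cost_square_mean by simp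
  finally show "second_moment image_law = limit_cost_variance + second_moment \<mu> / 2"
    by (simp add: second_moment_def)
  show "centered_square_integrable image_law"
    unfolding centered_square_integrable_def
    using real_distribution_image_law mean lin quad
    by (auto simp: image_law_def integrable_distr_eq)
qed

end


section \<open>Existence and uniqueness of the fixed point\<close>

lemma fixed_point_solution_iff:
  "law \<mu> \<Longrightarrow> fixed_point_solution \<mu> \<longleftrightarrow> law.image_law \<mu> = \<mu>"
  by (simp add: fixed_point_solution_def law.image_law_def)

lemma char_minus_1_le:
  assumes "centered_square_integrable \<mu>"
  shows "norm (char \<mu> t - 1) \<le> second_moment \<mu> / 2 * t\<^sup>2"
  using real_distribution.char_first_order[of \<mu> t] assms by (auto simp: centered_square_integrable_def)

text \<open>The characteristic functions of two centred laws differ by at most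
  \<open>C * t^2\<close>, and each application of the map halves \<open>C\<close>. Fixed points
  survive any number of applications.\<close>

lemma fixed_point_unique:
  assumes "centered_square_integrable \<mu>" "fixed_point_solution \<mu>"
    and "centered_square_integrable \<nu>" "fixed_point_solution \<nu>"
  shows "\<nu> = \<mu>"
proof -
  note l = centered_square_integrable_law[OF assms(1)] centered_square_integrable_law[OF assms(3)]
  define C where "C = second_moment \<nu> / 2 + second_moment \<mu> / 2"
  have bound: "norm (char \<nu> t - char \<mu> t) \<le> C / 2 ^ k * t\<^sup>2" for k t
  proof (induction k arbitrary: t)
    case 0
    have "norm (char \<nu> t - char \<mu> t) \<le> norm (char \<nu> t - 1) + norm (char \<mu> t - 1)"
      using norm_triangle_ineq4[of "char \<nu> t - 1" "char \<mu> t - 1"] by simp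
    with char_minus_1_le[OF assms(1), of t] char_minus_1_le[OF assms(3), of t]
    show ?case by (simp add: C_def algebra_simps)
  next
    case (Suc k)
    have "law.image_law \<nu> = \<nu>" "law.image_law \<mu> = \<mu>"
      using assms l by (auto simp: fixed_point_solution_iff)
    then show ?case using char_image_law_contraction[OF l(2,1) Suc, of t] by (simp add: mult.commute)
  qed
  have "char \<nu> t = char \<mu> t" for t
  proof -
    have "(\<lambda>k. C * t\<^sup>2 * (1 / 2) ^ k) \<longlonglongrightarrow> C * t\<^sup>2 * 0"
      by (intro tendsto_intros LIMSEQ_realpow_zero) auto
    then have "norm (char \<nu> t - char \<mu> t) \<le> 0"
      by (intro LIMSEQ_le_const[where X = "\<lambda>k. C * t\<^sup>2 * (1 / 2) ^ k"])
         (use bound[of t] in \<open>auto simp: power_divide mult_ac\<close>)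
    then show ?thesis by simp
  qed
  then show ?thesis using l by (intro Levy_uniqueness) (auto simp: law_def)
qed

text \<open>Successive approximation, started from the point mass at 0, the simplest centred
  law.\<close>

fun iterated_law :: "nat \<Rightarrow> real measure" where
  "iterated_law 0 = return borel 0"
| "iterated_law (Suc k) = law.image_law (iterated_law k)"

text \<open>With \<open>V\<close> for \<open>limit_cost_variance\<close>, the bound
  \<open>2 V\<close> reproduces itself since \<open>V + (2 V) / 2 = 2 V\<close>. It later yields
  tightness of the iterates.\<close>

lemma iterated_law_moments:
  "centered_square_integrable (iterated_law k) \<and> second_moment (iterated_law k) \<le> 2 * limit_cost_variance"
proof (induction k)
  case 0
  have "real_distribution (return borel (0 :: real))"
    by (intro real_distribution.intro real_distribution_axioms.intro prob_space_return) auto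
  moreover have int0: "integrable (return borel 0) f" if f [measurable]: "f \<in> borel_measurable borel" for f :: "real \<Rightarrow> real"
  proof -
    interpret R: prob_space "return borel (0 :: real)" by (rule prob_space_return) simp
    have "AE x in return borel (0 :: real). norm (f x) \<le> norm (f 0)" by (subst AE_return) (simp, measurable)
    then show ?thesis
    proof (rule R.integrable_const_bound)
      show "f \<in> borel_measurable (return borel 0)"
        using f measurable_cong_sets[OF sets_return[of borel 0] refl, of borel] by blast
    qed
  qed
  have "integrable (return borel 0) (\<lambda>x :: real. x)" "integrable (return borel 0) (\<lambda>x :: real. x\<^sup>2)"
    by (rule int0, simp)+
  moreover have "second_moment (return borel 0) = 0" "(\<integral>x. x \<partial>(return borel (0 :: real))) = 0"
    unfolding second_moment_def by (subst integral_return; simp)+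
  ultimately show ?case
    using limit_cost_variance_nonneg by (simp add: centered_square_integrable_def)
next
  case (Suc k)
  then show ?case using image_law_moments[of "iterated_law k"] by simp
qed

text \<open>Chebyshev's inequality with one radius for all laws. The summand 1 in the radius keeps
  it positive and the inequality strict even for \<open>C = 0\<close>.\<close>

lemma tight_of_second_moments:
  assumes rd: "\<And>k. real_distribution (M k)" and int: "\<And>k. integrable (M k) (\<lambda>x. x\<^sup>2)"
    and le: "\<And>k. (\<integral>x. x\<^sup>2 \<partial>(M k)) \<le> C"
  shows "tight M"
  unfolding tight_def
proof (intro conjI allI impI rd)
  fix e :: real assume e: "0 < e"
  have C: "0 \<le> C" using le[of 0] by (rule order_trans[rotated]) simp
  define R where "R = sqrt (C / e) + 1"
  have R: "C / e < R\<^sup>2" "0 < R"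
  proof -
    have "0 \<le> sqrt (C / e)" using C e by simp
    then show "0 < R" unfolding R_def by (rule add_nonneg_pos) simp
    have "C / e = (sqrt (C / e))\<^sup>2" using C e by simp
    also have "\<dots> < R\<^sup>2" unfolding R_def using \<open>0 \<le> sqrt (C / e)\<close> by (intro power_strict_mono) auto
    finally show "C / e < R\<^sup>2" .
  qed
  show "\<exists>a b. a < b \<and> (\<forall>n. 1 - e < measure (M n) {a<..b})"
  proof (intro exI conjI allI)
    show "- R < R" using R by simp
    fix n
    interpret real_distribution "M n" by (rule rd)
    have "measure (M n) {x \<in> space (M n). R\<^sup>2 \<le> x\<^sup>2} \<le> (\<integral>x. x\<^sup>2 \<partial>(M n)) / R\<^sup>2"
      by (rule integral_Markov_inequality_measure[where A = "{}"]) (use int[of n] R in auto)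
    also have "\<dots> \<le> C / R\<^sup>2" using le by (intro divide_right_mono) auto
    also have "\<dots> < e" using R e by (simp add: divide_simps mult.commute)
    finally have "measure (M n) {x \<in> space (M n). R\<^sup>2 \<le> x\<^sup>2} < e" .
    moreover have "1 - measure (M n) {x \<in> space (M n). R\<^sup>2 \<le> x\<^sup>2} = measure (M n) (space (M n) - {x \<in> space (M n). R\<^sup>2 \<le> x\<^sup>2})"
      by (subst prob_compl) auto
    moreover have "\<dots> \<le> measure (M n) {- R<..R}"
    proof (rule finite_measure_mono)
      show "space (M n) - {x \<in> space (M n). R\<^sup>2 \<le> x\<^sup>2} \<subseteq> {- R<..R}"
      proof
        fix x assume "x \<in> space (M n) - {x \<in> space (M n). R\<^sup>2 \<le> x\<^sup>2}"
        then have "\<bar>x\<bar> < \<bar>R\<bar>" by (auto simp: not_le abs_square_less_1 power2_less_imp_less intro: power2_less_imp_less)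
        then show "x \<in> {- R<..R}" using R by auto
      qed
    qed auto
    ultimately show "1 - e < measure (M n) {- R<..R}" by linarith
  qed
qed

text \<open>\<open>2 n^2 (1 - cos (x / n))\<close> tends to \<open>x^2\<close>, and its integral is
  given by the real part of the characteristic function at \<open>1 / n\<close>, hence at most
  \<open>2 C\<close>; Fatou's lemma yields the second moment. A nonzero mean would appear as a
  linear term, which the quadratic bound excludes near 0.\<close>

lemma square_integrable_of_char:
  assumes "real_distribution M" and le: "\<And>t. norm (char M t - 1) \<le> C * t\<^sup>2"
  shows "integrable M (\<lambda>x. x)" "integrable M (\<lambda>x. x\<^sup>2)" "(\<integral>x. x \<partial>M) = 0"
proof -
  interpret real_distribution M by fact
  define f where "f n x = 2 * (real n)\<^sup>2 * (1 - cos (x / real n))" for n and x :: real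
  have C: "0 \<le> C" using order_trans[OF norm_ge_zero le[of 1]] by simp
  have lim: "(\<lambda>n. f n x) \<longlonglongrightarrow> x\<^sup>2" for x
  proof (cases "x = 0")
    case False
    have "(\<lambda>n. 2 * (real n)\<^sup>2 * (1 - cos (y / real n))) \<longlonglongrightarrow> y * y" if "0 < y" for y
      using that by real_asymp
    from this[of x] this[of "- x"] False show ?thesis
      by (cases "0 < x") (simp_all add: f_def power2_eq_square)
  qed (simp add: f_def)
  have f_int: "integrable M (f n)" for n
  proof (rule integrable_const_bound)
    have "norm (f n x) \<le> 2 * (real n)\<^sup>2 * 2" for x
    proof -
      have "1 - cos (x / real n) \<le> 2" using cos_ge_minus_one[of "x / real n"] by linarith
      then have "f n x \<le> 2 * (real n)\<^sup>2 * 2" unfolding f_def by (rule mult_left_mono) simp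
      moreover have "0 \<le> f n x" by (simp add: f_def)
      ultimately show ?thesis by simp
    qed
    then show "AE x in M. norm (f n x) \<le> 2 * (real n)\<^sup>2 * 2" by simp
  qed (unfold f_def[abs_def], measurable)
  have f0: "0 \<le> f n x" for n x by (simp add: f_def)
  have f_le: "(\<integral>x. f n x \<partial>M) \<le> 2 * C" for n
  proof (cases "n = 0")
    case False
    have int: "integrable M (\<lambda>x. iexp (1 / real n * x))" by (intro integrable_iexp) auto
    have "Re (char M (1 / real n)) = (\<integral>x. cos (x / real n) \<partial>M)"
      unfolding char_def using int by (subst integral_Re[symmetric]) (auto simp: Re_exp)
    moreover have "integrable M (\<lambda>x. cos (x / real n))"
      by (rule integrable_const_bound[of _ 1]) auto
    ultimately have "(\<integral>x. f n x \<partial>M) = 2 * (real n)\<^sup>2 * (1 - Re (char M (1 / real n)))"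
      using prob_space by (simp add: f_def)
    also have "\<dots> \<le> 2 * (real n)\<^sup>2 * (C * (1 / real n)\<^sup>2)"
    proof (rule mult_left_mono)
      show "1 - Re (char M (1 / real n)) \<le> C * (1 / real n)\<^sup>2"
        using le[of "1 / real n"] abs_Re_le_cmod[of "char M (1 / real n) - 1"] by simp
    qed simp
    also have "\<dots> = 2 * C" using False by (simp add: power_divide)
    finally show ?thesis .
  qed (use C in \<open>simp add: f_def\<close>)
  have "(\<integral>\<^sup>+x. ennreal (x\<^sup>2) \<partial>M) = (\<integral>\<^sup>+x. liminf (\<lambda>n. ennreal (f n x)) \<partial>M)"
    by (intro nn_integral_cong lim_imp_Liminf[symmetric] tendsto_ennrealI lim) auto
  also have "\<dots> \<le> liminf (\<lambda>n. \<integral>\<^sup>+x. ennreal (f n x) \<partial>M)"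
    by (rule nn_integral_liminf) (auto simp: f_def)
  also have "\<dots> \<le> liminf (\<lambda>n. ennreal (2 * C))"
    by (intro Liminf_mono always_eventually allI)
       (subst nn_integral_eq_integral[OF f_int], auto simp: f0 f_le intro!: ennreal_leI)
  also have "\<dots> < \<infinity>" by (simp add: Liminf_const)
  finally show sq: "integrable M (\<lambda>x. x\<^sup>2)" by (simp add: integrable_iff_bounded)
  then show x: "integrable M (\<lambda>x. x)" by (rule square_integrable_imp_integrable[rotated]) auto
  define m where "m = (\<integral>x. x \<partial>M)"
  have "\<bar>m\<bar> \<le> (C + second_moment M / 2) * t" if t: "0 < t" for t
  proof -
    have "norm (\<i> * t * m) \<le> norm (char M t - 1) + norm (char M t - 1 - \<i> * t * m)"
      using norm_triangle_ineq4[of "char M t - 1" "char M t - 1 - \<i> * t * m"] by simp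
    also have "\<dots> \<le> C * t\<^sup>2 + second_moment M / 2 * t\<^sup>2"
      unfolding m_def by (intro add_mono le char_first_order x sq)
    finally have "\<bar>m\<bar> * t \<le> (C + second_moment M / 2) * t * t"
      using t by (simp add: norm_mult power2_eq_square algebra_simps)
    then show ?thesis using t by simp
  qed
  then have "\<bar>m\<bar> \<le> 0"
  proof (intro tendsto_lowerbound[of "\<lambda>t. (C + second_moment M / 2) * t" 0 "at_right 0"])
    show "((\<lambda>t. (C + second_moment M / 2) * t) \<longlongrightarrow> 0) (at_right 0)" by (auto intro!: tendsto_eq_intros)
    show "\<forall>\<^sub>F t in at_right 0. \<bar>m\<bar> \<le> (C + second_moment M / 2) * t" if "\<And>t. 0 < t \<Longrightarrow> \<bar>m\<bar> \<le> (C + second_moment M / 2) * t"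
      using that by (auto simp: eventually_at_right_less intro: eventually_mono[OF eventually_at_right_less])
  qed simp
  then show "(\<integral>x. x \<partial>M) = 0" by (simp add: m_def)
qed

text \<open>The characteristic functions of the iterates converge geometrically at each point, and
  tightness supplies a law to which the limit belongs. Weak convergence alone does not transfer
  moments; the limit is centred and square integrable because the bound by \<open>t^2\<close> passes
  to the limit pointwise.\<close>

lemma fixed_point_exists:
  obtains \<mu> where "centered_square_integrable \<mu>" "fixed_point_solution \<mu>"
    "second_moment \<mu> = 2 * limit_cost_variance"
proof -
  let ?M = iterated_law and ?V = limit_cost_variance
  note csi = iterated_law_moments[THEN conjunct1] and m2 = iterated_law_moments[THEN conjunct2]
  note l = centered_square_integrable_law[OF csi]
  have step: "norm (char (?M (Suc k)) t - char (?M k) t) \<le> 2 * ?V / 2 ^ k * t\<^sup>2" for k t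
  proof (induction k arbitrary: t)
    case 0
    have "norm (char (?M (Suc 0)) t - char (?M 0) t) \<le> norm (char (?M (Suc 0)) t - 1) + norm (char (?M 0) t - 1)"
      using norm_triangle_ineq4[of "char (?M (Suc 0)) t - 1" "char (?M 0) t - 1"] by simp
    also have "\<dots> \<le> second_moment (?M (Suc 0)) / 2 * t\<^sup>2 + second_moment (?M 0) / 2 * t\<^sup>2"
      by (intro add_mono char_minus_1_le csi)
    also have "\<dots> \<le> ?V * t\<^sup>2 + ?V * t\<^sup>2"
      using m2[of "Suc 0"] m2[of 0] by (intro add_mono mult_right_mono) auto
    finally show ?case by simp
  next
    case (Suc k)
    show ?case using char_image_law_contraction[OF l l Suc, of t] by (simp add: mult.commute)
  qed
  have "tight ?M"
    by (rule tight_of_second_moments[where C = "2 * ?V"])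
       (use csi m2 in \<open>auto simp: centered_square_integrable_def second_moment_def\<close>)
  from tight_imp_convergent_subsubsequence[OF this, of id]
  obtain r \<mu> where r: "strict_mono r" "real_distribution \<mu>" "weak_conv_m (?M \<circ> r) \<mu>"
    by (auto simp: strict_mono_id)
  have lm: "law \<mu>" using r(2) by (simp add: law_def)
  have conv: "(\<lambda>k. char (?M k) t) \<longlonglongrightarrow> char \<mu> t" "norm (char \<mu> t - char (?M k) t) \<le> 4 * ?V / 2 ^ k * t\<^sup>2" for t k
  proof -
    \<comment> \<open>The geometric sum of the increments in closed form, so that the induction step
      is an identity.\<close>
    have tail: "norm (char (?M (k + j)) t - char (?M k) t) \<le> 2 * ?V * t\<^sup>2 * (2 / 2 ^ k - 2 / 2 ^ (k + j))" for k j
    proof (induction j)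
      case (Suc j)
      have "norm (char (?M (k + Suc j)) t - char (?M k) t) \<le>
          norm (char (?M (Suc (k + j))) t - char (?M (k + j)) t) + norm (char (?M (k + j)) t - char (?M k) t)"
        using norm_triangle_ineq[of "char (?M (Suc (k + j))) t - char (?M (k + j)) t" "char (?M (k + j)) t - char (?M k) t"] by simp
      also have "\<dots> \<le> 2 * ?V / 2 ^ (k + j) * t\<^sup>2 + 2 * ?V * t\<^sup>2 * (2 / 2 ^ k - 2 / 2 ^ (k + j))"
        by (intro add_mono step Suc)
      also have "\<dots> = 2 * ?V * t\<^sup>2 * (2 / 2 ^ k - 2 / 2 ^ (k + Suc j))" by (simp add: field_simps)
      finally show ?case .
    qed simp
    have sub: "(\<lambda>j. char (?M (r j)) t) \<longlonglongrightarrow> char \<mu> t"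
      using levy_continuity1[of "?M \<circ> r" \<mu> t] r csi by (auto simp: centered_square_integrable_def)
    have b: "norm (char \<mu> t - char (?M k) t) \<le> 4 * ?V / 2 ^ k * t\<^sup>2" for k
    proof (rule LIMSEQ_le_const2)
      show "(\<lambda>j. norm (char (?M (r j)) t - char (?M k) t)) \<longlonglongrightarrow> norm (char \<mu> t - char (?M k) t)"
        by (intro tendsto_intros sub)
      have "norm (char (?M (r j)) t - char (?M k) t) \<le> 4 * ?V / 2 ^ k * t\<^sup>2" if "k \<le> j" for j
      proof -
        have "k \<le> r j" using seq_suble[OF r(1), of j] that by simp
        then have "norm (char (?M (r j)) t - char (?M k) t) \<le> 2 * ?V * t\<^sup>2 * (2 / 2 ^ k - 2 / 2 ^ r j)"
          using tail[of k "r j - k"] by simp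
        also have "\<dots> \<le> 2 * ?V * t\<^sup>2 * (2 / 2 ^ k)"
          using limit_cost_variance_nonneg by (intro mult_left_mono) auto
        finally show ?thesis by (simp add: mult_ac)
      qed
      then show "\<exists>N. \<forall>n\<ge>N. norm (char (?M (r n)) t - char (?M k) t) \<le> 4 * ?V / 2 ^ k * t\<^sup>2" by blast
    qed
    then show "norm (char \<mu> t - char (?M k) t) \<le> 4 * ?V / 2 ^ k * t\<^sup>2" .
    show "(\<lambda>k. char (?M k) t) \<longlonglongrightarrow> char \<mu> t"
    proof (rule Lim_transform2[OF tendsto_const])
      have "(\<lambda>k. 4 * ?V * t\<^sup>2 * (1 / 2) ^ k) \<longlonglongrightarrow> 4 * ?V * t\<^sup>2 * 0"
        by (intro tendsto_intros LIMSEQ_realpow_zero) auto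
      then have lim: "(\<lambda>k. 4 * ?V * t\<^sup>2 * (1 / 2) ^ k) \<longlonglongrightarrow> 0" by simp
      have "norm (char \<mu> t - char (?M k) t) \<le> 4 * ?V * t\<^sup>2 * (1 / 2) ^ k" for k
        using b[of k] by (simp add: power_divide)
      then show "(\<lambda>k. char \<mu> t - char (?M k) t) \<longlonglongrightarrow> 0"
        by (intro Lim_null_comparison[OF _ lim] always_eventually allI)
    qed
  qed
  have char_eq: "char (law.image_law \<mu>) t = char \<mu> t" for t
  proof (rule LIMSEQ_unique)
    show "(\<lambda>k. char (?M (Suc k)) t) \<longlonglongrightarrow> char \<mu> t" using conv(1) by (rule LIMSEQ_Suc)
    show "(\<lambda>k. char (?M (Suc k)) t) \<longlonglongrightarrow> char (law.image_law \<mu>) t"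
    proof (rule Lim_transform2[OF tendsto_const])
      have "(\<lambda>k. 2 * ?V * t\<^sup>2 * (1 / 2) ^ k) \<longlonglongrightarrow> 2 * ?V * t\<^sup>2 * 0"
        by (intro tendsto_intros LIMSEQ_realpow_zero) auto
      then have lim: "(\<lambda>k. 2 * ?V * t\<^sup>2 * (1 / 2) ^ k) \<longlonglongrightarrow> 0" by simp
      have "norm (char (law.image_law \<mu>) t - char (?M (Suc k)) t) \<le> 2 * ?V * t\<^sup>2 * (1 / 2) ^ k" for k
      proof -
        have "norm (char \<mu> u - char (?M k) u) \<le> 4 * ?V / 2 ^ k * u\<^sup>2" for u by (rule conv(2))
        from char_image_law_contraction[OF lm l this, of t] show ?thesis by (simp add: power_divide)
      qed
      then show "(\<lambda>k. char (law.image_law \<mu>) t - char (?M (Suc k)) t) \<longlonglongrightarrow> 0"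
        by (intro Lim_null_comparison[OF _ lim] always_eventually allI)
    qed
  qed
  then have fp: "law.image_law \<mu> = \<mu>"
    by (intro Levy_uniqueness law.real_distribution_image_law lm r(2) ext)
  have "norm (char \<mu> t - 1) \<le> ?V * t\<^sup>2" for t
  proof (rule LIMSEQ_le_const2)
    show "(\<lambda>k. norm (char (?M k) t - 1)) \<longlonglongrightarrow> norm (char \<mu> t - 1)" by (intro tendsto_intros conv)
    have "norm (char (?M k) t - 1) \<le> ?V * t\<^sup>2" for k
    proof -
      have "norm (char (?M k) t - 1) \<le> second_moment (?M k) / 2 * t\<^sup>2" by (rule char_minus_1_le[OF csi])
      also have "\<dots> \<le> ?V * t\<^sup>2" using m2[of k] by (intro mult_right_mono) auto
      finally show ?thesis .
    qed
    then show "\<exists>N. \<forall>n\<ge>N. norm (char (?M n) t - 1) \<le> ?V * t\<^sup>2" by blast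
  qed
  from square_integrable_of_char[OF r(2) this] have c: "centered_square_integrable \<mu>"
    using r(2) by (simp add: centered_square_integrable_def)
  show thesis
  proof (rule that[OF c])
    show "fixed_point_solution \<mu>" using fp by (simp only: fixed_point_solution_iff[OF lm])
    show "second_moment \<mu> = 2 * ?V" using image_law_moments(2)[OF c] unfolding fp by simp
  qed
qed

section \<open>Decimal bounds for the variance constant\<close>

lemma sin_ninth_order: "\<bar>sin x - (x - x ^ 3 / 6 + x ^ 5 / 120 - x ^ 7 / 5040 + x ^ 9 / 362880)\<bar> \<le> \<bar>x\<bar> ^ 10 / 3628800"
  for x :: real
proof -
  have s: "{..<10::nat} = {0, 1, 2, 3, 4, 5, 6, 7, 8, 9}" by auto
  have "(\<Sum>m<10. sin_coeff m * x ^ m) = x - x ^ 3 / 6 + x ^ 5 / 120 - x ^ 7 / 5040 + x ^ 9 / 362880"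
    unfolding s by (simp add: sin_coeff_def fact_numeral)
  moreover have "inverse (fact 10) * \<bar>x\<bar> ^ 10 = \<bar>x\<bar> ^ 10 / 3628800"
    by (simp only: fact_numeral) (simp add: fact_numeral)
  ultimately show ?thesis using Maclaurin_sin_bound[of x 10] by (simp only:)
qed

text \<open>\<open>sin (pi / 6) = 1 / 2\<close> and the sine increases there, so the Taylor
  polynomial at a sixth of the candidate decides on which side of pi the candidate lies.\<close>

lemma pi_bounds: "3.141592 < pi" "pi < 3.1415927"
proof -
  have s: "sin (pi / 6) = 1 / 2" by (rule sin_30)
  have "\<not> 3.1415927 / 6 \<le> pi / 6"
  proof
    assume "3.1415927 / 6 \<le> pi / 6"
    then have "sin (3.1415927 / 6) \<le> sin (pi / 6)" using pi_gt_zero by (intro sin_monotone_2pi_le) auto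
    with s sin_ninth_order[of "3.1415927 / 6"] show False by (simp add: abs_le_iff power_divide)
  qed
  then show "pi < 3.1415927" by simp
  have "\<not> pi / 6 \<le> 3.141592 / 6"
  proof
    assume a: "pi / 6 \<le> 3.141592 / 6"
    then have "sin (pi / 6) \<le> sin (3.141592 / 6)" using pi_gt3 by (intro sin_monotone_2pi_le) auto
    with s sin_ninth_order[of "3.141592 / 6"] show False by (simp add: abs_le_iff power_divide)
  qed
  then show "3.141592 < pi" by simp
qed

lemma variance_constant_bounds:
  "0.25901 \<le> 2231 / 360 - 361 / 600 * pi\<^sup>2" "2231 / 360 - 361 / 600 * pi\<^sup>2 < 0.25902"
proof -
  have "pi\<^sup>2 \<le> 3.1415927\<^sup>2" using pi_bounds by (intro power_mono) auto
  then show "0.25901 \<le> 2231 / 360 - 361 / 600 * pi\<^sup>2" by (simp add: power2_eq_square)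
  have "3.141592\<^sup>2 \<le> pi\<^sup>2" using pi_bounds by (intro power_mono) auto
  then show "2231 / 360 - 361 / 600 * pi\<^sup>2 < 0.25902" by (simp add: power2_eq_square)
qed


section \<open>Normalised costs\<close>

lemma perm_avg_cong: "(\<And>\<pi>. \<pi> \<in> perms n \<Longrightarrow> F \<pi> = G \<pi>) \<Longrightarrow> perm_avg n F = perm_avg n G"
  unfolding perm_avg_def by (intro arg_cong[of _ _ "\<lambda>x. x /\<^sub>R fact n"] sum.cong) auto

lemma perm_avg_mono:
  fixes F G :: "(int \<Rightarrow> int) \<Rightarrow> real"
  shows "(\<And>\<pi>. \<pi> \<in> perms n \<Longrightarrow> F \<pi> \<le> G \<pi>) \<Longrightarrow> perm_avg n F \<le> perm_avg n G"
  unfolding perm_avg_def by (intro scaleR_left_mono sum_mono) auto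

lemma perm_avg_nonneg:
  fixes F :: "(int \<Rightarrow> int) \<Rightarrow> real"
  shows "(\<And>\<pi>. \<pi> \<in> perms n \<Longrightarrow> 0 \<le> F \<pi>) \<Longrightarrow> 0 \<le> perm_avg n F"
  using perm_avg_mono[of n "\<lambda>_. 0" F] by simp

lemma perm_avg_mult_left:
  fixes c :: "'a::real_algebra"
  shows "perm_avg n (\<lambda>\<pi>. c * F \<pi>) = c * perm_avg n F"
  by (simp add: perm_avg_def sum_distrib_left)

lemma perm_avg_mult_right:
  fixes c :: "'a::real_algebra"
  shows "perm_avg n (\<lambda>\<pi>. F \<pi> * c) = perm_avg n F * c"
  by (simp add: perm_avg_def sum_distrib_right)

lemma perm_avg_norm: "norm (perm_avg n F) \<le> perm_avg n (\<lambda>\<pi>. norm (F \<pi>))"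
  by (simp add: perm_avg_def divide_inverse norm_sum mult_left_mono)

text \<open>Jensen's inequality, in the form that the variance of the absolute value is
  nonnegative.\<close>

lemma perm_avg_abs_le_sqrt:
  fixes F :: "(int \<Rightarrow> int) \<Rightarrow> real"
  shows "perm_avg n (\<lambda>\<pi>. \<bar>F \<pi>\<bar>) \<le> sqrt (perm_avg n (\<lambda>\<pi>. (F \<pi>)\<^sup>2))"
proof -
  define m where "m = perm_avg n (\<lambda>\<pi>. \<bar>F \<pi>\<bar>)"
  have "0 \<le> perm_avg n (\<lambda>\<pi>. (\<bar>F \<pi>\<bar> - m)\<^sup>2)" by (intro perm_avg_nonneg) auto
  also have "perm_avg n (\<lambda>\<pi>. (\<bar>F \<pi>\<bar> - m)\<^sup>2) = perm_avg n (\<lambda>\<pi>. ((F \<pi>)\<^sup>2 - 2 * m * \<bar>F \<pi>\<bar>) + m\<^sup>2)"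
    by (intro perm_avg_cong) (simp add: power2_diff)
  also have "\<dots> = perm_avg n (\<lambda>\<pi>. (F \<pi>)\<^sup>2) - m\<^sup>2"
    unfolding perm_avg_add perm_avg_diff perm_avg_mult_left perm_avg_const m_def[symmetric] by (simp add: power2_eq_square)
  finally show ?thesis unfolding m_def[symmetric] by (intro real_le_rsqrt) simp
qed

lemma expectation_random_permutation:
  fixes F :: "(int \<Rightarrow> int) \<Rightarrow> 'b::{banach, second_countable_topology}"
  shows "measure_pmf.expectation (random_permutation n) F = perm_avg n F"
proof -
  have "id \<in> perms n" by (simp add: permutes_id)
  then have ne: "perms n \<noteq> {}" by blast
  have "measure_pmf.expectation (random_permutation n) F = (\<Sum>\<pi>\<in>perms n. pmf (random_permutation n) \<pi> *\<^sub>R F \<pi>)"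
    by (rule integral_measure_pmf) (auto simp: random_permutation_def set_pmf_of_set[OF ne])
  also have "\<dots> = (\<Sum>\<pi>\<in>perms n. F \<pi> /\<^sub>R fact n)"
    by (intro sum.cong) (auto simp: random_permutation_def pmf_of_set[OF ne] card_perms divide_inverse)
  finally show ?thesis by (simp add: perm_avg_def scaleR_sum_right)
qed

text \<open>The term \<open>x ln x\<close> is not Lipschitz at 0, so the rate is taken from uniform
  continuity on the compact cube. The scale \<open>2 / n\<close> is the error of the coupling of the
  pivot ranks.\<close>

lemma limit_cost_modulus:
  obtains w where "w \<longlonglongrightarrow> (0 :: real)"
    "\<And>n d d'. d \<in> cube \<Longrightarrow> d' \<in> cube \<Longrightarrow> close_triples (2 / real n) d d' \<Longrightarrow> \<bar>limit_cost d - limit_cost d'\<bar> \<le> w n"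
proof -
  obtain B where B: "\<And>d. d \<in> cube \<Longrightarrow> \<bar>limit_cost d\<bar> \<le> B" using limit_cost_bounded by blast
  define S where "S n = {\<bar>limit_cost d - limit_cost d'\<bar> |d d'. d \<in> cube \<and> d' \<in> cube \<and> close_triples (2 / real n) d d'}" for n
  have bdd: "bdd_above (S n)" for n
  proof (rule bdd_aboveI)
    fix x assume "x \<in> S n"
    then obtain d d' where "x = \<bar>limit_cost d - limit_cost d'\<bar>" "d \<in> cube" "d' \<in> cube" unfolding S_def by blast
    then show "x \<le> 2 * B" using B[of d] B[of d'] by linarith
  qed
  have mem: "\<bar>limit_cost (0, 0, 0) - limit_cost (0, 0, 0)\<bar> \<in> S n" for n
    unfolding S_def by (intro CollectI exI conjI refl) (auto simp: close_triples_def)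
  have w0: "0 \<le> Sup (S n)" for n
    using cSup_upper[OF mem bdd, of n] by simp
  show thesis
  proof (rule that)
    fix n d d' assume "d \<in> cube" "d' \<in> cube" "close_triples (2 / real n) d d'"
    then have "\<bar>limit_cost d - limit_cost d'\<bar> \<in> S n" unfolding S_def by blast
    then show "\<bar>limit_cost d - limit_cost d'\<bar> \<le> Sup (S n)" by (rule cSup_upper[OF _ bdd])
  next
    have "uniformly_continuous_on cube limit_cost"
      by (intro compact_uniformly_continuous continuous_limit_cost compact_Times compact_Icc)
    show "(\<lambda>n. Sup (S n)) \<longlonglongrightarrow> 0"
    proof (rule tendstoI)
      fix e :: real assume e: "0 < e"
      with \<open>uniformly_continuous_on cube limit_cost\<close> obtain \<delta> where \<delta>: "0 < \<delta>"
        "\<And>d d'. d \<in> cube \<Longrightarrow> d' \<in> cube \<Longrightarrow> dist d' d < \<delta> \<Longrightarrow> dist (limit_cost d') (limit_cost d) < e / 2"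
        unfolding uniformly_continuous_on_def by (meson half_gt_zero)
      have "(\<lambda>n. 6 / real n) \<longlonglongrightarrow> 0" by (rule lim_const_over_n)
      then have "\<forall>\<^sub>F n in sequentially. 6 / real n < \<delta>" using \<delta>(1) by (rule order_tendstoD)
      then show "\<forall>\<^sub>F n in sequentially. dist (Sup (S n)) 0 < e"
      proof eventually_elim
        case (elim n)
        have "Sup (S n) \<le> e / 2"
        proof (rule cSup_least)
          show "S n \<noteq> {}" using mem[of n] by blast
          fix x assume "x \<in> S n"
          then obtain d d' where x: "x = \<bar>limit_cost d - limit_cost d'\<bar>" "d \<in> cube" "d' \<in> cube" "close_triples (2 / real n) d d'"
            unfolding S_def by blast
          obtain x1 x2 x3 y1 y2 y3 where dd: "d = (x1, x2, x3)" "d' = (y1, y2, y3)" by (metis prod_cases3)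
          have "dist d d' \<le> dist x1 y1 + (dist x2 y2 + dist x3 y3)"
            unfolding dd dist_Pair_Pair using sqrt_sum_squares_le_sum[of "dist x1 y1" "sqrt ((dist x2 y2)\<^sup>2 + (dist x3 y3)\<^sup>2)"]
              sqrt_sum_squares_le_sum[of "dist x2 y2" "dist x3 y3"] by simp
          also have "\<dots> \<le> 2 / real n + (2 / real n + 2 / real n)"
            using x(4) unfolding dd close_triples_def dist_real_def by auto
          also have "\<dots> < \<delta>" using elim by simp
          finally show "x \<le> e / 2" using \<delta>(2)[OF x(3,2)] x(1) by (simp add: dist_real_def)
        qed
        then show ?case using w0[of n] e by (simp add: dist_real_def)
      qed
    qed
  qed
qed

text \<open>Unlike the entropy term, the toll is a polynomial. The explicit constant keeps the error
  of \<open>n\<close> times its mean bounded, well within the \<open>sqrt n\<close> that the mean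
  recursion tolerates.\<close>

lemma limit_toll_lipschitz:
  assumes "d \<in> cube" "d' \<in> cube" "close_triples \<delta> d d'"
  shows "\<bar>limit_toll d - limit_toll d'\<bar> \<le> 12 * \<delta>"
proof -
  obtain x1 x2 x3 y1 y2 y3 where dd: "d = (x1, x2, x3)" "d' = (y1, y2, y3)" by (metis prod_cases3)
  have *: "0 \<le> x1" "x1 \<le> 1" "0 \<le> x2" "x2 \<le> 1" "0 \<le> x3" "x3 \<le> 1" "0 \<le> y1" "y1 \<le> 1" "0 \<le> y2" "y2 \<le> 1" "0 \<le> y3" "y3 \<le> 1"
    "\<bar>x1 - y1\<bar> \<le> \<delta>" "\<bar>x2 - y2\<bar> \<le> \<delta>" "\<bar>x3 - y3\<bar> \<le> \<delta>"
    using assms unfolding dd close_triples_def by auto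
  have "limit_toll d - limit_toll d' = (x1 + x2) * ((x2 - y2) + 2 * (x3 - y3)) + ((x1 - y1) + (x2 - y2)) * (y2 + 2 * y3)"
    unfolding dd limit_toll_def by (simp add: algebra_simps)
  also have "\<bar>\<dots>\<bar> \<le> \<bar>x1 + x2\<bar> * \<bar>(x2 - y2) + 2 * (x3 - y3)\<bar> + \<bar>(x1 - y1) + (x2 - y2)\<bar> * \<bar>y2 + 2 * y3\<bar>"
    unfolding abs_mult[symmetric] by (rule abs_triangle_ineq)
  also have "\<dots> \<le> 2 * (3 * \<delta>) + 2 * \<delta> * 3"
    using * by (intro add_mono mult_mono) auto
  finally show ?thesis by simp
qed

section \<open>Normalised costs and their recursion\<close>

locale dual_pivot =
  fixes M :: nat
  assumes M: "1 \<le> M"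
begin

text \<open>From this size on a call really partitions, and the mean-square estimate for the toll,
  stated for \<open>4 <= n\<close>, applies.\<close>

definition n0 :: nat where "n0 = max (M + 1) 4"

lemma n0: "n0 \<le> n \<Longrightarrow> 4 \<le> n \<and> M < n \<and> 2 \<le> n"
  by (auto simp: n0_def)

definition key_cost :: "nat \<Rightarrow> (int \<Rightarrow> int) \<Rightarrow> real" where
  "key_cost n \<pi> = real (cost M \<pi> 1 (int n))"

definition mean_cost :: "nat \<Rightarrow> real" where
  "mean_cost n = perm_avg n (key_cost n)"

definition scaled_cost :: "nat \<Rightarrow> (int \<Rightarrow> int) \<Rightarrow> real" where
  "scaled_cost n \<pi> = (key_cost n \<pi> - mean_cost n) / real n"

definition split_avg :: "nat \<Rightarrow> (int \<Rightarrow> int) \<Rightarrow> ((int \<Rightarrow> int) \<Rightarrow> (int \<Rightarrow> int) \<Rightarrow> (int \<Rightarrow> int) \<Rightarrow> 'b::real_vector) \<Rightarrow> 'b" where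
  "split_avg n \<pi> F = perm_avg (small_size n \<pi>) (\<lambda>a. perm_avg (medium_size n \<pi>) (\<lambda>b. perm_avg (large_size n \<pi>) (\<lambda>c. F a b c)))"

lemma comparisons_eq: "comparisons M n = key_cost n"
  by (simp add: fun_eq_iff comparisons_def key_cost_def cost_def)

lemma expected_comparisons_eq: "expected_comparisons M n = mean_cost n"
  by (simp add: expected_comparisons_def expectation_random_permutation comparisons_eq mean_cost_def)

lemma normalized_comparisons_eq: "normalized_comparisons M n = scaled_cost n"
  by (simp add: fun_eq_iff normalized_comparisons_def scaled_cost_def comparisons_eq expected_comparisons_eq)

lemma scaled_cost_mean: "perm_avg n (scaled_cost n) = 0"
proof -
  have "perm_avg n (\<lambda>\<pi>. (key_cost n \<pi> - mean_cost n) * (1 / real n)) = 0"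
    unfolding perm_avg_mult_right perm_avg_diff perm_avg_const mean_cost_def by simp
  then show ?thesis by (simp add: scaled_cost_def[abs_def])
qed

text \<open>Empty blocks occur, so \<open>n = 0\<close> has to be covered:
  \<open>scaled_cost\<close> is then 0 by division by zero, and the only permutation has the mean as
  its cost.\<close>

lemma key_cost_scaled: "\<pi> \<in> perms n \<Longrightarrow> key_cost n \<pi> = mean_cost n + real n * scaled_cost n \<pi>"
proof (cases "n = 0")
  case True
  assume pi: "\<pi> \<in> perms n"
  have "perms n = {id}" using True by auto
  then show ?thesis using pi True by (simp add: mean_cost_def perm_avg_def)
qed (simp add: scaled_cost_def)

lemma key_cost_rec:
  fixes f :: "real \<Rightarrow> 'b::real_vector"
  assumes "n0 \<le> n"
  shows "perm_avg n (\<lambda>\<pi>. f (key_cost n \<pi>)) = perm_avg n (\<lambda>\<pi>. split_avg n \<pi> (\<lambda>a b c.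
      f (real (toll n \<pi>) + key_cost (small_size n \<pi>) a + key_cost (medium_size n \<pi>) b + key_cost (large_size n \<pi>) c)))"
  using perm_avg_cost_rec[of n M "\<lambda>k. f (real k)"] n0[OF assms] by (simp add: key_cost_def split_avg_def)

definition mean_toll :: "nat \<Rightarrow> real" where
  "mean_toll n = perm_avg n (\<lambda>\<pi>. real (toll n \<pi>))"

lemma mean_cost_rec:
  assumes "n0 \<le> n"
  shows "mean_cost n = mean_toll n + 6 / (real n * (real n - 1)) * (\<Sum>k<n - 1. (real n - 1 - real k) * mean_cost k)"
proof -
  have "mean_cost n = perm_avg n (\<lambda>\<pi>. real (toll n \<pi>) + (mean_cost (small_size n \<pi>) + mean_cost (medium_size n \<pi>) + mean_cost (large_size n \<pi>)))"
    using key_cost_rec[OF assms, of "\<lambda>x. x"]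
    by (simp add: mean_cost_def split_avg_def perm_avg_add add_ac)
  also have "\<dots> = mean_toll n + perm_avg n (\<lambda>\<pi>. mean_cost (small_size n \<pi>) + mean_cost (medium_size n \<pi>) + mean_cost (large_size n \<pi>))"
    by (simp only: perm_avg_add mean_toll_def)
  finally show ?thesis using perm_avg_sum_sizes[of n mean_cost] n0[OF assms] by simp
qed

lemma mean_toll_approx:
  assumes "n0 \<le> n"
  shows "\<bar>mean_toll n - 19 / 12 * real n\<bar> \<le> (sqrt 33 + 36) * sqrt (real n)"
proof -
  have n: "4 \<le> n" "2 \<le> n" using n0[OF assms] by auto
  define D where "D \<pi> = real (toll n \<pi>) - n * limit_toll (proportions n \<pi>)" for \<pi>
  have "\<bar>perm_avg n D\<bar> \<le> perm_avg n (\<lambda>\<pi>. \<bar>D \<pi>\<bar>)" using perm_avg_norm[of n D] by simp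
  also have "\<dots> \<le> sqrt (perm_avg n (\<lambda>\<pi>. (D \<pi>)\<^sup>2))" by (rule perm_avg_abs_le_sqrt)
  \<comment> \<open>\<open>6 n + 108 <= 33 n\<close> holds from \<open>n = 4\<close> on.\<close>
  also have "\<dots> \<le> sqrt (33 * real n)"
    using toll_second_moment[OF n(1)] n by (intro real_sqrt_le_mono) (simp add: D_def)
  finally have 1: "\<bar>perm_avg n D\<bar> \<le> sqrt 33 * sqrt n" by (simp add: real_sqrt_mult)
  have "norm (perm_avg n (\<lambda>\<pi>. limit_toll (proportions n \<pi>)) - (\<integral>d. limit_toll d \<partial>spacings_law)) \<le> 24 / n + 12 / n"
  proof (rule perm_avg_proportions_approx[OF n(2) limit_toll_measurable])
    fix d d' assume d: "d \<in> cube" "d' \<in> cube"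
    show "norm (limit_toll d - limit_toll d') \<le> 24 / n" if "close_triples (2 / n) d d'"
      using limit_toll_lipschitz[OF d that] by simp
    have "close_triples 1 d d'" using d by (auto simp: close_triples_def abs_le_iff)
    then show "norm (limit_toll d - limit_toll d') \<le> 12" using limit_toll_lipschitz[OF d] by fastforce
  qed
  then have "real n * \<bar>perm_avg n (\<lambda>\<pi>. limit_toll (proportions n \<pi>)) - 19 / 12\<bar> \<le> real n * (36 / n)"
    unfolding limit_toll_mean by (intro mult_left_mono) auto
  then have "\<bar>real n * (perm_avg n (\<lambda>\<pi>. limit_toll (proportions n \<pi>)) - 19 / 12)\<bar> \<le> 36"
    using n by (simp add: abs_mult)
  moreover have "36 \<le> 36 * sqrt n" using n by simp
  moreover have "mean_toll n - 19 / 12 * n = perm_avg n D + real n * (perm_avg n (\<lambda>\<pi>. limit_toll (proportions n \<pi>)) - 19 / 12)"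
    unfolding D_def perm_avg_diff perm_avg_mult_left mean_toll_def by (simp add: algebra_simps)
  ultimately show ?thesis using 1 unfolding distrib_right by linarith
qed

text \<open>The coefficient is \<open>6 / 5\<close> times the mean toll \<open>19 / 12\<close>.
  Segments below the threshold enter the recursion as initial values only, so the leading
  coefficient is the same for every \<open>M\<close>.\<close>

lemma mean_cost_asymptotics:
  obtains c where "(\<lambda>n. mean_cost n / real n - 19 / 10 * ln (real n)) \<longlonglongrightarrow> c"
proof -
  have "2 \<le> n0" by (simp add: n0_def)
  from dual_pivot_recursion_asymptotics[OF this mean_cost_rec mean_toll_approx]
  obtain d where "(\<lambda>n. mean_cost n / real n - 6 / 5 * (19 / 12) * ln (real n)) \<longlonglongrightarrow> d" by blast
  then show thesis by (intro that[of d]) simp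
qed

text \<open>What remains of one step, besides the weighted block terms, once the costs of the blocks
  and of the whole are replaced by their centred and scaled versions.\<close>

definition scaled_toll :: "nat \<Rightarrow> (int \<Rightarrow> int) \<Rightarrow> real" where
  "scaled_toll n \<pi> = (real (toll n \<pi>) - mean_cost n + mean_cost (small_size n \<pi>) + mean_cost (medium_size n \<pi>) +
     mean_cost (large_size n \<pi>)) / real n"

lemma scaled_cost_rec:
  fixes f :: "real \<Rightarrow> 'b::real_vector"
  assumes n: "n0 \<le> n"
  shows "perm_avg n (\<lambda>\<pi>. f (scaled_cost n \<pi>)) = perm_avg n (\<lambda>\<pi>. split_avg n \<pi> (\<lambda>a b c.
      f (scaled_toll n \<pi> + (small_size n \<pi> / n * scaled_cost (small_size n \<pi>) a +
        (medium_size n \<pi> / n * scaled_cost (medium_size n \<pi>) b + large_size n \<pi> / n * scaled_cost (large_size n \<pi>) c)))))"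
proof -
  have "perm_avg n (\<lambda>\<pi>. f (scaled_cost n \<pi>)) = perm_avg n (\<lambda>\<pi>. split_avg n \<pi> (\<lambda>a b c.
      f ((real (toll n \<pi>) + key_cost (small_size n \<pi>) a + key_cost (medium_size n \<pi>) b + key_cost (large_size n \<pi>) c - mean_cost n) / n)))"
    using key_cost_rec[OF n, of "\<lambda>x. f ((x - mean_cost n) / n)"] by (simp add: scaled_cost_def)
  also have "\<dots> = perm_avg n (\<lambda>\<pi>. split_avg n \<pi> (\<lambda>a b c.
      f (scaled_toll n \<pi> + (small_size n \<pi> / n * scaled_cost (small_size n \<pi>) a +
        (medium_size n \<pi> / n * scaled_cost (medium_size n \<pi>) b + large_size n \<pi> / n * scaled_cost (large_size n \<pi>) c)))))"
    unfolding split_avg_def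
    by (intro perm_avg_cong arg_cong[of _ _ f])
       (simp add: key_cost_scaled scaled_toll_def add_divide_distrib diff_divide_distrib)
  finally show ?thesis .
qed

end


section \<open>The variance recursion\<close>

context dual_pivot
begin

text \<open>The block sizes add up to \<open>n - 2\<close>, so in the difference of the means the
  terms \<open>n ln n\<close> and \<open>c n\<close> cancel up to \<open>O(ln n)\<close>, and the
  entropy of the proportions remains. This part of the error is uniform over all permutations; the
  fluctuation of the toll is left in place, to be treated in mean square.\<close>

lemma scaled_toll_approx:
  obtains e where "e \<longlonglongrightarrow> (0 :: real)"
    "\<And>n \<pi>. n0 \<le> n \<Longrightarrow> \<pi> \<in> perms n \<Longrightarrow>
      \<bar>scaled_toll n \<pi> - limit_cost (proportions n \<pi>) - (real (toll n \<pi>) / n - limit_toll (proportions n \<pi>))\<bar> \<le> e n"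
proof -
  obtain c where c: "(\<lambda>n. mean_cost n / real n - 19 / 10 * ln (real n)) \<longlonglongrightarrow> c"
    by (rule mean_cost_asymptotics)
  define r where "r n = mean_cost n - 19 / 10 * (real n * ln (real n)) - c * real n" for n
  \<comment> \<open>The running maximum makes the error \<open>o(n)\<close> of the mean uniform over
    all block sizes, small ones included.\<close>
  define R where "R n = Max ((\<lambda>k. \<bar>r k\<bar>) ` {..n}) / real n" for n
  have r_le: "\<bar>r k\<bar> \<le> R n * real n" if "k \<le> n" "0 < n" for k n
    using that by (auto simp: R_def intro!: Max_ge)
  have r0: "(\<lambda>n. r n / real n) \<longlonglongrightarrow> 0"
  proof (rule Lim_transform_eventually)
    show "(\<lambda>n. mean_cost n / real n - 19 / 10 * ln (real n) - c) \<longlonglongrightarrow> 0"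
      using tendsto_diff[OF c tendsto_const[of c]] by simp
    show "\<forall>\<^sub>F n in sequentially. mean_cost n / real n - 19 / 10 * ln (real n) - c = r n / real n"
      using eventually_gt_at_top[of 0] by eventually_elim (simp add: r_def diff_divide_distrib)
  qed
  have R0: "R \<longlonglongrightarrow> 0"
  proof (rule tendstoI)
    fix e :: real assume e: "0 < e"
    have "\<forall>\<^sub>F n in sequentially. \<bar>r n / real n\<bar> < e / 2" using tendstoD[OF r0, of "e / 2"] e by (simp add: dist_real_def)
    then obtain N where N: "\<And>n. N \<le> n \<Longrightarrow> \<bar>r n / real n\<bar> < e / 2" by (auto simp: eventually_sequentially)
    define C where "C = Max ((\<lambda>k. \<bar>r k\<bar>) ` {..N})"
    have C: "\<bar>r k\<bar> \<le> C" if "k \<le> N" for k using that by (auto simp: C_def intro!: Max_ge)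
    have "(\<lambda>n. C / real n) \<longlonglongrightarrow> 0" by (rule lim_const_over_n)
    then have "\<forall>\<^sub>F n in sequentially. C / real n < e / 2" using e by (intro order_tendstoD(2)) auto
    then show "\<forall>\<^sub>F n in sequentially. dist (R n) 0 < e" using eventually_gt_at_top[of 0]
    proof eventually_elim
      case (elim n)
      have "\<bar>r k\<bar> \<le> C + e / 2 * real n" if k: "k \<le> n" for k
      proof (cases "k \<le> N \<or> k = 0")
        case True
        then have "\<bar>r k\<bar> \<le> C" using C by auto
        then show ?thesis using e by (simp add: add_increasing2)
      next
        case False
        then have "\<bar>r k\<bar> < e / 2 * real k" using N[of k] by (simp add: field_simps abs_divide)
        also have "\<dots> \<le> e / 2 * real n" using k e by (intro mult_left_mono) auto
        finally show ?thesis using C[of 0] by simp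
      qed
      then have "Max ((\<lambda>k. \<bar>r k\<bar>) ` {..n}) \<le> C + e / 2 * real n" by (intro Max.boundedI) auto
      then have "R n \<le> (C + e / 2 * real n) / real n" unfolding R_def by (rule divide_right_mono) simp
      also have "\<dots> = C / real n + e / 2" using elim by (simp add: add_divide_distrib)
      also have "\<dots> < e" using elim(1) by linarith
      finally have "R n < e" .
      moreover have "0 \<le> R n * real n" using r_le[of 0 n] elim by (meson abs_ge_zero order_trans zero_le)
      ultimately show ?case using elim by (simp add: dist_real_def zero_le_mult_iff)
    qed
  qed
  \<comment> \<open>The two pivots missing from the block sizes leave
    \<open>2 * (19 / 10) * ln n\<close> and \<open>2 * c\<close>; the four errors \<open>r\<close>
    belong to the three blocks and to the whole array.\<close>
  define e where "e n = 19 / 5 * (ln (real n) / real n) + 2 * \<bar>c\<bar> / real n + 4 * R n" for n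
  show thesis
  proof (rule that)
    have "(\<lambda>n. ln (real n) / real n) \<longlonglongrightarrow> 0" by real_asymp
    then have "e \<longlonglongrightarrow> 19 / 5 * 0 + 0 + 4 * 0" unfolding e_def
      by (intro tendsto_add tendsto_mult tendsto_const R0 lim_const_over_n)
    then show "e \<longlonglongrightarrow> 0" by simp
  next
    fix n \<pi> assume n: "n0 \<le> n" and pi: "\<pi> \<in> perms n"
    have n2: "2 \<le> n" "0 < real n" using n0[OF n] by auto
    define s m l where "s = small_size n \<pi>" and "m = medium_size n \<pi>" and "l = large_size n \<pi>"
    have "s + m + l = n - 2" using sizes_sum[OF pi n2(1)] by (simp add: s_def m_def l_def)
    then have sum: "real s + real m + real l = real n - 2" and le: "s \<le> n" "m \<le> n" "l \<le> n" using n2 by (auto simp: of_nat_diff)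
    have xl: "real k * ln (real k) = real n * xlnx (real k / real n) + real k * ln (real n)" for k
      using n2 by (cases "k = 0") (auto simp: xlnx_def ln_div algebra_simps)
    have mc: "mean_cost k = r k + 19 / 10 * (real n * xlnx (real k / real n) + real k * ln (real n)) + c * real k" for k
      unfolding xl[symmetric] by (simp add: r_def)
    have mcn: "mean_cost n = r n + 19 / 10 * (real n * ln (real n)) + c * real n" by (simp add: r_def)
    define X where "X = xlnx (real s / real n) + xlnx (real m / real n) + xlnx (real l / real n)"
    have "scaled_toll n \<pi> * real n = real (toll n \<pi>) - mean_cost n + mean_cost s + mean_cost m + mean_cost l"
      using n2 by (simp add: scaled_toll_def s_def m_def l_def)
    also have "\<dots> = real (toll n \<pi>) - r n - 19 / 10 * (real n * ln (real n)) - c * real n + (r s + r m + r l) +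
        19 / 10 * (real n * X + (real s + real m + real l) * ln (real n)) + c * (real s + real m + real l)"
      unfolding mcn mc X_def by (simp add: algebra_simps)
    also have "\<dots> = real (toll n \<pi>) + 19 / 10 * (real n * X) + (r s + r m + r l - r n - 19 / 5 * ln (real n) - 2 * c)"
      unfolding sum by (simp add: algebra_simps)
    finally have "scaled_toll n \<pi> = (real (toll n \<pi>) + 19 / 10 * (real n * X) + (r s + r m + r l - r n - 19 / 5 * ln (real n) - 2 * c)) / n"
      using n2(2) by (simp only: eq_divide_eq) simp
    then have "scaled_toll n \<pi> = real (toll n \<pi>) / n + 19 / 10 * X + (r s + r m + r l - r n - 19 / 5 * ln (real n) - 2 * c) / n"
      using n2(2) by (simp only: add_divide_distrib) simp
    then have "scaled_toll n \<pi> - limit_cost (proportions n \<pi>) - (real (toll n \<pi>) / n - limit_toll (proportions n \<pi>)) =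
        (r s + r m + r l - r n - 19 / 5 * ln (real n) - 2 * c) / n"
      by (simp add: limit_cost_def proportions_def X_def s_def m_def l_def)
    moreover have "\<bar>r s + r m + r l - r n - 19 / 5 * ln (real n) - 2 * c\<bar> \<le> 4 * (R n * n) + 19 / 5 * ln (real n) + 2 * \<bar>c\<bar>"
    proof -
      have "0 \<le> ln (real n)" using n2 by simp
      then show ?thesis using r_le[OF le(1)] r_le[OF le(2)] r_le[OF le(3)] r_le[of n n] n2 by linarith
    qed
    then have "\<bar>(r s + r m + r l - r n - 19 / 5 * ln (real n) - 2 * c) / n\<bar> \<le> (4 * (R n * n) + 19 / 5 * ln (real n) + 2 * \<bar>c\<bar>) / n"
      unfolding abs_divide by (simp add: divide_right_mono)
    moreover have "(4 * (R n * n) + 19 / 5 * ln (real n) + 2 * \<bar>c\<bar>) / n = e n"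
      using n2(2) by (simp add: e_def add_divide_distrib)
    ultimately show "\<bar>scaled_toll n \<pi> - limit_cost (proportions n \<pi>) - (real (toll n \<pi>) / n - limit_toll (proportions n \<pi>))\<bar> \<le> e n"
      by simp
  qed
qed

text \<open>The uniform error of the means is combined with the fluctuation of the toll, whose mean
  square \<open>O(n)\<close> becomes \<open>O(1 / n)\<close> after scaling.\<close>

lemma scaled_toll_L2:
  obtains q where "q \<longlonglongrightarrow> (0 :: real)" "\<And>n. 0 \<le> q n"
    "\<And>n. n0 \<le> n \<Longrightarrow> perm_avg n (\<lambda>\<pi>. (scaled_toll n \<pi> - limit_cost (proportions n \<pi>))\<^sup>2) \<le> q n"
proof -
  obtain e where e: "e \<longlonglongrightarrow> (0 :: real)"
    "\<And>n \<pi>. n0 \<le> n \<Longrightarrow> \<pi> \<in> perms n \<Longrightarrow>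
      \<bar>scaled_toll n \<pi> - limit_cost (proportions n \<pi>) - (real (toll n \<pi>) / n - limit_toll (proportions n \<pi>))\<bar> \<le> e n"
    by (rule scaled_toll_approx) blast
  define q where "q n = 2 / (real n)\<^sup>2 * (6 * real n + 108) + 2 * (e n)\<^sup>2" for n
  show thesis
  proof (rule that)
    have "(\<lambda>n. 2 / (real n)\<^sup>2 * (6 * real n + 108)) \<longlonglongrightarrow> 0" by real_asymp
    then have "q \<longlonglongrightarrow> 0 + 2 * 0\<^sup>2" unfolding q_def by (intro tendsto_add tendsto_mult tendsto_power tendsto_const e(1))
    then show "q \<longlonglongrightarrow> 0" by simp
    show "0 \<le> q n" for n by (simp add: q_def)
    fix n assume n: "n0 \<le> n"
    then have n4: "4 \<le> n" using n0 by blast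
    define D where "D \<pi> = real (toll n \<pi>) - n * limit_toll (proportions n \<pi>)" for \<pi>
    have "perm_avg n (\<lambda>\<pi>. (scaled_toll n \<pi> - limit_cost (proportions n \<pi>))\<^sup>2) \<le> perm_avg n (\<lambda>\<pi>. 2 / (real n)\<^sup>2 * (D \<pi>)\<^sup>2 + 2 * (e n)\<^sup>2)"
    proof (rule perm_avg_mono)
      fix \<pi> assume pi: "\<pi> \<in> perms n"
      define y where "y = scaled_toll n \<pi> - limit_cost (proportions n \<pi>) - D \<pi> / n"
      have "\<bar>y\<bar> \<le> e n" using e(2)[OF n pi] n4 by (simp add: y_def D_def diff_divide_distrib)
      then have y: "y\<^sup>2 \<le> (e n)\<^sup>2" using power_mono[of "\<bar>y\<bar>" "e n" 2] by simp
      have "(D \<pi> / n + y)\<^sup>2 \<le> 2 * (D \<pi> / n)\<^sup>2 + 2 * y\<^sup>2"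
      proof -
        have "0 \<le> (D \<pi> / n - y)\<^sup>2" by simp
        then show ?thesis unfolding power2_sum power2_diff by linarith
      qed
      also have "\<dots> \<le> 2 / (real n)\<^sup>2 * (D \<pi>)\<^sup>2 + 2 * (e n)\<^sup>2" using y by (simp add: power_divide)
      finally show "(scaled_toll n \<pi> - limit_cost (proportions n \<pi>))\<^sup>2 \<le> 2 / (real n)\<^sup>2 * (D \<pi>)\<^sup>2 + 2 * (e n)\<^sup>2"
        by (simp add: y_def)
    qed
    also have "\<dots> = 2 / (real n)\<^sup>2 * perm_avg n (\<lambda>\<pi>. (D \<pi>)\<^sup>2) + 2 * (e n)\<^sup>2"
      by (simp only: perm_avg_add perm_avg_mult_left perm_avg_const)
    also have "\<dots> \<le> q n"
      unfolding q_def D_def using toll_second_moment[OF n4] by (intro add_mono mult_left_mono) auto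
    finally show "perm_avg n (\<lambda>\<pi>. (scaled_toll n \<pi> - limit_cost (proportions n \<pi>))\<^sup>2) \<le> q n" .
  qed
qed

text \<open>As \<open>limit_cost\<close> is bounded on the cube, closeness in mean square carries
  over to the squares; the coupling then replaces the proportions by the spacings.\<close>

lemma scaled_toll_square_mean:
  "(\<lambda>n. perm_avg n (\<lambda>\<pi>. (scaled_toll n \<pi>)\<^sup>2)) \<longlonglongrightarrow> limit_cost_variance"
proof -
  obtain B where B: "0 \<le> B" "\<And>d. d \<in> cube \<Longrightarrow> \<bar>limit_cost d\<bar> \<le> B" using limit_cost_bounded by blast
  obtain w where w: "w \<longlonglongrightarrow> (0 :: real)"
    "\<And>n d d'. d \<in> cube \<Longrightarrow> d' \<in> cube \<Longrightarrow> close_triples (2 / real n) d d' \<Longrightarrow> \<bar>limit_cost d - limit_cost d'\<bar> \<le> w n"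
    by (rule limit_cost_modulus) blast
  obtain q where q: "q \<longlonglongrightarrow> (0 :: real)" "\<And>n. 0 \<le> q n"
    "\<And>n. n0 \<le> n \<Longrightarrow> perm_avg n (\<lambda>\<pi>. (scaled_toll n \<pi> - limit_cost (proportions n \<pi>))\<^sup>2) \<le> q n"
    by (rule scaled_toll_L2) blast
  define L where "L n \<pi> = limit_cost (proportions n \<pi>)" for n \<pi>
  define g where "g n = (q n + 2 * B * sqrt (q n)) + (2 * B * w n + 4 * B\<^sup>2 / real n)" for n
  have "norm (perm_avg n (\<lambda>\<pi>. (scaled_toll n \<pi>)\<^sup>2) - limit_cost_variance) \<le> (q n + 2 * B * sqrt (q n)) + (2 * B * w n + 4 * B\<^sup>2 / n)"
    if n: "n0 \<le> n" for n
  proof -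
    have n2: "2 \<le> n" using n0[OF n] by simp
    have sq: "\<bar>(limit_cost d)\<^sup>2 - (limit_cost d')\<^sup>2\<bar> \<le> 2 * B * \<bar>limit_cost d - limit_cost d'\<bar>" if "d \<in> cube" "d' \<in> cube" for d d'
    proof -
      have eq: "(limit_cost d)\<^sup>2 - (limit_cost d')\<^sup>2 = (limit_cost d + limit_cost d') * (limit_cost d - limit_cost d')"
        by (simp add: power2_eq_square algebra_simps)
      have "\<bar>limit_cost d + limit_cost d'\<bar> \<le> 2 * B" using B(2)[OF that(1)] B(2)[OF that(2)] by linarith
      then show ?thesis unfolding eq abs_mult by (rule mult_right_mono) simp
    qed
    have "norm (perm_avg n (\<lambda>\<pi>. (limit_cost (proportions n \<pi>))\<^sup>2) - (\<integral>d. (limit_cost d)\<^sup>2 \<partial>spacings_law)) \<le> 2 * B * w n + 4 * B\<^sup>2 / n"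
    proof (rule perm_avg_proportions_approx[OF n2 borel_measurable_power[OF limit_cost_measurable]])
      fix d d' assume d: "d \<in> cube" "d' \<in> cube"
      show "norm ((limit_cost d)\<^sup>2 - (limit_cost d')\<^sup>2) \<le> 2 * B * w n" if "close_triples (2 / n) d d'"
      proof -
        have "2 * B * \<bar>limit_cost d - limit_cost d'\<bar> \<le> 2 * B * w n" using w(2)[OF d that] B(1) by (intro mult_left_mono) auto
        then show ?thesis using sq[OF d] by simp
      qed
      have "\<bar>limit_cost d - limit_cost d'\<bar> \<le> 2 * B" using B(2)[OF d(1)] B(2)[OF d(2)] by linarith
      then have "2 * B * \<bar>limit_cost d - limit_cost d'\<bar> \<le> 2 * B * (2 * B)" using B(1) by (intro mult_left_mono) auto
      then show "norm ((limit_cost d)\<^sup>2 - (limit_cost d')\<^sup>2) \<le> 4 * B\<^sup>2" using sq[OF d] by (simp add: power2_eq_square)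
    qed
    then have 1: "\<bar>perm_avg n (\<lambda>\<pi>. (L n \<pi>)\<^sup>2) - limit_cost_variance\<bar> \<le> 2 * B * w n + 4 * B\<^sup>2 / n"
      unfolding limit_cost_square_mean L_def by simp
    have "\<bar>perm_avg n (\<lambda>\<pi>. (scaled_toll n \<pi>)\<^sup>2 - (L n \<pi>)\<^sup>2)\<bar> \<le> perm_avg n (\<lambda>\<pi>. \<bar>(scaled_toll n \<pi>)\<^sup>2 - (L n \<pi>)\<^sup>2\<bar>)"
      using perm_avg_norm[of n "\<lambda>\<pi>. (scaled_toll n \<pi>)\<^sup>2 - (L n \<pi>)\<^sup>2"] by simp
    also have "\<dots> \<le> perm_avg n (\<lambda>\<pi>. (scaled_toll n \<pi> - L n \<pi>)\<^sup>2 + 2 * B * \<bar>scaled_toll n \<pi> - L n \<pi>\<bar>)"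
    proof (rule perm_avg_mono)
      fix \<pi> assume "\<pi> \<in> perms n"
      then have Lb: "\<bar>L n \<pi>\<bar> \<le> B" unfolding L_def by (intro B(2) proportions_in_cube n2)
      define y where "y = scaled_toll n \<pi> - L n \<pi>"
      have "(scaled_toll n \<pi>)\<^sup>2 - (L n \<pi>)\<^sup>2 = y\<^sup>2 + 2 * L n \<pi> * y"
        by (simp add: y_def power2_eq_square algebra_simps)
      moreover have "\<bar>2 * L n \<pi> * y\<bar> \<le> 2 * B * \<bar>y\<bar>"
        unfolding abs_mult using Lb by (intro mult_right_mono) auto
      ultimately show "\<bar>(scaled_toll n \<pi>)\<^sup>2 - (L n \<pi>)\<^sup>2\<bar> \<le> (scaled_toll n \<pi> - L n \<pi>)\<^sup>2 + 2 * B * \<bar>scaled_toll n \<pi> - L n \<pi>\<bar>"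
        using abs_triangle_ineq[of "y\<^sup>2" "2 * L n \<pi> * y"] by (simp add: y_def)
    qed
    also have "\<dots> = perm_avg n (\<lambda>\<pi>. (scaled_toll n \<pi> - L n \<pi>)\<^sup>2) + 2 * B * perm_avg n (\<lambda>\<pi>. \<bar>scaled_toll n \<pi> - L n \<pi>\<bar>)"
      by (simp only: perm_avg_add perm_avg_mult_left)
    also have "\<dots> \<le> q n + 2 * B * sqrt (q n)"
    proof (intro add_mono mult_left_mono)
      show "perm_avg n (\<lambda>\<pi>. (scaled_toll n \<pi> - L n \<pi>)\<^sup>2) \<le> q n" using q(3)[OF n] by (simp add: L_def)
      then show "perm_avg n (\<lambda>\<pi>. \<bar>scaled_toll n \<pi> - L n \<pi>\<bar>) \<le> sqrt (q n)"
        by (rule order_trans[OF perm_avg_abs_le_sqrt real_sqrt_le_mono])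
    qed (use B in auto)
    finally have "\<bar>perm_avg n (\<lambda>\<pi>. (scaled_toll n \<pi>)\<^sup>2) - perm_avg n (\<lambda>\<pi>. (L n \<pi>)\<^sup>2)\<bar> \<le> q n + 2 * B * sqrt (q n)"
      by (simp only: perm_avg_diff)
    with 1 show ?thesis unfolding real_norm_def by linarith
  qed
  then have bound: "norm (perm_avg n (\<lambda>\<pi>. (scaled_toll n \<pi>)\<^sup>2) - limit_cost_variance) \<le> g n" if "n0 \<le> n" for n
    using that by (simp only: g_def)
  have "g \<longlonglongrightarrow> (0 + 2 * B * sqrt 0) + (2 * B * 0 + 0)" unfolding g_def
    by (rule tendsto_add[OF tendsto_add[OF q(1) tendsto_mult[OF tendsto_const tendsto_real_sqrt[OF q(1)]]]
        tendsto_add[OF tendsto_mult[OF tendsto_const w(1)] lim_const_over_n]])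
  then have lim: "g \<longlonglongrightarrow> 0" by (simp only: real_sqrt_zero mult_zero_right add_0_right)
  have "(\<lambda>n. perm_avg n (\<lambda>\<pi>. (scaled_toll n \<pi>)\<^sup>2) - limit_cost_variance) \<longlonglongrightarrow> 0"
    by (rule Lim_null_comparison[OF eventually_sequentiallyI[OF bound] lim])
  then show ?thesis by (rule Lim_null[THEN iffD2])
qed

definition scaled_variance :: "nat \<Rightarrow> real" where
  "scaled_variance n = perm_avg n (\<lambda>\<pi>. (scaled_cost n \<pi>)\<^sup>2)"

lemma perm_avg_shifted_square:
  "perm_avg k (\<lambda>c. (u + z * scaled_cost k c)\<^sup>2) = u\<^sup>2 + z\<^sup>2 * scaled_variance k"
proof -
  have "perm_avg k (\<lambda>c. (u + z * scaled_cost k c)\<^sup>2) = perm_avg k (\<lambda>c. (u\<^sup>2 + 2 * u * z * scaled_cost k c) + z\<^sup>2 * (scaled_cost k c)\<^sup>2)"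
    by (intro perm_avg_cong) (simp add: power2_eq_square algebra_simps)
  then show ?thesis
    by (simp only: perm_avg_add perm_avg_mult_left perm_avg_const scaled_cost_mean scaled_variance_def
        mult_zero_right add_0_right)
qed

text \<open>Block costs are centred and averaged independently, so all cross terms disappear, one
  block at a time.\<close>

lemma scaled_variance_rec:
  assumes n: "n0 \<le> n"
  shows "scaled_variance n = perm_avg n (\<lambda>\<pi>. (scaled_toll n \<pi>)\<^sup>2) +
    6 / (real n * (real n - 1)) * (\<Sum>k<n - 1. (real n - 1 - real k) * ((real k / n)\<^sup>2 * scaled_variance k))"
proof -
  have n2: "2 \<le> n" using n0[OF n] by simp
  have sp: "split_avg n \<pi> (\<lambda>a b c. (u + (x * scaled_cost (small_size n \<pi>) a + (y * scaled_cost (medium_size n \<pi>) b + z * scaled_cost (large_size n \<pi>) c)))\<^sup>2)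
    = u\<^sup>2 + (x\<^sup>2 * scaled_variance (small_size n \<pi>) + y\<^sup>2 * scaled_variance (medium_size n \<pi>) + z\<^sup>2 * scaled_variance (large_size n \<pi>))" for \<pi> u x y z
    unfolding split_avg_def
    by (simp only: add.assoc[symmetric] perm_avg_shifted_square perm_avg_add perm_avg_const) 
  have "scaled_variance n = perm_avg n (\<lambda>\<pi>. (scaled_toll n \<pi>)\<^sup>2 + ((small_size n \<pi> / n)\<^sup>2 * scaled_variance (small_size n \<pi>) +
      (medium_size n \<pi> / n)\<^sup>2 * scaled_variance (medium_size n \<pi>) + (large_size n \<pi> / n)\<^sup>2 * scaled_variance (large_size n \<pi>)))"
    using scaled_cost_rec[OF n, of "\<lambda>x. x\<^sup>2"] unfolding sp by (simp only: scaled_variance_def)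
  also have "\<dots> = perm_avg n (\<lambda>\<pi>. (scaled_toll n \<pi>)\<^sup>2) + perm_avg n (\<lambda>\<pi>. (small_size n \<pi> / n)\<^sup>2 * scaled_variance (small_size n \<pi>) +
      (medium_size n \<pi> / n)\<^sup>2 * scaled_variance (medium_size n \<pi>) + (large_size n \<pi> / n)\<^sup>2 * scaled_variance (large_size n \<pi>))"
    by (rule perm_avg_add)
  also have "perm_avg n (\<lambda>\<pi>. (small_size n \<pi> / n)\<^sup>2 * scaled_variance (small_size n \<pi>) +
      (medium_size n \<pi> / n)\<^sup>2 * scaled_variance (medium_size n \<pi>) + (large_size n \<pi> / n)\<^sup>2 * scaled_variance (large_size n \<pi>)) =
      6 / (real n * (real n - 1)) * (\<Sum>k<n - 1. (real n - 1 - real k) * ((real k / n)\<^sup>2 * scaled_variance k))"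
    by (rule perm_avg_sum_sizes[OF n2, of "\<lambda>k. (real k / n)\<^sup>2 * scaled_variance k"])
  finally show ?thesis .
qed

text \<open>The limit \<open>V\<close> solves \<open>V = limit_cost_variance + V / 2\<close>, and
  the coefficients \<open>x n k\<close> have total mass tending to \<open>1 / 2\<close>. Subtracting
  \<open>V\<close> therefore leaves a recursion with vanishing inhomogeneity whose coefficients are
  dominated by \<open>weight\<close>.\<close>

lemma scaled_variance_tendsto: "scaled_variance \<longlonglongrightarrow> 2 * limit_cost_variance"
proof -
  define V where "V = 2 * limit_cost_variance"
  define x where "x n k = 6 / (real n * (real n - 1)) * (real n - 1 - real k) * (real k / real n)\<^sup>2" for n k
  define W where "W n = (\<Sum>k<n - 1. x n k)" for n
  have x_le: "0 \<le> x n k" "x n k \<le> weight n k" if "k < n - 1" for n k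
  proof -
    have nn: "0 \<le> 6 / (real n * (real n - 1)) * (real n - 1 - real k)"
      using that by (intro mult_nonneg_nonneg divide_nonneg_nonneg) auto
    show "0 \<le> x n k" unfolding x_def by (rule mult_nonneg_nonneg[OF nn]) simp
    show "x n k \<le> weight n k" unfolding x_def weight_def by (rule mult_left_mono[OF _ nn]) simp
  qed
  have W: "W \<longlonglongrightarrow> 1 / 2"
  proof (rule Lim_transform_eventually)
    show "(\<lambda>n. 6 / (real n * (real n - 1)) / (real n)\<^sup>2 * ((real n - 1) * ((real n - 2) * (real n - 1) * (2 * real n - 3) / 6) -
        ((real n - 1) * (real n - 2) / 2)\<^sup>2)) \<longlonglongrightarrow> 1 / 2"
    proof -
      have 1: "2 - 6 * (1 / 2)\<^sup>2 = (1 / 2 :: real)" by (simp add: power2_eq_square)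
      have "(\<lambda>n. 6 / (real n * (real n - 1)) / (real n)\<^sup>2 * ((real n - 1) * ((real n - 2) * (real n - 1) * (2 * real n - 3) / 6) -
        ((real n - 1) * (real n - 2) / 2)\<^sup>2)) \<longlonglongrightarrow> 2 - 6 * (1 / 2)\<^sup>2" by real_asymp
      then show ?thesis unfolding 1 .
    qed
    show "\<forall>\<^sub>F n in sequentially. 6 / (real n * (real n - 1)) / (real n)\<^sup>2 * ((real n - 1) * ((real n - 2) * (real n - 1) * (2 * real n - 3) / 6) -
        ((real n - 1) * (real n - 2) / 2)\<^sup>2) = W n"
      using eventually_ge_at_top[of 2]
    proof eventually_elim
      case (elim n)
      have "W n = 6 / (real n * (real n - 1)) / (real n)\<^sup>2 * (\<Sum>k<n - 1. (real n - 1 - real k) * (real k)\<^sup>2)"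
        unfolding W_def x_def sum_distrib_left by (intro sum.cong) (auto simp: power_divide)
      moreover have "real (n - 1) = real n - 1" using elim by (simp add: of_nat_diff)
      ultimately show ?case unfolding sum_sub_mult by simp
    qed
  qed
  define r where "r n = \<bar>perm_avg n (\<lambda>\<pi>. (scaled_toll n \<pi>)\<^sup>2) - limit_cost_variance\<bar> + \<bar>V\<bar> * \<bar>W n - 1 / 2\<bar>" for n
  have "(\<lambda>n. \<bar>scaled_variance n - V\<bar>) \<longlonglongrightarrow> 0"
  proof (rule weighted_recursion_tendsto_0)
    show "2 \<le> n0" by (simp add: n0_def)
    have "r \<longlonglongrightarrow> \<bar>limit_cost_variance - limit_cost_variance\<bar> + \<bar>V\<bar> * \<bar>1 / 2 - 1 / 2\<bar>"
      unfolding r_def by (intro tendsto_intros scaled_toll_square_mean W)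
    then show "r \<longlonglongrightarrow> 0" by simp
    fix n assume n: "n0 \<le> n"
    have "scaled_variance n = perm_avg n (\<lambda>\<pi>. (scaled_toll n \<pi>)\<^sup>2) + (\<Sum>k<n - 1. x n k * scaled_variance k)"
      unfolding scaled_variance_rec[OF n] x_def sum_distrib_left by (simp only: mult.assoc)
    also have "(\<Sum>k<n - 1. x n k * scaled_variance k) = (\<Sum>k<n - 1. x n k * (scaled_variance k - V)) + V * W n"
      unfolding W_def by (simp add: right_diff_distrib sum_subtractf sum_distrib_left mult.commute)
    finally have "scaled_variance n - V = (perm_avg n (\<lambda>\<pi>. (scaled_toll n \<pi>)\<^sup>2) - limit_cost_variance) + V * (W n - 1 / 2) +
        (\<Sum>k<n - 1. x n k * (scaled_variance k - V))"
      by (simp add: V_def algebra_simps)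
    moreover have "\<bar>\<Sum>k<n - 1. x n k * (scaled_variance k - V)\<bar> \<le> (\<Sum>k<n - 1. weight n k * \<bar>scaled_variance k - V\<bar>)"
    proof (rule order_trans[OF sum_abs sum_mono])
      fix k assume "k \<in> {..<n - 1}"
      then show "\<bar>x n k * (scaled_variance k - V)\<bar> \<le> weight n k * \<bar>scaled_variance k - V\<bar>"
        using x_le[of k n] by (simp add: abs_mult mult_right_mono)
    qed
    ultimately show "\<bar>scaled_variance n - V\<bar> \<le> r n + (\<Sum>k<n - 1. weight n k * \<bar>scaled_variance k - V\<bar>)"
      unfolding r_def abs_mult[symmetric] by linarith
  qed simp
  then show ?thesis unfolding V_def by (rule Lim_null[THEN iffD2, OF tendsto_rabs_zero_cancel])
qed

end


section \<open>Convergence of characteristic functions\<close>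

lemma sqrt_le_affine: "0 \<le> x \<Longrightarrow> sqrt x \<le> x + 1 / 4" for x :: real
proof -
  assume x: "0 \<le> x"
  have "0 \<le> (sqrt x - 1 / 2)\<^sup>2" by simp
  then have "sqrt x \<le> (sqrt x)\<^sup>2 + 1 / 4" unfolding power2_diff by (simp add: power2_eq_square)
  then show ?thesis using x by simp
qed

text \<open>The metric has the weight \<open>t powr (3/2)\<close>: error terms of order \<open>t\<close> alone would not be summable against
  the quadratic bound near 0, but the minimum of both is controlled by their geometric mean.\<close>

lemma min_le_geometric:
  fixes t :: real
  assumes "0 \<le> K" "0 \<le> r" "x \<le> K * t\<^sup>2" "x \<le> S + r * \<bar>t\<bar>" "0 \<le> S"
  shows "x \<le> S + sqrt (K * r) * (\<bar>t\<bar> * sqrt \<bar>t\<bar>)"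
proof -
  let ?g = "sqrt (K * r) * (\<bar>t\<bar> * sqrt \<bar>t\<bar>)"
  have g: "?g = sqrt ((K * t\<^sup>2) * (r * \<bar>t\<bar>))"
    by (simp add: real_sqrt_mult)
  have m: "min a b \<le> sqrt (a * b)" if "0 \<le> a" "0 \<le> b" for a b :: real
  proof (rule real_le_rsqrt)
    show "(min a b)\<^sup>2 \<le> a * b" unfolding power2_eq_square using that by (intro mult_mono) auto
  qed
  have "min (K * t\<^sup>2) (r * \<bar>t\<bar>) \<le> ?g" unfolding g by (rule m) (use assms in auto)
  then show ?thesis using assms(3-5) by linarith
qed

context dual_pivot
begin

definition cost_char :: "nat \<Rightarrow> real \<Rightarrow> complex" where
  "cost_char n t = perm_avg n (\<lambda>\<pi>. iexp (t * scaled_cost n \<pi>))"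

lemma cost_char_norm: "norm (cost_char n t) \<le> 1"
  unfolding cost_char_def by (rule perm_avg_norm_le) simp

lemma cost_char_minus_1: "norm (cost_char n t - 1) \<le> scaled_variance n / 2 * t\<^sup>2"
proof -
  have "perm_avg n (\<lambda>\<pi>. complex_of_real (scaled_cost n \<pi>)) = complex_of_real (perm_avg n (scaled_cost n))"
    by (simp add: perm_avg_def scaleR_conv_of_real)
  then have "perm_avg n (\<lambda>\<pi>. iexp (t * scaled_cost n \<pi>) - (1 + \<i> * t * scaled_cost n \<pi>)) = cost_char n t - (1 + \<i> * t * 0)"
    unfolding perm_avg_diff perm_avg_add perm_avg_mult_left perm_avg_const cost_char_def scaled_cost_mean by simp
  then have "norm (cost_char n t - 1) \<le> perm_avg n (\<lambda>\<pi>. norm (iexp (t * scaled_cost n \<pi>) - (1 + \<i> * t * scaled_cost n \<pi>)))"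
    using perm_avg_norm[of n "\<lambda>\<pi>. iexp (t * scaled_cost n \<pi>) - (1 + \<i> * t * scaled_cost n \<pi>)"] by simp
  also have "\<dots> \<le> perm_avg n (\<lambda>\<pi>. t\<^sup>2 / 2 * (scaled_cost n \<pi>)\<^sup>2)"
  proof (rule perm_avg_mono)
    show "norm (iexp (t * scaled_cost n \<pi>) - (1 + \<i> * t * scaled_cost n \<pi>)) \<le> t\<^sup>2 / 2 * (scaled_cost n \<pi>)\<^sup>2" for \<pi>
      using iexp_approx1[of "t * scaled_cost n \<pi>" 1] by (simp add: power2_eq_square algebra_simps)
  qed
  also have "\<dots> = scaled_variance n / 2 * t\<^sup>2" unfolding perm_avg_mult_left scaled_variance_def by simp
  finally show ?thesis .
qed

lemma cost_char_rec:
  assumes "n0 \<le> n"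
  shows "cost_char n t = perm_avg n (\<lambda>\<pi>. iexp (t * scaled_toll n \<pi>) * (cost_char (small_size n \<pi>) (t * (small_size n \<pi> / n)) *
    (cost_char (medium_size n \<pi>) (t * (medium_size n \<pi> / n)) * cost_char (large_size n \<pi>) (t * (large_size n \<pi> / n)))))"
proof -
  have "split_avg n \<pi> (\<lambda>a b c. iexp (t * (u + (x * scaled_cost (small_size n \<pi>) a + (y * scaled_cost (medium_size n \<pi>) b + z * scaled_cost (large_size n \<pi>) c)))))
    = iexp (t * u) * (cost_char (small_size n \<pi>) (t * x) * (cost_char (medium_size n \<pi>) (t * y) * cost_char (large_size n \<pi>) (t * z)))" for \<pi> u x y z
  proof -
    have e: "iexp (t * (u + (x * a + (y * b + z * c)))) = iexp (t * u) * (iexp (t * x * a) * (iexp (t * y * b) * iexp (t * z * c)))" for a b c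
      by (simp add: exp_add[symmetric] algebra_simps)
    show ?thesis unfolding split_avg_def e
      by (simp only: perm_avg_mult_left perm_avg_mult_right cost_char_def)
  qed
  then show ?thesis
    using scaled_cost_rec[OF assms, of "\<lambda>x. iexp (t * x)"] by (simp only: cost_char_def)
qed

text \<open>The recursion for finite \<open>n\<close> is compared with the fixed-point equation by
  way of the mixture with factors \<open>char \<mu>\<close> at the finite proportions. Replacing the
  characteristic functions of the blocks produces the weighted sum of earlier distances; replacing
  toll and proportions by their limits produces an error \<open>r n * |u|\<close> with
  \<open>r n\<close> tending to 0.\<close>

lemma cost_char_tendsto:
  assumes csi: "centered_square_integrable \<mu>" and fp: "fixed_point_solution \<mu>"
  shows "(\<lambda>n. cost_char n t) \<longlonglongrightarrow> char \<mu> t"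
proof -
  interpret law \<mu> by (rule centered_square_integrable_law[OF csi])
  have fix_eq: "image_law = \<mu>" using fp by (simp only: fixed_point_solution_iff[OF law_axioms])
  obtain B where B: "0 \<le> B" "\<And>d. d \<in> cube \<Longrightarrow> \<bar>limit_cost d\<bar> \<le> B" using limit_cost_bounded by blast
  obtain w where w: "w \<longlonglongrightarrow> (0 :: real)"
    "\<And>n d d'. d \<in> cube \<Longrightarrow> d' \<in> cube \<Longrightarrow> close_triples (2 / real n) d d' \<Longrightarrow> \<bar>limit_cost d - limit_cost d'\<bar> \<le> w n"
    by (rule limit_cost_modulus) blast
  obtain q where q: "q \<longlonglongrightarrow> (0 :: real)" "\<And>n. 0 \<le> q n"
    "\<And>n. n0 \<le> n \<Longrightarrow> perm_avg n (\<lambda>\<pi>. (scaled_toll n \<pi> - limit_cost (proportions n \<pi>))\<^sup>2) \<le> q n"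
    by (rule scaled_toll_L2) blast
  define A where "A = (\<integral>x. \<bar>x\<bar> \<partial>\<mu>)"
  have A0: "0 \<le> A" by (simp add: A_def)
  have lip: "norm (char \<mu> s - char \<mu> u) \<le> A * \<bar>s - u\<bar>" for s u
    unfolding A_def by (rule char_lipschitz) (rule csi_facts[OF csi])
  have w0: "0 \<le> w n" for n
    using w(2)[of "(0, 0, 0)" "(0, 0, 0)" n] by (simp add: close_triples_def)
  \<comment> \<open>This collects the coefficients of \<open>|u|\<close>: the mean error of the
    toll, the effect of moving the proportions by \<open>2 / n\<close> on \<open>limit_cost\<close>
    and on the three factors, and the diagonal of the coupling.\<close>
  define r where "r n = sqrt (q n) + ((w n + 6 * A / n) + (2 * B + 3 * A) / n)" for n
  have r0: "0 \<le> r n" for n unfolding r_def using q(2)[of n] w0[of n] A0 B(1) by (intro add_nonneg_nonneg) auto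
  obtain V where V: "\<And>n. scaled_variance n \<le> V"
  proof -
    obtain V where "\<And>n. norm (scaled_variance n) \<le> V"
      using convergent_imp_Bseq[OF convergentI[OF scaled_variance_tendsto]] by (auto simp: Bseq_def)
    then show thesis using that[of V] by (auto simp: abs_le_iff)
  qed
  define K where "K = V / 2 + second_moment \<mu> / 2"
  have K: "norm (cost_char n u - char \<mu> u) \<le> K * u\<^sup>2" for n u
  proof -
    have "norm (cost_char n u - char \<mu> u) \<le> norm (cost_char n u - 1) + norm (char \<mu> u - 1)"
      using norm_triangle_ineq4[of "cost_char n u - 1" "char \<mu> u - 1"] by simp
    also have "\<dots> \<le> V / 2 * u\<^sup>2 + second_moment \<mu> / 2 * u\<^sup>2"
    proof (intro add_mono char_minus_1_le csi)
      have "scaled_variance n / 2 * u\<^sup>2 \<le> V / 2 * u\<^sup>2" using V by (intro mult_right_mono) auto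
      then show "norm (cost_char n u - 1) \<le> V / 2 * u\<^sup>2" using cost_char_minus_1[of n u] by simp
    qed
    finally show ?thesis by (simp add: K_def distrib_right)
  qed
  have K0: "0 \<le> K" using order_trans[OF norm_ge_zero K[of 0 1]] by simp
  define h where "h u = \<bar>u\<bar> * sqrt \<bar>u\<bar>" for u :: real
  have h0: "0 \<le> h u" for u by (simp add: h_def)
  define D where "D n u = norm (cost_char n u - char \<mu> u) / h u" for n u
  \<comment> \<open>The supremum defining \<open>a n\<close> has to be finite: for
    \<open>|u| <= 1\<close> the quadratic bound is at most \<open>K * h u\<close>, and beyond that
    the trivial bound 2 suffices because \<open>h u >= 1\<close>.\<close>
  have D_bound: "D n u \<le> K + 2" for n u
  proof (cases "u = 0")
    case False
    have hp: "0 < h u" using False by (simp add: h_def)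
    have "norm (cost_char n u - char \<mu> u) \<le> (K + 2) * h u"
    proof (cases "\<bar>u\<bar> \<le> 1")
      case True
      then have "\<bar>u\<bar>\<^sup>2 \<le> \<bar>u\<bar>" unfolding power2_eq_square by (intro mult_left_le) auto
      then have "\<bar>u\<bar> * \<bar>u\<bar> \<le> \<bar>u\<bar> * sqrt \<bar>u\<bar>" by (intro mult_left_mono real_le_rsqrt) auto
      then have "u\<^sup>2 \<le> h u" by (simp add: h_def power2_eq_square)
      then have "K * u\<^sup>2 \<le> K * h u" using K0 by (rule mult_left_mono)
      then show ?thesis using K[of n u] hp by (simp add: distrib_right)
    next
      case False
      then have "1 * 1 \<le> h u" unfolding h_def by (intro mult_mono) auto
      moreover have "norm (cost_char n u - char \<mu> u) \<le> 2"
        using norm_triangle_ineq4[of "cost_char n u" "char \<mu> u"] cost_char_norm[of n u] cmod_char_le_1[of u] by linarith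
      moreover have "0 \<le> K * h u" using K0 hp by simp
      ultimately show ?thesis by (simp add: distrib_right)
    qed
    then show ?thesis using hp by (simp add: D_def divide_le_eq)
  qed (use K0 in \<open>simp add: D_def h_def\<close>)
  have bdd: "bdd_above (range (D n))" for n using D_bound by (intro bdd_aboveI[of _ "K + 2"]) auto
  define a where "a n = (SUP u. D n u)" for n
  have D_a: "D n u \<le> a n" for n u unfolding a_def by (rule cSUP_upper[OF UNIV_I bdd])
  have diff_le: "norm (cost_char n u - char \<mu> u) \<le> a n * h u" for n u
  proof (cases "u = 0")
    case True
    then show ?thesis using K[of n u] by (simp add: h_def)
  next
    case False
    then have "0 < h u" by (simp add: h_def)
    then show ?thesis using D_a[of n u] by (simp add: D_def pos_divide_le_eq)
  qed
  have a0: "0 \<le> a n" for n using D_a[of n 0] by (simp add: D_def h_def)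
  have rec: "a n \<le> sqrt (K * r n) + (\<Sum>k<n - 1. weight n k * a k)" if n: "n0 \<le> n" for n
    unfolding a_def[of n]
  proof (rule cSUP_least)
    fix u
    have n2: "2 \<le> n" using n0[OF n] by simp
    define W where "W = (\<Sum>k<n - 1. weight n k * a k)"
    have W0: "0 \<le> W" unfolding W_def by (intro sum_nonneg mult_nonneg_nonneg weight_nonneg a0) auto
    define G where "G k = a k * h (u * (real k / n))" for k
    have "norm (cost_char n u - char \<mu> u) \<le> W * h u + r n * \<bar>u\<bar>"
    proof -
      define E1 where "E1 \<pi> = iexp (u * scaled_toll n \<pi>) * (cost_char (small_size n \<pi>) (u * (small_size n \<pi> / n)) *
        (cost_char (medium_size n \<pi>) (u * (medium_size n \<pi> / n)) * cost_char (large_size n \<pi>) (u * (large_size n \<pi> / n))))" for \<pi>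
      have 1: "norm (cost_char n u - perm_avg n (\<lambda>\<pi>. mixture_char u (proportions n \<pi>))) \<le> \<bar>u\<bar> * sqrt (q n) + W * h u"
      proof -
        have "cost_char n u - perm_avg n (\<lambda>\<pi>. mixture_char u (proportions n \<pi>)) = perm_avg n (\<lambda>\<pi>. E1 \<pi> - mixture_char u (proportions n \<pi>))"
          unfolding cost_char_rec[OF n, of u] E1_def by (simp only: perm_avg_diff)
        also have "norm \<dots> \<le> perm_avg n (\<lambda>\<pi>. norm (E1 \<pi> - mixture_char u (proportions n \<pi>)))" by (rule perm_avg_norm)
        also have "\<dots> \<le> perm_avg n (\<lambda>\<pi>. \<bar>u\<bar> * \<bar>scaled_toll n \<pi> - limit_cost (proportions n \<pi>)\<bar> +
            (G (small_size n \<pi>) + G (medium_size n \<pi>) + G (large_size n \<pi>)))"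
        proof (rule perm_avg_mono)
          fix \<pi> assume "\<pi> \<in> perms n"
          define P where "P = cost_char (small_size n \<pi>) (u * (small_size n \<pi> / n)) *
            (cost_char (medium_size n \<pi>) (u * (medium_size n \<pi> / n)) * cost_char (large_size n \<pi>) (u * (large_size n \<pi> / n)))"
          define Q where "Q = char \<mu> (u * (small_size n \<pi> / n)) * (char \<mu> (u * (medium_size n \<pi> / n)) * char \<mu> (u * (large_size n \<pi> / n)))"
          define L where "L = limit_cost (proportions n \<pi>)"
          have P1: "norm P \<le> 1" unfolding P_def norm_mult by (intro mult_le_one cost_char_norm mult_nonneg_nonneg norm_ge_zero)
          have "E1 \<pi> - mixture_char u (proportions n \<pi>) = (iexp (u * scaled_toll n \<pi>) - iexp (u * L)) * P + iexp (u * L) * (P - Q)"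
            unfolding E1_def P_def Q_def mixture_char_def L_def proportions_def by (simp add: algebra_simps)
          also have "norm \<dots> \<le> norm (iexp (u * scaled_toll n \<pi>) - iexp (u * L)) * norm P + norm (iexp (u * L)) * norm (P - Q)"
            by (rule order_trans[OF norm_triangle_ineq]) (simp add: norm_mult)
          also have "\<dots> \<le> \<bar>u * scaled_toll n \<pi> - u * L\<bar> * 1 + 1 * norm (P - Q)"
            using P1 by (intro add_mono mult_mono iexp_diff_le) auto
          also have "\<bar>u * scaled_toll n \<pi> - u * L\<bar> = \<bar>u\<bar> * \<bar>scaled_toll n \<pi> - L\<bar>"
            by (simp add: abs_mult[symmetric] right_diff_distrib)
          also have "norm (P - Q) \<le> G (small_size n \<pi>) + G (medium_size n \<pi>) + G (large_size n \<pi>)"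
            unfolding P_def Q_def G_def
            by (rule order_trans[OF norm_mult3_diff]) (intro cost_char_norm cmod_char_le_1 add_mono diff_le)+
          finally show "norm (E1 \<pi> - mixture_char u (proportions n \<pi>)) \<le> \<bar>u\<bar> * \<bar>scaled_toll n \<pi> - limit_cost (proportions n \<pi>)\<bar> +
            (G (small_size n \<pi>) + G (medium_size n \<pi>) + G (large_size n \<pi>))" by (simp add: L_def)
        qed
        also have "\<dots> = \<bar>u\<bar> * perm_avg n (\<lambda>\<pi>. \<bar>scaled_toll n \<pi> - limit_cost (proportions n \<pi>)\<bar>) +
            6 / (real n * (real n - 1)) * (\<Sum>k<n - 1. (real n - 1 - real k) * G k)"
          unfolding perm_avg_sum_sizes[OF n2, of G, symmetric] by (simp only: perm_avg_add perm_avg_mult_left)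
        also have "\<dots> \<le> \<bar>u\<bar> * sqrt (q n) + W * h u"
        proof (intro add_mono mult_left_mono)
          show "perm_avg n (\<lambda>\<pi>. \<bar>scaled_toll n \<pi> - limit_cost (proportions n \<pi>)\<bar>) \<le> sqrt (q n)"
            by (rule order_trans[OF perm_avg_abs_le_sqrt real_sqrt_le_mono]) (rule q(3)[OF n])
          have "6 / (real n * (real n - 1)) * ((real n - 1 - real k) * G k) \<le> weight n k * a k * h u" if k: "k < n - 1" for k
          proof -
            define x where "x = real k / n"
            have x0: "0 \<le> x" by (simp add: x_def)
            \<comment> \<open>Homogeneity of degree \<open>3 / 2\<close> turns the shrinking of the
              argument into a factor \<open>x powr (3/2)\<close>, which the polynomial in
              \<open>weight\<close> dominates.\<close>
            have "h (u * x) = h u * (x * sqrt x)" using x0 by (simp add: h_def abs_mult real_sqrt_mult)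
            also have "\<dots> \<le> h u * (x / 4 + x\<^sup>2)"
            proof (rule mult_left_mono[OF _ h0])
              have "x * sqrt x \<le> x * (x + 1 / 4)" using sqrt_le_affine[OF x0] x0 by (rule mult_left_mono)
              then show "x * sqrt x \<le> x / 4 + x\<^sup>2" by (simp add: power2_eq_square algebra_simps)
            qed
            finally have "a k * h (u * x) \<le> a k * (h u * (x / 4 + x\<^sup>2))" using a0 by (rule mult_left_mono)
            moreover have "0 \<le> 6 / (real n * (real n - 1)) * (real n - 1 - real k)"
              using k by (intro mult_nonneg_nonneg divide_nonneg_nonneg) auto
            ultimately have "6 / (real n * (real n - 1)) * (real n - 1 - real k) * G k \<le>
                6 / (real n * (real n - 1)) * (real n - 1 - real k) * (a k * (h u * (x / 4 + x\<^sup>2)))"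
              unfolding G_def x_def[symmetric] by (rule mult_left_mono)
            then show ?thesis unfolding weight_def x_def[symmetric] by (simp only: mult_ac)
          qed
          then show "6 / (real n * (real n - 1)) * (\<Sum>k<n - 1. (real n - 1 - real k) * G k) \<le> W * h u"
            unfolding W_def sum_distrib_left sum_distrib_right by (intro sum_mono) simp
        qed simp
        finally show ?thesis .
      qed
      have 2: "norm (perm_avg n (\<lambda>\<pi>. mixture_char u (proportions n \<pi>)) - (CLINT d|spacings_law. mixture_char u d)) \<le>
          \<bar>u\<bar> * (w n + 6 * A / n) + \<bar>u\<bar> * (2 * B + 3 * A) / n"
      proof (rule perm_avg_proportions_approx[OF n2 mixture_char_measurable])
        have md: "norm (mixture_char u d - mixture_char u d') \<le> \<bar>u\<bar> * (\<bar>limit_cost d - limit_cost d'\<bar> + 3 * A * \<delta>)"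
          if "close_triples \<delta> d d'" for d d' \<delta>
        proof -
          obtain x1 x2 x3 y1 y2 y3 where dd: "d = (x1, x2, x3)" "d' = (y1, y2, y3)" by (metis prod_cases3)
          have cl: "\<bar>x1 - y1\<bar> \<le> \<delta>" "\<bar>x2 - y2\<bar> \<le> \<delta>" "\<bar>x3 - y3\<bar> \<le> \<delta>" using that unfolding dd close_triples_def by auto
          define P where "P = char \<mu> (u * x1) * (char \<mu> (u * x2) * char \<mu> (u * x3))"
          define Q where "Q = char \<mu> (u * y1) * (char \<mu> (u * y2) * char \<mu> (u * y3))"
          have P1: "norm P \<le> 1" unfolding P_def norm_mult by (intro mult_le_one cmod_char_le_1 mult_nonneg_nonneg norm_ge_zero)
          have l: "norm (char \<mu> (u * x) - char \<mu> (u * y)) \<le> \<bar>u\<bar> * (A * \<delta>)" if "\<bar>x - y\<bar> \<le> \<delta>" for x y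
          proof -
            have "norm (char \<mu> (u * x) - char \<mu> (u * y)) \<le> A * (\<bar>u\<bar> * \<bar>x - y\<bar>)"
              using lip[of "u * x" "u * y"] by (simp add: abs_mult[symmetric] right_diff_distrib)
            also have "\<dots> \<le> A * (\<bar>u\<bar> * \<delta>)" using that A0 by (intro mult_left_mono) auto
            finally show ?thesis by (simp only: mult_ac)
          qed
          have "mixture_char u d - mixture_char u d' = (iexp (u * limit_cost d) - iexp (u * limit_cost d')) * P + iexp (u * limit_cost d') * (P - Q)"
            unfolding P_def Q_def mixture_char_def dd by (simp add: algebra_simps)
          also have "norm \<dots> \<le> norm (iexp (u * limit_cost d) - iexp (u * limit_cost d')) * norm P + norm (iexp (u * limit_cost d')) * norm (P - Q)"
            by (rule order_trans[OF norm_triangle_ineq]) (simp add: norm_mult)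
          also have "\<dots> \<le> \<bar>u * limit_cost d - u * limit_cost d'\<bar> * 1 + 1 * norm (P - Q)"
            using P1 by (intro add_mono mult_mono iexp_diff_le) auto
          also have "\<bar>u * limit_cost d - u * limit_cost d'\<bar> = \<bar>u\<bar> * \<bar>limit_cost d - limit_cost d'\<bar>"
            by (simp add: abs_mult[symmetric] right_diff_distrib)
          also have "norm (P - Q) \<le> \<bar>u\<bar> * (A * \<delta>) + \<bar>u\<bar> * (A * \<delta>) + \<bar>u\<bar> * (A * \<delta>)"
            unfolding P_def Q_def
            by (rule order_trans[OF norm_mult3_diff]) (intro cmod_char_le_1 add_mono l cl)+
          finally show ?thesis by (simp add: algebra_simps)
        qed
        fix d d' assume d: "d \<in> cube" "d' \<in> cube"
        show "norm (mixture_char u d - mixture_char u d') \<le> \<bar>u\<bar> * (w n + 6 * A / n)" if c: "close_triples (2 / n) d d'"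
        proof -
          have "\<bar>u\<bar> * (\<bar>limit_cost d - limit_cost d'\<bar> + 3 * A * (2 / n)) \<le> \<bar>u\<bar> * (w n + 6 * A / n)"
            using w(2)[OF d c] by (intro mult_left_mono) auto
          then show ?thesis using md[OF c] by linarith
        qed
        have "close_triples 1 d d'" using d by (auto simp: close_triples_def abs_le_iff)
        note md[OF this]
        also have "\<bar>u\<bar> * (\<bar>limit_cost d - limit_cost d'\<bar> + 3 * A * 1) \<le> \<bar>u\<bar> * (2 * B + 3 * A)"
          using B(2)[OF d(1)] B(2)[OF d(2)] by (intro mult_left_mono) linarith+
        finally show "norm (mixture_char u d - mixture_char u d') \<le> \<bar>u\<bar> * (2 * B + 3 * A)" .
      qed
      \<comment> \<open>Here the fixed-point equation enters: \<open>\<mu>\<close> is its own image,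
        so the integral of the mixture over the spacings is the target itself.\<close>
      have "char \<mu> u = (CLINT d|spacings_law. mixture_char u d)"
        using char_image_law[of u] unfolding fix_eq .
      then have "norm (cost_char n u - char \<mu> u) \<le> (\<bar>u\<bar> * sqrt (q n) + W * h u) + (\<bar>u\<bar> * (w n + 6 * A / n) + \<bar>u\<bar> * (2 * B + 3 * A) / n)"
        using norm_triangle_ineq[of "cost_char n u - perm_avg n (\<lambda>\<pi>. mixture_char u (proportions n \<pi>))"
            "perm_avg n (\<lambda>\<pi>. mixture_char u (proportions n \<pi>)) - char \<mu> u"] 1 2 by simp
      also have "\<dots> = W * h u + r n * \<bar>u\<bar>" unfolding r_def by (simp add: algebra_simps)
      finally show ?thesis .
    qed
    from min_le_geometric[OF K0 r0 K this] W0 h0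
    have "norm (cost_char n u - char \<mu> u) \<le> (sqrt (K * r n) + W) * h u" by (simp add: h_def distrib_right)
    then show "D n u \<le> sqrt (K * r n) + (\<Sum>k<n - 1. weight n k * a k)"
      unfolding W_def[symmetric] D_def
    proof (cases "h u = 0")
      case True
      then show "norm (cost_char n u - char \<mu> u) / h u \<le> sqrt (K * r n) + W" using W0 K0 r0 by simp
    next
      case False
      then have "0 < h u" using h0[of u] by linarith
      then show "norm (cost_char n u - char \<mu> u) / h u \<le> sqrt (K * r n) + W"
        using \<open>norm (cost_char n u - char \<mu> u) \<le> (sqrt (K * r n) + W) * h u\<close> by (simp add: pos_divide_le_eq)
    qed
  qed simp
  have "a \<longlonglongrightarrow> 0"
  proof (rule weighted_recursion_tendsto_0[OF a0 _ _ rec])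
    have "r \<longlonglongrightarrow> sqrt 0 + ((0 + 0) + 0)" unfolding r_def
      by (rule tendsto_add[OF tendsto_real_sqrt[OF q(1)] tendsto_add[OF tendsto_add[OF w(1) lim_const_over_n] lim_const_over_n]])
    then have "r \<longlonglongrightarrow> 0" by (simp only: real_sqrt_zero add_0_right)
    from tendsto_real_sqrt[OF tendsto_mult[OF tendsto_const[of K] this]]
    have "(\<lambda>n. sqrt (K * r n)) \<longlonglongrightarrow> sqrt (K * 0)" .
    then show "(\<lambda>n. sqrt (K * r n)) \<longlonglongrightarrow> 0" by simp
    show "2 \<le> n0" by (simp add: n0_def)
  qed
  then have lim: "(\<lambda>n. a n * h t) \<longlonglongrightarrow> 0" by (rule tendsto_mult_left_zero)
  have "(\<lambda>n. cost_char n t - char \<mu> t) \<longlonglongrightarrow> 0"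
    by (rule Lim_null_comparison[OF always_eventually[OF allI[OF diff_le]] lim])
  then show ?thesis by (rule Lim_null[THEN iffD2])
qed

section \<open>Weak convergence and the variance\<close>

lemma weak_convergence:
  assumes "centered_square_integrable \<mu>" "fixed_point_solution \<mu>"
  shows "weak_conv_m (\<lambda>n. distr (measure_pmf (random_permutation n)) borel (scaled_cost n)) \<mu>"
proof (rule levy_continuity)
  show "real_distribution (distr (measure_pmf (random_permutation n)) borel (scaled_cost n))" for n
    by (intro prob_space.real_distribution_distr prob_space_measure_pmf) simp
  show "real_distribution \<mu>" using assms(1) by (simp add: centered_square_integrable_def)
  show "(\<lambda>n. char (distr (measure_pmf (random_permutation n)) borel (scaled_cost n)) t) \<longlonglongrightarrow> char \<mu> t" for t
  proof -
    have "char (distr (measure_pmf (random_permutation n)) borel (scaled_cost n)) t = cost_char n t" for n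
      unfolding char_def cost_char_def by (subst integral_distr) (simp_all add: expectation_random_permutation)
    then show ?thesis using cost_char_tendsto[OF assms] by simp
  qed
qed

lemma variance_comparisons_eq: "1 \<le> n \<Longrightarrow> variance_comparisons M n = scaled_variance n * (real n)\<^sup>2"
proof -
  assume n: "1 \<le> n"
  have "variance_comparisons M n = perm_avg n (\<lambda>\<pi>. (key_cost n \<pi> - mean_cost n)\<^sup>2)"
    by (simp add: variance_comparisons_def expectation_random_permutation comparisons_eq mean_cost_def)
  also have "\<dots> = perm_avg n (\<lambda>\<pi>. (real n)\<^sup>2 * (scaled_cost n \<pi>)\<^sup>2)"
    using n by (intro perm_avg_cong) (simp add: scaled_cost_def power_divide)
  also have "\<dots> = scaled_variance n * (real n)\<^sup>2" unfolding perm_avg_mult_left scaled_variance_def by simp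
  finally show ?thesis .
qed

lemma variance_asymptotics:
  "variance_comparisons M \<sim>[at_top] (\<lambda>n. (2231 / 360 - 361 / 600 * pi\<^sup>2) * (real n)\<^sup>2)"
proof (rule asymp_equivI')
  define V where "V = 2231 / 360 - 361 / 600 * pi\<^sup>2"
  \<comment> \<open>Asymptotic equivalence needs a positive constant; the decimal lower bound
    provides this.\<close>
  have V: "V = 2 * limit_cost_variance" "0 < V"
    using variance_constant_bounds(1) by (simp_all add: V_def limit_cost_variance_def)
  have "(\<lambda>n. scaled_variance n / V) \<longlonglongrightarrow> V / V"
    using scaled_variance_tendsto V by (intro tendsto_divide tendsto_const) auto
  then have "(\<lambda>n. scaled_variance n / V) \<longlonglongrightarrow> 1" using V(2) by simp
  moreover have "\<forall>\<^sub>F n in sequentially. scaled_variance n / V = variance_comparisons M n / (V * (real n)\<^sup>2)"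
    using eventually_ge_at_top[of 1]
    by eventually_elim (simp add: variance_comparisons_eq)
  ultimately have "(\<lambda>n. variance_comparisons M n / (V * (real n)\<^sup>2)) \<longlonglongrightarrow> 1"
    by (rule Lim_transform_eventually)
  then show "(\<lambda>n. variance_comparisons M n / ((2231 / 360 - 361 / 600 * pi\<^sup>2) * (real n)\<^sup>2)) \<longlonglongrightarrow> 1"
    by (simp only: V_def)
qed

end

theorem theorem4p3:
  fixes M :: nat
  assumes "M \<ge> 1"
  shows "(\<exists>\<mu> :: real measure.
        (centered_square_integrable \<mu> \<and> fixed_point_solution \<mu>)
      \<and> (\<forall>\<nu>. centered_square_integrable \<nu> \<and> fixed_point_solution \<nu> \<longrightarrow> \<nu> = \<mu>)
      \<and> weak_conv_m
          (\<lambda>n. distr (measure_pmf (random_permutation n)) borel (normalized_comparisons M n)) \<mu>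
      \<and> (\<lambda>n. measure_pmf.expectation (random_permutation n)
               (\<lambda>\<pi>. (normalized_comparisons M n \<pi>)\<^sup>2)) \<longlonglongrightarrow> (\<integral>x. x\<^sup>2 \<partial>\<mu>))
    \<and> variance_comparisons M \<sim>[at_top] (\<lambda>n. (2231 / 360 - 361 / 600 * pi\<^sup>2) * (real n)\<^sup>2)
    \<and> 0.25901 \<le> 2231 / 360 - 361 / 600 * pi\<^sup>2
    \<and> 2231 / 360 - 361 / 600 * pi\<^sup>2 < 0.25902"
proof -
  interpret dual_pivot M by unfold_locales (rule assms)
  obtain \<mu> where \<mu>: "centered_square_integrable \<mu>" "fixed_point_solution \<mu>" "second_moment \<mu> = 2 * limit_cost_variance"
    by (rule fixed_point_exists)
  have "measure_pmf.expectation (random_permutation n) (\<lambda>\<pi>. (normalized_comparisons M n \<pi>)\<^sup>2) = scaled_variance n" for n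
    by (simp only: normalized_comparisons_eq expectation_random_permutation scaled_variance_def)
  then have conv: "(\<lambda>n. measure_pmf.expectation (random_permutation n) (\<lambda>\<pi>. (normalized_comparisons M n \<pi>)\<^sup>2)) \<longlonglongrightarrow> (\<integral>x. x\<^sup>2 \<partial>\<mu>)"
    using scaled_variance_tendsto \<mu>(3) by (simp add: second_moment_def)
  have weak: "weak_conv_m (\<lambda>n. distr (measure_pmf (random_permutation n)) borel (normalized_comparisons M n)) \<mu>"
    using weak_convergence[OF \<mu>(1,2)] by (simp only: normalized_comparisons_eq)
  have "\<exists>\<mu>. (centered_square_integrable \<mu> \<and> fixed_point_solution \<mu>)
      \<and> (\<forall>\<nu>. centered_square_integrable \<nu> \<and> fixed_point_solution \<nu> \<longrightarrow> \<nu> = \<mu>)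
      \<and> weak_conv_m (\<lambda>n. distr (measure_pmf (random_permutation n)) borel (normalized_comparisons M n)) \<mu>
      \<and> (\<lambda>n. measure_pmf.expectation (random_permutation n) (\<lambda>\<pi>. (normalized_comparisons M n \<pi>)\<^sup>2)) \<longlonglongrightarrow> (\<integral>x. x\<^sup>2 \<partial>\<mu>)"
    using \<mu>(1,2) conv weak fixed_point_unique[OF \<mu>(1,2)] by (intro exI[of _ \<mu>]) blast
  then show ?thesis using variance_asymptotics variance_constant_bounds by (intro conjI)
qed

end
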